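(* Let $d\ge 2$ and let $P\in\mathcal{H}_{2d-1}$. Then the Bers slice $\mathfrak{B}(P)$ is pre-compact (has compact closure) in $\mathrm{Rat}_{2d}(\mathbb{C})/\sim$.
   Context: Write $\eta(z)=1/z$. For $k\ge2$, $\mathcal{H}_k$ is the principal hyperbolic component of degree-$k$ polynomials: the connected component containing $z^k$ of the set of monic centered degree-$k$ complex polynomials having an attracting fixed point in $\mathbb{C}$ whose immediate basin contains all finite critical points. For such $P$, $\mathcal{K}(P)$ is the filled Julia set and $\psi_P:\widehat{\mathbb{C}}\setminus\overline{\mathbb{D}}\to\widehat{\mathbb{C}}\setminus\mathcal{K}(P)$ the Böttcher coordinate (conjugating $z^k$ to $P$, tangent to the identity at $\infty$), which extends continuously to $\mathbb{S}^1$. Let $\Pi_0\subset\mathbb{D}$ be the regular ideal $2d$-gon with vertices at the $2d$-th roots of unity and $\Gamma_0$ the Fuchsian group generated by the Möbius side-pairings sending each side of $\Pi_0$ to its complex-conjugate side; $\mathbb{D}/\Gamma_0$ is a sphere with $d+1$ punctures. Points of the Teichmüller space $\mathrm{Teich}(S_{0,d+1})$ are represented by marked groups $\Gamma=\phi\Gamma_0\phi^{-1}$, $\phi:\mathbb{D}\to\mathbb{D}$ quasiconformal with $\phi(1)=1$. The Bowen–Series map $A_{\Gamma_0}$ is defined on $\mathcal{D}_0=\overline{\mathbb{D}}\setminus\mathrm{int}\,\Pi_0$: on the closed region between a side $s$ of $\Pi_0$ and the arc of $\mathbb{S}^1$ cut off by $s$, it equals the side-pairing sending $s$ to its conjugate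 side; $A_\Gamma:=\phi\circ A_{\Gamma_0}\circ\phi^{-1}$ on $\mathcal{D}_\Gamma=\phi(\mathcal{D}_0)$. Let $\mathfrak{h}_\Gamma:\mathbb{S}^1\to\mathbb{S}^1$ be the homeomorphism conjugating $z^{2d-1}$ to $A_\Gamma$ with $\mathfrak{h}_\Gamma(1)=1$. For $P\in\mathcal{H}_{2d-1}$, a conformal mating of $A_\Gamma$ and $P$ is a continuous $F:\overline{\Omega}\to\widehat{\mathbb{C}}$, holomorphic on $\Omega$, with continuous maps $\mathfrak{X}_P:\mathcal{K}(P)\to\widehat{\mathbb{C}}$, $\mathfrak{X}_\Gamma:\overline{\mathbb{D}}\to\widehat{\mathbb{C}}$ conformal on the interiors, such that $\mathfrak{X}_P(\mathcal{K}(P))\cup\mathfrak{X}_\Gamma(\overline{\mathbb{D}})=\widehat{\mathbb{C}}$, $\Omega=\mathfrak{X}_P(\mathcal{K}(P))\cup\mathfrak{X}_\Gamma(\mathcal{D}_\Gamma)$, $\mathfrak{X}_P\circ P=F\circ\mathfrak{X}_P$ on $\mathcal{K}(P)$, $\mathfrak{X}_\Gamma\circ A_\Gamma=F\circ\mathfrak{X}_\Gamma$ on $\mathcal{D}_\Gamma$, and $\mathfrak{X}_P(z)=\mathfrak{X}_\Gamma(w)$ iff $z\sim w$, where $\sim$ is generated by $\psi_P(\zeta)\sim\mathfrak{h}_\Gamma(\overline{\zeta})$, $\zeta\in\mathbb{S}^1$. It is known that this mating exists, is unique up to Möbius conjugacy, and that there are a Jordan domain $\mathfrak{D}$ with $1\in\partial\mathfrak{D}$,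 $\eta(\mathfrak{D})=\widehat{\mathbb{C}}\setminus\overline{\mathfrak{D}}$, and a rational map $R$ of degree $2d$ with $R|_{\mathfrak{D}}:\mathfrak{D}\to\Omega$ a conformal isomorphism and $F=R\circ\eta\circ(R|_{\mathfrak{D}})^{-1}$ on $\Omega$. $\mathrm{Rat}_{2d}(\mathbb{C})$ is the space of degree-$2d$ rational maps (an open subset of $\mathbb{P}^{4d+1}$ via coefficients); $R\sim\widetilde R$ iff $\widetilde R=M_2\circ R\circ M_1$ with $M_2$ Möbius and $M_1$ a Möbius map commuting with $\eta$; $\mathrm{Rat}_{2d}(\mathbb{C})/\sim$ has the quotient topology. The class $[R]$ depends only on $(\Gamma,P)$; write $R_{\Gamma,P}$ for a representative and $\mathfrak{G}(\Gamma,P)=[R_{\Gamma,P}]$. The associated correspondence is $\mathfrak{C}_{R}=\{(x,y)\in\widehat{\mathbb{C}}^2:\frac{R(x)-R(\eta(y))}{x-\eta(y)}=0\}$. The Bers slice through $P$ is $\mathfrak{B}(P):=\mathfrak{G}(\mathrm{Teich}(S_{0,d+1})\times\{P\})\subset\mathrm{Rat}_{2d}(\mathbb{C})/\sim$. *)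

theory Defs
  imports "HOL-Complex_Analysis.Complex_Analysis" "HOL-Computational_Algebra.Polynomial"
begin

text \<open>The Riemann sphere is modelled as complex option; None is the point at infinity.
  Its topology is that of the one-point compactification of the plane.\<close>

type_synonym csph = "complex option"

definition sph_open :: "csph set \<Rightarrow> bool" where
  "sph_open U \<longleftrightarrow> open {z. Some z \<in> U} \<and>
     (None \<in> U \<longrightarrow> (\<exists>R. \<forall>z. R < cmod z \<longrightarrow> Some z \<in> U))"

lemma istopology_sph_open: "istopology sph_open"
  unfolding istopology_def
proof (intro conjI allI impI)
  fix S T assume S: "sph_open S" and T: "sph_open T"
  have "{z. Some z \<in> S \<inter> T} = {z. Some z \<in> S} \<inter> {z. Some z \<in> T}" by auto
  moreover have "None \<in> S \<inter> T \<longrightarrow> (\<exists>R. \<forall>z. R < cmod z \<longrightarrow> Some z \<in> S \<inter> T)"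
  proof
    assume "None \<in> S \<inter> T"
    then obtain R1 R2 where "\<forall>z. R1 < cmod z \<longrightarrow> Some z \<in> S" "\<forall>z. R2 < cmod z \<longrightarrow> Some z \<in> T"
      using S T unfolding sph_open_def by blast
    then show "\<exists>R. \<forall>z. R < cmod z \<longrightarrow> Some z \<in> S \<inter> T"
      by (intro exI[of _ "max R1 R2"]) auto
  qed
  ultimately show "sph_open (S \<inter> T)" using S T unfolding sph_open_def by auto
next
  fix K assume K: "\<forall>S\<in>K. sph_open S"
  have "{z. Some z \<in> \<Union>K} = (\<Union>S\<in>K. {z. Some z \<in> S})" by auto
  moreover have "open (\<Union>S\<in>K. {z. Some z \<in> S})" using K unfolding sph_open_def by auto
  moreover have "None \<in> \<Union>K \<longrightarrow> (\<exists>R. \<forall>z. R < cmod z \<longrightarrow> Some z \<in> \<Union>K)"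
    using K unfolding sph_open_def by blast
  ultimately show "sph_open (\<Union>K)" unfolding sph_open_def by auto
qed

definition sph_top :: "csph topology" where
  "sph_top = topology sph_open"

lemma openin_sph_top: "openin sph_top = sph_open"
  unfolding sph_top_def using istopology_sph_open by (simp add: topology_inverse')

definition eta :: "csph \<Rightarrow> csph" where
  "eta x = (case x of None \<Rightarrow> Some 0 | Some z \<Rightarrow> (if z = 0 then None else Some (1 / z)))"

definition sinv :: "complex \<Rightarrow> csph" where
  "sinv w = (if w = 0 then None else Some (1 / w))"

definition ch0 :: "csph \<Rightarrow> complex" where
  "ch0 x = (case x of None \<Rightarrow> 0 | Some z \<Rightarrow> z)"

definition chinf :: "csph \<Rightarrow> complex" where
  "chinf x = (case x of None \<Rightarrow> 0 | Some z \<Rightarrow> 1 / z)"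

definition cholo_at :: "complex set \<Rightarrow> (complex \<Rightarrow> csph) \<Rightarrow> complex \<Rightarrow> bool" where
  "cholo_at U g z \<longleftrightarrow> (\<exists>e>0. ball z e \<subseteq> U \<and>
     (((\<forall>w\<in>ball z e. g w \<noteq> None) \<and> (ch0 \<circ> g) holomorphic_on ball z e) \<or>
      ((\<forall>w\<in>ball z e. g w \<noteq> Some 0) \<and> (chinf \<circ> g) holomorphic_on ball z e)))"

definition cholo_on :: "complex set \<Rightarrow> (complex \<Rightarrow> csph) \<Rightarrow> bool" where
  "cholo_on U g \<longleftrightarrow> (\<forall>z\<in>U. cholo_at U g z)"

definition sholo_on :: "csph set \<Rightarrow> (csph \<Rightarrow> csph) \<Rightarrow> bool" where
  "sholo_on U f \<longleftrightarrow>
     (\<forall>z. Some z \<in> U \<longrightarrow> cholo_at {w. Some w \<in> U} (f \<circ> Some) z) \<and>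
     (None \<in> U \<longrightarrow> cholo_at {w. sinv w \<in> U} (f \<circ> sinv) 0)"

definition jordan_domain :: "csph set \<Rightarrow> bool" where
  "jordan_domain D \<longleftrightarrow> (\<exists>\<gamma>. continuous_map (subtopology euclidean (sphere (0::complex) 1)) sph_top \<gamma> \<and>
      inj_on \<gamma> (sphere 0 1) \<and>
      D \<in> connected_components_of (subtopology sph_top (- (\<gamma> ` sphere 0 1))))"

definition moeb :: "complex \<Rightarrow> complex \<Rightarrow> complex \<Rightarrow> complex \<Rightarrow> csph \<Rightarrow> csph" where
  "moeb a b c e x = (case x of
      None \<Rightarrow> (if c = 0 then None else Some (a / c))
    | Some z \<Rightarrow> (if c * z + e = 0 then None else Some ((a * z + b) / (c * z + e))))"

definition is_moeb :: "(csph \<Rightarrow> csph) \<Rightarrow> bool" where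
  "is_moeb M \<longleftrightarrow> (\<exists>a b c e. a * e - b * c \<noteq> 0 \<and> M = moeb a b c e)"

text \<open>A coefficient vector c (coordinates 0..4d+1 of a point of C^(4d+2)) encodes
  R = (c_0 + ... + c_2d z^2d) / (c_(2d+1) + ... + c_(4d+1) z^2d).\<close>
definition numer :: "nat \<Rightarrow> (nat \<Rightarrow> complex) \<Rightarrow> complex \<Rightarrow> complex" where
  "numer d c z = (\<Sum>i\<le>2*d. c i * z ^ i)"

definition denom :: "nat \<Rightarrow> (nat \<Rightarrow> complex) \<Rightarrow> complex \<Rightarrow> complex" where
  "denom d c z = (\<Sum>i\<le>2*d. c (2*d + 1 + i) * z ^ i)"

definition rat_space :: "nat \<Rightarrow> (nat \<Rightarrow> complex) set" where
  "rat_space d = {c. (\<forall>i>4*d+1. c i = 0) \<and> (c (2*d) \<noteq> 0 \<or> c (4*d+1) \<noteq> 0) \<and>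
      \<not> (\<exists>z. numer d c z = 0 \<and> denom d c z = 0)}"

definition ratmap :: "nat \<Rightarrow> (nat \<Rightarrow> complex) \<Rightarrow> csph \<Rightarrow> csph" where
  "ratmap d c x = (case x of
      None \<Rightarrow> (if c (4*d+1) = 0 then None else Some (c (2*d) / c (4*d+1)))
    | Some z \<Rightarrow> (if denom d c z = 0 then None else Some (numer d c z / denom d c z)))"

definition rat_equiv :: "nat \<Rightarrow> (nat \<Rightarrow> complex) \<Rightarrow> (nat \<Rightarrow> complex) \<Rightarrow> bool" where
  "rat_equiv d c c' \<longleftrightarrow> (\<exists>M1 M2. is_moeb M1 \<and> is_moeb M2 \<and> M1 \<circ> eta = eta \<circ> M1 \<and>
      ratmap d c' = M2 \<circ> ratmap d c \<circ> M1)"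

definition rat_cls :: "nat \<Rightarrow> (nat \<Rightarrow> complex) \<Rightarrow> (nat \<Rightarrow> complex) set" where
  "rat_cls d c = {c' \<in> rat_space d. rat_equiv d c c'}"

definition quot_top :: "'a topology \<Rightarrow> ('a \<Rightarrow> 'b) \<Rightarrow> 'b topology" where
  "quot_top X q = topology (\<lambda>U. U \<subseteq> q ` topspace X \<and> openin X {x \<in> topspace X. q x \<in> U})"

lemma istopology_quot: "istopology (\<lambda>U. U \<subseteq> q ` topspace X \<and> openin X {x \<in> topspace X. q x \<in> U})"
proof -
  have i: "{x \<in> topspace X. q x \<in> S \<inter> T} = {x \<in> topspace X. q x \<in> S} \<inter> {x \<in> topspace X. q x \<in> T}" for S T
    by auto
  have u: "{x \<in> topspace X. q x \<in> \<Union>K} = (\<Union>S\<in>K. {x \<in> topspace X. q x \<in> S})" for K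
    by auto
  show ?thesis
    unfolding istopology_def i u by auto
qed

text \<open>Rat_2d(C)/~ with the quotient topology.  Rat_2d is an open subset of P^(4d+1); its
  topology is the quotient of the subspace of coefficient vectors in C^(4d+2), so
  Rat_2d/~ is the quotient of that subspace by the composite relation.\<close>
definition rat_mod_top :: "nat \<Rightarrow> (nat \<Rightarrow> complex) set topology" where
  "rat_mod_top d = quot_top (subtopology euclidean (rat_space d)) (rat_cls d)"

definition monic_centered :: "nat \<Rightarrow> complex poly \<Rightarrow> bool" where
  "monic_centered k P \<longleftrightarrow> degree P = k \<and> lead_coeff P = 1 \<and> coeff P (k - 1) = 0"

definition basin :: "complex poly \<Rightarrow> complex \<Rightarrow> complex set" where
  "basin P a = {z. (\<lambda>n. (poly P ^^ n) z) \<longlonglongrightarrow> a}"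

definition imm_basin :: "complex poly \<Rightarrow> complex \<Rightarrow> complex set" where
  "imm_basin P a = connected_component_set (basin P a) a"

definition hyp_locus :: "nat \<Rightarrow> complex poly set" where
  "hyp_locus k = {P. monic_centered k P \<and> (\<exists>a. poly P a = a \<and> cmod (poly (pderiv P) a) < 1 \<and>
      (\<forall>c. poly (pderiv P) c = 0 \<longrightarrow> c \<in> imm_basin P a))}"

definition coeffvec :: "complex poly \<Rightarrow> nat \<Rightarrow> complex" where
  "coeffvec P = (\<lambda>i. coeff P i)"

definition principal_hyp :: "nat \<Rightarrow> complex poly set" where
  "principal_hyp k = {P. monic_centered k P \<and>
      coeffvec P \<in> connected_component_set (coeffvec ` hyp_locus k) (coeffvec (monom 1 k))}"

definition filled_julia :: "complex poly \<Rightarrow> complex set" where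
  "filled_julia P = {z. bounded (range (\<lambda>n. (poly P ^^ n) z))}"

definition boettcher :: "complex poly \<Rightarrow> (complex \<Rightarrow> complex) \<Rightarrow> bool" where
  "boettcher P \<psi> \<longleftrightarrow> continuous_on {z. 1 \<le> cmod z} \<psi> \<and>
     \<psi> holomorphic_on {z. 1 < cmod z} \<and> inj_on \<psi> {z. 1 < cmod z} \<and>
     \<psi> ` {z. 1 < cmod z} = - filled_julia P \<and>
     (\<forall>z. 1 < cmod z \<longrightarrow> \<psi> (z ^ degree P) = poly P (\<psi> z)) \<and>
     ((\<lambda>z. \<psi> z / z) \<longlongrightarrow> 1) at_infinity"

text \<open>Side j of the regular ideal 2d-gon joins exp(i pi j/d) and exp(i pi (j+1)/d); it lies on the
  circle of centre bs_center d j and radius bs_rad d (orthogonal to the unit circle).\<close>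
definition bs_center :: "nat \<Rightarrow> nat \<Rightarrow> complex" where
  "bs_center d j = cis (pi * (2 * real j + 1) / (2 * real d)) / complex_of_real (cos (pi / (2 * real d)))"

definition bs_rad :: "nat \<Rightarrow> real" where
  "bs_rad d = tan (pi / (2 * real d))"

text \<open>Side pairing: complex conjugation composed with reflection in side j; it maps side j onto
  its complex-conjugate side.\<close>
definition bs_gen :: "nat \<Rightarrow> nat \<Rightarrow> complex \<Rightarrow> complex" where
  "bs_gen d j z = cnj (bs_center d j) + complex_of_real ((bs_rad d)\<^sup>2) / (z - bs_center d j)"

definition bs_region :: "nat \<Rightarrow> nat \<Rightarrow> complex set" where
  "bs_region d j = cball 0 1 \<inter> cball (bs_center d j) (bs_rad d)"

definition poly_interior :: "nat \<Rightarrow> complex set" where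
  "poly_interior d = {z. cmod z < 1 \<and> (\<forall>j<2*d. bs_rad d < cmod (z - bs_center d j))}"

definition bs_dom :: "nat \<Rightarrow> complex set" where
  "bs_dom d = cball 0 1 - poly_interior d"

definition bs_map :: "nat \<Rightarrow> complex \<Rightarrow> complex" where
  "bs_map d z = bs_gen d (LEAST j. j < 2*d \<and> z \<in> bs_region d j) z"

definition circ_orient_pres :: "(complex \<Rightarrow> complex) \<Rightarrow> bool" where
  "circ_orient_pres f \<longleftrightarrow> (\<exists>\<theta>::real\<Rightarrow>real. continuous_on UNIV \<theta> \<and> strict_mono \<theta> \<and>
      (\<forall>t. f (cis t) = cis (\<theta> t)))"

definition quasiconformal_on :: "complex set \<Rightarrow> (complex \<Rightarrow> complex) \<Rightarrow> bool" where
  "quasiconformal_on U f \<longleftrightarrow> open U \<and> inj_on f U \<and> continuous_on U f \<and>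
     (\<exists>H. \<forall>z\<in>U. \<exists>\<delta>>0. cball z \<delta> \<subseteq> U \<and>
        (\<forall>r h h'. 0 < r \<and> r < \<delta> \<and> cmod h = r \<and> cmod h' = r \<longrightarrow>
            cmod (f (z + h) - f z) \<le> H * cmod (f (z + h') - f z)))"

text \<open>A marking: an orientation preserving quasiconformal self-map of the disc (extended to the
  closed disc) fixing 1 and conjugating the generators of Gamma_0 into disc automorphisms.\<close>
definition teich_marking :: "nat \<Rightarrow> (complex \<Rightarrow> complex) \<Rightarrow> (complex \<Rightarrow> complex) \<Rightarrow> bool" where
  "teich_marking d \<phi> \<phi>i \<longleftrightarrow> homeomorphism (cball 0 1) (cball 0 1) \<phi> \<phi>i \<and>
     quasiconformal_on (ball 0 1) \<phi> \<and> circ_orient_pres \<phi> \<and> \<phi> 1 = 1 \<and>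
     (\<forall>j<2*d. \<exists>\<theta> a. cmod a < 1 \<and>
        (\<forall>z\<in>ball 0 1. \<phi> (bs_gen d j z) = cis \<theta> * (\<phi> z - a) / (1 - cnj a * \<phi> z)))"

definition circle_conj :: "nat \<Rightarrow> (complex \<Rightarrow> complex) \<Rightarrow> (complex \<Rightarrow> complex) \<Rightarrow> (complex \<Rightarrow> complex) \<Rightarrow> bool" where
  "circle_conj d \<phi> \<phi>i h \<longleftrightarrow> (\<exists>hi. homeomorphism (sphere 0 1) (sphere 0 1) h hi) \<and>
     circ_orient_pres h \<and> h 1 = 1 \<and>
     (\<forall>\<zeta>\<in>sphere 0 1. h (\<zeta> ^ (2*d - 1)) = \<phi> (bs_map d (\<phi>i (h \<zeta>))))"

definition mate_rel :: "(complex \<Rightarrow> complex) \<Rightarrow> (complex \<Rightarrow> complex) \<Rightarrow> complex + complex \<Rightarrow> complex + complex \<Rightarrow> bool" where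
  "mate_rel \<psi> h a b \<longleftrightarrow> (\<exists>\<zeta>. cmod \<zeta> = 1 \<and> a = Inl (\<psi> \<zeta>) \<and> b = Inr (h (cnj \<zeta>)))"

definition mating_set :: "nat \<Rightarrow> complex poly \<Rightarrow> (complex \<Rightarrow> complex) \<Rightarrow> (complex \<Rightarrow> csph) \<Rightarrow> (complex \<Rightarrow> csph) \<Rightarrow> csph set" where
  "mating_set d P \<phi> XP XG = XP ` filled_julia P \<union> XG ` (\<phi> ` bs_dom d)"

definition conformal_mating :: "nat \<Rightarrow> complex poly \<Rightarrow> (complex \<Rightarrow> complex) \<Rightarrow> (complex \<Rightarrow> complex) \<Rightarrow>
    (csph \<Rightarrow> csph) \<Rightarrow> (complex \<Rightarrow> csph) \<Rightarrow> (complex \<Rightarrow> csph) \<Rightarrow> bool" where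
  "conformal_mating d P \<phi> \<phi>i F XP XG \<longleftrightarrow>
     continuous_map (subtopology sph_top (sph_top closure_of mating_set d P \<phi> XP XG)) sph_top F \<and>
     sholo_on (sph_top interior_of mating_set d P \<phi> XP XG) F \<and>
     continuous_map (subtopology euclidean (filled_julia P)) sph_top XP \<and>
     cholo_on (interior (filled_julia P)) XP \<and> inj_on XP (interior (filled_julia P)) \<and>
     continuous_map (subtopology euclidean (cball 0 1)) sph_top XG \<and>
     cholo_on (ball 0 1) XG \<and> inj_on XG (ball 0 1) \<and>
     XP ` filled_julia P \<union> XG ` cball 0 1 = UNIV \<and>
     (\<forall>z\<in>filled_julia P. XP (poly P z) = F (XP z)) \<and>
     (\<forall>w\<in>\<phi> ` bs_dom d. XG (\<phi> (bs_map d (\<phi>i w))) = F (XG w)) \<and>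
     (\<exists>\<psi> h. boettcher P \<psi> \<and> circle_conj d \<phi> \<phi>i h \<and>
        (\<forall>z\<in>filled_julia P. \<forall>w\<in>cball 0 1.
            XP z = XG w \<longleftrightarrow> equivclp (mate_rel \<psi> h) (Inl z) (Inr w)))"

text \<open>Coefficient vectors c of representatives R_{Gamma,P}, Gamma ranging over Teich(S_{0,d+1}).\<close>
definition bers_rep :: "nat \<Rightarrow> complex poly \<Rightarrow> (nat \<Rightarrow> complex) \<Rightarrow> bool" where
  "bers_rep d P c \<longleftrightarrow> c \<in> rat_space d \<and>
     (\<exists>\<phi> \<phi>i F XP XG D. teich_marking d \<phi> \<phi>i \<and> conformal_mating d P \<phi> \<phi>i F XP XG \<and>
        jordan_domain D \<and> Some 1 \<in> sph_top frontier_of D \<and>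
        eta ` D = - (sph_top closure_of D) \<and>
        sholo_on D (ratmap d c) \<and> inj_on (ratmap d c) D \<and>
        ratmap d c ` D = sph_top interior_of mating_set d P \<phi> XP XG \<and>
        (\<forall>x\<in>D. F (ratmap d c x) = ratmap d c (eta x)))"

definition bers_slice :: "nat \<Rightarrow> complex poly \<Rightarrow> (nat \<Rightarrow> complex) set set" where
  "bers_slice d P = rat_cls d ` {c. bers_rep d P c}"

end

theory Submission
  imports Defs "HOL-Computational_Algebra.Fundamental_Theorem_Algebra"
begin

text \<open>Let \<open>A\<close> be the immediate basin of \<open>P\<close>. In the source coordinate \<open>(z - 1) / (z + 1)\<close> the map \<open>\<eta>\<close>
  becomes \<open>z \<mapsto> - z\<close>, and a mating yields \<open>R = N / D\<close> of degree \<open>2d\<close>, a conformal map \<open>X\<close> of \<open>A\<close>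
  (the embedding of the polynomial side) and a lift \<open>g\<close> of \<open>X\<close> with \<open>R \<circ> g = X\<close> and
  \<open>R \<circ> (- g) = X \<circ> P\<close> on \<open>A\<close>, where \<open>g(A)\<close> and \<open>- g(A)\<close> are disjoint. After
  normalization the maps \<open>g\<close> and \<open>X\<close> form normal families, and the functional equations determine \<open>R\<close>
  from their limits. Degree can only be lost at the points \<open>0\<close> and \<open>\<infinity>\<close>; this is excluded because
  the \<open>2d\<close> critical points of \<open>R\<close> lying over the ideal vertices, which include \<open>0\<close>, \<open>\<infinity>\<close> and a pair
  \<open>\<plusminus> v\<close>, are provided by a Riemann--Hurwitz count. To pass to the quotient, the orbit of a compact set
  under the noncompact group of changes of coordinates is closed once the polynomial maps of the
  source coordinate, which contain all degenerate limits, are added; up to scaling these form a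
  compact set.\<close>

section \<open>Coefficientwise convergence of polynomials\<close>

text \<open>Being normalized at two points, \<open>X\<close> cannot degenerate, and
  \<open>g\<close>, which avoids 0 and \<open>- g(a)\<close>, can only collapse to the constant 1.
  Blowing up at 1 and at -1 by the rate \<open>g(p) - 1\<close> then yields two limits of
  \<open>R\<close>: the identity at 1, and at -1 a quotient with numerator of degree
  \<open>2d - 1\<close>. The identity has no critical points, so by symmetry the pair
  \<open>v\<close>, \<open>- v\<close> escapes from both charts. With 0 and infinity, three critical
  points have left the chart at -1, and its limit grows at least quadratically. Pulling a large disc
  back along orbits of \<open>P\<close>, from a neighbourhood of the fixed point, then bounds
  \<open>X\<close> on \<open>A\<close>; but \<open>X(A)\<close> accumulates at \<open>R(0)\<close>,
  which is infinity. The root counts behind these limits need \<open>A\<close> to be totally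
  invariant, which comes from a covering argument outside a continuum of critical values. A second
  obstacle is that the quotient is not Hausdorff: letting \<open>c\<close> tend to 0 in
  \<open>z^(2d) + c z\<close> moves within one class towards another. A compact set therefore need
  not have closed image, and closedness is proved for the saturation instead.\<close>

definition pconv :: "(nat \<Rightarrow> complex poly) \<Rightarrow> complex poly \<Rightarrow> bool" where
  "pconv q p \<longleftrightarrow> (\<forall>j. (\<lambda>i. coeff (q i) j) \<longlonglongrightarrow> coeff p j)"

lemma pconv_const [intro]: "pconv (\<lambda>i. p) p"
  by (simp add: pconv_def)

lemma pconv_subseq: "pconv q p \<Longrightarrow> strict_mono r \<Longrightarrow> pconv (\<lambda>i. q (r i)) p"
  unfolding pconv_def using LIMSEQ_subseq_LIMSEQ[of _ _ r] by (auto simp: o_def)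

lemma pconv_mult: "pconv q p \<Longrightarrow> pconv q' p' \<Longrightarrow> pconv (\<lambda>i. q i * q' i) (p * p')"
  unfolding pconv_def coeff_mult by (auto intro!: tendsto_intros)

lemma pconv_diff: "pconv q p \<Longrightarrow> pconv q' p' \<Longrightarrow> pconv (\<lambda>i. q i - q' i) (p - p')"
  unfolding pconv_def coeff_diff by (auto intro!: tendsto_intros)

lemma pconv_smult: "c \<longlonglongrightarrow> b \<Longrightarrow> pconv q p \<Longrightarrow> pconv (\<lambda>i. smult (c i) (q i)) (smult b p)"
  unfolding pconv_def coeff_smult by (auto intro!: tendsto_intros)

lemma pconv_pderiv: "pconv q p \<Longrightarrow> pconv (\<lambda>i. pderiv (q i)) (pderiv p)"
  unfolding pconv_def coeff_pderiv by (auto intro!: tendsto_intros)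

lemma pconv_linear: "a \<longlonglongrightarrow> x \<Longrightarrow> b \<longlonglongrightarrow> y \<Longrightarrow> pconv (\<lambda>i. [:a i, b i:]) [:x, y:]"
  unfolding pconv_def coeff_pCons by (auto split: nat.splits)

lemma pconv_prod:
  assumes "\<And>x. x \<in> S \<Longrightarrow> pconv (\<lambda>i. q x i) (p x)"
  shows "pconv (\<lambda>i. \<Prod>x\<in>S. q x i) (\<Prod>x\<in>S. p x)"
proof (cases "finite S")
  case True
  thus ?thesis using assms
    by (induction S rule: finite_induct) (auto intro!: pconv_mult)
qed auto

lemma pconv_degree:
  assumes "pconv q p" "\<And>i. degree (q i) \<le> M"
  shows "degree p \<le> M"
proof (rule degree_le, intro allI impI)
  fix j assume "M < j"
  hence "(\<lambda>i. coeff (q i) j) = (\<lambda>i. 0)"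
    using assms(2) by (intro ext coeff_eq_0) (meson le_less_trans)
  moreover have "(\<lambda>i. coeff (q i) j) \<longlonglongrightarrow> coeff p j"
    using assms(1) unfolding pconv_def by blast
  ultimately show "coeff p j = 0"
    by (simp add: LIMSEQ_const_iff)
qed

lemma pconv_poly:
  assumes q: "pconv q p" and M: "\<And>i. degree (q i) \<le> M" and z: "z \<longlonglongrightarrow> w"
  shows "(\<lambda>i. poly (q i) (z i)) \<longlonglongrightarrow> poly p w"
proof -
  have e: "poly f u = (\<Sum>j\<le>M. coeff f j * u ^ j)" if "degree f \<le> M" for f :: "complex poly" and u
  proof -
    have "poly f u = (\<Sum>j\<le>degree f. coeff f j * u ^ j)" by (rule poly_altdef)
    also have "\<dots> = (\<Sum>j\<le>M. coeff f j * u ^ j)"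
      using that by (intro sum.mono_neutral_left) (auto simp: coeff_eq_0)
    finally show ?thesis .
  qed
  have "(\<lambda>i. \<Sum>j\<le>M. coeff (q i) j * z i ^ j) \<longlonglongrightarrow> (\<Sum>j\<le>M. coeff p j * w ^ j)"
    using q z unfolding pconv_def by (intro tendsto_intros) auto
  thus ?thesis
    using e[OF M] e[OF pconv_degree[OF q M]] by simp
qed

text \<open>The coefficient of index \<open>m\<close> serves as a gauge: it tends to 1 along
  \<open>E\<close>, so dividing by it recovers the factors \<open>c i\<close>, about which nothing
  is assumed. In this way factors that are only known to exist are shown to converge.\<close>

lemma pconv_unscale:
  assumes E: "pconv E e" "coeff e m = 1" and q: "pconv q p" and eq: "\<And>i. q i = smult (c i) (E i)"
  shows "c \<longlonglongrightarrow> coeff p m" "p = smult (coeff p m) e"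
proof -
  have Em: "(\<lambda>i. coeff (E i) m) \<longlonglongrightarrow> 1" using E unfolding pconv_def by metis
  have "(\<lambda>i. coeff (q i) m / coeff (E i) m) \<longlonglongrightarrow> coeff p m / 1"
    using q Em unfolding pconv_def by (intro tendsto_intros) auto
  moreover have "\<forall>\<^sub>F i in sequentially. coeff (E i) m \<noteq> 0"
    using Em tendsto_imp_eventually_ne zero_neq_one by metis
  hence "\<forall>\<^sub>F i in sequentially. coeff (q i) m / coeff (E i) m = c i"
    by eventually_elim (simp add: eq)
  ultimately show c: "c \<longlonglongrightarrow> coeff p m"
    by (simp add: tendsto_cong)
  have "pconv q (smult (coeff p m) e)"
    using pconv_smult[OF c E(1)] by (simp add: eq[symmetric])
  thus "p = smult (coeff p m) e"
    using q unfolding pconv_def by (intro poly_eqI) (metis LIMSEQ_unique)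
qed

text \<open>Division by \<open>[:1, - e i:]\<close> is a recursion that adds \<open>e i\<close>
  times the previous coefficient of the quotient, so convergence climbs from the constant term
  upwards. Escaping roots \<open>r\<close> enter through factors \<open>1 - x / r\<close>, which
  tend to 1.\<close>

lemma pconv_linear_cancel:
  assumes q: "pconv (\<lambda>i. [:1, - e i:] * S i) p" and e: "e \<longlonglongrightarrow> 0"
  shows "pconv S p"
  unfolding pconv_def
proof
  fix j
  have q': "(\<lambda>i. coeff ([:1, - e i:] * S i) j) \<longlonglongrightarrow> coeff p j" for j
    using q unfolding pconv_def by blast
  show "(\<lambda>i. coeff (S i) j) \<longlonglongrightarrow> coeff p j"
  proof (induction j)
    case 0
    show ?case using q'[of 0] by simp
  next
    case (Suc j)
    have "(\<lambda>i. coeff ([:1, - e i:] * S i) (Suc j) + e i * coeff (S i) j) \<longlonglongrightarrow> coeff p (Suc j) + 0 * coeff p j"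
      using q'[of "Suc j"] Suc e by (intro tendsto_intros)
    thus ?case by simp
  qed
qed

text \<open>Each root that escapes to infinity lowers the degree of the limit by one. Starting from
  the bound \<open>Suc M\<close>, two distinct escaping roots leave at most
  \<open>M - 1\<close>.\<close>

lemma pconv_escaping_roots:
  assumes q: "pconv q p" and M: "\<And>i. degree (q i) \<le> Suc M" "0 < M"
    and r: "\<And>i. poly (q i) (r i) = 0" "\<And>i. r i \<noteq> 0" "(\<lambda>i. 1 / r i) \<longlonglongrightarrow> 0"
    and s: "\<And>i. poly (q i) (s i) = 0" "\<And>i. s i \<noteq> 0" "(\<lambda>i. 1 / s i) \<longlonglongrightarrow> 0"
    and ne: "\<And>i. r i \<noteq> s i"
  shows "coeff p M = 0"
proof -
  have "\<exists>S. q i = [:1, - (1 / r i):] * ([:1, - (1 / s i):] * S) \<and> degree S \<le> M - 1" for i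
  proof -
    obtain q1 where q1: "q i = [:- r i, 1:] * q1"
      using r(1) poly_eq_0_iff_dvd by (metis dvdE)
    have "poly q1 (s i) = 0"
      using s(1)[of i] ne[of i] by (simp add: q1)
    then obtain q2 where q2: "q1 = [:- s i, 1:] * q2"
      using poly_eq_0_iff_dvd by (metis dvdE)
    have l: "[:- x, 1:] = smult (- x) [:1, - (1 / x):]" if "x \<noteq> 0" for x :: complex
      using that by simp
    have "q i = [:1, - (1 / r i):] * ([:1, - (1 / s i):] * smult (r i * s i) q2)"
      unfolding q1 q2 l[OF r(2)[of i]] l[OF s(2)[of i]]
      by (simp only: mult_smult_left mult_smult_right smult_smult minus_mult_minus mult.assoc mult.commute[of "s i" "r i"])
    moreover have "degree q2 \<le> M - 1"
    proof (cases "q2 = 0")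
      case False
      have "degree (q i) = degree [:- r i, 1:] + (degree [:- s i, 1:] + degree q2)"
        unfolding q1 q2 using False by (metis degree_mult_eq mult_eq_0_iff pCons_eq_0_iff zero_neq_one)
      thus ?thesis using M(1)[of i] by simp
    qed simp
    ultimately show ?thesis
      by (intro exI[of _ "smult (r i * s i) q2"]) auto
  qed
  hence "\<exists>S. \<forall>i. q i = [:1, - (1 / r i):] * ([:1, - (1 / s i):] * S i) \<and> degree (S i) \<le> M - 1"
    by (intro choice allI)
  then obtain S where S: "\<And>i. q i = [:1, - (1 / r i):] * ([:1, - (1 / s i):] * S i)"
    "\<And>i. degree (S i) \<le> M - 1" by blast
  have qe: "q = (\<lambda>i. [:1, - (1 / r i):] * ([:1, - (1 / s i):] * S i))"
    using S(1) by (rule ext)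
  have "pconv (\<lambda>i. [:1, - (1 / r i):] * ([:1, - (1 / s i):] * S i)) p"
    using q unfolding qe .
  from pconv_linear_cancel[OF pconv_linear_cancel[OF this r(3)] s(3)]
  have "pconv S p" .
  hence "degree p \<le> M - 1" using S(2) by (rule pconv_degree)
  thus ?thesis using M(2) by (simp add: coeff_eq_0)
qed

text \<open>Matching the coefficient of index \<open>card S\<close> with the monic product leaves a
  difference of smaller degree with \<open>card S\<close> roots, hence 0. That coefficient replaces
  the leading one so that \<open>p\<close> of smaller degree, necessarily 0, is covered too.\<close>

lemma poly_factor_roots:
  fixes p :: "complex poly"
  assumes "finite S" "degree p \<le> card S" "\<And>r. r \<in> S \<Longrightarrow> poly p r = 0"
  shows "p = smult (coeff p (card S)) (\<Prod>r\<in>S. [:- r, 1:])"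
proof -
  define E where "E = (\<Prod>r\<in>S. [:- r, 1:])"
  have dE: "degree E = card S" unfolding E_def
    using assms(1) by (simp add: degree_prod_eq_sum_degree)
  have "lead_coeff E = 1" unfolding E_def by (simp add: lead_coeff_prod)
  hence cE: "coeff E (card S) = 1" by (simp add: dE)
  define q where "q = p - smult (coeff p (card S)) E"
  have rq: "poly q r = 0" if "r \<in> S" for r
    using assms(1,3) that unfolding q_def E_def by (auto simp: poly_prod)
  have "q = 0"
  proof (rule ccontr)
    assume nz: "q \<noteq> 0"
    have "degree q \<le> card S"
      unfolding q_def using assms(2) dE by (intro degree_diff_le) (auto intro: order_trans[OF degree_smult_le])
    moreover have "coeff q (card S) = 0" by (simp add: q_def cE)
    ultimately have lt: "degree q < card S" using nz
      by (metis le_neq_implies_less leading_coeff_0_iff)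
    have "card S \<le> card {r. poly q r = 0}"
      using rq poly_roots_finite[OF nz] by (intro card_mono) auto
    also have "\<dots> \<le> degree q" using nz by (rule card_poly_roots_bound)
    finally show False using lt by simp
  qed
  thus ?thesis by (simp add: q_def E_def)
qed

text \<open>The numerator of the derivative of \<open>f / g\<close>. For a coprime pair defining a
  map of degree \<open>n\<close> its zeros are the finite critical points, multiple poles included,
  and its degree is below \<open>2 * n - 2\<close> exactly when infinity is critical.\<close>

definition wronskian :: "complex poly \<Rightarrow> complex poly \<Rightarrow> complex poly" where
  "wronskian f g = pderiv f * g - f * pderiv g"

lemma wronskian_smult: "wronskian (smult s f) (smult s g) = smult (s * s) (wronskian f g)"
  by (simp add: wronskian_def pderiv_smult smult_diff_right)

lemma wronskian_pcompose:
  "wronskian (pcompose f [:b, c:]) (pcompose g [:b, c:]) = smult c (pcompose (wronskian f g) [:b, c:])"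
proof -
  have "pderiv [:b, c:] = [:c:]" by (simp add: pderiv_pCons)
  thus ?thesis
    by (simp add: wronskian_def pderiv_pcompose pcompose_diff pcompose_mult smult_diff_right mult.commute)
qed

lemma pconv_wronskian: "pconv f F \<Longrightarrow> pconv g G \<Longrightarrow> pconv (\<lambda>i. wronskian (f i) (g i)) (wronskian F G)"
  unfolding wronskian_def by (intro pconv_diff pconv_mult pconv_pderiv)

text \<open>Projective space is compact: after division by the sum \<open>\<mu> i\<close> of the
  moduli of all coefficients the total weight is 1, and this passes to the limit, so the two limits
  do not both vanish. The scale is common to both polynomials because only their quotient
  matters.\<close>

lemma pair_normalized_subsequence:
  fixes A B :: "nat \<Rightarrow> complex poly"
  assumes deg: "\<And>i. degree (A i) \<le> M" "\<And>i. degree (B i) \<le> M"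
    and nz: "\<And>i. A i \<noteq> 0 \<or> B i \<noteq> 0"
  obtains r :: "nat \<Rightarrow> nat" and s A' B' where "strict_mono r" "\<And>i. s i \<noteq> (0::complex)"
    "pconv (\<lambda>i. smult (s i) (A (r i))) A'" "pconv (\<lambda>i. smult (s i) (B (r i))) B'" "A' \<noteq> 0 \<or> B' \<noteq> 0"
proof -
  define \<mu> where "\<mu> i = (\<Sum>j\<le>M. cmod (coeff (A i) j) + cmod (coeff (B i) j))" for i
  have le: "cmod (coeff (A i) j) + cmod (coeff (B i) j) \<le> \<mu> i" for i j
  proof (cases "j \<le> M")
    case True
    thus ?thesis unfolding \<mu>_def
      by (intro member_le_sum) auto
  next
    case False
    hence "coeff (A i) j = 0" "coeff (B i) j = 0" using deg[of i] by (auto simp: coeff_eq_0)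
    thus ?thesis by (simp add: \<mu>_def sum_nonneg)
  qed
  have pos: "\<mu> i > 0" for i
  proof -
    obtain j where "coeff (A i) j \<noteq> 0 \<or> coeff (B i) j \<noteq> 0"
      using nz[of i] by (metis leading_coeff_0_iff)
    hence "0 < cmod (coeff (A i) j) + cmod (coeff (B i) j)"
      by (smt (verit) norm_ge_zero zero_less_norm_iff)
    thus ?thesis using le[of i j] by linarith
  qed
  \<comment> \<open>Indexing the coefficients of both polynomials by one sum type lets a single
    diagonal extraction treat them together.\<close>
  define f where "f i x = (case x of Inl j \<Rightarrow> coeff (A i) j / \<mu> i | Inr j \<Rightarrow> coeff (B i) j / \<mu> i)"
    for i and x :: "nat + nat"
  have bd: "norm (f i x) \<le> 1" for i x
  proof -
    have "cmod (coeff (A i) j) \<le> \<mu> i" "cmod (coeff (B i) j) \<le> \<mu> i" for j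
      using le[of i j] norm_ge_zero[of "coeff (A i) j"] norm_ge_zero[of "coeff (B i) j"] by linarith+
    thus ?thesis using pos[of i]
      by (auto simp: f_def norm_divide split: sum.splits)
  qed
  obtain r where r: "strict_mono r" "\<And>x. \<exists>l. (\<lambda>n. f (r n) x) \<longlonglongrightarrow> l"
    using function_convergent_subsequence[of "UNIV :: (nat + nat) set" f 1] bd by auto
  then obtain L where L: "\<And>x. (\<lambda>n. f (r n) x) \<longlonglongrightarrow> L x" by metis
  have L0: "L (Inl j) = 0" "L (Inr j) = 0" if "M < j" for j
  proof -
    have "f n (Inl j) = 0" "f n (Inr j) = 0" for n
      using deg[of n] that by (auto simp: f_def coeff_eq_0)
    thus "L (Inl j) = 0" "L (Inr j) = 0" using L[of "Inl j"] L[of "Inr j"]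
      by (auto intro: LIMSEQ_unique[OF _ tendsto_const])
  qed
  define A' where "A' = Abs_poly (\<lambda>j. L (Inl j))"
  define B' where "B' = Abs_poly (\<lambda>j. L (Inr j))"
  have cA: "coeff A' j = L (Inl j)" and cB: "coeff B' j = L (Inr j)" for j
    unfolding A'_def B'_def using L0 by (subst coeff_Abs_poly[of M]; auto)+
  show ?thesis
  proof
    show "strict_mono r" by fact
    show "complex_of_real (1 / \<mu> (r i)) \<noteq> 0" for i using pos[of "r i"] by auto
    show "pconv (\<lambda>i. smult (complex_of_real (1 / \<mu> (r i))) (A (r i))) A'"
      "pconv (\<lambda>i. smult (complex_of_real (1 / \<mu> (r i))) (B (r i))) B'"
      using L[of "Inl _"] L[of "Inr _"] unfolding pconv_def by (auto simp: cA cB f_def)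
    have "(\<lambda>n. \<Sum>j\<le>M. cmod (f (r n) (Inl j)) + cmod (f (r n) (Inr j))) \<longlonglongrightarrow>
        (\<Sum>j\<le>M. cmod (L (Inl j)) + cmod (L (Inr j)))"
      using L by (intro tendsto_intros)
    moreover have "(\<Sum>j\<le>M. cmod (f n (Inl j)) + cmod (f n (Inr j))) = 1" for n
    proof -
      have "(\<Sum>j\<le>M. cmod (f n (Inl j)) + cmod (f n (Inr j))) =
          (\<Sum>j\<le>M. (cmod (coeff (A n) j) + cmod (coeff (B n) j)) / \<mu> n)"
        using pos[of n] by (intro sum.cong) (auto simp: f_def norm_divide add_divide_distrib)
      also have "\<dots> = \<mu> n / \<mu> n"
        by (subst sum_divide_distrib[symmetric]) (simp add: \<mu>_def)
      finally have "(\<Sum>j\<le>M. cmod (f n (Inl j)) + cmod (f n (Inr j))) = \<mu> n / \<mu> n" .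
      thus ?thesis using pos[of n] by simp
    qed
    ultimately have "(\<Sum>j\<le>M. cmod (L (Inl j)) + cmod (L (Inr j))) = 1"
      by (simp add: LIMSEQ_const_iff)
    moreover have "L (Inl j) = 0" "L (Inr j) = 0" if "A' = 0" "B' = 0" for j
      using cA[of j] cB[of j] that by simp_all
    ultimately show "A' \<noteq> 0 \<or> B' \<noteq> 0" by fastforce
  qed
qed

section \<open>Normal families of injective functions\<close>

lemma max_modulus_circle:
  fixes h :: "complex \<Rightarrow> complex"
  assumes "h holomorphic_on S" "open S" "cball c r \<subseteq> S" "0 < r" "\<And>z. z \<in> sphere c r \<Longrightarrow> norm (h z) \<le> B"
    "w \<in> cball c r"
  shows "norm (h w) \<le> B"
proof (rule maximum_modulus_frontier[of h "cball c r"])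
  show "h holomorphic_on interior (cball c r)"
    using assms(1,3) by (meson holomorphic_on_subset interior_subset order_trans)
  show "continuous_on (closure (cball c r)) h"
    using assms(1,3) by (auto intro: holomorphic_on_imp_continuous_on holomorphic_on_subset)
  show "norm (h z) \<le> B" if "z \<in> frontier (cball c r)" for z
    using that assms(4,5) by auto
qed (use assms in auto)

text \<open>If the values at \<open>q\<close> were unbounded, the functions \<open>1 / f n\<close>
  would omit 0 and 1 on \<open>A\<close> without the two points and tend to 0 at \<open>q\<close>.
  Picard's bound, Montel and Hurwitz make a subsequence tend to 0 locally uniformly there. They
  become small on a circle about \<open>p2\<close>, and the maximum principle contradicts their
  value 1 at \<open>p2\<close>.\<close>

lemma injective_two_point_bounded_at:
  assumes A: "open A" "connected A" and p: "p1 \<in> A" "p2 \<in> A" "p1 \<noteq> p2"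
    and q: "q \<in> A" "q \<noteq> p1" "q \<noteq> p2"
  shows "\<exists>B. \<forall>f. f holomorphic_on A \<longrightarrow> inj_on f A \<longrightarrow> f p1 = 0 \<longrightarrow> f p2 = 1 \<longrightarrow> cmod (f q) \<le> B"
proof (rule ccontr)
  assume "\<not> ?thesis"
  hence "\<exists>f. f holomorphic_on A \<and> inj_on f A \<and> f p1 = 0 \<and> f p2 = (1::complex) \<and> real n + 1 < cmod (f q)" for n :: nat
    by (meson not_le)
  then obtain f where f: "\<And>n. f n holomorphic_on A" "\<And>n. inj_on (f n) A" "\<And>n. f n p1 = 0" "\<And>n. f n p2 = (1::complex)"
    and fq: "\<And>n::nat. real n + 1 < cmod (f n q)" by metis
  define A1 where "A1 = A - {p1}"
  define A2 where "A2 = A - {p1} - {p2}"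
  have A1: "open A1" "connected A1" unfolding A1_def using A by (auto intro: connected_open_delete open_delete)
  have A2: "open A2" "connected A2" unfolding A2_def using A1 unfolding A1_def
    by (auto intro: connected_open_delete open_delete)
  have sub: "A2 \<subseteq> A1" "A1 \<subseteq> A" "q \<in> A2" "p2 \<in> A1" using q p by (auto simp: A1_def A2_def)
  define h where "h n z = 1 / f n z" for n z
  have f0: "f n z \<noteq> 0" if "z \<in> A1" for n z
    using f(2)[of n] f(3)[of n] that p(1) unfolding A1_def inj_on_def by (metis Diff_iff insertI1)
  have f1: "f n z \<noteq> 1" if "z \<in> A2" for n z
    using f(2)[of n] f(4)[of n] that p(2) unfolding A2_def inj_on_def by (metis Diff_iff insertI1)
  \<comment> \<open>The point \<open>p2\<close> is removed for the sake of the omitted value 1;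
    \<open>1 / f n\<close> itself is holomorphic there, as the final use of the maximum principle
    requires.\<close>
  have holh: "h n holomorphic_on A1" for n
    unfolding h_def[abs_def] using f(1)[of n] f0 sub(2)
    by (intro holomorphic_intros) (auto intro: holomorphic_on_subset)
  have h01: "h n z \<noteq> 0 \<and> h n z \<noteq> 1" if "z \<in> A2" for n z
    using f0[of z n] f1[of z n] that sub(1) by (auto simp: h_def)
  have hq: "cmod (h n q) \<le> 1 / (real n + 1)" for n
    using fq[of n] by (auto simp: h_def norm_divide frac_le)
  have hq1: "cmod (h n q) \<le> 1" for n
    using order_trans[OF hq[of n]] by simp
  have bd: "\<exists>B. \<forall>g\<in>range h. \<forall>z\<in>K. cmod (g z) \<le> B" if K: "compact K" "K \<subseteq> A2" for K
  proof -
    obtain B where "\<And>g z. g \<in> range h \<Longrightarrow> z \<in> K \<Longrightarrow> cmod (g z) \<le> B"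
    proof (rule GPicard3[of A2 q "range h" "range h" K])
      show "\<And>g. g \<in> range h \<Longrightarrow> g holomorphic_on A2" using holh sub(1) by (auto intro: holomorphic_on_subset)
    qed (use A2 sub h01 hq1 K in auto)
    thus ?thesis by blast
  qed
  have holh2: "g holomorphic_on A2" if "g \<in> range h" for g
    using that holh sub(1) by (auto intro: holomorphic_on_subset)
  obtain g r where g: "g holomorphic_on A2" "strict_mono (r :: nat \<Rightarrow> nat)"
    "\<And>x. x \<in> A2 \<Longrightarrow> (\<lambda>n. h (r n) x) \<longlonglongrightarrow> g x"
    "\<And>K. compact K \<Longrightarrow> K \<subseteq> A2 \<Longrightarrow> uniform_limit K (h \<circ> r) g sequentially"
    by (rule Montel[OF A2(1) holh2 bd order.refl]) (rule that | assumption)+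
  have "(\<lambda>n. h n q) \<longlonglongrightarrow> 0"
  proof (rule Lim_null_comparison)
    show "\<forall>\<^sub>F n in sequentially. norm (h n q) \<le> 1 / (real n + 1)" using hq by simp
    show "(\<lambda>n. 1 / (real n + 1)) \<longlonglongrightarrow> 0" 
      using LIMSEQ_inverse_real_of_nat by (simp add: inverse_eq_divide add.commute)
  qed
  hence "(\<lambda>n. h (r n) q) \<longlonglongrightarrow> 0" using g(2) LIMSEQ_subseq_LIMSEQ by (force simp: o_def)
  hence gq: "g q = 0" using g(3)[OF sub(3)] LIMSEQ_unique by blast
  have "g constant_on A2"
  proof (rule ccontr)
    assume "\<not> g constant_on A2"
    moreover have "(h \<circ> r) n holomorphic_on A2" for n
      using holh sub(1) by (auto intro: holomorphic_on_subset)
    moreover have "(h \<circ> r) n z \<noteq> 0" if "z \<in> A2" for n z using h01 that by auto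
    ultimately have "g q \<noteq> 0"
      using Hurwitz_no_zeros[OF A2, of "h \<circ> r" g q] g(1,4) sub(3) by blast
    thus False using gq by simp
  qed
  hence g0: "g z = 0" if "z \<in> A2" for z
    using gq sub(3) that unfolding constant_on_def by metis
  obtain e where e: "e > 0" "cball p2 e \<subseteq> A1" using A1(1) sub(4) open_contains_cball by blast
  have sph: "sphere p2 e \<subseteq> A2" using e unfolding A2_def A1_def by auto
  have "uniform_limit (sphere p2 e) (h \<circ> r) g sequentially" using g(4) sph by simp
  hence "\<forall>\<^sub>F n in sequentially. \<forall>x\<in>sphere p2 e. dist ((h \<circ> r) n x) (g x) < 1/2"
    unfolding uniform_limit_iff by (meson half_gt_zero_iff zero_less_one)
  hence "\<exists>n. \<forall>x\<in>sphere p2 e. dist ((h \<circ> r) n x) (g x) < 1/2"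
    by (rule eventually_happens'[OF sequentially_bot])
  then obtain n where n: "\<forall>x\<in>sphere p2 e. dist (h (r n) x) (g x) < 1/2"
    by auto
  have "cmod (h (r n) p2) \<le> 1/2"
  proof (rule max_modulus_circle[OF holh A1(1) e(2,1)])
    show "cmod (h (r n) z) \<le> 1/2" if "z \<in> sphere p2 e" for z
      using n that g0 sph by (fastforce simp: dist_norm)
  qed (use e in auto)
  thus False using f(4) by (simp add: h_def)
qed

lemma locally_bounded_imp_bounded_on_compact:
  fixes F :: "(complex \<Rightarrow> complex) set"
  assumes K: "compact K"
    and loc: "\<And>w. w \<in> K \<Longrightarrow> \<exists>B Z. open Z \<and> w \<in> Z \<and> (\<forall>f\<in>F. \<forall>z\<in>Z. cmod (f z) \<le> B)"
  shows "\<exists>B. \<forall>f\<in>F. \<forall>z\<in>K. cmod (f z) \<le> B"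
proof -
  have "\<forall>w\<in>K. \<exists>p. open (snd p) \<and> w \<in> snd p \<and> (\<forall>f\<in>F. \<forall>z\<in>snd p. cmod (f z) \<le> fst p)"
    using loc by fastforce
  then obtain p where p: "\<forall>w\<in>K. open (snd (p w)) \<and> w \<in> snd (p w) \<and> (\<forall>f\<in>F. \<forall>z\<in>snd (p w). cmod (f z) \<le> fst (p w))"
    using bchoice[of K "\<lambda>w p. open (snd p) \<and> w \<in> snd p \<and> (\<forall>f\<in>F. \<forall>z\<in>snd p. cmod (f z) \<le> fst p)"]
    by blast
  obtain D where D: "D \<subseteq> K" "finite D" "K \<subseteq> (\<Union>w\<in>D. snd (p w))"
    using compactE_image[OF K, of K "\<lambda>w. snd (p w)"] p by blast
  have le: "fst (p w) \<le> (\<Sum>v\<in>D. \<bar>fst (p v)\<bar>)" if "w \<in> D" for w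
    using member_le_sum[OF that, of "\<lambda>v. \<bar>fst (p v)\<bar>"] D(2) by simp
  show ?thesis
  proof (intro exI ballI)
    fix f z assume "f \<in> F" "z \<in> K"
    then obtain w where w: "w \<in> D" "z \<in> snd (p w)" using D by blast
    hence "cmod (f z) \<le> fst (p w)" using p D(1) \<open>f \<in> F\<close> by blast
    also note le[OF w(1)]
    finally show "cmod (f z) \<le> (\<Sum>v\<in>D. \<bar>fst (p v)\<bar>)" .
  qed
qed

text \<open>Away from the two points the omitted values 0 and 1 turn a bound at one point into a
  local bound. Around \<open>p1\<close> or \<open>p2\<close> the bound is read off a circle avoiding
  both points and carried inside by the maximum principle.\<close>

lemma injective_two_point_bounded:
  assumes A: "open A" "connected A" and p: "p1 \<in> A" "p2 \<in> A" "p1 \<noteq> p2"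
    and K: "compact K" "K \<subseteq> A"
  shows "\<exists>B. \<forall>f. f holomorphic_on A \<longrightarrow> inj_on f A \<longrightarrow> f p1 = 0 \<longrightarrow> f p2 = 1 \<longrightarrow> (\<forall>z\<in>K. cmod (f z) \<le> B)"
proof -
  define Fam where "Fam = {f. f holomorphic_on A \<and> inj_on f A \<and> f p1 = 0 \<and> f p2 = (1::complex)}"
  define A2 where "A2 = A - {p1} - {p2}"
  have A2: "open A2" "connected A2" unfolding A2_def using A by (auto intro!: connected_open_delete open_delete)
  have F01: "f z \<noteq> 0 \<and> f z \<noteq> 1" if "f \<in> Fam" "z \<in> A2" for f z
  proof -
    have "z \<in> A" "z \<noteq> p1" "z \<noteq> p2" using that(2) by (auto simp: A2_def)
    moreover have inj: "inj_on f A" "f p1 = 0" "f p2 = 1" using that(1) by (auto simp: Fam_def)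
    ultimately show ?thesis
      using inj_onD[OF inj(1), of z p1] inj_onD[OF inj(1), of z p2] p by auto
  qed
  have loc2: "\<exists>B Z. open Z \<and> w \<in> Z \<and> (\<forall>f\<in>Fam. \<forall>z\<in>Z. cmod (f z) \<le> B)" if w: "w \<in> A2" for w
  proof -
    obtain B0 where B0: "\<And>f. f \<in> Fam \<Longrightarrow> cmod (f w) \<le> B0"
      using injective_two_point_bounded_at[OF A p, of w] w unfolding A2_def Fam_def by blast
    obtain B Z where "open Z" "w \<in> Z" "\<And>h z. h \<in> Fam \<Longrightarrow> z \<in> Z \<Longrightarrow> cmod (h z) \<le> B"
    proof (rule GPicard1[OF A2 w, of "max B0 1" Fam Fam])
      show "\<And>h. h \<in> Fam \<Longrightarrow> h holomorphic_on A2"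
        by (auto simp: Fam_def A2_def intro: holomorphic_on_subset)
      show "cmod (h w) \<le> max B0 1" if "h \<in> Fam" for h using B0[OF that] by simp
    qed (use F01 in auto)
    thus ?thesis by blast
  qed
  have bd2: "\<exists>B. \<forall>f\<in>Fam. \<forall>z\<in>C. cmod (f z) \<le> B" if C: "compact C" "C \<subseteq> A2" for C
    using locally_bounded_imp_bounded_on_compact[OF C(1), of Fam] loc2 C(2) by blast
  have loc: "\<exists>B Z. open Z \<and> w \<in> Z \<and> (\<forall>f\<in>Fam. \<forall>z\<in>Z. cmod (f z) \<le> B)" if w: "w \<in> A" for w
  proof (cases "w \<in> A2")
    case True thus ?thesis using loc2 by blast
  next
    case False
    hence "w = p1 \<or> w = p2" using w by (auto simp: A2_def)
    define w' where "w' = (if w = p1 then p2 else p1)"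
    have "open (A - {w'})" "w \<in> A - {w'}"
      using A(1) w \<open>w = p1 \<or> w = p2\<close> p(3) by (auto simp: w'_def)
    then obtain e where e: "e > 0" "cball w e \<subseteq> A - {w'}" by (meson open_contains_cball)
    hence "sphere w e \<subseteq> A2"
      using \<open>w = p1 \<or> w = p2\<close> by (auto simp: A2_def w'_def split: if_splits)
    then obtain B where B: "\<And>f z. f \<in> Fam \<Longrightarrow> z \<in> sphere w e \<Longrightarrow> cmod (f z) \<le> B"
      using bd2[OF compact_sphere] by meson
    have "cmod (f z) \<le> B" if "f \<in> Fam" "z \<in> ball w e" for f z
      using max_modulus_circle[of f A w e B z] e B that A(1) by (auto simp: Fam_def)
    thus ?thesis using e(1) by (intro exI[of _ B] exI[of _ "ball w e"]) auto
  qed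
  have "\<exists>B. \<forall>f\<in>Fam. \<forall>z\<in>K. cmod (f z) \<le> B"
    using locally_bounded_imp_bounded_on_compact[OF K(1), of Fam] loc K(2) by blast
  thus ?thesis unfolding Fam_def by blast
qed

lemma injective_two_point_normal:
  assumes A: "open A" "connected A" and p: "p1 \<in> A" "p2 \<in> A" "p1 \<noteq> p2"
    and f: "\<And>n. f n holomorphic_on A" "\<And>n. inj_on (f n) A" "\<And>n. f n p1 = 0" "\<And>n. f n p2 = (1::complex)"
  obtains g r where "g holomorphic_on A" "inj_on g A" "strict_mono (r :: nat \<Rightarrow> nat)"
    "\<And>x. x \<in> A \<Longrightarrow> (\<lambda>n. f (r n) x) \<longlonglongrightarrow> g x"
    "\<And>K. compact K \<Longrightarrow> K \<subseteq> A \<Longrightarrow> uniform_limit K (f \<circ> r) g sequentially"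
proof -
  have bd: "\<exists>B. \<forall>h\<in>range f. \<forall>z\<in>K. cmod (h z) \<le> B" if K: "compact K" "K \<subseteq> A" for K
  proof -
    obtain B where B: "\<And>h. h holomorphic_on A \<Longrightarrow> inj_on h A \<Longrightarrow> h p1 = 0 \<Longrightarrow> h p2 = 1 \<Longrightarrow> (\<forall>z\<in>K. cmod (h z) \<le> B)"
      using injective_two_point_bounded[OF A p K] by blast
    show ?thesis using B[OF f(1) f(2) f(3) f(4)] by (intro exI[of _ B]) auto
  qed
  have hol': "\<And>h. h \<in> range f \<Longrightarrow> h holomorphic_on A" using f(1) by auto
  obtain g r where g: "g holomorphic_on A" "strict_mono (r :: nat \<Rightarrow> nat)"
    "\<And>x. x \<in> A \<Longrightarrow> (\<lambda>n. f (r n) x) \<longlonglongrightarrow> g x"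
    "\<And>K. compact K \<Longrightarrow> K \<subseteq> A \<Longrightarrow> uniform_limit K (f \<circ> r) g sequentially"
    by (rule Montel[OF A(1) hol' bd order.refl]) (rule that | assumption)+
  have "g p1 = 0" "g p2 = 1"
    using LIMSEQ_unique[OF g(3)[OF p(1)], of 0] LIMSEQ_unique[OF g(3)[OF p(2)], of 1] f(3,4) by simp_all
  hence "\<not> g constant_on A" using p(1,2) unfolding constant_on_def by (metis zero_neq_one)
  hence "inj_on g A"
    using Hurwitz_injective[OF A, of "f \<circ> r" g] f(1,2) g(1,4) by auto
  thus ?thesis using that g by metis
qed

text \<open>The functions \<open>- f n\<close> omit 0 and 1, which gives normality. As only the
  value at \<open>a\<close> is prescribed, a constant limit remains possible, and it must be 1; this
  is the collapse that has to be excluded separately.\<close>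

lemma omit_zero_and_opposite_normal:
  assumes A: "open A" "connected A" and a: "a \<in> A"
    and f: "\<And>n. f n holomorphic_on A" "\<And>n. inj_on (f n) A" "\<And>n. f n a = (1::complex)"
      "\<And>n x. x \<in> A \<Longrightarrow> f n x \<noteq> 0 \<and> f n x \<noteq> -1"
  obtains g r where "g holomorphic_on A" "inj_on g A \<or> (\<forall>x\<in>A. g x = 1)" "strict_mono (r :: nat \<Rightarrow> nat)"
    "\<And>x. x \<in> A \<Longrightarrow> (\<lambda>n. f (r n) x) \<longlonglongrightarrow> g x"
    "\<And>K. compact K \<Longrightarrow> K \<subseteq> A \<Longrightarrow> uniform_limit K (f \<circ> r) g sequentially"
proof -
  have bd: "\<exists>B. \<forall>h\<in>range f. \<forall>z\<in>K. cmod (h z) \<le> B" if K: "compact K" "K \<subseteq> A" for K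
  proof -
    let ?Y = "range (\<lambda>n z. - f n z)"
    obtain B where "\<And>h z. h \<in> ?Y \<Longrightarrow> z \<in> K \<Longrightarrow> cmod (h z) \<le> B"
    proof (rule GPicard3[of A a ?Y ?Y K])
      show "\<And>h. h \<in> ?Y \<Longrightarrow> h holomorphic_on A" using f(1) by (auto intro!: holomorphic_intros)
      show "h z \<noteq> 0 \<and> h z \<noteq> 1" if h: "h \<in> ?Y" "z \<in> A" for h z
      proof -
        obtain n where "h = (\<lambda>z. - f n z)" using h(1) by auto
        thus ?thesis using f(4)[OF h(2), of n] by (auto simp: minus_equation_iff[of "f n z"])
      qed
      show "\<And>h. h \<in> ?Y \<Longrightarrow> cmod (h a) \<le> 1" using f(3) by auto
    qed (use A a K in auto)
    hence "cmod (f n z) \<le> B" if "z \<in> K" for n z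
      using that norm_minus_cancel[of "f n z"] by (metis (no_types, lifting) rangeI)
    thus ?thesis by (intro exI[of _ B]) auto
  qed
  have hol': "\<And>h. h \<in> range f \<Longrightarrow> h holomorphic_on A" using f(1) by auto
  obtain g r where g: "g holomorphic_on A" "strict_mono (r :: nat \<Rightarrow> nat)"
    "\<And>x. x \<in> A \<Longrightarrow> (\<lambda>n. f (r n) x) \<longlonglongrightarrow> g x"
    "\<And>K. compact K \<Longrightarrow> K \<subseteq> A \<Longrightarrow> uniform_limit K (f \<circ> r) g sequentially"
    by (rule Montel[OF A(1) hol' bd order.refl]) (rule that | assumption)+
  have "g a = 1" using g(3)[OF a] f(3) by (simp add: LIMSEQ_const_iff)
  moreover have "inj_on g A" if "\<not> g constant_on A"
    using Hurwitz_injective[OF A, of "f \<circ> r" g] f(1,2) g(1,4) that by auto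
  ultimately have "inj_on g A \<or> (\<forall>x\<in>A. g x = 1)"
    using a unfolding constant_on_def by metis
  thus ?thesis using that g by metis
qed

section \<open>Compactness of normalized matings\<close>

lemma coeff_mult_degree_bounds:
  fixes p q :: "complex poly"
  assumes "degree p \<le> m" "degree q \<le> n"
  shows "coeff (p * q) (m + n) = coeff p m * coeff q n"
proof -
  have "coeff (p * q) (m + n) = (\<Sum>i\<le>m + n. coeff p i * coeff q (m + n - i))"
    by (simp add: coeff_mult)
  also have "\<dots> = (\<Sum>i\<in>{m}. coeff p i * coeff q (m + n - i))"
  proof (rule sum.mono_neutral_right)
    show "\<forall>i\<in>{..m + n} - {m}. coeff p i * coeff q (m + n - i) = 0"
    proof
      fix i assume "i \<in> {..m + n} - {m}"
      hence "m < i \<or> n < m + n - i" by auto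
      thus "coeff p i * coeff q (m + n - i) = 0"
        using assms by (auto simp: coeff_eq_0)
    qed
  qed auto
  finally show ?thesis by simp
qed

lemma poly_over_power_at_infinity:
  fixes p :: "complex poly"
  assumes "degree p \<le> k"
  shows "((\<lambda>u. poly p u / u ^ k) \<longlongrightarrow> coeff p k) at_infinity"
proof -
  have "((\<lambda>u::complex. \<Sum>j\<le>k. coeff p j * inverse u ^ (k - j)) \<longlongrightarrow> (\<Sum>j\<le>k. coeff p j * 0 ^ (k - j))) at_infinity"
    by (intro tendsto_intros tendsto_inverse_0)
  moreover have "(\<Sum>j\<le>k. coeff p j * 0 ^ (k - j)) = coeff p k"
  proof -
    have "(\<Sum>j\<le>k. coeff p j * 0 ^ (k - j)) = (\<Sum>j\<in>{k}. coeff p j * 0 ^ (k - j))"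
      by (rule sum.mono_neutral_right) auto
    thus ?thesis by simp
  qed
  moreover have "\<forall>\<^sub>F u in at_infinity. (\<Sum>j\<le>k. coeff p j * inverse u ^ (k - j)) = poly p u / u ^ k"
  proof -
    have "(\<Sum>j\<le>k. coeff p j * inverse u ^ (k - j)) = poly p u / u ^ k" if "1 \<le> norm u" for u
    proof -
      have u: "u \<noteq> 0" using that by auto
      have "poly p u = (\<Sum>j\<le>k. coeff p j * u ^ j)"
        unfolding poly_altdef using assms by (intro sum.mono_neutral_left) (auto simp: coeff_eq_0)
      hence "poly p u / u ^ k = (\<Sum>j\<le>k. coeff p j * u ^ j / u ^ k)"
        by (simp add: sum_divide_distrib)
      also have "\<dots> = (\<Sum>j\<le>k. coeff p j * inverse u ^ (k - j))"
        using u by (intro sum.cong) (auto simp: power_diff field_simps)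
      finally show ?thesis by simp
    qed
    thus ?thesis unfolding eventually_at_infinity by blast
  qed
  ultimately show ?thesis by (simp add: tendsto_cong)
qed

lemma poly_dominates_at_infinity:
  fixes p q :: "complex poly"
  assumes "degree p \<le> k" "coeff p k \<noteq> 0" "degree q < k"
  shows "\<exists>R. \<forall>u. R \<le> cmod u \<longrightarrow> 2 * cmod (poly q u) < cmod (poly p u)"
proof -
  have p: "((\<lambda>u. cmod (poly p u / u ^ k)) \<longlongrightarrow> cmod (coeff p k)) at_infinity"
    by (intro tendsto_norm poly_over_power_at_infinity assms)
  have "((\<lambda>u. poly q u / u ^ k) \<longlongrightarrow> coeff q k) at_infinity"
    using assms(3) by (intro poly_over_power_at_infinity) simp
  hence "((\<lambda>u. 2 * cmod (poly q u / u ^ k)) \<longlongrightarrow> 2 * cmod (coeff q k)) at_infinity"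
    by (intro tendsto_intros)
  hence q: "((\<lambda>u. 2 * cmod (poly q u / u ^ k)) \<longlongrightarrow> 0) at_infinity"
    using assms(3) by (simp add: coeff_eq_0)
  have "\<forall>\<^sub>F u in at_infinity. 2 * cmod (poly q u / u ^ k) < cmod (coeff p k) / 2"
    using q assms(2) by (intro order_tendstoD) auto
  moreover have "\<forall>\<^sub>F u in at_infinity. cmod (coeff p k) / 2 < cmod (poly p u / u ^ k)"
    using p assms(2) by (intro order_tendstoD) auto
  moreover have "\<forall>\<^sub>F u in at_infinity. u \<noteq> (0::complex)"
    unfolding eventually_at_infinity by (intro exI[of _ 1]) auto
  ultimately have "\<forall>\<^sub>F u in at_infinity. 2 * cmod (poly q u) < cmod (poly p u)"
  proof eventually_elim
    case (elim u)
    hence "2 * cmod (poly q u / u ^ k) < cmod (poly p u / u ^ k)" by linarith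
    thus ?case using elim(3) by (simp add: norm_divide field_simps)
  qed
  thus ?thesis unfolding eventually_at_infinity by blast
qed

lemma linear_factor_rescale: "r \<noteq> 0 \<Longrightarrow> [:- r, 1:] = smult (- r) [:1, - (1 / r):]"
  for r :: complex
  by simp

lemma degree_eq_sum_orders:
  fixes p :: "complex poly"
  assumes "p \<noteq> 0"
  shows "degree p = (\<Sum>z | poly p z = 0. order z p)"
proof -
  have fin: "finite {z. poly p z = 0}" using assms by (rule poly_roots_finite)
  have "degree p = degree (smult (lead_coeff p) (\<Prod>z | poly p z = 0. [:- z, 1:] ^ order z p))"
    by (simp only: complex_poly_decompose)
  also have "\<dots> = degree (\<Prod>z | poly p z = 0. [:- z, 1:] ^ order z p)"
    using assms by simp
  also have "\<dots> = (\<Sum>z | poly p z = 0. degree ([:- z, 1:] ^ order z p))"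
    by (intro degree_prod_eq_sum_degree) auto
  also have "\<dots> = (\<Sum>z | poly p z = 0. order z p)"
    by (intro sum.cong) (auto simp: degree_power_eq)
  finally show ?thesis .
qed

lemma rsquarefree_card_roots:
  fixes p :: "complex poly"
  assumes "p \<noteq> 0" "rsquarefree p"
  shows "card {z. poly p z = 0} = degree p"
proof -
  have "(\<Sum>z | poly p z = 0. order z p) = (\<Sum>z | poly p z = 0. 1)"
    using assms by (intro sum.cong) (auto simp: rsquarefree_root_order)
  thus ?thesis using degree_eq_sum_orders[OF assms(1)] by simp
qed

text \<open>What the limit argument has to know about the immediate basin: \<open>A\<close> is
  totally invariant, so that a fibre over a noncritical value in \<open>A\<close> has all its
  \<open>k\<close> points in \<open>A\<close>, and iteration carries compact subsets near
  \<open>a\<close>. The second point \<open>p\<close> is there to normalize injective maps.\<close>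

locale poly_basin =
  fixes P :: "complex poly" and A :: "complex set" and a p :: complex and k :: nat and \<epsilon> :: real
  assumes openA: "open A" and connA: "connected A" and aA: "a \<in> A" and pA: "p \<in> A" and pa: "p \<noteq> a"
    and degP: "degree P = k" and k2: "2 \<le> k" and Pa: "poly P a = a"
    and invA: "\<And>x. x \<in> A \<Longrightarrow> poly P x \<in> A" and preimA: "\<And>x. poly P x \<in> A \<Longrightarrow> x \<in> A"
    and crit: "\<And>c. poly (pderiv P) c = 0 \<Longrightarrow> c \<in> A"
    and eps: "0 < \<epsilon>" "cball a \<epsilon> \<subseteq> A"
    and absorb: "\<And>C. compact C \<Longrightarrow> C \<subseteq> A \<Longrightarrow> \<exists>n. (poly P ^^ n) ` C \<subseteq> cball a \<epsilon>"
begin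

definition gen :: "complex set" where
  "gen = A - poly P ` {c. poly (pderiv P) c = 0}"

definition fib :: "complex \<Rightarrow> complex set" where
  "fib w = {x. poly P x = w}"

lemma pderiv_nz: "pderiv P \<noteq> 0"
  using degP k2 by (simp add: pderiv_eq_0_iff)

lemma gen_A: "w \<in> gen \<Longrightarrow> w \<in> A" by (simp add: gen_def)

lemma A_infinite: "infinite A"
  using uncountable_cball[OF eps(1), of a] eps(2) countable_finite finite_subset by blast

lemma gen_infinite: "infinite gen"
proof -
  have "finite (poly P ` {c. poly (pderiv P) c = 0})"
    using pderiv_nz by (intro finite_imageI poly_roots_finite)
  moreover have "infinite A" using A_infinite .
  ultimately show ?thesis unfolding gen_def by (simp add: Diff_infinite_finite)
qed

lemma gen_two: obtains w w' where "w \<in> gen" "w' \<in> gen" "w \<noteq> w'"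
  using gen_infinite by (metis finite.emptyI finite_insert finite_subset insertI1 insert_iff subsetI)

lemma fib_gen:
  assumes "w \<in> gen"
  shows "finite (fib w)" "card (fib w) = k" "fib w \<subseteq> A"
proof -
  have nz: "P - [:w:] \<noteq> 0" and dg: "degree (P - [:w:]) = k"
  proof -
    have "degree (P + [:- w:]) = degree P"
      using degP k2 by (intro degree_add_eq_left) simp
    moreover have "P + [:- w:] = P - [:w:]" by simp
    ultimately show d: "degree (P - [:w:]) = k" using degP by metis
    thus "P - [:w:] \<noteq> 0" using k2 by auto
  qed
  have eq: "fib w = {x. poly (P - [:w:]) x = 0}" by (auto simp: fib_def)
  show "finite (fib w)" unfolding eq using nz by (rule poly_roots_finite)
  have "rsquarefree (P - [:w:])"
    unfolding rsquarefree_roots using assms by (auto simp: gen_def pderiv_diff pderiv_pCons)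
  thus "card (fib w) = k" unfolding eq using rsquarefree_card_roots[OF nz] dg by simp
  show "fib w \<subseteq> A" using preimA gen_A[OF assms] by (auto simp: fib_def)
qed

text \<open>For generic \<open>w\<close> the polynomial \<open>N - X(w) D\<close> has the
  \<open>k + 1\<close> distinct roots \<open>g(w)\<close> and \<open>- g(x)\<close> with
  \<open>P(x) = w\<close>, which forces full degree. A common root of \<open>N\<close> and
  \<open>D\<close> would have to be among these roots for every generic \<open>w\<close>, while
  injectivity of \<open>g\<close> permits this for finitely many \<open>w\<close> only.\<close>

lemma limit_nondegenerate:
  fixes N D :: "complex poly"
  assumes deg: "degree N \<le> k + 1" "degree D \<le> k + 1" and nz: "N \<noteq> 0 \<or> D \<noteq> 0"
    and g: "inj_on g A" "\<And>x y. x \<in> A \<Longrightarrow> y \<in> A \<Longrightarrow> g x \<noteq> - g y" and X: "inj_on X A"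
    and e1: "\<And>x. x \<in> A \<Longrightarrow> poly N (g x) = X x * poly D (g x)"
    and e2: "\<And>x. x \<in> A \<Longrightarrow> poly N (- g x) = X (poly P x) * poly D (- g x)"
  shows "degree N = k + 1 \<or> degree D = k + 1" "\<not> (poly N z = 0 \<and> poly D z = 0)"
proof -
  define q where "q w = N - smult (X w) D" for w
  have qnz: "q w \<noteq> 0" if "w \<in> A" for w
  proof
    assume "q w = 0"
    hence N: "N = smult (X w) D" by (simp add: q_def)
    hence D0: "D \<noteq> 0" using nz by auto
    have "X x = X w" if "x \<in> A" "poly D (g x) \<noteq> 0" for x
      using e1[OF that(1)] that(2) by (simp add: N)
    hence "A \<subseteq> insert w {x \<in> A. poly D (g x) = 0}"
      using X \<open>w \<in> A\<close> unfolding inj_on_def by blast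
    moreover have "finite (g ` {x \<in> A. poly D (g x) = 0})"
      by (rule finite_subset[OF _ poly_roots_finite[OF D0]]) auto
    hence "finite {x \<in> A. poly D (g x) = 0}"
      by (rule finite_imageD) (use g(1) in \<open>auto intro: inj_on_subset\<close>)
    ultimately have "finite A" using finite_subset by blast
    thus False using A_infinite by simp
  qed
  define S where "S w = insert (g w) ((\<lambda>x. - g x) ` fib w)" for w
  have S: "finite (S w)" "card (S w) = k + 1" "\<And>r. r \<in> S w \<Longrightarrow> poly (q w) r = 0" if w: "w \<in> gen" for w
  proof -
    show "finite (S w)" using fib_gen[OF w] by (simp add: S_def)
    have "inj_on (\<lambda>x. - g x) (fib w)"
      using g(1) fib_gen(3)[OF w] by (auto simp: inj_on_def)
    moreover have "g w \<notin> (\<lambda>x. - g x) ` fib w"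
      using g(2) gen_A[OF w] fib_gen(3)[OF w] by auto
    ultimately show "card (S w) = k + 1"
      using fib_gen[OF w] by (simp add: S_def card_image)
    show "poly (q w) r = 0" if "r \<in> S w" for r
      using that e1[OF gen_A[OF w]] e2 fib_gen(3)[OF w] by (auto simp: S_def q_def fib_def)
  qed
  have dq: "degree (q w) \<le> k + 1" for w
    unfolding q_def using deg by (intro degree_diff_le) (auto intro: order_trans[OF degree_smult_le])
  obtain w where w: "w \<in> gen" using gen_two by blast
  have "k + 1 \<le> degree (q w)"
  proof -
    have "card (S w) \<le> card {r. poly (q w) r = 0}"
      using S[OF w] poly_roots_finite[OF qnz[OF gen_A[OF w]]] by (intro card_mono) auto
    also have "\<dots> \<le> degree (q w)" using qnz[OF gen_A[OF w]] by (rule card_poly_roots_bound)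
    finally show ?thesis using S(2)[OF w] by simp
  qed
  moreover have "degree (q w) \<le> max (degree N) (degree D)"
    unfolding q_def by (rule order_trans[OF degree_diff_le_max]) (auto intro: le_max_iff_disj[THEN iffD2])
  ultimately show "degree N = k + 1 \<or> degree D = k + 1" using deg by linarith
  show "\<not> (poly N z = 0 \<and> poly D z = 0)"
  proof
    assume z: "poly N z = 0 \<and> poly D z = 0"
    have mem: "z \<in> S w" if w: "w \<in> gen" for w
    proof (rule ccontr)
      assume "z \<notin> S w"
      hence "k + 2 = card (insert z (S w))" using S[OF w] by simp
      also have "\<dots> \<le> card {r. poly (q w) r = 0}"
        using S[OF w] z poly_roots_finite[OF qnz[OF gen_A[OF w]]] by (intro card_mono) (auto simp: q_def)
      also have "\<dots> \<le> degree (q w)" using qnz[OF gen_A[OF w]] by (rule card_poly_roots_bound)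
      finally show False using dq[of w] by simp
    qed
    have "gen \<subseteq> {w \<in> A. g w = z} \<union> poly P ` {x \<in> A. - g x = z}"
      using mem fib_gen(3) gen_A unfolding S_def fib_def by fast
    moreover have "finite {w \<in> A. g w = z}" "finite {x \<in> A. - g x = z}"
    proof -
      show "finite {w \<in> A. g w = z}"
        by (rule finite_imageD[of g]) (use g(1) in \<open>auto intro: inj_on_subset finite_subset[of _ "{z}"]\<close>)
      show "finite {x \<in> A. - g x = z}"
        by (rule finite_imageD[of g]) (use g(1) in \<open>auto intro: inj_on_subset finite_subset[of _ "{-z}"]\<close>)
    qed
    ultimately show False using gen_infinite by (meson finite_UnI finite_imageI finite_subset)
  qed
qed

text \<open>Here \<open>k\<close> is \<open>2d - 1\<close>. A map of degree \<open>k + 1\<close> has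
  \<open>2 * k\<close> critical points, so the bound \<open>2 * k - 1\<close> says that infinity is
  critical, and the zeros of the Wronskian say the same of 0, \<open>v\<close> and
  \<open>- v\<close>. The functional equations are cross-multiplied because in this form they
  survive limits in which \<open>D\<close> may vanish.\<close>

definition mating_data :: "complex poly \<Rightarrow> complex poly \<Rightarrow> (complex \<Rightarrow> complex) \<Rightarrow> (complex \<Rightarrow> complex) \<Rightarrow> bool" where
  "mating_data N D g X \<longleftrightarrow> degree N \<le> k + 1 \<and> degree D \<le> k + 1 \<and> (\<forall>z. \<not> (poly N z = 0 \<and> poly D z = 0)) \<and>
     g holomorphic_on A \<and> X holomorphic_on A \<and> inj_on g A \<and> inj_on X A \<and>
     (\<forall>x\<in>A. g x \<noteq> 0) \<and> (\<forall>x\<in>A. \<forall>y\<in>A. g x \<noteq> - g y) \<and>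
     (\<forall>x\<in>A. poly N (g x) = X x * poly D (g x)) \<and>
     (\<forall>x\<in>A. poly N (- g x) = X (poly P x) * poly D (- g x)) \<and>
     degree (wronskian N D) \<le> 2 * k - 1 \<and> poly (wronskian N D) 0 = 0 \<and>
     (\<exists>v. v \<noteq> 0 \<and> poly (wronskian N D) v = 0 \<and> poly (wronskian N D) (- v) = 0) \<and>
     poly D 0 = 0 \<and> \<not> bounded (X ` A) \<and> X a = 0 \<and> X p = 1 \<and> g a = 1"

end

section \<open>Exclusion of collapsing sequences\<close>

lemma reciprocal_quotient: "h \<noteq> 0 \<Longrightarrow> e \<noteq> 0 \<Longrightarrow> 1 / (- h / e) = - e / h"
  for h e :: complex
  by (simp add: field_simps)

context poly_basin
begin

text \<open>Two generic points suffice: an affine function with equal values at two different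
  arguments has slope 0. It is applied to single coefficients of the pencil
  \<open>N - Xl(w) D\<close>, and shows that a coefficient independent of \<open>w\<close> comes
  from \<open>N\<close> alone.\<close>

lemma not_all_A_coeff:
  fixes Xl :: "complex \<Rightarrow> complex"
  assumes "inj_on Xl A" "\<And>w. w \<in> gen \<Longrightarrow> u - Xl w * v = \<alpha>"
  shows "v = 0"
proof -
  obtain w w' where w: "w \<in> gen" "w' \<in> gen" "w \<noteq> w'" using gen_two .
  hence "Xl w \<noteq> Xl w'" using assms(1) gen_A by (auto dest: inj_onD)
  moreover have "u - Xl w * v = u - Xl w' * v"
    using assms(2)[OF w(1)] assms(2)[OF w(2)] by simp
  hence "(Xl w' - Xl w) * v = 0" by (auto simp: left_diff_distrib)
  ultimately show ?thesis by simp
qed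

end

text \<open>The situation to be refuted: all \<open>g i\<close> tend to 1, at the rate
  \<open>dl i\<close>. The charts \<open>1 + dl u\<close> and \<open>- 1 - dl u\<close> are
  exchanged by \<open>z -> - z\<close>, so the same function \<open>G\<close> describes the limit of
  \<open>g\<close> in the first and of \<open>- g\<close> in the second. The pairs
  \<open>N1\<close>, \<open>D1\<close> and \<open>N2\<close>, \<open>D2\<close> are the limits of
  \<open>R\<close> in these charts, and \<open>\<rho>0\<close> bounds the rescaled \<open>g\<close>
  on the absorbing disc, where the pullback will start.\<close>

locale collapsing = poly_basin +
  fixes N D :: "nat \<Rightarrow> complex poly" and g X :: "nat \<Rightarrow> complex \<Rightarrow> complex"
    and s t :: "nat \<Rightarrow> complex" and G Xl :: "complex \<Rightarrow> complex" and N1 D1 N2 D2 :: "complex poly"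
    and dl :: "nat \<Rightarrow> complex" and \<rho>0 :: real
  assumes md: "\<And>i. mating_data (N i) (D i) (g i) (X i)"
    and dl: "\<And>i. dl i \<noteq> 0" "dl \<longlonglongrightarrow> 0"
    and glim: "\<And>x. x \<in> A \<Longrightarrow> (\<lambda>i. g i x) \<longlonglongrightarrow> 1"
    and Glim: "\<And>x. x \<in> A \<Longrightarrow> (\<lambda>i. (g i x - 1) / dl i) \<longlonglongrightarrow> G x"
    and Gp: "\<And>i. (g i p - 1) / dl i = 1"
    and Gbd: "\<forall>\<^sub>F i in sequentially. \<forall>x\<in>cball a \<epsilon>. cmod ((g i x - 1) / dl i) < \<rho>0"
    and Xlim: "\<And>x. x \<in> A \<Longrightarrow> (\<lambda>i. X i x) \<longlonglongrightarrow> Xl x" and Xinj: "inj_on Xl A"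
    and st: "\<And>i. s i \<noteq> 0" "\<And>i. t i \<noteq> 0"
    and n1lim: "pconv (\<lambda>i. smult (s i) (pcompose (N i) [:1, dl i:])) N1"
    and d1lim: "pconv (\<lambda>i. smult (s i) (pcompose (D i) [:1, dl i:])) D1"
    and n2lim: "pconv (\<lambda>i. smult (t i) (pcompose (N i) [:-1, - dl i:])) N2"
    and d2lim: "pconv (\<lambda>i. smult (t i) (pcompose (D i) [:-1, - dl i:])) D2"
    and nz: "N1 \<noteq> 0 \<or> D1 \<noteq> 0" "N2 \<noteq> 0 \<or> D2 \<noteq> 0"
begin

abbreviation "n1 i \<equiv> smult (s i) (pcompose (N i) [:1, dl i:])"
abbreviation "d1 i \<equiv> smult (s i) (pcompose (D i) [:1, dl i:])"
abbreviation "n2 i \<equiv> smult (t i) (pcompose (N i) [:-1, - dl i:])"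
abbreviation "d2 i \<equiv> smult (t i) (pcompose (D i) [:-1, - dl i:])"
abbreviation "GG i x \<equiv> (g i x - 1) / dl i"

lemma degND: "degree (N i) \<le> k + 1" "degree (D i) \<le> k + 1"
  using md[of i] by (auto simp: mating_data_def)

lemma deg12: "degree (n1 i) \<le> k + 1" "degree (d1 i) \<le> k + 1" "degree (n2 i) \<le> k + 1" "degree (d2 i) \<le> k + 1"
  using degND[of i] by (auto simp: degree_pcompose dl st)

lemma deg_lim: "degree N1 \<le> k + 1" "degree D1 \<le> k + 1" "degree N2 \<le> k + 1" "degree D2 \<le> k + 1"
  using pconv_degree[OF n1lim deg12(1)] pconv_degree[OF d1lim deg12(2)]
    pconv_degree[OF n2lim deg12(3)] pconv_degree[OF d2lim deg12(4)] by auto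

lemma g_inj: "inj_on (g i) A" and g_ne: "x \<in> A \<Longrightarrow> y \<in> A \<Longrightarrow> g i x \<noteq> - g i y"
  using md[of i] by (auto simp: mating_data_def)

lemma eqN: "x \<in> A \<Longrightarrow> poly (N i) (g i x) = X i x * poly (D i) (g i x)"
  "x \<in> A \<Longrightarrow> poly (N i) (- g i x) = X i (poly P x) * poly (D i) (- g i x)"
  using md[of i] by (auto simp: mating_data_def)

lemma eq1: "x \<in> A \<Longrightarrow> poly (n1 i) (GG i x) = X i x * poly (d1 i) (GG i x)"
  using eqN(1)[of x i] dl(1)[of i] by (simp add: poly_pcompose)

lemma eq2: "x \<in> A \<Longrightarrow> poly (n2 i) (GG i x) = X i (poly P x) * poly (d2 i) (GG i x)"
  using eqN(2)[of x i] dl(1)[of i] by (simp add: poly_pcompose)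

lemma GGa: "GG i a = 0"
  using md[of i] by (simp add: mating_data_def)

lemma Xl_vals: "Xl a = 0" "Xl p = 1"
  using LIMSEQ_unique[OF Xlim[OF aA], of 0] LIMSEQ_unique[OF Xlim[OF pA], of 1] md
  by (simp_all add: mating_data_def)

lemma G_vals: "G a = 0" "G p = 1"
  using LIMSEQ_unique[OF Glim[OF aA], of 0] LIMSEQ_unique[OF Glim[OF pA], of 1] GGa Gp by simp_all

lemma gen_facts: "w \<in> gen \<Longrightarrow> g i w \<noteq> -1 \<and> 1 + g i w \<noteq> 0" "w \<in> A \<Longrightarrow> g i w \<noteq> -1 \<and> 1 + g i w \<noteq> 0"
proof -
  show *: "g i w \<noteq> -1 \<and> 1 + g i w \<noteq> 0" if "w \<in> A" for w
  proof -
    have 1: "g i a = 1" using md[of i] by (simp add: mating_data_def)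
    have "g i w \<noteq> - 1" using g_ne[OF that aA, of i] unfolding 1 .
    thus ?thesis by (simp add: add_eq_0_iff)
  qed
  show "w \<in> gen \<Longrightarrow> g i w \<noteq> -1 \<and> 1 + g i w \<noteq> 0" using * gen_A by blast
qed

text \<open>The \<open>k + 1\<close> roots of the pencil as seen in the first chart. The one that
  stays is written as a monic factor; the others sit near -1, hence far away at
  \<open>- (1 + g i x) / dl i\<close>, and are written as factors tending to 1. In \<open>E2\<close>
  the roles are exchanged: \<open>k\<close> roots stay and one escapes.\<close>

definition E1 :: "nat \<Rightarrow> complex \<Rightarrow> complex poly" where
  "E1 i w = [:- GG i w, 1:] * (\<Prod>x\<in>fib w. [:1, - (- dl i / (1 + g i x)):])"

definition E2 :: "nat \<Rightarrow> complex \<Rightarrow> complex poly" where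
  "E2 i w = (\<Prod>x\<in>fib w. [:- GG i x, 1:]) * [:1, - (- dl i / (1 + g i w)):]"

lemma factor1:
  assumes w: "w \<in> gen"
  shows "\<exists>c. n1 i - smult (X i w) (d1 i) = smult c (E1 i w)"
proof -
  let ?q = "n1 i - smult (X i w) (d1 i)"
  define u where "u x = - (1 + g i x) / dl i" for x
  define S where "S = insert (GG i w) (u ` fib w)"
  have sub: "fib w \<subseteq> A" "finite (fib w)" "card (fib w) = k" using fib_gen[OF w] by auto
  have inj: "inj_on u (fib w)"
    using g_inj[of i] sub(1) dl(1)[of i] by (auto simp: u_def inj_on_def)
  have nin: "GG i w \<notin> u ` fib w"
    using g_ne[OF gen_A[OF w]] sub(1) dl(1)[of i] by (force simp: u_def)
  have S: "finite S" "card S = k + 1" using sub inj nin by (auto simp: S_def card_image)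
  have un: "u x \<noteq> 0" if "x \<in> fib w" for x
    using gen_facts(2)[of x i] that sub(1) dl(1)[of i] by (auto simp: u_def)
  have "?q = smult (coeff ?q (card S)) (\<Prod>r\<in>S. [:- r, 1:])"
  proof (rule poly_factor_roots[OF S(1)])
    show "degree ?q \<le> card S"
      unfolding S(2) by (intro degree_diff_le deg12 order_trans[OF degree_smult_le])
    show "poly ?q r = 0" if rS: "r \<in> S" for r
    proof (cases "r = GG i w")
      case True
      thus ?thesis using eq1[OF gen_A[OF w], of i] by simp
    next
      case False
      then obtain x where x: "x \<in> fib w" "r = u x" using rS by (auto simp: S_def)
      hence "1 + dl i * r = - g i x" using dl(1)[of i] by (simp add: u_def)
      moreover have "poly P x = w" "x \<in> A" using x sub(1) by (auto simp: fib_def)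
      ultimately show ?thesis using eqN(2)[of x i] by (simp add: poly_pcompose mult.commute[of r])
    qed
  qed
  also have "(\<Prod>r\<in>S. [:- r, 1:]) = [:- GG i w, 1:] * (\<Prod>x\<in>fib w. [:- u x, 1:])"
    using nin sub(2) inj by (simp add: S_def prod.reindex)
  also have "(\<Prod>x\<in>fib w. [:- u x, 1:]) = (\<Prod>x\<in>fib w. smult (- u x) [:1, - (- dl i / (1 + g i x)):])"
  proof (rule prod.cong[OF refl])
    fix x assume x: "x \<in> fib w"
    have "1 / u x = - dl i / (1 + g i x)"
      unfolding u_def using gen_facts(2)[of x i] x sub(1) dl(1)[of i] by (intro reciprocal_quotient) auto
    thus "[:- u x, 1:] = smult (- u x) [:1, - (- dl i / (1 + g i x)):]"
      using linear_factor_rescale[OF un[OF x]] by metis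
  qed
  also have "\<dots> = smult (\<Prod>x\<in>fib w. - u x) (\<Prod>x\<in>fib w. [:1, - (- dl i / (1 + g i x)):])"
    by (simp only: prod_smult)
  finally have "?q = smult (coeff ?q (card S) * (\<Prod>x\<in>fib w. - u x)) (E1 i w)"
    unfolding E1_def by (simp only: mult_smult_right smult_smult)
  thus ?thesis by blast
qed

lemma factor2:
  assumes w: "w \<in> gen"
  shows "\<exists>c. n2 i - smult (X i w) (d2 i) = smult c (E2 i w)"
proof -
  let ?q = "n2 i - smult (X i w) (d2 i)"
  define u where "u = - (1 + g i w) / dl i"
  define S where "S = insert u ((\<lambda>x. GG i x) ` fib w)"
  have sub: "fib w \<subseteq> A" "finite (fib w)" "card (fib w) = k" using fib_gen[OF w] by auto
  have inj: "inj_on (\<lambda>x. GG i x) (fib w)"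
    using g_inj[of i] sub(1) dl(1)[of i] by (auto simp: inj_on_def)
  have nin: "u \<notin> (\<lambda>x. GG i x) ` fib w"
  proof
    assume "u \<in> (\<lambda>x. GG i x) ` fib w"
    then obtain x where "x \<in> fib w" "u = GG i x" by blast
    hence "g i x = - g i w" using dl(1)[of i] by (simp add: u_def field_simps)
    thus False using g_ne[of x w i] \<open>x \<in> fib w\<close> sub(1) gen_A[OF w] by auto
  qed
  have S: "finite S" "card S = k + 1" using sub inj nin by (auto simp: S_def card_image)
  have un: "u \<noteq> 0" and ui: "1 / u = - dl i / (1 + g i w)"
    using gen_facts(1)[OF w, of i] dl(1)[of i] by (auto simp: u_def field_simps)
  have "?q = smult (coeff ?q (card S)) (\<Prod>r\<in>S. [:- r, 1:])"
  proof (rule poly_factor_roots[OF S(1)])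
    show "degree ?q \<le> card S"
      unfolding S(2) by (intro degree_diff_le deg12 order_trans[OF degree_smult_le])
    show "poly ?q r = 0" if rS: "r \<in> S" for r
    proof (cases "r = u")
      case True
      hence "-1 - dl i * r = g i w" using dl(1)[of i] by (simp add: u_def)
      thus ?thesis using eqN(1)[OF gen_A[OF w], of i] by (simp add: poly_pcompose mult.commute[of r])
    next
      case False
      then obtain x where x: "x \<in> fib w" "r = GG i x" using rS by (auto simp: S_def)
      moreover have "poly P x = w" "x \<in> A" using x sub(1) by (auto simp: fib_def)
      ultimately show ?thesis using eq2[of x i] by simp
    qed
  qed
  also have "(\<Prod>r\<in>S. [:- r, 1:]) = [:- u, 1:] * (\<Prod>x\<in>fib w. [:- GG i x, 1:])"
    using nin sub(2) inj by (simp add: S_def prod.reindex)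
  also have "[:- u, 1:] = smult (- u) [:1, - (- dl i / (1 + g i w)):]"
    using linear_factor_rescale[OF un] ui by metis
  finally have "?q = smult (coeff ?q (card S) * (- u)) (E2 i w)"
    unfolding E2_def by (simp only: mult_smult_left smult_smult mult.commute)
  thus ?thesis by blast
qed

lemma small_lim: "x \<in> A \<Longrightarrow> (\<lambda>i. - dl i / (1 + g i x)) \<longlonglongrightarrow> 0"
  using tendsto_divide[OF tendsto_minus[OF dl(2)] tendsto_add[OF tendsto_const[of 1] glim[of x]]] by simp

lemma half_lim: "x \<in> A \<Longrightarrow> (\<lambda>i. 1 - 1 / (1 + g i x)) \<longlonglongrightarrow> 1 / 2"
proof -
  assume "x \<in> A"
  hence "(\<lambda>i. 1 - 1 / (1 + g i x)) \<longlonglongrightarrow> 1 - 1 / (1 + 1)"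
    by (intro tendsto_intros glim) auto
  thus ?thesis by simp
qed

lemma one_lim: "x \<in> A \<Longrightarrow> (\<lambda>i. 1 + dl i * GG i x) \<longlonglongrightarrow> 1"
  using glim[of x] dl(1) by simp

text \<open>The second claim comes from evaluating the pencil at \<open>- 1 / dl i\<close>, that is
  at \<open>z = 0\<close>, where \<open>D i\<close> vanishes: its left-hand side does not involve
  \<open>w\<close>. Each of the \<open>k\<close> escaping factors contributes a limit
  \<open>1 / 2\<close> there, because \<open>1 + g i x\<close> tends to 2.\<close>

lemma limit1:
  assumes w: "w \<in> gen"
  shows "N1 - smult (Xl w) D1 = smult (coeff (N1 - smult (Xl w) D1) 1) [:- G w, 1:]"
    "(\<lambda>i. poly (n1 i) (- 1 / dl i) * (- dl i)) \<longlonglongrightarrow> coeff (N1 - smult (Xl w) D1) 1 * (1 / 2) ^ k"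
proof -
  let ?Q = "N1 - smult (Xl w) D1"
  have sub: "fib w \<subseteq> A" "finite (fib w)" "card (fib w) = k" using fib_gen[OF w] by auto
  have "\<exists>c. \<forall>i. n1 i - smult (X i w) (d1 i) = smult (c i) (E1 i w)"
    using factor1[OF w] by (intro choice) blast
  then obtain c where c: "\<And>i. n1 i - smult (X i w) (d1 i) = smult (c i) (E1 i w)" by blast
  have E: "pconv (\<lambda>i. E1 i w) ([:- G w, 1:] * (\<Prod>x\<in>fib w. [:1, - 0:]))"
    unfolding E1_def
    using sub(1) by (intro pconv_mult pconv_prod pconv_linear tendsto_minus tendsto_const Glim gen_A[OF w] small_lim) auto
  have "(\<Prod>x\<in>fib w. [:1, - 0:]) = (1 :: complex poly)" by (simp add: one_pCons[symmetric])
  hence E': "pconv (\<lambda>i. E1 i w) [:- G w, 1:]" using E by (simp only: mult_1_right)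
  have Q: "pconv (\<lambda>i. n1 i - smult (X i w) (d1 i)) ?Q"
    by (intro pconv_diff pconv_smult n1lim d1lim Xlim gen_A[OF w])
  have m1: "coeff [:- G w, 1:] 1 = 1" by simp
  note un = pconv_unscale[OF E' m1 Q c]
  show "?Q = smult (coeff ?Q 1) [:- G w, 1:]" by (rule un(2))
  have "poly (n1 i) (- 1 / dl i) * (- dl i) = c i * ((1 + dl i * GG i w) * (\<Prod>x\<in>fib w. 1 - 1 / (1 + g i x)))" for i
  proof -
    have d0: "poly (d1 i) (- 1 / dl i) = 0"
      using md[of i] dl(1)[of i] by (simp add: poly_pcompose mating_data_def)
    have "poly (n1 i) (- 1 / dl i) = poly (n1 i - smult (X i w) (d1 i)) (- 1 / dl i)"
      using d0 by simp
    also have "\<dots> = c i * poly (E1 i w) (- 1 / dl i)" by (simp only: c poly_smult)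
    also have "poly (E1 i w) (- 1 / dl i) = (- 1 / dl i - GG i w) * (\<Prod>x\<in>fib w. 1 - 1 / (1 + g i x))"
      unfolding E1_def poly_mult poly_prod using dl(1)[of i] by simp
    finally have "poly (n1 i) (- 1 / dl i) * (- dl i) =
        c i * (((- 1 / dl i - GG i w) * (- dl i)) * (\<Prod>x\<in>fib w. 1 - 1 / (1 + g i x)))"
      by (simp only: mult_ac)
    also have "(- 1 / dl i - GG i w) * (- dl i) = 1 + dl i * GG i w"
      using dl(1)[of i] by (simp add: field_simps)
    finally show ?thesis .
  qed
  moreover have "(\<lambda>i. c i * ((1 + dl i * GG i w) * (\<Prod>x\<in>fib w. 1 - 1 / (1 + g i x)))) \<longlonglongrightarrow>
      coeff ?Q 1 * (1 * (\<Prod>x\<in>fib w. 1 / 2))"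
    using sub(1) by (intro tendsto_mult un(1) one_lim gen_A[OF w] tendsto_prod half_lim) auto
  ultimately show "(\<lambda>i. poly (n1 i) (- 1 / dl i) * (- dl i)) \<longlonglongrightarrow> coeff ?Q 1 * (1 / 2) ^ k"
    using sub(3) by (simp add: power_divide)
qed

text \<open>The same evaluation at \<open>z = 0\<close> in the chart at -1. Now \<open>k\<close>
  monic factors need \<open>k\<close> powers of \<open>- dl i\<close>, and the one escaping factor
  gives a single \<open>1 / 2\<close>.\<close>

lemma limit2:
  assumes w: "w \<in> gen"
  shows "N2 - smult (Xl w) D2 = smult (coeff (N2 - smult (Xl w) D2) k) (\<Prod>x\<in>fib w. [:- G x, 1:])"
    "(\<lambda>i. poly (n2 i) (- 1 / dl i) * (- dl i) ^ k) \<longlonglongrightarrow> coeff (N2 - smult (Xl w) D2) k * (1 / 2)"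
proof -
  let ?Q = "N2 - smult (Xl w) D2" and ?E = "\<Prod>x\<in>fib w. [:- G x, 1:]"
  have sub: "fib w \<subseteq> A" "finite (fib w)" "card (fib w) = k" using fib_gen[OF w] by auto
  have "\<exists>c. \<forall>i. n2 i - smult (X i w) (d2 i) = smult (c i) (E2 i w)"
    using factor2[OF w] by (intro choice) blast
  then obtain c where c: "\<And>i. n2 i - smult (X i w) (d2 i) = smult (c i) (E2 i w)" by blast
  have E: "pconv (\<lambda>i. E2 i w) (?E * [:1, - 0:])"
    unfolding E2_def
    using sub(1) by (intro pconv_mult pconv_prod pconv_linear tendsto_minus tendsto_const Glim gen_A[OF w] small_lim) auto
  have "[:1, - 0:] = (1 :: complex poly)" by (simp add: one_pCons[symmetric])
  hence E': "pconv (\<lambda>i. E2 i w) ?E" using E by (simp only: mult_1_right)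
  have Q: "pconv (\<lambda>i. n2 i - smult (X i w) (d2 i)) ?Q"
    by (intro pconv_diff pconv_smult n2lim d2lim Xlim gen_A[OF w])
  have m1: "coeff ?E k = 1"
  proof -
    have "degree ?E = k" using sub by (simp add: degree_prod_eq_sum_degree)
    moreover have "lead_coeff ?E = 1" by (simp add: lead_coeff_prod)
    ultimately show ?thesis by simp
  qed
  note un = pconv_unscale[OF E' m1 Q c]
  show "?Q = smult (coeff ?Q k) ?E" by (rule un(2))
  have "poly (n2 i) (- 1 / dl i) * (- dl i) ^ k = c i * ((\<Prod>x\<in>fib w. 1 + dl i * GG i x) * (1 - 1 / (1 + g i w)))" for i
  proof -
    have d0: "poly (d2 i) (- 1 / dl i) = 0"
      using md[of i] dl(1)[of i] by (simp add: poly_pcompose mating_data_def)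
    have "poly (n2 i) (- 1 / dl i) = poly (n2 i - smult (X i w) (d2 i)) (- 1 / dl i)"
      using d0 by simp
    also have "\<dots> = c i * poly (E2 i w) (- 1 / dl i)" by (simp only: c poly_smult)
    also have "poly (E2 i w) (- 1 / dl i) = (\<Prod>x\<in>fib w. - GG i x - 1 / dl i) * (1 - 1 / (1 + g i w))"
      unfolding E2_def poly_mult poly_prod using dl(1)[of i] by simp
    finally have "poly (n2 i) (- 1 / dl i) * (- dl i) ^ k =
        c i * (((\<Prod>x\<in>fib w. - GG i x - 1 / dl i) * (- dl i) ^ k) * (1 - 1 / (1 + g i w)))"
      by simp
    also have "(\<Prod>x\<in>fib w. - GG i x - 1 / dl i) * (- dl i) ^ k = (\<Prod>x\<in>fib w. (- GG i x - 1 / dl i) * (- dl i))"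
      using sub(3) by (simp only: prod.distrib prod_constant)
    also have "\<dots> = (\<Prod>x\<in>fib w. 1 + dl i * GG i x)"
      using dl(1)[of i] by (intro prod.cong) (auto simp: field_simps)
    finally show ?thesis .
  qed
  moreover have "(\<lambda>i. c i * ((\<Prod>x\<in>fib w. 1 + dl i * GG i x) * (1 - 1 / (1 + g i w)))) \<longlonglongrightarrow>
      coeff ?Q k * ((\<Prod>x\<in>fib w. 1) * (1 / 2))"
    using sub(1) by (intro tendsto_mult un(1) one_lim gen_A[OF w] tendsto_prod half_lim) auto
  ultimately show "(\<lambda>i. poly (n2 i) (- 1 / dl i) * (- dl i) ^ k) \<longlonglongrightarrow> coeff ?Q k * (1 / 2)"
    by simp
qed

end

context collapsing
begin

text \<open>Evaluation at \<open>z = 0\<close> does not see \<open>w\<close>, so the coefficient of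
  index 1 of \<open>N1 - Xl(w) D1\<close> does not depend on \<open>w\<close>; since
  \<open>Xl\<close> is injective, \<open>D1\<close> is constant. The normalizations at
  \<open>a\<close> and \<open>p\<close> then make the limit of \<open>R\<close> in the first chart
  the identity.\<close>

lemma D1_const: obtains d0 where "d0 \<noteq> 0" "D1 = [:d0:]" "N1 = [:0, d0:]"
proof -
  obtain w0 where w0: "w0 \<in> gen" using gen_two by blast
  have eqc: "coeff (N1 - smult (Xl w) D1) 1 = coeff (N1 - smult (Xl w0) D1) 1" if "w \<in> gen" for w
    using LIMSEQ_unique[OF limit1(2)[OF that] limit1(2)[OF w0]] by simp
  have c1: "coeff D1 1 = 0"
    by (rule not_all_A_coeff[OF Xinj, of "coeff N1 1" _ "coeff (N1 - smult (Xl w0) D1) 1"])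
      (use eqc in auto)
  have dz: "coeff D1 j = 0" if "j > 1" for j
  proof (rule not_all_A_coeff[OF Xinj, of "coeff N1 j" _ 0])
    fix w assume "w \<in> gen"
    have "coeff (N1 - smult (Xl w) D1) j = coeff (smult (coeff (N1 - smult (Xl w) D1) 1) [:- G w, 1:]) j"
      using limit1(1)[OF \<open>w \<in> gen\<close>] by (rule arg_cong)
    thus "coeff N1 j - Xl w * coeff D1 j = 0"
      using that by (simp add: coeff_pCons split: nat.splits)
  qed
  have D1: "D1 = [:coeff D1 0:]"
    by (rule poly_eqI) (use c1 dz in \<open>auto simp: coeff_pCons split: nat.splits; metis One_nat_def Suc_lessI zero_less_Suc\<close>)
  have nzj: "coeff N1 j = 0" if "j > 1" for j
  proof -
    have "coeff (N1 - smult (Xl w0) D1) j = coeff (smult (coeff (N1 - smult (Xl w0) D1) 1) [:- G w0, 1:]) j"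
      using limit1(1)[OF w0] by (rule arg_cong)
    thus ?thesis using that dz[OF that] by (simp add: coeff_pCons split: nat.splits)
  qed
  have N1: "N1 = [:coeff N1 0, coeff N1 1:]"
    by (rule poly_eqI) (use nzj in \<open>auto simp: coeff_pCons split: nat.splits\<close>)
  have lim: "poly N1 (G x) = Xl x * poly D1 (G x)" if x: "x \<in> A" for x
  proof -
    have "(\<lambda>i. poly (n1 i) (GG i x)) \<longlonglongrightarrow> poly N1 (G x)"
      by (rule pconv_poly[OF n1lim deg12(1) Glim[OF x]])
    moreover have "(\<lambda>i. X i x * poly (d1 i) (GG i x)) \<longlonglongrightarrow> Xl x * poly D1 (G x)"
      by (intro tendsto_mult Xlim[OF x] pconv_poly[OF d1lim deg12(2) Glim[OF x]])
    moreover have "(\<lambda>i. poly (n1 i) (GG i x)) = (\<lambda>i. X i x * poly (d1 i) (GG i x))"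
      by (intro ext eq1[OF x])
    ultimately show ?thesis using LIMSEQ_unique by simp
  qed
  have p0: "poly N1 0 = 0" using lim[OF aA] Xl_vals G_vals by simp
  have p1: "poly N1 1 = poly D1 1" using lim[OF pA] Xl_vals G_vals by simp
  have n0: "coeff N1 0 = 0" using p0 by (simp add: poly_0_coeff_0)
  have "poly N1 1 = coeff N1 1" by (subst N1) (simp add: n0)
  moreover have "poly D1 1 = coeff D1 0" by (subst D1) simp
  ultimately have c: "coeff N1 1 = coeff D1 0" using p1 by simp
  have "coeff D1 0 \<noteq> 0"
  proof
    assume "coeff D1 0 = 0"
    hence "D1 = 0" "N1 = 0" using D1 N1 n0 c by auto
    thus False using nz by auto
  qed
  thus ?thesis using that[of "coeff D1 0"] D1 N1 n0 c by metis
qed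

text \<open>As in the first chart, independence of \<open>w\<close> removes the coefficient of index
  \<open>k\<close> from \<open>D2\<close>. If it vanished in \<open>N2\<close> as well, the whole
  pencil would be 0, and with it both limits.\<close>

lemma D2_degree: "coeff N2 k \<noteq> 0" "degree N2 \<le> k" "degree D2 \<le> k - 1"
proof -
  obtain w0 where w0: "w0 \<in> gen" using gen_two by blast
  have eqc: "coeff (N2 - smult (Xl w) D2) k = coeff (N2 - smult (Xl w0) D2) k" if "w \<in> gen" for w
    using LIMSEQ_unique[OF limit2(2)[OF that] limit2(2)[OF w0]] by simp
  have ck: "coeff D2 k = 0"
    by (rule not_all_A_coeff[OF Xinj, of "coeff N2 k" _ "coeff (N2 - smult (Xl w0) D2) k"])
      (use eqc in auto)
  have dE: "degree (\<Prod>x\<in>fib w. [:- G x, 1:]) \<le> k" if "w \<in> gen" for w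
    using fib_gen[OF that] by (simp add: degree_prod_eq_sum_degree)
  have hi: "coeff (N2 - smult (Xl w) D2) j = 0" if "w \<in> gen" "j > k" for j w
  proof -
    have "coeff (N2 - smult (Xl w) D2) j = coeff (smult (coeff (N2 - smult (Xl w) D2) k) (\<Prod>x\<in>fib w. [:- G x, 1:])) j"
      using limit2(1)[OF that(1)] by (rule arg_cong)
    thus ?thesis using dE[OF that(1)] that(2) by (simp add: coeff_eq_0)
  qed
  have dz: "coeff D2 j = 0" if "j > k" for j
    by (rule not_all_A_coeff[OF Xinj, of "coeff N2 j" _ 0]) (use hi that in auto)
  have nz': "coeff N2 j = 0" if "j > k" for j
    using hi[OF w0 that] dz[OF that] by simp
  show "degree N2 \<le> k" using nz' by (rule degree_le[OF allI[OF impI]])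
  have "coeff D2 j = 0" if "k - 1 < j" for j
    using that ck dz[of j] by (cases "j = k") auto
  thus "degree D2 \<le> k - 1" by (intro degree_le) auto
  show "coeff N2 k \<noteq> 0"
  proof
    assume z: "coeff N2 k = 0"
    have all: "N2 = smult (Xl w) D2" if "w \<in> gen" for w
      using limit2(1)[OF that] ck z by simp
    have D20: "D2 = 0"
    proof (rule poly_eqI)
      fix j
      have "coeff D2 j = 0"
        by (rule not_all_A_coeff[OF Xinj, of "coeff N2 j" _ 0]) (metis all coeff_smult diff_self)
      thus "coeff D2 j = coeff 0 j" by simp
    qed
    hence "N2 = 0" using all[OF w0] by simp
    thus False using D20 nz(2) by auto
  qed
qed

text \<open>In the first chart the limit is the identity, whose Wronskian is the nonzero constant
  \<open>d0 * d0\<close>, so no critical point can stay at bounded distance. The critical point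
  \<open>- v\<close> has coordinate \<open>(- 1 - v) / dl\<close> there, and this number is also the
  coordinate of \<open>v\<close> in the second chart.\<close>

lemma escaping_wronskian_root:
  assumes v: "\<And>i. poly (wronskian (N i) (D i)) (- v i) = 0"
  shows "filterlim (\<lambda>i. (- 1 - v i) / dl i) at_infinity sequentially"
proof -
  obtain d0 where d0: "d0 \<noteq> 0" "D1 = [:d0:]" "N1 = [:0, d0:]" using D1_const .
  have W: "pconv (\<lambda>i. wronskian (n1 i) (d1 i)) [:d0 * d0:]"
    using pconv_wronskian[OF n1lim d1lim] by (simp add: d0 wronskian_def pderiv_pCons)
  have degW: "degree (wronskian (n1 i) (d1 i)) \<le> 2 * k - 1" for i
    using md[of i] by (simp add: wronskian_smult wronskian_pcompose degree_pcompose st dl mating_data_def)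
  let ?s = "\<lambda>i. (- 1 - v i) / dl i"
  have root: "poly (wronskian (n1 i) (d1 i)) (?s i) = 0" for i
    using v[of i] dl(1)[of i] by (simp add: wronskian_smult wronskian_pcompose poly_pcompose)
  show ?thesis
  proof (rule ccontr)
    assume "\<not> ?thesis"
    then obtain B where "B > 0" "\<not> (\<forall>\<^sub>F i in sequentially. B \<le> cmod (?s i))"
      unfolding filterlim_at_infinity[OF order.refl] by blast
    hence fr: "\<exists>\<^sub>F i in sequentially. cmod (?s i) < B"
      by (simp add: frequently_def not_less)
    hence "infinite {i. cmod (?s i) < B}"
      by (simp add: frequently_cofinite[symmetric] cofinite_eq_sequentially)
    then obtain r where r: "strict_mono (r :: nat \<Rightarrow> nat)" "\<And>i. cmod (?s (r i)) < B"
      using infinite_enumerate[of "{i. cmod (?s i) < B}"] by blast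
    have "?s (r i) \<in> cball 0 B" for i using r(2)[of i] by simp
    then obtain l q where q: "strict_mono q" "((\<lambda>i. ?s (r i)) \<circ> q) \<longlonglongrightarrow> l"
      using seq_compactE[OF compact_imp_seq_compact[OF compact_cball[of "0 :: complex" B]], of "\<lambda>i. ?s (r i)"]
      by blast
    hence ql: "(\<lambda>i. ?s (r (q i))) \<longlonglongrightarrow> l" by (simp only: o_def)
    have "pconv (\<lambda>i. wronskian (n1 (r (q i))) (d1 (r (q i)))) [:d0 * d0:]"
      using pconv_subseq[OF pconv_subseq[OF W r(1)] q(1)] .
    from pconv_poly[OF this degW ql]
    have "(\<lambda>i. 0) \<longlonglongrightarrow> poly [:d0 * d0:] l" using root by simp
    thus False using d0(1) by (simp add: LIMSEQ_const_iff)
  qed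
qed

text \<open>Three critical points leave the second chart: infinity, already paid for by the bound
  \<open>2 * k - 1\<close>, the point 0 at \<open>- 1 / dl\<close>, and \<open>v\<close>. Hence the
  limiting Wronskian has no term of degree \<open>2 * k - 2\<close>. That coefficient is the product
  of the top coefficients of \<open>N2\<close> and \<open>D2\<close>, with factor
  \<open>k - (k - 1) = 1\<close>.\<close>

lemma D2_degree': "degree D2 \<le> k - 2"
proof -
  have "\<exists>v. \<forall>i. v i \<noteq> 0 \<and> poly (wronskian (N i) (D i)) (v i) = 0 \<and> poly (wronskian (N i) (D i)) (- v i) = 0"
    using md by (intro choice) (auto simp: mating_data_def)
  then obtain v where v: "\<And>i. v i \<noteq> 0" "\<And>i. poly (wronskian (N i) (D i)) (v i) = 0"
    "\<And>i. poly (wronskian (N i) (D i)) (- v i) = 0" by blast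
  let ?s = "\<lambda>i. (- 1 - v i) / dl i" and ?r = "\<lambda>i. - 1 / dl i"
  have sinf: "filterlim ?s at_infinity sequentially" by (rule escaping_wronskian_root[OF v(3)])
  hence s0: "(\<lambda>i. 1 / ?s i) \<longlonglongrightarrow> 0"
    using filterlim_compose[OF tendsto_inverse_0 sinf] by (simp add: inverse_eq_divide)
  have r0: "(\<lambda>i. 1 / ?r i) \<longlonglongrightarrow> 0"
    using tendsto_minus[OF dl(2)] by simp
  have "\<forall>\<^sub>F i in sequentially. 1 \<le> cmod (?s i)"
    using sinf unfolding filterlim_at_infinity[OF order.refl] by (meson zero_less_one)
  then obtain K where K: "\<And>i. K \<le> i \<Longrightarrow> 1 \<le> cmod (?s i)"
    unfolding eventually_sequentially by blast
  \<comment> \<open>Passing to a tail makes every root nonzero, not just eventually.\<close>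
  define \<sigma> where "\<sigma> i = i + K" for i
  have \<sigma>: "strict_mono \<sigma>" by (auto simp: \<sigma>_def strict_mono_def)
  have W: "pconv (\<lambda>i. wronskian (n2 (\<sigma> i)) (d2 (\<sigma> i))) (wronskian N2 D2)"
    by (rule pconv_subseq[OF pconv_wronskian[OF n2lim d2lim] \<sigma>])
  have "coeff (wronskian N2 D2) (2 * k - 2) = 0"
  proof (rule pconv_escaping_roots[OF W, where r = "\<lambda>i. ?r (\<sigma> i)" and s = "\<lambda>i. ?s (\<sigma> i)"])
    have e: "2 * k - 1 = Suc (2 * k - 2)" using k2 by linarith
    have degW: "degree (wronskian (n2 i) (d2 i)) \<le> 2 * k - 1" for i
      using md[of i] by (simp add: wronskian_smult wronskian_pcompose degree_pcompose st dl mating_data_def)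
    show "degree (wronskian (n2 (\<sigma> i)) (d2 (\<sigma> i))) \<le> Suc (2 * k - 2)" for i
      unfolding e[symmetric] by (rule degW)
    show "0 < 2 * k - 2" using k2 by simp
    show "poly (wronskian (n2 (\<sigma> i)) (d2 (\<sigma> i))) (?r (\<sigma> i)) = 0" for i
      using md[of "\<sigma> i"] dl(1)[of "\<sigma> i"]
      by (simp add: wronskian_smult wronskian_pcompose poly_pcompose mating_data_def)
    show "poly (wronskian (n2 (\<sigma> i)) (d2 (\<sigma> i))) (?s (\<sigma> i)) = 0" for i
      using v(2)[of "\<sigma> i"] dl(1)[of "\<sigma> i"]
      by (simp add: wronskian_smult wronskian_pcompose poly_pcompose)
    show "?r (\<sigma> i) \<noteq> 0" for i using dl(1) by simp
    show "?s (\<sigma> i) \<noteq> 0" for i using K[of "\<sigma> i"] by (auto simp: \<sigma>_def)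
    show "?r (\<sigma> i) \<noteq> ?s (\<sigma> i)" for i using dl(1)[of "\<sigma> i"] v(1)[of "\<sigma> i"] by (simp add: field_simps)
    show "(\<lambda>i. 1 / ?r (\<sigma> i)) \<longlonglongrightarrow> 0" "(\<lambda>i. 1 / ?s (\<sigma> i)) \<longlonglongrightarrow> 0"
      using LIMSEQ_subseq_LIMSEQ[OF r0 \<sigma>] LIMSEQ_subseq_LIMSEQ[OF s0 \<sigma>] by (simp_all add: o_def)
  qed
  moreover have "coeff (wronskian N2 D2) (2 * k - 2) = coeff N2 k * coeff D2 (k - 1)"
  proof -
    have "degree (pderiv N2) \<le> k - 1" using D2_degree(2) by (simp add: degree_pderiv)
    hence "coeff (pderiv N2 * D2) ((k - 1) + (k - 1)) = coeff (pderiv N2) (k - 1) * coeff D2 (k - 1)"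
      by (rule coeff_mult_degree_bounds[OF _ D2_degree(3)])
    moreover have "degree (pderiv D2) \<le> k - 2" using D2_degree(3) by (simp add: degree_pderiv)
    hence "coeff (N2 * pderiv D2) (k + (k - 2)) = coeff N2 k * coeff (pderiv D2) (k - 2)"
      by (rule coeff_mult_degree_bounds[OF D2_degree(2)])
    moreover have "(k - 1) + (k - 1) = 2 * k - 2" "k + (k - 2) = 2 * k - 2" "Suc (k - 1) = k" "Suc (k - 2) = k - 1"
      using k2 by auto
    ultimately show ?thesis using k2
      by (simp add: wronskian_def coeff_pderiv algebra_simps of_nat_diff)
  qed
  ultimately have "coeff D2 (k - 1) = 0" using D2_degree(1) by simp
  hence "coeff D2 j = 0" if "k - 2 < j" for j
    using that coeff_eq_0[of D2 j] D2_degree(3) by (cases "j = k - 1") auto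
  thus ?thesis by (intro degree_le) auto
qed

text \<open>Turns a strict inequality between limits, at every point of a compact set, into one that
  holds on the whole set for all large indices.\<close>

lemma sequence_in_compact_contradiction:
  assumes C: "compact (C :: complex set)"
    and lim: "\<And>r u l. strict_mono (r :: nat \<Rightarrow> nat) \<Longrightarrow> u \<longlonglongrightarrow> l \<Longrightarrow> l \<in> C \<Longrightarrow> (\<And>i. Q (r i) (u i)) \<Longrightarrow> False"
  shows "\<forall>\<^sub>F i in sequentially. \<forall>u\<in>C. \<not> Q i u"
proof (rule ccontr)
  assume "\<not> ?thesis"
  hence "\<exists>\<^sub>F i in sequentially. \<exists>u\<in>C. Q i u" by (simp add: frequently_def)
  hence "infinite {i. \<exists>u\<in>C. Q i u}"
    by (simp add: frequently_cofinite[symmetric] cofinite_eq_sequentially)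
  then obtain r where r: "strict_mono (r :: nat \<Rightarrow> nat)" "\<forall>i. r i \<in> {i. \<exists>u\<in>C. Q i u}"
    using infinite_enumerate by blast
  hence "\<forall>i. \<exists>u. u \<in> C \<and> Q (r i) u" by blast
  then obtain u where u: "\<And>i. u i \<in> C" "\<And>i. Q (r i) (u i)" using choice[of "\<lambda>i u. u \<in> C \<and> Q (r i) u"] by blast
  obtain l q where q: "l \<in> C" "strict_mono (q :: nat \<Rightarrow> nat)" "(u \<circ> q) \<longlonglongrightarrow> l"
    using seq_compactE[OF compact_imp_seq_compact[OF C], of u] u(1) by blast
  have "strict_mono (r \<circ> q)" using r(1) q(2) by (rule strict_mono_o)
  from lim[OF this q(3,1)] u(2) show False by simp
qed

text \<open>For large \<open>\<rho>\<close> and large \<open>i\<close>, the map has modulus below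
  \<open>2 * \<rho>\<close> on the closed disc of radius \<open>\<rho>\<close> in the first chart,
  and above \<open>2 * \<rho>\<close> on the circle in the second. If the rescaled \<open>g\<close>
  at \<open>P(x)\<close> lies in the disc, then \<open>X(P(x))\<close> is below
  \<open>2 * \<rho>\<close>, so at \<open>x\<close> it cannot lie on the circle. This barrier is
  transported along backward orbits and keeps all of \<open>A\<close> inside, so \<open>X\<close>
  would be bounded.\<close>

lemma impossible: False
proof -
  obtain d0 where d0: "d0 \<noteq> 0" "D1 = [:d0:]" "N1 = [:0, d0:]" using D1_const .
  \<comment> \<open>The extra factor \<open>u\<close> is what the degree gap of two pays for: far
    out, \<open>N2\<close> exceeds \<open>2 u D2\<close> in modulus.\<close>
  have "degree ([:0, 1:] * D2) < k"
    using D2_degree' k2 degree_mult_le[of "[:0, 1:]" D2] by simp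
  from poly_dominates_at_infinity[OF D2_degree(2,1) this]
  obtain R0 where R0: "\<And>u. R0 \<le> cmod u \<Longrightarrow> 2 * cmod (poly ([:0, 1:] * D2) u) < cmod (poly N2 u)"
    by blast
  define \<rho> where "\<rho> = max (max R0 \<rho>0) 1"
  have \<rho>: "R0 \<le> \<rho>" "\<rho>0 \<le> \<rho>" "0 < \<rho>" by (auto simp: \<rho>_def)
  have ev2: "\<forall>\<^sub>F i in sequentially. \<forall>u\<in>sphere 0 \<rho>. \<not> cmod (poly (n2 i) u) \<le> 2 * \<rho> * cmod (poly (d2 i) u)"
  proof (rule sequence_in_compact_contradiction[OF compact_sphere])
    fix r :: "nat \<Rightarrow> nat" and u :: "nat \<Rightarrow> complex" and l
    assume r: "strict_mono r" "u \<longlonglongrightarrow> l" "l \<in> sphere 0 \<rho>"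
      and le: "\<And>i. cmod (poly (n2 (r i)) (u i)) \<le> 2 * \<rho> * cmod (poly (d2 (r i)) (u i))"
    have "(\<lambda>i. cmod (poly (n2 (r i)) (u i))) \<longlonglongrightarrow> cmod (poly N2 l)"
      by (intro tendsto_norm pconv_poly[OF pconv_subseq[OF n2lim r(1)] deg12(3) r(2)])
    moreover have "(\<lambda>i. 2 * \<rho> * cmod (poly (d2 (r i)) (u i))) \<longlonglongrightarrow> 2 * \<rho> * cmod (poly D2 l)"
      by (intro tendsto_intros tendsto_norm pconv_poly[OF pconv_subseq[OF d2lim r(1)] deg12(4) r(2)])
    ultimately have "cmod (poly N2 l) \<le> 2 * \<rho> * cmod (poly D2 l)"
      using le by (intro LIMSEQ_le) auto
    thus False using R0[of l] r(3) \<rho>(1) by (simp add: norm_mult)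
  qed
  have ev1: "\<forall>\<^sub>F i in sequentially. \<forall>u\<in>cball 0 \<rho>. \<not> 2 * \<rho> * cmod (poly (d1 i) u) \<le> cmod (poly (n1 i) u)"
  proof (rule sequence_in_compact_contradiction[OF compact_cball])
    fix r :: "nat \<Rightarrow> nat" and u :: "nat \<Rightarrow> complex" and l
    assume r: "strict_mono r" "u \<longlonglongrightarrow> l" "l \<in> cball 0 \<rho>"
      and le: "\<And>i. 2 * \<rho> * cmod (poly (d1 (r i)) (u i)) \<le> cmod (poly (n1 (r i)) (u i))"
    have "(\<lambda>i. cmod (poly (n1 (r i)) (u i))) \<longlonglongrightarrow> cmod (poly N1 l)"
      by (intro tendsto_norm pconv_poly[OF pconv_subseq[OF n1lim r(1)] deg12(1) r(2)])
    moreover have "(\<lambda>i. 2 * \<rho> * cmod (poly (d1 (r i)) (u i))) \<longlonglongrightarrow> 2 * \<rho> * cmod (poly D1 l)"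
      by (intro tendsto_intros tendsto_norm pconv_poly[OF pconv_subseq[OF d1lim r(1)] deg12(2) r(2)])
    ultimately have "2 * \<rho> * cmod (poly D1 l) \<le> cmod (poly N1 l)"
      using le by (intro LIMSEQ_le) auto
    hence "2 * \<rho> * cmod d0 \<le> cmod l * cmod d0" by (simp add: d0 norm_mult)
    hence "2 * \<rho> \<le> cmod l" using d0(1) by simp
    thus False using r(3) \<rho>(3) by simp
  qed
  from eventually_conj[OF Gbd eventually_conj[OF ev1 ev2]]
  have "\<exists>i. (\<forall>x\<in>cball a \<epsilon>. cmod (GG i x) < \<rho>0) \<and>
     (\<forall>u\<in>cball 0 \<rho>. \<not> 2 * \<rho> * cmod (poly (d1 i) u) \<le> cmod (poly (n1 i) u)) \<and>
     (\<forall>u\<in>sphere 0 \<rho>. \<not> cmod (poly (n2 i) u) \<le> 2 * \<rho> * cmod (poly (d2 i) u))"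
    by (rule eventually_happens'[OF sequentially_bot])
  then obtain i where i0: "\<forall>x\<in>cball a \<epsilon>. cmod (GG i x) < \<rho>0"
     "\<forall>u\<in>cball 0 \<rho>. \<not> 2 * \<rho> * cmod (poly (d1 i) u) \<le> cmod (poly (n1 i) u)"
     "\<forall>u\<in>sphere 0 \<rho>. \<not> cmod (poly (n2 i) u) \<le> 2 * \<rho> * cmod (poly (d2 i) u)"
    by blast
  have i: "\<And>x. x \<in> cball a \<epsilon> \<Longrightarrow> cmod (GG i x) < \<rho>0"
    "\<And>u. cmod u \<le> \<rho> \<Longrightarrow> cmod (poly (n1 i) u) < 2 * \<rho> * cmod (poly (d1 i) u)"
    "\<And>u. cmod u = \<rho> \<Longrightarrow> 2 * \<rho> * cmod (poly (d2 i) u) < cmod (poly (n2 i) u)"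
    using i0 unfolding not_le by simp_all
  have Xb: "cmod (X i y) < 2 * \<rho>" if "y \<in> A" "cmod (GG i y) \<le> \<rho>" for y
  proof -
    have "cmod (X i y) * cmod (poly (d1 i) (GG i y)) < 2 * \<rho> * cmod (poly (d1 i) (GG i y))"
      using i(2)[OF that(2)] eq1[OF that(1), of i] by (simp only: norm_mult)
    thus ?thesis using norm_ge_zero[of "poly (d1 i) (GG i y)"] by (simp only: mult_less_cancel_right)
  qed
  have skip: "cmod (GG i x) \<noteq> \<rho>" if "x \<in> A" "cmod (GG i (poly P x)) < \<rho>" for x
  proof
    assume c: "cmod (GG i x) = \<rho>"
    have "cmod (X i (poly P x)) < 2 * \<rho>" using Xb[OF invA[OF that(1)]] that(2) by simp
    hence "cmod (poly (n2 i) (GG i x)) \<le> 2 * \<rho> * cmod (poly (d2 i) (GG i x))"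
      unfolding eq2[OF that(1), of i] norm_mult by (intro mult_right_mono) auto
    thus False using i(3)[OF c] by simp
  qed
  have contGG: "continuous_on A (GG i)"
  proof -
    have "continuous_on A (g i)"
      using md[of i] holomorphic_on_imp_continuous_on unfolding mating_data_def by blast
    thus ?thesis using dl(1)[of i] by (intro continuous_intros) auto
  qed
  have iter: "(poly P ^^ j) x \<in> A" if "x \<in> A" for j x
    using that invA by (induction j) auto
  have iter_a: "(poly P ^^ j) a = a" for j using Pa by (induction j) auto
  have iter_cont: "continuous_on UNIV (poly P ^^ j)" for j
  proof (induction j)
    case 0 thus ?case by (simp add: id_def)
  next
    case (Suc j)
    thus ?case unfolding funpow.simps by (intro continuous_on_compose continuous_intros) (auto intro: continuous_on_subset)
  qed
  have all: "cmod (GG i x) < \<rho>" if x: "x \<in> A" for x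
  proof -
    have "path_connected A" using openA connA by (simp add: connected_open_path_connected)
    then obtain \<gamma> where \<gamma>: "path \<gamma>" "path_image \<gamma> \<subseteq> A" "pathstart \<gamma> = a" "pathfinish \<gamma> = x"
      using aA x unfolding path_connected_def by blast
    define C where "C = path_image \<gamma>"
    have C: "compact C" "connected C" "C \<subseteq> A" "a \<in> C" "x \<in> C"
      using \<gamma> by (auto simp: C_def compact_path_image connected_path_image)
    obtain n where n: "(poly P ^^ n) ` C \<subseteq> cball a \<epsilon>" using absorb[OF C(1,3)] by blast
    \<comment> \<open>Over a connected set containing the fixed point the moduli of the rescaled
      \<open>g\<close> form an interval containing 0. As the value \<open>\<rho>\<close> is barred,
      the interval stays below it.\<close>
    have step: "\<forall>y\<in>(poly P ^^ j) ` C. cmod (GG i y) < \<rho>"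
      if IH: "\<forall>y\<in>(poly P ^^ Suc j) ` C. cmod (GG i y) < \<rho>" for j
    proof (rule ccontr)
      let ?S = "(\<lambda>y. cmod (GG i y)) ` ((poly P ^^ j) ` C)"
      assume "\<not> ?thesis"
      then obtain y where y: "y \<in> (poly P ^^ j) ` C" "\<rho> \<le> cmod (GG i y)" by (auto simp: not_less)
      have sub: "(poly P ^^ j) ` C \<subseteq> A" using iter C(3) by auto
      have cj: "connected ((poly P ^^ j) ` C)"
        by (rule connected_continuous_image[OF continuous_on_subset[OF iter_cont subset_UNIV] C(2)])
      have "continuous_on ((poly P ^^ j) ` C) (\<lambda>y. cmod (GG i y))"
        by (rule continuous_on_norm[OF continuous_on_subset[OF contGG sub]])
      hence "connected ?S" by (rule connected_continuous_image[OF _ cj])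
      moreover have "0 \<in> ?S"
      proof -
        have "a \<in> (poly P ^^ j) ` C" by (rule image_eqI[where x = a]) (simp_all add: iter_a C(4))
        thus ?thesis by (rule rev_image_eqI) (simp only: GGa norm_zero)
      qed
      moreover have "cmod (GG i y) \<in> ?S" using y(1) by blast
      ultimately have "\<rho> \<in> ?S"
        using connectedD_interval[of ?S 0 "cmod (GG i y)" \<rho>] y(2) \<rho>(3) by simp
      then obtain y' where y': "y' \<in> (poly P ^^ j) ` C" "cmod (GG i y') = \<rho>" by auto
      hence "poly P y' \<in> (poly P ^^ Suc j) ` C" by auto
      thus False using skip[of y'] IH y' sub by blast
    qed
    have base: "\<forall>y\<in>(poly P ^^ n) ` C. cmod (GG i y) < \<rho>"
      using i(1) n \<rho>(2) by fastforce
    have "\<forall>y\<in>(poly P ^^ (n - m)) ` C. cmod (GG i y) < \<rho>" if "m \<le> n" for m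
      using that
    proof (induction m)
      case 0 thus ?case using base by simp
    next
      case (Suc m)
      hence "Suc (n - Suc m) = n - m" by simp
      thus ?case using step[of "n - Suc m"] Suc by simp
    qed
    from this[of n] show ?thesis using C(5) by simp
  qed
  have "bounded (X i ` A)"
    unfolding bounded_iff using Xb all by (intro exI[of _ "2 * \<rho>"]) (force intro: less_imp_le)
  thus False using md[of i] by (simp add: mating_data_def)
qed

end

section \<open>Subsequential limits of mating data\<close>

context poly_basin
begin

lemma mating_data_not_collapsing:
  assumes md: "\<And>i. mating_data (N i) (D i) (g i) (X i)"
    and glim: "\<And>x. x \<in> A \<Longrightarrow> (\<lambda>i. g i x) \<longlonglongrightarrow> 1"
    and Xlim: "\<And>x. x \<in> A \<Longrightarrow> (\<lambda>i. X i x) \<longlonglongrightarrow> Xl x" and Xinj: "inj_on Xl A"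
  shows False
proof -
  define dl where "dl i = g i p - 1" for i
  have ginj: "inj_on (g i) A" and ga: "g i a = 1" and ghol: "g i holomorphic_on A" for i
    using md[of i] by (auto simp: mating_data_def)
  have dl0: "dl i \<noteq> 0" for i
    using inj_onD[OF ginj[of i], of p a] ga[of i] pa pA aA by (auto simp: dl_def)
  have dllim: "dl \<longlonglongrightarrow> 0"
    unfolding dl_def[abs_def] using tendsto_diff[OF glim[OF pA] tendsto_const[of 1]] by simp
  define f where "f i x = (g i x - 1) / dl i" for i x
  have fhol: "f i holomorphic_on A" for i
    unfolding f_def[abs_def] using ghol dl0 by (intro holomorphic_intros)
  have finj: "inj_on (f i) A" for i
    using ginj[of i] dl0[of i] by (auto simp: f_def inj_on_def)
  have fa: "f i a = 0" and fp: "f i p = 1" for i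
    using ga[of i] dl0[of i] by (simp_all add: f_def) (simp add: dl_def)
  obtain G r4 where G: "G holomorphic_on A" "strict_mono (r4 :: nat \<Rightarrow> nat)"
    "\<And>x. x \<in> A \<Longrightarrow> (\<lambda>n. f (r4 n) x) \<longlonglongrightarrow> G x"
    "\<And>K. compact K \<Longrightarrow> K \<subseteq> A \<Longrightarrow> uniform_limit K (f \<circ> r4) G sequentially"
    by (rule injective_two_point_normal[where f = f, OF openA connA aA pA pa[symmetric] fhol finj fa fp]) (rule that | assumption)+
  have deg: "degree (N i) \<le> k + 1" "degree (D i) \<le> k + 1" and nz: "N i \<noteq> 0 \<or> D i \<noteq> 0" for i
    using md[of i] by (auto simp: mating_data_def)
  define A1 where "A1 i = pcompose (N (r4 i)) [:1, dl (r4 i):]" for i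
  define B1 where "B1 i = pcompose (D (r4 i)) [:1, dl (r4 i):]" for i
  have d: "degree (A1 i) \<le> k + 1" "degree (B1 i) \<le> k + 1" for i
    using deg[of "r4 i"] dl0[of "r4 i"] by (auto simp: A1_def B1_def degree_pcompose)
  have z: "A1 i \<noteq> 0 \<or> B1 i \<noteq> 0" for i
    using nz[of "r4 i"] dl0[of "r4 i"] by (auto simp: A1_def B1_def pcompose_eq_0_iff)
  obtain r5 s5 N1 D1 where r5: "strict_mono r5" "\<And>i. s5 i \<noteq> (0::complex)"
    "pconv (\<lambda>i. smult (s5 i) (A1 (r5 i))) N1" "pconv (\<lambda>i. smult (s5 i) (B1 (r5 i))) D1" "N1 \<noteq> 0 \<or> D1 \<noteq> 0"
    by (rule pair_normalized_subsequence[where A = A1 and B = B1, OF d z]) (rule that | assumption)+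
  \<comment> \<open>The second chart is normalized by a scale of its own, since the coefficients
    around 1 and around -1 may be of quite different sizes.\<close>
  define A2 where "A2 i = pcompose (N (r4 (r5 i))) [:-1, - dl (r4 (r5 i)):]" for i
  define B2 where "B2 i = pcompose (D (r4 (r5 i))) [:-1, - dl (r4 (r5 i)):]" for i
  have d2: "degree (A2 i) \<le> k + 1" "degree (B2 i) \<le> k + 1" for i
    using deg[of "r4 (r5 i)"] dl0[of "r4 (r5 i)"] by (auto simp: A2_def B2_def degree_pcompose)
  have z2: "A2 i \<noteq> 0 \<or> B2 i \<noteq> 0" for i
    using nz[of "r4 (r5 i)"] dl0[of "r4 (r5 i)"] by (auto simp: A2_def B2_def pcompose_eq_0_iff)
  obtain r6 s6 N2 D2 where r6: "strict_mono r6" "\<And>i. s6 i \<noteq> (0::complex)"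
    "pconv (\<lambda>i. smult (s6 i) (A2 (r6 i))) N2" "pconv (\<lambda>i. smult (s6 i) (B2 (r6 i))) D2" "N2 \<noteq> 0 \<or> D2 \<noteq> 0"
    by (rule pair_normalized_subsequence[where A = A2 and B = B2, OF d2 z2]) (rule that | assumption)+
  define q where "q i = r4 (r5 (r6 i))" for i
  have q': "strict_mono (\<lambda>i. r5 (r6 i))" using r5(1) r6(1) by (simp add: strict_mono_def)
  have q: "strict_mono q" using G(2) q' unfolding q_def strict_mono_def by simp
  have cb: "compact (cball a \<epsilon>)" by simp
  have "continuous_on (cball a \<epsilon>) G"
    using G(1) eps(2) by (meson holomorphic_on_imp_continuous_on continuous_on_subset)
  hence "bounded (G ` cball a \<epsilon>)"
    by (intro compact_imp_bounded compact_continuous_image) auto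
  then obtain B where B: "\<And>x. x \<in> cball a \<epsilon> \<Longrightarrow> cmod (G x) \<le> B"
    unfolding bounded_iff by blast
  have "\<forall>\<^sub>F n in sequentially. \<forall>x\<in>cball a \<epsilon>. dist ((f \<circ> r4) n x) (G x) < 1"
    using G(4)[OF cb eps(2)] unfolding uniform_limit_iff by (meson zero_less_one)
  hence ev: "\<forall>\<^sub>F n in sequentially. \<forall>x\<in>cball a \<epsilon>. cmod (f (r4 n) x) < B + 1"
  proof eventually_elim
    case (elim n)
    show ?case
    proof
      fix x assume x: "x \<in> cball a \<epsilon>"
      have "cmod (f (r4 n) x) \<le> cmod (G x) + dist (f (r4 n) x) (G x)"
        by (metis dist_norm norm_triangle_sub)
      also have "\<dots> < B + 1" using elim x B[OF x] by (intro add_le_less_mono) auto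
      finally show "cmod (f (r4 n) x) < B + 1" .
    qed
  qed
  have ev': "\<forall>\<^sub>F n in sequentially. \<forall>x\<in>cball a \<epsilon>. cmod (f (q n) x) < B + 1"
    using eventually_subseq[OF q' ev] by (simp add: q_def)
  interpret collapsing P A a p k \<epsilon> "\<lambda>i. N (q i)" "\<lambda>i. D (q i)" "\<lambda>i. g (q i)" "\<lambda>i. X (q i)"
    "\<lambda>i. s5 (r6 i)" s6 G Xl N1 D1 N2 D2 "\<lambda>i. dl (q i)" "B + 1"
  proof unfold_locales
    show "mating_data (N (q i)) (D (q i)) (g (q i)) (X (q i))" for i by (rule md)
    show "dl (q i) \<noteq> 0" for i by (rule dl0)
    show "(\<lambda>i. dl (q i)) \<longlonglongrightarrow> 0" using LIMSEQ_subseq_LIMSEQ[OF dllim q] by (simp add: o_def)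
    show "(\<lambda>i. g (q i) x) \<longlonglongrightarrow> 1" if "x \<in> A" for x
      using LIMSEQ_subseq_LIMSEQ[OF glim[OF that] q] by (simp add: o_def)
    show "(\<lambda>i. X (q i) x) \<longlonglongrightarrow> Xl x" if "x \<in> A" for x
      using LIMSEQ_subseq_LIMSEQ[OF Xlim[OF that] q] by (simp add: o_def)
    show "(\<lambda>i. (g (q i) x - 1) / dl (q i)) \<longlonglongrightarrow> G x" if "x \<in> A" for x
      using LIMSEQ_subseq_LIMSEQ[OF G(3)[OF that] q'] by (simp add: o_def f_def q_def)
    show "(g (q i) p - 1) / dl (q i) = 1" for i using fp[of "q i"] by (simp add: f_def)
    show "\<forall>\<^sub>F i in sequentially. \<forall>x\<in>cball a \<epsilon>. cmod ((g (q i) x - 1) / dl (q i)) < B + 1"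
      using ev' by (simp add: f_def)
    show "inj_on Xl A" by (rule Xinj)
    show "s5 (r6 i) \<noteq> 0" "s6 i \<noteq> 0" for i by (rule r5(2)) (rule r6(2))
    show "pconv (\<lambda>i. smult (s5 (r6 i)) (pcompose (N (q i)) [:1, dl (q i):])) N1"
      using pconv_subseq[OF r5(3) r6(1)] by (simp add: A1_def q_def)
    show "pconv (\<lambda>i. smult (s5 (r6 i)) (pcompose (D (q i)) [:1, dl (q i):])) D1"
      using pconv_subseq[OF r5(4) r6(1)] by (simp add: B1_def q_def)
    show "pconv (\<lambda>i. smult (s6 i) (pcompose (N (q i)) [:-1, - dl (q i):])) N2"
      using r6(3) by (simp add: A2_def q_def)
    show "pconv (\<lambda>i. smult (s6 i) (pcompose (D (q i)) [:-1, - dl (q i):])) D2"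
      using r6(4) by (simp add: B2_def q_def)
    show "N1 \<noteq> 0 \<or> D1 \<noteq> 0" by (rule r5(5))
    show "N2 \<noteq> 0 \<or> D2 \<noteq> 0" by (rule r6(5))
  qed
  show False by (rule impossible)
qed

theorem mating_data_precompact:
  assumes md: "\<And>i. mating_data (N i) (D i) (g i) (X i)"
  obtains r s N' D' where "strict_mono (r :: nat \<Rightarrow> nat)" "\<And>i. s i \<noteq> (0::complex)"
    "pconv (\<lambda>i. smult (s i) (N (r i))) N'" "pconv (\<lambda>i. smult (s i) (D (r i))) D'"
    "degree N' \<le> k + 1" "degree D' \<le> k + 1" "degree N' = k + 1 \<or> degree D' = k + 1"
    "\<And>z. \<not> (poly N' z = 0 \<and> poly D' z = 0)"
proof -
  have deg: "degree (N i) \<le> k + 1" "degree (D i) \<le> k + 1" and nz: "N i \<noteq> 0 \<or> D i \<noteq> 0" for i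
    using md[of i] by (auto simp: mating_data_def)
  obtain r1 s1 N' D' where r1: "strict_mono r1" "\<And>i. s1 i \<noteq> (0::complex)"
    "pconv (\<lambda>i. smult (s1 i) (N (r1 i))) N'" "pconv (\<lambda>i. smult (s1 i) (D (r1 i))) D'" "N' \<noteq> 0 \<or> D' \<noteq> 0"
    by (rule pair_normalized_subsequence[where A = N and B = D, OF deg nz]) (rule that | assumption)+
  have X: "X i holomorphic_on A" "inj_on (X i) A" "X i a = 0" "X i p = 1"
    and g: "g i holomorphic_on A" "inj_on (g i) A" "g i a = 1" for i
    using md[of i] by (auto simp: mating_data_def)
  have g0: "x \<in> A \<Longrightarrow> g i x \<noteq> 0 \<and> g i x \<noteq> -1" and gne: "x \<in> A \<Longrightarrow> y \<in> A \<Longrightarrow> g i x + g i y \<noteq> 0" for i x y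
  proof -
    show *: "g i x + g i y \<noteq> 0" if "x \<in> A" "y \<in> A" for x y
    proof -
      have "g i x \<noteq> - g i y" using md[of i] that unfolding mating_data_def by blast
      thus ?thesis by (simp add: add_eq_0_iff2)
    qed
    assume x: "x \<in> A"
    hence "g i x \<noteq> 0" using md[of i] unfolding mating_data_def by blast
    moreover have "g i x \<noteq> -1" using *[OF x aA] g(3)[of i] by (auto simp: add_eq_0_iff2)
    ultimately show "g i x \<noteq> 0 \<and> g i x \<noteq> -1" by blast
  qed
  obtain Xl r2 where r2: "Xl holomorphic_on A" "inj_on Xl A" "strict_mono (r2 :: nat \<Rightarrow> nat)"
    "\<And>x. x \<in> A \<Longrightarrow> (\<lambda>n. X (r1 (r2 n)) x) \<longlonglongrightarrow> Xl x"
    by (rule injective_two_point_normal[where f = "\<lambda>n. X (r1 n)", OF openA connA aA pA pa[symmetric] X]) (rule that | assumption)+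
  obtain gl r3 where r3: "gl holomorphic_on A" "inj_on gl A \<or> (\<forall>x\<in>A. gl x = 1)" "strict_mono (r3 :: nat \<Rightarrow> nat)"
    "\<And>x. x \<in> A \<Longrightarrow> (\<lambda>n. g (r1 (r2 (r3 n))) x) \<longlonglongrightarrow> gl x"
    "\<And>K. compact K \<Longrightarrow> K \<subseteq> A \<Longrightarrow> uniform_limit K ((\<lambda>n. g (r1 (r2 n))) \<circ> r3) gl sequentially"
    by (rule omit_zero_and_opposite_normal[where f = "\<lambda>n. g (r1 (r2 n))", OF openA connA aA g g0]) (rule that | assumption)+
  define q where "q i = r2 (r3 i)" for i
  have q: "strict_mono q" using r2(3) r3(3) by (simp add: q_def strict_mono_def)
  have Xl: "(\<lambda>n. X (r1 (q n)) x) \<longlonglongrightarrow> Xl x" if "x \<in> A" for x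
    using LIMSEQ_subseq_LIMSEQ[OF r2(4)[OF that] r3(3)] by (simp add: o_def q_def)
  have gl: "(\<lambda>n. g (r1 (q n)) x) \<longlonglongrightarrow> gl x" if "x \<in> A" for x
    using r3(4)[OF that] by (simp add: q_def)
  \<comment> \<open>The normal family leaves only the collapse to the constant 1 as an
    alternative.\<close>
  have ginj: "inj_on gl A"
  proof (rule ccontr)
    assume "\<not> inj_on gl A"
    hence "gl x = 1" if "x \<in> A" for x using r3(2) that by blast
    hence "(\<lambda>n. g (r1 (q n)) x) \<longlonglongrightarrow> 1" if "x \<in> A" for x using gl[OF that] that by simp
    from mating_data_not_collapsing[of "\<lambda>i. N (r1 (q i))" "\<lambda>i. D (r1 (q i))" "\<lambda>i. g (r1 (q i))" "\<lambda>i. X (r1 (q i))" Xl, OF md this Xl r2(2)]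
    show False .
  qed
  have Nl: "pconv (\<lambda>i. smult (s1 (q i)) (N (r1 (q i)))) N'" "pconv (\<lambda>i. smult (s1 (q i)) (D (r1 (q i)))) D'"
    using pconv_subseq[OF r1(3) q] pconv_subseq[OF r1(4) q] by simp_all
  have dg: "degree (smult (s1 (q i)) (N (r1 (q i)))) \<le> k + 1" "degree (smult (s1 (q i)) (D (r1 (q i)))) \<le> k + 1" for i
    using deg r1(2) by simp_all
  have dl: "degree N' \<le> k + 1" "degree D' \<le> k + 1"
    using pconv_degree[OF Nl(1) dg(1)] pconv_degree[OF Nl(2) dg(2)] by auto
  have e1: "poly N' (gl x) = Xl x * poly D' (gl x)" if x: "x \<in> A" for x
  proof -
    have "(\<lambda>i. poly (smult (s1 (q i)) (N (r1 (q i)))) (g (r1 (q i)) x)) \<longlonglongrightarrow> poly N' (gl x)"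
      by (rule pconv_poly[OF Nl(1) dg(1) gl[OF x]])
    moreover have "(\<lambda>i. X (r1 (q i)) x * poly (smult (s1 (q i)) (D (r1 (q i)))) (g (r1 (q i)) x)) \<longlonglongrightarrow> Xl x * poly D' (gl x)"
      by (intro tendsto_mult Xl[OF x] pconv_poly[OF Nl(2) dg(2) gl[OF x]])
    moreover have "poly (smult (s1 (q i)) (N (r1 (q i)))) (g (r1 (q i)) x) = X (r1 (q i)) x * poly (smult (s1 (q i)) (D (r1 (q i)))) (g (r1 (q i)) x)" for i
      using md[of "r1 (q i)"] x by (simp add: mating_data_def)
    ultimately show ?thesis by (simp only: LIMSEQ_unique)
  qed
  have e2: "poly N' (- gl x) = Xl (poly P x) * poly D' (- gl x)" if x: "x \<in> A" for x
  proof -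
    have "(\<lambda>i. poly (smult (s1 (q i)) (N (r1 (q i)))) (- g (r1 (q i)) x)) \<longlonglongrightarrow> poly N' (- gl x)"
      by (rule pconv_poly[OF Nl(1) dg(1) tendsto_minus[OF gl[OF x]]])
    moreover have "(\<lambda>i. X (r1 (q i)) (poly P x) * poly (smult (s1 (q i)) (D (r1 (q i)))) (- g (r1 (q i)) x)) \<longlonglongrightarrow> Xl (poly P x) * poly D' (- gl x)"
      by (intro tendsto_mult Xl invA x pconv_poly[OF Nl(2) dg(2) tendsto_minus[OF gl[OF x]]])
    moreover have "poly (smult (s1 (q i)) (N (r1 (q i)))) (- g (r1 (q i)) x) = X (r1 (q i)) (poly P x) * poly (smult (s1 (q i)) (D (r1 (q i)))) (- g (r1 (q i)) x)" for i
      using md[of "r1 (q i)"] x by (simp add: mating_data_def)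
    ultimately show ?thesis by (simp only: LIMSEQ_unique)
  qed
  \<comment> \<open>Hurwitz is applied in one variable, with \<open>y\<close> fixed: the sums
    \<open>g(z) + g(y)\<close> have no zero in \<open>z\<close>, and their limit is not constant
    because the limit of \<open>g\<close> is injective.\<close>
  have opp: "gl x \<noteq> - gl y" if x: "x \<in> A" and y: "y \<in> A" for x y
  proof -
    have "gl x + gl y \<noteq> 0"
    proof (rule Hurwitz_no_zeros[OF openA connA, of "\<lambda>n z. g (r1 (q n)) z + g (r1 (q n)) y" "\<lambda>z. gl z + gl y"])
      show "(\<lambda>z. g (r1 (q n)) z + g (r1 (q n)) y) holomorphic_on A" for n
        using g(1) by (intro holomorphic_intros)
      show "(\<lambda>z. gl z + gl y) holomorphic_on A" using r3(1) by (intro holomorphic_intros)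
      show "uniform_limit K (\<lambda>n z. g (r1 (q n)) z + g (r1 (q n)) y) (\<lambda>z. gl z + gl y) sequentially"
        if K: "compact K" "K \<subseteq> A" for K
      proof (intro uniform_limit_add)
        show "uniform_limit K (\<lambda>n z. g (r1 (q n)) z) (\<lambda>z. gl z) sequentially"
          using r3(5)[OF K] by (simp add: o_def q_def)
        show "uniform_limit K (\<lambda>n z. g (r1 (q n)) y) (\<lambda>z. gl y) sequentially"
          using gl[OF y] by (auto simp: uniform_limit_iff tendsto_iff)
      qed
      show "\<not> (\<lambda>z. gl z + gl y) constant_on A"
      proof
        assume "(\<lambda>z. gl z + gl y) constant_on A"
        hence "gl a + gl y = gl p + gl y" using aA pA unfolding constant_on_def by metis
        thus False using inj_onD[OF ginj, of a p] aA pA pa by simp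
      qed
      show "g (r1 (q n)) z + g (r1 (q n)) y \<noteq> 0" if "z \<in> A" for n z by (rule gne[OF that y])
    qed (rule x)
    thus ?thesis by (auto simp: add_eq_0_iff2)
  qed
  have rq: "strict_mono (\<lambda>i. r1 (q i))" using r1(1) q by (simp add: strict_mono_def)
  show ?thesis
    by (rule that[OF rq _ Nl dl])
      (use limit_nondegenerate[OF dl r1(5) ginj opp r2(2) e1 e2] r1(2) in auto)
qed

end

section \<open>Polynomials with an attracting fixed point\<close>

text \<open>In the plane a punctured disc is connected, so it lies on one side of any separation of
  \<open>M - {a}\<close>. Adding the full disc to that side and cutting a smaller closed disc out of
  the other yields a separation of \<open>M\<close>.\<close>

lemma connected_minus_interior_point:
  fixes a :: complex
  assumes M: "connected M" and e: "0 < e" "ball a e \<subseteq> M"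
  shows "connected (M - {a})"
proof (rule connectedI)
  have Bp: "connected (ball a e - {a})"
    using connected_punctured_ball[of a e] by simp
  have key: False
    if AB: "open A" "open B" "A \<inter> (M - {a}) \<noteq> {}" "B \<inter> (M - {a}) \<noteq> {}" "M - {a} \<subseteq> A \<union> B"
      "A \<inter> B \<inter> (M - {a}) = {}" and sub: "ball a e - {a} \<subseteq> A" for A B
  proof -
    define A' where "A' = A \<union> ball a e"
    define B' where "B' = B - cball a (e / 2)"
    have "open A'" "open B'" using AB by (auto simp: A'_def B'_def)
    moreover have "A' \<inter> B' \<inter> M = {}"
    proof (rule ccontr)
      assume "\<not> ?thesis"
      then obtain x where x: "x \<in> A'" "x \<in> B'" "x \<in> M" by blast
      hence xa: "x \<noteq> a" "x \<in> B" using e(1) by (auto simp: B'_def)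
      hence "x \<in> A" using x(1) sub by (auto simp: A'_def)
      thus False using AB(6) xa x(3) by blast
    qed
    moreover have "M \<subseteq> A' \<union> B'"
    proof
      fix x assume "x \<in> M"
      show "x \<in> A' \<union> B'"
      proof (cases "x \<in> ball a e")
        case False
        hence "x \<noteq> a" using e by auto
        hence "x \<in> A \<or> x \<in> B" using \<open>x \<in> M\<close> AB(5) by auto
        thus ?thesis using False e by (auto simp: A'_def B'_def)
      qed (auto simp: A'_def)
    qed
    moreover have "A' \<inter> M \<noteq> {}" using AB(3) by (auto simp: A'_def)
    moreover have "B' \<inter> M \<noteq> {}"
    proof -
      obtain x where x: "x \<in> B" "x \<in> M" "x \<noteq> a" using AB(4) by auto
      hence "x \<notin> A" using AB(6) by auto
      hence "x \<notin> ball a e" using sub x(3) by auto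
      thus ?thesis using x e by (auto simp: B'_def)
    qed
    ultimately show False using M unfolding connected_def by blast
  qed
  fix A B assume AB: "open A" "open B" "A \<inter> (M - {a}) \<noteq> {}" "B \<inter> (M - {a}) \<noteq> {}" "M - {a} \<subseteq> A \<union> B"
      "A \<inter> B \<inter> (M - {a}) = {}"
  have "ball a e - {a} \<subseteq> A \<or> ball a e - {a} \<subseteq> B"
  proof (rule ccontr)
    assume "\<not> ?thesis"
    hence "A \<inter> (ball a e - {a}) \<noteq> {}" "B \<inter> (ball a e - {a}) \<noteq> {}" using AB(5) e by blast+
    moreover have "A \<inter> B \<inter> (ball a e - {a}) = {}" "ball a e - {a} \<subseteq> A \<union> B" using AB e by blast+
    ultimately show False using Bp AB(1,2) unfolding connected_def by blast
  qed
  thus False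
  proof
    assume "ball a e - {a} \<subseteq> A"
    from key[OF AB this] show False .
  next
    assume s: "ball a e - {a} \<subseteq> B"
    have "M - {a} \<subseteq> B \<union> A" "B \<inter> A \<inter> (M - {a}) = {}" using AB by auto
    from key[OF AB(2,1,4,3) this s] show False .
  qed
qed

lemma poly_fiber_card:
  fixes P :: "complex poly"
  assumes "0 < degree P" and "\<And>c. poly (pderiv P) c = 0 \<Longrightarrow> poly P c \<noteq> w"
  shows "finite {x. poly P x = w}" "card {x. poly P x = w} = degree P"
proof -
  have "degree (P + [:- w:]) = degree P"
    using assms(1) by (intro degree_add_eq_left) simp
  moreover have "P + [:- w:] = P - [:w:]" by simp
  ultimately have dg: "degree (P - [:w:]) = degree P" by metis
  hence nz: "P - [:w:] \<noteq> 0" using assms(1) by auto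
  have eq: "{x. poly P x = w} = {x. poly (P - [:w:]) x = 0}" by auto
  show "finite {x. poly P x = w}" unfolding eq using nz by (rule poly_roots_finite)
  have "rsquarefree (P - [:w:])"
    unfolding rsquarefree_roots using assms(2) by (auto simp: pderiv_diff pderiv_pCons)
  thus "card {x. poly P x = w} = degree P" unfolding eq using rsquarefree_card_roots[OF nz] dg by simp
qed

lemma finite_separated_radius:
  fixes F :: "complex set"
  assumes "finite F"
  obtains dl where "0 < dl" "\<And>x y. x \<in> F \<Longrightarrow> y \<in> F \<Longrightarrow> x \<noteq> y \<Longrightarrow> ball x dl \<inter> ball y dl = {}"
proof -
  define S where "S = (\<lambda>p. dist (fst p) (snd p) / 2) ` {p \<in> F \<times> F. fst p \<noteq> snd p}"
  have S: "finite S" "\<And>s. s \<in> S \<Longrightarrow> 0 < s" using assms by (auto simp: S_def)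
  define dl where "dl = (if S = {} then 1 else Min S)"
  have "0 < dl" using S by (auto simp: dl_def)
  moreover have "ball x dl \<inter> ball y dl = {}" if "x \<in> F" "y \<in> F" "x \<noteq> y" for x y
  proof -
    have mem: "dist x y / 2 \<in> S" using that unfolding S_def by (force intro!: image_eqI[of _ _ "(x, y)"])
    hence "S \<noteq> {}" by blast
    hence "dl \<le> dist x y / 2" using Min_le[OF S(1) mem] by (simp add: dl_def)
    hence "2 * dl \<le> dist x y" by simp
    thus ?thesis by (intro disjoint_ballI) simp
  qed
  ultimately show ?thesis by (rule that)
qed

text \<open>Around each of the \<open>degree P\<close> points over \<open>w\<close> there is a local
  inverse on a common neighbourhood \<open>T\<close>. No other sheet exists because these already
  provide as many preimages of every value in \<open>T\<close> as the degree allows.\<close>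

lemma poly_covering_space:
  fixes P :: "complex poly"
  assumes deg: "0 < degree P" and Y: "open Y" and ncv: "\<And>c. poly (pderiv P) c = 0 \<Longrightarrow> poly P c \<notin> Y"
  shows "covering_space (poly P -` Y) (poly P) Y"
proof
  show "continuous_on (poly P -` Y) (poly P)" by (intro continuous_intros)
  show "poly P ` (poly P -` Y) = Y"
  proof -
    have "\<exists>x. poly P x = w" for w
    proof -
      have "\<not> constant (poly P)" using deg by (simp add: constant_degree)
      have "degree (P + [:- w:]) = degree P" using deg by (intro degree_add_eq_left) simp
      moreover have "P + [:- w:] = P - [:w:]" by simp
      ultimately have "degree (P - [:w:]) = degree P" by metis
      hence "degree (P - [:w:]) \<noteq> 0" using deg by simp
      hence "\<not> constant (poly (P - [:w:]))" by (simp add: constant_degree)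
      then obtain x where "poly (P - [:w:]) x = 0" using fundamental_theorem_of_algebra by blast
      thus ?thesis by auto
    qed
    hence "surj (poly P)" unfolding surj_def by metis
    thus ?thesis by (rule surj_image_vimage_eq)
  qed
  fix w assume w: "w \<in> Y"
  define F where "F = {x. poly P x = w}"
  have F: "finite F" "card F = degree P"
    using poly_fiber_card[OF deg, of w] ncv w by (auto simp: F_def)
  obtain dl where dl: "0 < dl" "\<And>x y. x \<in> F \<Longrightarrow> y \<in> F \<Longrightarrow> x \<noteq> y \<Longrightarrow> ball x dl \<inter> ball y dl = {}"
    using finite_separated_radius[OF F(1)] by blast
  have oX: "open (poly P -` Y)"
    using Y by (intro open_vimage continuous_intros)
  have "\<exists>r. 0 < r \<and> r \<le> dl \<and> ball x r \<subseteq> poly P -` Y \<and> inj_on (poly P) (ball x r)" if x: "x \<in> F" for x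
  proof -
    have "poly P holomorphic_on poly P -` Y" by (intro holomorphic_intros)
    moreover have "x \<in> poly P -` Y" using x w by (simp add: F_def)
    moreover have "deriv (poly P) x \<noteq> 0"
      using ncv[of x] x w by (auto simp: F_def DERIV_imp_deriv[OF poly_DERIV])
    ultimately obtain r where "0 < r" "ball x r \<subseteq> poly P -` Y" "inj_on (poly P) (ball x r)"
      using oX has_complex_derivative_locally_injective by blast
    moreover have "ball x (min r dl) \<subseteq> ball x r" by auto
    ultimately show ?thesis using dl(1)
      by (intro exI[of _ "min r dl"]) (auto intro: inj_on_subset)
  qed
  hence "\<forall>x\<in>F. \<exists>r. 0 < r \<and> r \<le> dl \<and> ball x r \<subseteq> poly P -` Y \<and> inj_on (poly P) (ball x r)" by blast
  from bchoice[OF this] obtain r where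
    r: "\<And>x. x \<in> F \<Longrightarrow> 0 < r x" "\<And>x. x \<in> F \<Longrightarrow> r x \<le> dl" "\<And>x. x \<in> F \<Longrightarrow> ball x (r x) \<subseteq> poly P -` Y"
      "\<And>x. x \<in> F \<Longrightarrow> inj_on (poly P) (ball x (r x))" by blast
  have opi: "open (poly P ` ball x (r x))" if "x \<in> F" for x
    by (rule invariance_of_domain) (use r(4)[OF that] in \<open>auto intro!: continuous_intros\<close>)
  define T where "T = Y \<inter> (\<Inter>x\<in>F. poly P ` ball x (r x))"
  have oT: "open T" unfolding T_def using Y opi F(1) by auto
  have wT: "w \<in> T"
    unfolding T_def using w r(1) by (auto simp: F_def intro!: rev_image_eqI)
  define U where "U x = ball x (r x) \<inter> poly P -` T" for x
  have oU: "open (U x)" for x unfolding U_def using oT by (intro open_Int open_vimage continuous_intros) auto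
  have disj: "U x \<inter> U y = {}" if "x \<in> F" "y \<in> F" "x \<noteq> y" for x y
  proof -
    have "ball x (r x) \<subseteq> ball x dl" "ball y (r y) \<subseteq> ball y dl"
      using r(2)[OF that(1)] r(2)[OF that(2)] by (auto intro: subset_ball)
    thus ?thesis using dl(2)[OF that] unfolding U_def by blast
  qed
  have cover: "z \<in> \<Union>(U ` F)" if z: "poly P z \<in> T" for z
  proof -
    have "\<forall>x\<in>F. \<exists>y. y \<in> ball x (r x) \<and> poly P y = poly P z" using z by (force simp: T_def)
    from bchoice[OF this] obtain y where y: "\<And>x. x \<in> F \<Longrightarrow> y x \<in> ball x (r x) \<and> poly P (y x) = poly P z" by blast
    have yU: "y x \<in> U x" if "x \<in> F" for x using y[OF that] z by (simp add: U_def)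
    have inj: "inj_on y F"
      using disj yU by (metis (no_types, lifting) disjoint_iff inj_onI)
    have zY: "poly P z \<in> Y" using z by (simp add: T_def)
    have fz: "finite {x. poly P x = poly P z}" "card {x. poly P x = poly P z} = degree P"
      using poly_fiber_card[OF deg, of "poly P z"] ncv zY by metis+
    have "y ` F = {x. poly P x = poly P z}"
      by (rule card_subset_eq[OF fz(1)]) (use y inj F fz in \<open>auto simp: card_image\<close>)
    then obtain x where "x \<in> F" "z = y x" by blast
    thus ?thesis using yU by blast
  qed
  show "\<exists>T. w \<in> T \<and> openin (top_of_set Y) T \<and>
      (\<exists>v. \<Union> v = poly P -` Y \<inter> poly P -` T \<and> (\<forall>u\<in>v. openin (top_of_set (poly P -` Y)) u) \<and>
        pairwise disjnt v \<and> (\<forall>u\<in>v. \<exists>q. homeomorphism u T (poly P) q))"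
  proof (intro exI[of _ T] exI[of _ "U ` F"] conjI ballI)
    show "openin (top_of_set Y) T"
      using oT by (intro open_subset) (auto simp: T_def)
    show "\<Union> (U ` F) = poly P -` Y \<inter> poly P -` T"
      using cover by (auto simp: U_def T_def)
    show "openin (top_of_set (poly P -` Y)) u" if "u \<in> U ` F" for u
      using that oU by (intro open_subset) (auto simp: U_def T_def)
    show "pairwise disjnt (U ` F)"
      using disj by (auto simp: pairwise_def disjnt_def)
    show "\<exists>q. homeomorphism u T (poly P) q" if u: "u \<in> U ` F" for u
    proof -
      obtain x where x: "x \<in> F" "u = U x" using u by blast
      have img: "poly P ` U x = T"
      proof
        show "poly P ` U x \<subseteq> T" unfolding U_def by blast
        show "T \<subseteq> poly P ` U x"
        proof
          fix t assume t: "t \<in> T"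
          then obtain y where "y \<in> ball x (r x)" "t = poly P y" using x(1) unfolding T_def by blast
          thus "t \<in> poly P ` U x" using t unfolding U_def by blast
        qed
      qed
      have i: "inj_on (poly P) (U x)" using r(4)[OF x(1)] by (auto simp: U_def intro: inj_on_subset)
      have c: "continuous_on (U x) (poly P)" by (intro continuous_intros)
      obtain q where "homeomorphism (U x) (poly P ` U x) (poly P) q"
        by (rule invariance_of_domain_homeomorphism[OF oU c order.refl i])
      thus ?thesis using x(2) img by auto
    qed
  qed (rule wT)
qed

text \<open>If all critical values of \<open>P\<close> lie in a continuum \<open>L \<subseteq> W\<close>, the exterior of \<open>L\<close> is uniformized by
  a punctured disc; its universal cover, a half-plane, lifts through \<open>P\<close> onto the whole preimage of
  the exterior. The preimage of a curve close to \<open>L\<close> is therefore connected, and it meets every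
  component of \<open>P -` W\<close>.\<close>

lemma exterior_uniformization:
  fixes a :: complex
  assumes L: "compact L" "connected L" and e: "0 < e" "ball a e \<subseteq> L"
  obtains \<beta> :: "complex \<Rightarrow> complex" where
    "continuous_on {ze. Re ze < 0} \<beta>" "\<beta> ` {ze. Re ze < 0} = outside L"
    "\<And>ze \<xi>. Re ze < 0 \<Longrightarrow> Re \<xi> < 0 \<Longrightarrow> \<beta> ze = \<beta> \<xi> \<longleftrightarrow> exp ze = exp \<xi>"
    "\<And>W. open W \<Longrightarrow> L \<subseteq> W \<Longrightarrow> \<exists>c<0. \<forall>ze. Re ze = c \<longrightarrow> \<beta> ze \<in> W"
proof -
  define Y where "Y = outside L"
  have bL: "bounded L" using L by (simp add: compact_imp_bounded)
  have Y: "open Y" "connected Y" "Y \<inter> L = {}"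
    unfolding Y_def using L bL by (auto simp: open_outside compact_imp_closed connected_outside outside_no_overlap)
  have aL: "a \<in> L" using e by auto
  define M where "M = - Y"
  have M: "M = L \<union> inside L" by (simp add: M_def Y_def union_with_inside)
  have cM: "connected M" unfolding M using L by (simp add: connected_with_inside compact_imp_closed)
  have cMa: "connected (M - {a})"
    using connected_minus_interior_point[OF cM e(1)] e(2) by (auto simp: M)
  have bM: "bounded M" unfolding M using bL by (simp add: bounded_inside)
  \<comment> \<open>The inversion \<open>s = 1 / (w - a)\<close> turns the exterior together with
    infinity into a plane domain, in which 0 stands for infinity.\<close>
  define S where "S = {s. s = 0 \<or> a + 1 / s \<in> Y}"
  have far: "\<exists>B>0. \<forall>w. B < cmod (w - a) \<longrightarrow> w \<in> Y"
  proof -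
    obtain B where "B > 0" "M \<subseteq> ball a B" using bM bounded_subset_ballD by blast
    thus ?thesis by (intro exI[of _ B]) (auto simp: M_def dist_norm norm_minus_commute)
  qed
  have oS: "open S"
  proof -
    have "open {s \<in> - {0}. a + 1 / s \<in> Y}"
    proof -
      have "open ((\<lambda>s. a + 1 / s) -` Y \<inter> - {0})"
        by (rule continuous_open_preimage[OF _ _ Y(1), of "- {0}" "\<lambda>s. a + 1 / s", unfolded Int_commute[of "- {0}"]])
          (auto intro!: continuous_intros)
      thus ?thesis by (simp add: Int_def vimage_def conj_commute)
    qed
    moreover obtain B where B: "B > 0" "\<And>w. B < cmod (w - a) \<Longrightarrow> w \<in> Y" using far by blast
    have "ball 0 (1 / B) \<subseteq> S"
    proof
      fix s :: complex assume "s \<in> ball 0 (1 / B)"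
      hence "s \<noteq> 0 \<Longrightarrow> B < cmod (1 / s)"
        using B(1) by (simp add: norm_divide field_simps)
      thus "s \<in> S" using B(2)[of "a + 1 / s"] by (auto simp: S_def)
    qed
    hence "S = {s \<in> - {0}. a + 1 / s \<in> Y} \<union> ball 0 (1 / B)"
      using B(1) by (auto simp: S_def)
    ultimately show ?thesis by auto
  qed
  have notS: "- S = (\<lambda>w. 1 / (w - a)) ` (M - {a})"
  proof (rule set_eqI, rule iffI)
    fix s assume "s \<in> - S"
    hence "s \<noteq> 0" "a + 1 / s \<in> M" by (auto simp: S_def M_def)
    thus "s \<in> (\<lambda>w. 1 / (w - a)) ` (M - {a})"
      by (intro image_eqI[of _ _ "a + 1 / s"]) auto
  qed (auto simp: S_def M_def)
  have conS: "connected S"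
  proof -
    have img: "S - {0} = (\<lambda>w. 1 / (w - a)) ` Y"
    proof (rule set_eqI, rule iffI)
      fix s assume "s \<in> S - {0}"
      thus "s \<in> (\<lambda>w. 1 / (w - a)) ` Y"
        by (intro image_eqI[of _ _ "a + 1 / s"]) (auto simp: S_def)
    next
      fix s assume "s \<in> (\<lambda>w. 1 / (w - a)) ` Y"
      then obtain w where "w \<in> Y" "s = 1 / (w - a)" by blast
      moreover have "w \<noteq> a" using \<open>w \<in> Y\<close> aL Y(3) by auto
      ultimately show "s \<in> S - {0}" by (auto simp: S_def)
    qed
    have "continuous_on Y (\<lambda>w. 1 / (w - a))" using aL Y(3) by (intro continuous_intros) auto
    hence "connected (S - {0})" unfolding img using Y(2) by (rule connected_continuous_image)
    moreover have "S \<subseteq> closure (S - {0})"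
    proof -
      have "0 islimpt S" using oS by (simp add: S_def interior_limit_point interior_open)
      hence "0 \<in> closure (S - {0})" by (simp add: islimpt_in_closure)
      thus ?thesis using closure_subset[of "S - {0}"] by blast
    qed
    ultimately show ?thesis using connected_intermediate_closure[of "S - {0}" S] by auto
  qed
  \<comment> \<open>The complement of \<open>S\<close> is the image of \<open>M - {a}\<close>, hence
    connected, and it is unbounded because \<open>a\<close> is interior to \<open>L\<close>. So
    \<open>S\<close> encloses nothing and is simply connected.\<close>
  have "inside S = {}"
  proof -
    have cn: "connected (- S)"
      unfolding notS using cMa by (intro connected_continuous_image continuous_intros) auto
    have unb: "\<not> bounded (- S)"
    proof
      assume "bounded (- S)"
      then obtain B where B: "\<And>s. s \<in> - S \<Longrightarrow> cmod s \<le> B" unfolding bounded_iff by blast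
      define t where "t = min (e / 2) (1 / (\<bar>B\<bar> + 1))"
      have t: "0 < t" "t < e" "t \<le> 1 / (\<bar>B\<bar> + 1)" using e(1) by (auto simp: t_def)
      have "a + complex_of_real t \<in> ball a e" using t by (simp add: dist_norm)
      hence "a + complex_of_real t \<in> M - {a}" using e(2) t(1) by (auto simp: M)
      hence "1 / complex_of_real t \<in> - S" unfolding notS by (intro image_eqI) auto
      from B[OF this] have "1 / t \<le> B" using t(1) by (simp add: norm_divide)
      moreover have "\<bar>B\<bar> + 1 \<le> 1 / t" using t by (simp add: field_simps)
      ultimately show False by linarith
    qed
    have "connected_component_set (- S) x = - S" if "x \<in> - S" for x
      by (rule connected_component_eq_self[OF cn that])
    thus ?thesis using unb by (auto simp: inside_def)
  qed
  hence scS: "simply_connected S"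
    using simply_connected_eq_empty_inside[OF oS] conS by simp
  have "S \<noteq> {}" "S \<noteq> UNIV"
  proof -
    show "S \<noteq> {}" by (auto simp: S_def)
    have "a + complex_of_real (e / 2) \<in> ball a e" using e by (simp add: dist_norm)
    hence "a + complex_of_real (e / 2) \<in> L" using e(2) by blast
    hence "1 / complex_of_real (e / 2) \<notin> S" using e(1) Y(3) by (auto simp: S_def)
    thus "S \<noteq> UNIV" by blast
  qed
  then obtain f0 g0 where fg0: "f0 holomorphic_on S" "g0 holomorphic_on ball 0 1"
    "\<And>z. z \<in> S \<Longrightarrow> f0 z \<in> ball 0 1 \<and> g0 (f0 z) = z" "\<And>z. z \<in> ball 0 1 \<Longrightarrow> g0 z \<in> S \<and> f0 (g0 z) = z"
    using Riemann_mapping_theorem[of S] oS scS by blast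
  have S0: "0 \<in> S" by (simp add: S_def)
  hence "f0 0 \<in> ball 0 1" using fg0(3) by blast
  then obtain m mi where m: "m (f0 0) = 0" "m holomorphic_on ball 0 1" "m ` ball 0 1 \<subseteq> ball 0 1"
    "mi holomorphic_on ball 0 1" "mi ` ball 0 1 \<subseteq> ball 0 1"
    "\<And>z. z \<in> ball 0 1 \<Longrightarrow> m (mi z) = z" "\<And>z. z \<in> ball 0 1 \<Longrightarrow> mi (m z) = z"
    using ball_biholomorphism_exists by blast
  define f where "f z = m (f0 z)" for z
  define g where "g z = g0 (mi z)" for z
  have f: "f z \<in> ball 0 1" "g (f z) = z" if "z \<in> S" for z
  proof -
    have 1: "f0 z \<in> ball 0 1" "g0 (f0 z) = z" using fg0(3)[OF that] by auto
    show "f z \<in> ball 0 1" unfolding f_def using m(3) 1(1) by blast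
    show "g (f z) = z" unfolding f_def g_def using m(7)[OF 1(1)] 1(2) by simp
  qed
  have g: "g z \<in> S" "f (g z) = z" if "z \<in> ball 0 1" for z
  proof -
    have 1: "mi z \<in> ball 0 1" using m(5) that by blast
    show "g z \<in> S" "f (g z) = z" unfolding f_def g_def using fg0(4)[OF 1] m(6)[OF that] by simp_all
  qed
  have f0: "f 0 = 0" by (simp add: f_def m)
  have contf: "continuous_on S f" unfolding f_def[abs_def]
    by (rule continuous_on_compose2[OF holomorphic_on_imp_continuous_on[OF m(2)] holomorphic_on_imp_continuous_on[OF fg0(1)]])
      (use fg0(3) in blast)
  have contg: "continuous_on (ball 0 1) g" unfolding g_def[abs_def]
    by (rule continuous_on_compose2[OF holomorphic_on_imp_continuous_on[OF fg0(2)] holomorphic_on_imp_continuous_on[OF m(4)] m(5)])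
  have g0: "g z = 0 \<longleftrightarrow> z = 0" if "z \<in> ball 0 1" for z
    using g[OF that] f(2)[OF S0] f0 by metis
  \<comment> \<open>The exponential covers the punctured disc by the left half-plane; the puncture
    corresponds to infinity, which is not part of \<open>outside L\<close>.\<close>
  define \<beta> where "\<beta> ze = a + 1 / g (exp ze)" for ze
  have eb: "exp ze \<in> ball 0 1" if "Re ze < 0" for ze using that by simp
  have gne: "g (exp ze) \<noteq> 0" if "Re ze < 0" for ze using g0[OF eb[OF that]] by simp
  show ?thesis
  proof
    show "continuous_on {ze. Re ze < 0} \<beta>"
      unfolding \<beta>_def using gne by (intro continuous_intros continuous_on_compose2[OF contg]) auto
    show "\<beta> ` {ze. Re ze < 0} = outside L"
    proof (rule set_eqI, rule iffI)
      fix w assume "w \<in> \<beta> ` {ze. Re ze < 0}"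
      then obtain ze where ze: "Re ze < 0" "w = \<beta> ze" by auto
      thus "w \<in> outside L"
        using g(1)[OF eb[OF ze(1)]] gne[OF ze(1)] by (auto simp: S_def \<beta>_def Y_def)
    next
      fix w assume w: "w \<in> outside L"
      hence wa: "w \<noteq> a" using aL Y(3) unfolding Y_def by blast
      define s where "s = 1 / (w - a)"
      have s: "s \<in> S" "s \<noteq> 0" "a + 1 / s = w" using w wa by (auto simp: S_def s_def Y_def)
      have "f s \<noteq> 0" using f(2)[OF s(1)] g0[of 0] s(2) by auto
      hence ex: "exp (Ln (f s)) = f s" by simp
      have "cmod (f s) < 1" using f(1)[OF s(1)] by simp
      hence "Re (Ln (f s)) < 0" using \<open>f s \<noteq> 0\<close> by simp
      moreover have "\<beta> (Ln (f s)) = w" using ex f(2)[OF s(1)] s(3) by (simp add: \<beta>_def)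
      ultimately show "w \<in> \<beta> ` {ze. Re ze < 0}" by blast
    qed
    show "\<beta> ze = \<beta> \<xi> \<longleftrightarrow> exp ze = exp \<xi>" if "Re ze < 0" "Re \<xi> < 0" for ze \<xi>
    proof
      assume "\<beta> ze = \<beta> \<xi>"
      hence "g (exp ze) = g (exp \<xi>)" using gne that by (simp add: \<beta>_def)
      thus "exp ze = exp \<xi>" using g(2)[OF eb[OF that(1)]] g(2)[OF eb[OF that(2)]] by metis
    qed (simp add: \<beta>_def)
    show "\<exists>c<0. \<forall>ze. Re ze = c \<longrightarrow> \<beta> ze \<in> W" if W: "open W" "L \<subseteq> W" for W
    proof -
      \<comment> \<open>The part of the exterior that \<open>W\<close> misses; intersecting with
        \<open>Y \<union> L\<close> shows that it is closed. Together with infinity it becomes a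
        compact subset of \<open>S\<close>, so its image under the Riemann map stays in a smaller
        disc, and any circle beyond that disc works.\<close>
      define V where "V = (- W) \<inter> (Y \<union> L)"
      have "closure Y \<subseteq> Y \<union> L"
        unfolding Y_def using closure_outside_subset[OF compact_imp_closed[OF L(1)]] by auto
      moreover have "closed (Y \<union> L)"
        using calculation closure_subset L(1) by (metis Un_least closed_Un closure_Un closure_closed closure_subset_eq compact_imp_closed sup.cobounded2)
      ultimately have V: "closed V" "V \<subseteq> Y" unfolding V_def using W by auto
      define E where "E = insert 0 ((\<lambda>w. 1 / (w - a)) ` V)"
      have ES: "E \<subseteq> S" using V(2) by (auto simp: E_def S_def)
      have "compact E"
      proof -
        have "bounded E"
        proof -
          have "cmod s \<le> 1 / e" if "s \<in> E" for s
          proof (cases "s = 0")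
            case False
            then obtain w where w: "w \<in> V" "s = 1 / (w - a)" using \<open>s \<in> E\<close> by (auto simp: E_def)
            hence "w \<notin> ball a e" using V(2) Y(3) e(2) by blast
            hence "e \<le> cmod (w - a)" by (simp add: dist_norm norm_minus_commute)
            thus ?thesis using w(2) e(1) by (simp add: norm_divide frac_le)
          qed (use e in simp)
          thus ?thesis unfolding bounded_iff by blast
        qed
        moreover have "closed E"
        proof -
          have "- E = {s. s \<noteq> 0 \<and> a + 1 / s \<in> - V}"
          proof (rule set_eqI, rule iffI)
            fix s assume "s \<in> - E"
            thus "s \<in> {s. s \<noteq> 0 \<and> a + 1 / s \<in> - V}"
              by (auto simp: E_def intro!: image_eqI[of _ _ "a + 1 / s"])
          next
            fix s assume "s \<in> {s. s \<noteq> 0 \<and> a + 1 / s \<in> - V}"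
            moreover have "w \<noteq> a" if "w \<in> V" for w using that V(2) Y(3) aL by auto
            ultimately show "s \<in> - E" by (auto simp: E_def)
          qed
          moreover have "open ((\<lambda>s. a + 1 / s) -` (- V) \<inter> - {0})"
            by (rule continuous_open_preimage[OF _ _ open_Compl[OF V(1)], of "- {0}" "\<lambda>s. a + 1 / s", unfolded Int_commute[of "- {0}"]])
              (auto intro!: continuous_intros)
          ultimately have "open (- E)" by (simp add: Int_def vimage_def conj_commute)
          thus ?thesis by (simp add: closed_def)
        qed
        ultimately show ?thesis by (simp add: compact_eq_bounded_closed)
      qed
      hence "compact (f ` E)" using contf ES by (intro compact_continuous_image) (auto intro: continuous_on_subset)
      moreover have "f ` E \<noteq> {}" by (simp add: E_def)
      ultimately obtain s where s: "s \<in> f ` E" "\<And>t. t \<in> f ` E \<Longrightarrow> cmod t \<le> cmod s"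
        using continuous_attains_sup[of "f ` E" cmod] by (auto intro: continuous_intros)
      have "cmod s < 1" using s(1) ES f(1) by auto
      then obtain r where r: "cmod s < r" "r < 1" using dense by blast
      hence r0: "0 < r" using norm_ge_zero[of s] by linarith
      show ?thesis
      proof (intro exI[of _ "ln r"] conjI allI impI)
        show "ln r < 0" using r r0 by simp
        fix ze :: complex assume ze: "Re ze = ln r"
        have n: "cmod (exp ze) = r" using ze r0 by simp
        have Rz: "Re ze < 0" using ze r r0 by simp
        have gS: "g (exp ze) \<in> S" "f (g (exp ze)) = exp ze" using g[OF eb[OF Rz]] by auto
        have "g (exp ze) \<notin> E"
        proof
          assume "g (exp ze) \<in> E"
          hence "exp ze \<in> f ` E" using gS(2) by (metis imageI)
          from s(2)[OF this] show False using n r by simp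
        qed
        moreover have "\<beta> ze \<in> Y" using gS(1) gne[OF Rz] by (auto simp: \<beta>_def S_def)
        moreover have "g (exp ze) = 1 / (\<beta> ze - a)" using gne[OF Rz] by (simp add: \<beta>_def)
        ultimately show "\<beta> ze \<in> W" unfolding E_def V_def by blast
      qed
    qed
  qed
qed

text \<open>The image of a component is open by the open mapping theorem and relatively closed in
  \<open>W\<close> by properness, so it exhausts the connected set \<open>W\<close>.\<close>

lemma component_preimage_onto:
  fixes P :: "complex poly"
  assumes deg: "0 < degree P" and W: "open W" "connected W" and x: "poly P x \<in> W"
    and proper: "\<And>B. \<exists>R. \<forall>z. R < cmod z \<longrightarrow> B < cmod (poly P z)"
  shows "W \<subseteq> poly P ` connected_component_set (poly P -` W) x"
proof -
  define X where "X = poly P -` W"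
  define C where "C = connected_component_set X x"
  have oX: "open X" unfolding X_def using W(1) by (intro open_vimage continuous_intros)
  have C: "open C" "connected C" "C \<subseteq> X" "x \<in> C"
    using oX x by (auto simp: C_def X_def open_connected_component connected_component_subset)
  have "\<not> poly P constant_on C"
  proof
    assume "poly P constant_on C"
    then obtain c where c: "\<And>z. z \<in> C \<Longrightarrow> poly P z = c" unfolding constant_on_def by blast
    have "P - [:c:] \<noteq> 0"
      using deg by (metis degree_pCons_0 eq_iff_diff_eq_0 less_numeral_extra(3))
    hence "finite {z. poly (P - [:c:]) z = 0}" by (rule poly_roots_finite)
    hence "finite C" by (rule finite_subset[rotated]) (use c in auto)
    thus False using C(1,4) finite_imp_not_open by blast
  qed
  hence oP: "open (poly P ` C)"
    by (intro open_mapping_thm[of "poly P" C C] C(1,2) order.refl holomorphic_intros)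
  have cl: "y \<in> poly P ` C" if y: "y \<in> W" "y \<in> closure (poly P ` C)" for y
  proof -
    obtain u where u: "\<And>n. u n \<in> poly P ` C" "u \<longlonglongrightarrow> y" using y(2) unfolding closure_sequential by auto
    have "\<exists>v. v \<in> C \<and> poly P v = u n" for n
      using u(1)[of n] by (elim imageE) auto
    hence "\<forall>n. \<exists>v. v \<in> C \<and> poly P v = u n" by (rule allI)
    from choice[OF this] obtain v where v: "\<And>n. v n \<in> C" "\<And>n. poly P (v n) = u n" by blast
    have "bounded (range u)" using u(2) convergent_imp_bounded by blast
    then obtain B where B: "\<And>n. cmod (u n) \<le> B" unfolding bounded_iff by auto
    obtain R where R: "\<And>z. R < cmod z \<Longrightarrow> B < cmod (poly P z)" using proper by blast
    have "v n \<in> cball 0 R" for n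
      using R[of "v n"] v(2)[of n] B[of n] by (auto simp: not_less[symmetric])
    then obtain l q where l: "strict_mono q" "(v \<circ> q) \<longlonglongrightarrow> l"
      using seq_compactE[OF compact_imp_seq_compact[OF compact_cball[of "0::complex" R]], of v] by blast
    have "(\<lambda>n. poly P ((v \<circ> q) n)) \<longlonglongrightarrow> poly P l" by (intro tendsto_intros l(2))
    moreover have "(\<lambda>n. poly P ((v \<circ> q) n)) \<longlonglongrightarrow> y"
      using LIMSEQ_subseq_LIMSEQ[OF u(2) l(1)] v(2) by (simp add: o_def)
    ultimately have Pl: "poly P l = y" by (rule LIMSEQ_unique)
    hence "l \<in> X" using y(1) by (simp add: X_def)
    then obtain d where d: "0 < d" "ball l d \<subseteq> X" using oX open_contains_ball by blast
    have "\<forall>\<^sub>F n in sequentially. dist ((v \<circ> q) n) l < d" using l(2) d(1) by (rule tendstoD)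
    then obtain n where "dist (v (q n)) l < d" using eventually_happens'[OF sequentially_bot] by auto
    hence vb: "v (q n) \<in> ball l d" by (simp add: dist_commute)
    have "ball l d \<subseteq> connected_component_set X (v (q n))"
      using d vb by (intro connected_component_maximal) auto
    also have "\<dots> = C" using v(1)[of "q n"] unfolding C_def by (metis connected_component_eq)
    finally have "l \<in> C" using d(1) by auto
    thus ?thesis using Pl by blast
  qed
  have "poly P ` C \<subseteq> W" using C(3) by (auto simp: X_def)
  have "W \<subseteq> poly P ` C"
  proof (rule ccontr)
    assume n: "\<not> ?thesis"
    define V where "V = - closure (poly P ` C)"
    have "open V" unfolding V_def by (rule open_Compl[OF closed_closure])
    moreover have "W \<subseteq> poly P ` C \<union> V" using cl by (auto simp: V_def)
    moreover have "poly P ` C \<inter> V \<inter> W = {}" using closure_subset[of "poly P ` C"] unfolding V_def by blast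
    moreover have "poly P ` C \<inter> W \<noteq> {}" using C(4) x by blast
    moreover have "V \<inter> W \<noteq> {}" using n cl by (auto simp: V_def)
    ultimately show False using W(2) oP unfolding connected_def by blast
  qed
  thus ?thesis by (simp add: C_def X_def)
qed

lemma poly_proper:
  fixes P :: "complex poly"
  assumes "2 \<le> degree P"
  obtains \<rho> where "1 \<le> \<rho>" "\<And>z. \<rho> \<le> cmod z \<Longrightarrow> 2 * cmod z < cmod (poly P z)"
proof -
  have "degree [:0, 1 :: complex:] < degree P" using assms by simp
  moreover have "coeff P (degree P) \<noteq> 0" using assms by auto
  ultimately obtain R where R: "\<And>u. R \<le> cmod u \<Longrightarrow> 2 * cmod (poly [:0, 1:] u) < cmod (poly P u)"
    using poly_dominates_at_infinity[of P "degree P" "[:0, 1:]"] by blast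
  show ?thesis
    by (rule that[of "max R 1"]) (use R in auto)
qed

lemma connected_preimage:
  fixes P :: "complex poly"
  assumes deg: "2 \<le> degree P" and W: "open W" "connected W"
    and L: "compact L" "connected L" "L \<subseteq> W" "0 < e" "ball a e \<subseteq> L"
    and cv: "\<And>c. poly (pderiv P) c = 0 \<Longrightarrow> poly P c \<in> L"
  shows "connected (poly P -` W)"
proof -
  define H where "H = {ze. Re ze < 0}"
  obtain \<beta> where \<beta>: "continuous_on H \<beta>" "\<beta> ` H = outside L"
    "\<And>ze \<xi>. Re ze < 0 \<Longrightarrow> Re \<xi> < 0 \<Longrightarrow> \<beta> ze = \<beta> \<xi> \<longleftrightarrow> exp ze = exp \<xi>"
    "\<And>W. open W \<Longrightarrow> L \<subseteq> W \<Longrightarrow> \<exists>c<0. \<forall>ze. Re ze = c \<longrightarrow> \<beta> ze \<in> W"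
    using exterior_uniformization[OF L(1,2,4,5)] unfolding H_def by blast
  define Y where "Y = outside L"
  define X where "X = poly P -` Y"
  have bL: "bounded L" using L by (simp add: compact_imp_bounded)
  have Y: "open Y" "Y \<inter> L = {}" "\<not> bounded Y"
    unfolding Y_def using L bL by (auto simp: open_outside compact_imp_closed outside_no_overlap unbounded_outside)
  have oX: "open X" unfolding X_def using Y(1) by (intro open_vimage continuous_intros)
  have cov: "covering_space X (poly P) Y"
    unfolding X_def by (rule poly_covering_space) (use deg Y cv in auto)
  have H: "open H" "convex H" by (auto simp: H_def open_halfspace_Re_lt convex_halfspace_Re_lt)
  hence scH: "simply_connected H" "locally path_connected H" "connected H"
    by (auto simp: convex_imp_simply_connected open_imp_locally_path_connected convex_connected)
  have \<beta>Y: "\<beta> \<in> H \<rightarrow> Y" using \<beta>(2) by (auto simp: Y_def)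
  have lift: "\<exists>\<tau>. continuous_on H \<tau> \<and> \<tau> \<in> H \<rightarrow> X \<and> (\<forall>ze\<in>H. poly P (\<tau> ze) = \<beta> ze) \<and> x \<in> \<tau> ` H" if x: "x \<in> X" for x
  proof -
    have "poly P x \<in> \<beta> ` H" using x \<beta>(2) by (simp add: X_def Y_def)
    then obtain ze where ze: "ze \<in> H" "\<beta> ze = poly P x" by auto
    obtain \<tau> where "continuous_on H \<tau>" "\<tau> \<in> H \<rightarrow> X" "\<tau> ze = x" "\<And>y. y \<in> H \<Longrightarrow> poly P (\<tau> y) = \<beta> y"
      using covering_space_lift_strong[OF cov x ze(1) scH(1,2) \<beta>(1) \<beta>Y ze(2)] by blast
    thus ?thesis using ze(1) by blast
  qed
  \<comment> \<open>A lift is injective wherever \<open>exp\<close> is, in particular on discs of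
    radius 1, whose imaginary parts vary by less than \<open>2 * pi\<close>; invariance of domain
    then applies.\<close>
  have lift_open: "open (\<tau> ` H)"
    if \<tau>: "continuous_on H \<tau>" "\<tau> \<in> H \<rightarrow> X" "\<And>ze. ze \<in> H \<Longrightarrow> poly P (\<tau> ze) = \<beta> ze" for \<tau>
  proof (subst open_subopen, intro ballI)
    fix y assume "y \<in> \<tau> ` H"
    then obtain ze where ze: "ze \<in> H" "y = \<tau> ze" by blast
    obtain r where r: "0 < r" "ball ze r \<subseteq> H" using H(1) ze(1) open_contains_ball by blast
    define B where "B = ball ze (min r 1)"
    have B: "open B" "B \<subseteq> H" "ze \<in> B" using r by (auto simp: B_def)
    have "inj_on \<tau> B"
    proof (rule inj_onI)
      fix u v assume uv: "u \<in> B" "v \<in> B" "\<tau> u = \<tau> v"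
      hence "u \<in> H" "v \<in> H" using B(2) by blast+
      hence "\<beta> u = \<beta> v" using \<tau>(3)[of u] \<tau>(3)[of v] uv(3) by simp
      hence "exp u = exp v" using \<beta>(3)[of u v] uv B(2) by (auto simp: H_def)
      moreover have "\<bar>Im u - Im v\<bar> < 2 * pi"
      proof -
        have "dist u v < 2" using uv(1,2) dist_triangle_half_l[of u ze 2 v] by (simp add: B_def dist_commute)
        hence "\<bar>Im u - Im v\<bar> < 2"
          using abs_Im_le_cmod[of "u - v"] by (simp add: dist_norm)
        thus ?thesis using pi_gt3 by linarith
      qed
      ultimately show "u = v" by (rule exp_complex_eqI[rotated])
    qed
    hence "open (\<tau> ` B)"
      using invariance_of_domain[of B \<tau>] B(1) continuous_on_subset[OF \<tau>(1) B(2)] by blast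
    thus "\<exists>T. open T \<and> y \<in> T \<and> T \<subseteq> \<tau> ` H" using B ze by blast
  qed
  obtain \<rho> where \<rho>: "1 \<le> \<rho>" "\<And>z. \<rho> \<le> cmod z \<Longrightarrow> 2 * cmod z < cmod (poly P z)" using poly_proper[OF deg] by blast
  have proper: "\<exists>R. \<forall>z. R < cmod z \<longrightarrow> B < cmod (poly P z)" for B
  proof (intro exI allI impI)
    fix z assume "max \<rho> B < cmod z"
    hence "\<rho> \<le> cmod z" "B < cmod z" by simp_all
    thus "B < cmod (poly P z)" using \<rho>(2)[of z] norm_ge_zero[of z] by linarith
  qed
  have conX: "connected X"
  proof -
    obtain B0 where B0: "\<And>w. B0 < cmod w \<Longrightarrow> w \<in> Y"
    proof -
      have "bounded (- Y)" unfolding Y_def using bL by (simp add: cobounded_outside)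
      then obtain B where "\<And>w. w \<in> - Y \<Longrightarrow> cmod w \<le> B" unfolding bounded_iff by blast
      thus ?thesis using that[of B] by (meson ComplI not_le)
    qed
    obtain R where R: "\<And>z. R < cmod z \<Longrightarrow> B0 < cmod (poly P z)" using proper by blast
    define E where "E = - cball (0::complex) R"
    have E: "connected E" "E \<subseteq> X"
      unfolding E_def using R B0 by (auto simp: X_def intro: connected_complement_bounded_convex)
    have meet: "\<exists>T. connected T \<and> T \<subseteq> X \<and> x \<in> T \<and> T \<inter> E \<noteq> {}" if x: "x \<in> X" for x
    proof -
      obtain \<tau> where \<tau>: "continuous_on H \<tau>" "\<tau> \<in> H \<rightarrow> X" "\<forall>ze\<in>H. poly P (\<tau> ze) = \<beta> ze" "x \<in> \<tau> ` H"
        using lift[OF x] by blast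
      \<comment> \<open>A lift covers the unbounded set \<open>Y\<close>, so its image cannot stay
        in a bounded disc; it reaches the connected set \<open>E\<close> around infinity, through
        which all lifts are joined.\<close>
      have "\<tau> ` H \<inter> E \<noteq> {}"
      proof
        assume "\<tau> ` H \<inter> E = {}"
        hence "\<tau> ` H \<subseteq> cball 0 R" by (auto simp: E_def)
        hence "poly P ` \<tau> ` H \<subseteq> poly P ` cball 0 R" by blast
        moreover have "poly P ` \<tau> ` H = Y" using \<tau>(3) \<beta>(2) by (force simp: Y_def image_image)
        moreover have "compact (poly P ` cball 0 R)" by (intro compact_continuous_image continuous_intros) auto
        ultimately show False using Y(3) bounded_subset compact_imp_bounded by metis
      qed
      thus ?thesis using \<tau> scH(3) by (intro exI[of _ "\<tau> ` H"]) (auto intro: connected_continuous_image)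
    qed
    show ?thesis
      unfolding connected_iff_connected_component
    proof (intro ballI)
      fix x y assume "x \<in> X" "y \<in> X"
      then obtain T T' where T: "connected T" "T \<subseteq> X" "x \<in> T" "T \<inter> E \<noteq> {}"
        "connected T'" "T' \<subseteq> X" "y \<in> T'" "T' \<inter> E \<noteq> {}"
        using meet by meson
      have "connected (T \<union> E \<union> T')"
        using T E by (intro connected_Un) auto
      thus "connected_component X x y"
        by (rule connected_componentI) (use T E in auto)
    qed
  qed
  have "\<beta> (-1) \<in> Y" using \<beta>Y by (auto simp: H_def)
  then obtain x0 where x0: "x0 \<in> X"
    using covering_space_imp_surjective[OF cov] by blast
  obtain \<tau> where \<tau>: "continuous_on H \<tau>" "\<tau> \<in> H \<rightarrow> X" "\<And>ze. ze \<in> H \<Longrightarrow> poly P (\<tau> ze) = \<beta> ze" "x0 \<in> \<tau> ` H"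
    using lift[OF x0] by blast
  have oS: "open (\<tau> ` H)" using lift_open[OF \<tau>(1,2,3)] .
  have oO: "open (X - \<tau> ` H)"
  proof (subst open_subopen, intro ballI)
    fix x assume x: "x \<in> X - \<tau> ` H"
    then obtain \<tau>' where \<tau>': "continuous_on H \<tau>'" "\<tau>' \<in> H \<rightarrow> X" "\<And>ze. ze \<in> H \<Longrightarrow> poly P (\<tau>' ze) = \<beta> ze" "x \<in> \<tau>' ` H"
      using lift[of x] by blast
    \<comment> \<open>If two lifts meet, the parameters differ by a period \<open>c\<close> of
      \<open>exp\<close>. By uniqueness one lift is then the other one translated by
      \<open>c\<close>, a translation that preserves the half-plane, so the point \<open>x\<close>
      would lie in the image of \<open>\<tau>\<close> after all.\<close>
    have "\<tau>' ` H \<inter> \<tau> ` H = {}"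
    proof (rule ccontr)
      assume "\<not> ?thesis"
      then obtain ze ze' where z: "ze \<in> H" "ze' \<in> H" "\<tau>' ze' = \<tau> ze" by blast
      hence "\<beta> ze' = \<beta> ze" using \<tau>(3)[of ze] \<tau>'(3)[of ze'] by simp
      hence ex: "exp ze' = exp ze" using \<beta>(3) z by (simp add: H_def)
      define c where "c = ze - ze'"
      have ec: "exp c = 1" using ex by (simp add: c_def exp_diff)
      hence rc: "Re c = 0" by (metis exp_eq_one_iff norm_exp_eq_Re norm_one)
      have Hc: "\<eta> + c \<in> H" if "\<eta> \<in> H" for \<eta> using that rc by (simp add: H_def)
      have bc: "\<beta> (\<eta> + c) = \<beta> \<eta>" if "\<eta> \<in> H" for \<eta>
        using \<beta>(3)[of "\<eta> + c" \<eta>] Hc[OF that] that ec by (simp add: H_def exp_add)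
      obtain \<eta> where \<eta>: "\<eta> \<in> H" "x = \<tau>' \<eta>" using \<tau>'(4) by blast
      have "\<tau>' \<eta> = (\<lambda>u. \<tau> (u + c)) \<eta>"
      proof (rule covering_space_lift_unique[OF cov _ \<beta>(1) \<beta>Y \<tau>'(1,2) _ _ _ _ scH(3) z(2) \<eta>(1)])
        show "\<tau>' ze' = \<tau> (ze' + c)" using z(3) by (simp add: c_def)
        show "continuous_on H (\<lambda>u. \<tau> (u + c))"
          by (rule continuous_on_compose2[OF \<tau>(1)]) (use Hc in \<open>auto intro: continuous_intros\<close>)
        show "(\<lambda>u. \<tau> (u + c)) \<in> H \<rightarrow> X" using Hc \<tau>(2) by auto
        show "\<beta> u = poly P (\<tau>' u)" if "u \<in> H" for u using \<tau>'(3)[OF that] by simp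
        show "\<beta> u = poly P (\<tau> (u + c))" if "u \<in> H" for u using \<tau>(3)[OF Hc[OF that]] bc[OF that] by simp
      qed
      thus False using x \<eta> Hc[OF \<eta>(1)] by blast
    qed
    moreover have "\<tau>' ` H \<subseteq> X" using \<tau>'(2) by auto
    ultimately show "\<exists>T. open T \<and> x \<in> T \<and> T \<subseteq> X - \<tau> ` H"
      using lift_open[OF \<tau>'(1,2,3)] \<tau>'(4) by (intro exI[of _ "\<tau>' ` H"]) auto
  qed
  have XS: "X \<subseteq> \<tau> ` H"
  proof (rule ccontr)
    assume "\<not> ?thesis"
    hence "(X - \<tau> ` H) \<inter> X \<noteq> {}" by blast
    moreover have "\<tau> ` H \<inter> X \<noteq> {}" using \<tau>(4) x0 by blast
    moreover have "\<tau> ` H \<inter> (X - \<tau> ` H) \<inter> X = {}" "X \<subseteq> \<tau> ` H \<union> (X - \<tau> ` H)" by auto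
    ultimately show False using conX oS oO unfolding connected_def by blast
  qed
  obtain c where c: "c < 0" "\<And>ze. Re ze = c \<Longrightarrow> \<beta> ze \<in> W" using \<beta>(4)[OF W(1) L(3)] by blast
  define C0 where "C0 = \<tau> ` {ze. Re ze = c}"
  have lH: "{ze. Re ze = c} \<subseteq> H" using c(1) by (auto simp: H_def)
  have cC0: "connected C0" unfolding C0_def
  proof (rule connected_continuous_image)
    show "continuous_on {ze. Re ze = c} \<tau>" using \<tau>(1) lH by (rule continuous_on_subset)
    show "connected {ze. Re ze = c}" using convex_hyperplane[of "1 :: complex" c] convex_connected by (simp add: inner_complex_def)
  qed
  have sC0: "C0 \<subseteq> poly P -` W"
    using \<tau>(3) c lH by (auto simp: C0_def)
  have hit: "\<exists>y\<in>C0. connected_component (poly P -` W) x y" if x: "x \<in> poly P -` W" for x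
  proof -
    define ze0 where "ze0 = complex_of_real c"
    have z0: "Re ze0 = c" "ze0 \<in> H" using c(1) by (auto simp: ze0_def H_def)
    have "W \<subseteq> poly P ` connected_component_set (poly P -` W) x"
      by (rule component_preimage_onto) (use deg W x proper in auto)
    then obtain y where y: "connected_component (poly P -` W) x y" "poly P y = \<beta> ze0"
      using c(2)[OF z0(1)] by fastforce
    hence "y \<in> X" using \<beta>Y z0(2) by (auto simp: X_def)
    then obtain ze1 where z1: "ze1 \<in> H" "y = \<tau> ze1" using XS by blast
    hence "\<beta> ze1 = \<beta> ze0" using \<tau>(3)[OF z1(1)] y(2) by simp
    hence "exp ze1 = exp ze0" using \<beta>(3) z1(1) z0(2) by (simp add: H_def)
    hence "Re ze1 = c" using z0(1) by (metis norm_exp_eq_Re exp_inj_iff)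
    hence "y \<in> C0" using z1(2) by (auto simp: C0_def)
    thus ?thesis using y(1) by blast
  qed
  show ?thesis
    unfolding connected_iff_connected_component
  proof (intro ballI)
    fix x y assume "x \<in> poly P -` W" "y \<in> poly P -` W"
    then obtain x' y' where xy: "x' \<in> C0" "connected_component (poly P -` W) x x'"
      "y' \<in> C0" "connected_component (poly P -` W) y y'" using hit by meson
    have "connected_component (poly P -` W) x' y'"
      using connected_componentI[OF cC0 sC0 xy(1,3)] .
    thus "connected_component (poly P -` W) x y"
      using xy(2,4) connected_component_trans connected_component_sym by meson
  qed
qed

section \<open>Attracting basin and filled Julia set\<close>

lemma holomorphic_poly_funpow: "(poly P ^^ n) holomorphic_on S" for P :: "complex poly"
proof (induction n)
  case 0 thus ?case by (simp add: id_def)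
next
  case (Suc n)
  have "poly P holomorphic_on UNIV" by (intro holomorphic_intros)
  hence "(poly P \<circ> (poly P ^^ n)) holomorphic_on S"
    using Suc by (intro holomorphic_on_compose_gen) auto
  thus ?case by (simp only: funpow.simps)
qed

lemma continuous_poly_funpow: "continuous_on S (poly P ^^ n)" for P :: "complex poly"
  by (intro holomorphic_on_imp_continuous_on holomorphic_poly_funpow)

lemma funpow_shift: "(f ^^ n) (f x) = (f ^^ Suc n) x"
  by (simp add: funpow_swap1)

locale attracting_poly =
  fixes P :: "complex poly" and a :: complex
  assumes deg: "2 \<le> degree P" and fixed: "poly P a = a" and attr: "cmod (poly (pderiv P) a) < 1"
    and crit_imm: "\<And>c. poly (pderiv P) c = 0 \<Longrightarrow> c \<in> imm_basin P a"
begin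

lemma attracting_disc:
  obtains \<epsilon> c where "0 < \<epsilon>" "0 \<le> c" "c < 1"
    "\<And>n z. z \<in> cball a \<epsilon> \<Longrightarrow> cmod ((poly P ^^ n) z - a) \<le> c ^ n * cmod (z - a)"
proof -
  define c where "c = (cmod (poly (pderiv P) a) + 1) / 2"
  have c: "0 \<le> c" "c < 1" "cmod (poly (pderiv P) a) < c" using attr by (auto simp: c_def)
  have "((\<lambda>y. (poly P y - poly P a) / (y - a)) \<longlongrightarrow> poly (pderiv P) a) (at a)"
    using poly_DERIV[of P a] unfolding has_field_derivative_iff .
  hence "((\<lambda>y. cmod ((poly P y - poly P a) / (y - a))) \<longlongrightarrow> cmod (poly (pderiv P) a)) (at a)"
    by (rule tendsto_norm)
  from order_tendstoD(2)[OF this c(3)]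
  obtain d where d: "0 < d" "\<And>y. y \<noteq> a \<Longrightarrow> dist y a < d \<Longrightarrow> cmod ((poly P y - poly P a) / (y - a)) < c"
    unfolding eventually_at by blast
  have step: "cmod (poly P z - a) \<le> c * cmod (z - a)" if "z \<in> cball a (d / 2)" for z
  proof (cases "z = a")
    case False
    have "dist z a < d" using that d(1) by (simp add: dist_commute)
    from d(2)[OF False this] show ?thesis using False fixed by (simp add: norm_divide field_simps)
  qed (simp add: fixed)
  have "(poly P ^^ n) z \<in> cball a (d / 2) \<and> cmod ((poly P ^^ n) z - a) \<le> c ^ n * cmod (z - a)"
    if z: "z \<in> cball a (d / 2)" for n z
  proof (induction n)
    case 0 thus ?case using z by simp
  next
    case (Suc n)
    let ?w = "(poly P ^^ n) z"
    have le: "cmod (poly P ?w - a) \<le> c * cmod (?w - a)" using step Suc by blast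
    also have "\<dots> \<le> 1 * cmod (?w - a)" using c by (intro mult_right_mono) auto
    also have "\<dots> \<le> d / 2" using Suc by (simp add: dist_norm norm_minus_commute)
    finally have "poly P ?w \<in> cball a (d / 2)" by (simp add: dist_norm norm_minus_commute)
    moreover have "c * cmod (?w - a) \<le> c * (c ^ n * cmod (z - a))" using Suc c(1) by (intro mult_left_mono) auto
    ultimately show ?case using le by (simp add: mult.assoc)
  qed
  thus ?thesis using that[of "d / 2" c] d(1) c by auto
qed

lemma basin_absorbing:
  obtains \<epsilon> where "0 < \<epsilon>" "cball a \<epsilon> \<subseteq> basin P a" "poly P ` ball a \<epsilon> \<subseteq> ball a \<epsilon>"
    "\<And>z. z \<in> basin P a \<longleftrightarrow> (\<exists>n. (poly P ^^ n) z \<in> ball a \<epsilon>)"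
proof -
  obtain \<epsilon> c where e: "0 < \<epsilon>" "0 \<le> c" "c < 1"
    "\<And>n z. z \<in> cball a \<epsilon> \<Longrightarrow> cmod ((poly P ^^ n) z - a) \<le> c ^ n * cmod (z - a)"
    by (rule attracting_disc) (rule that | assumption)+
  have sub: "cball a \<epsilon> \<subseteq> basin P a"
  proof
    fix z assume z: "z \<in> cball a \<epsilon>"
    have "(\<lambda>n. c ^ n) \<longlonglongrightarrow> 0" using e by (intro LIMSEQ_power_zero) auto
    hence "(\<lambda>n. c ^ n * cmod (z - a)) \<longlonglongrightarrow> 0 * cmod (z - a)" by (intro tendsto_mult tendsto_const)
    hence "(\<lambda>n. c ^ n * cmod (z - a)) \<longlonglongrightarrow> 0" by simp
    hence "(\<lambda>n. (poly P ^^ n) z - a) \<longlonglongrightarrow> 0"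
      by (rule Lim_null_comparison[rotated]) (use e(4)[OF z] in auto)
    thus "z \<in> basin P a" by (simp add: basin_def LIM_zero_iff)
  qed
  have img: "poly P ` ball a \<epsilon> \<subseteq> ball a \<epsilon>"
  proof
    fix y assume "y \<in> poly P ` ball a \<epsilon>"
    then obtain z where z: "z \<in> ball a \<epsilon>" "y = poly P z" by blast
    have "cmod (y - a) \<le> c * cmod (z - a)" using e(4)[of z 1] z by simp
    also have "\<dots> \<le> 1 * cmod (z - a)" using e(3) by (intro mult_right_mono) auto
    finally show "y \<in> ball a \<epsilon>" using z by (simp add: dist_norm norm_minus_commute)
  qed
  have iff: "z \<in> basin P a \<longleftrightarrow> (\<exists>n. (poly P ^^ n) z \<in> ball a \<epsilon>)" for z
  proof
    assume "z \<in> basin P a"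
    hence "(\<lambda>n. (poly P ^^ n) z) \<longlonglongrightarrow> a" by (simp add: basin_def)
    from tendstoD[OF this e(1)] have "\<exists>n. dist ((poly P ^^ n) z) a < \<epsilon>"
      by (rule eventually_happens'[OF sequentially_bot])
    thus "\<exists>n. (poly P ^^ n) z \<in> ball a \<epsilon>" by (simp add: dist_commute)
  next
    assume "\<exists>n. (poly P ^^ n) z \<in> ball a \<epsilon>"
    then obtain n where n: "(poly P ^^ n) z \<in> cball a \<epsilon>" by (auto intro: less_imp_le)
    hence "(\<lambda>m. (poly P ^^ m) ((poly P ^^ n) z)) \<longlonglongrightarrow> a" using sub by (auto simp: basin_def)
    moreover have "(poly P ^^ m) ((poly P ^^ n) z) = (poly P ^^ (m + n)) z" for m
      by (simp add: funpow_add)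
    ultimately have "(\<lambda>m. (poly P ^^ (m + n)) z) \<longlonglongrightarrow> a" by simp
    thus "z \<in> basin P a" unfolding basin_def mem_Collect_eq by (rule LIMSEQ_offset)
  qed
  show ?thesis using that[OF e(1) sub img iff] .
qed

lemma open_basin: "open (basin P a)"
proof -
  obtain \<epsilon> where e: "\<And>z. z \<in> basin P a \<longleftrightarrow> (\<exists>n. (poly P ^^ n) z \<in> ball a \<epsilon>)"
    by (rule basin_absorbing) (rule that | assumption)+
  have "basin P a = (\<Union>n. (poly P ^^ n) -` ball a \<epsilon>)" using e by auto
  thus ?thesis by (auto intro!: open_UN open_vimage continuous_poly_funpow)
qed

lemma basin_iff: "poly P z \<in> basin P a \<longleftrightarrow> z \<in> basin P a"
proof -
  have "(\<lambda>n. (poly P ^^ n) (poly P z)) = (\<lambda>n. (poly P ^^ Suc n) z)"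
    by (rule ext) (rule funpow_shift)
  thus ?thesis unfolding basin_def mem_Collect_eq
    using filterlim_sequentially_Suc[of "\<lambda>n. (poly P ^^ n) z"] by simp
qed

lemma absorb_compact:
  assumes e: "poly P ` ball a \<epsilon> \<subseteq> ball a \<epsilon>" "\<And>z. z \<in> basin P a \<longleftrightarrow> (\<exists>n. (poly P ^^ n) z \<in> ball a \<epsilon>)"
    and C: "compact C" "C \<subseteq> basin P a"
  shows "\<exists>n. (poly P ^^ n) ` C \<subseteq> ball a \<epsilon>"
proof -
  let ?V = "\<lambda>n. (poly P ^^ n) -` ball a \<epsilon>"
  have cv: "C \<subseteq> (\<Union>n\<in>UNIV. ?V n)" using e(2) C(2) by auto
  have op: "open (?V n)" if "n \<in> UNIV" for n by (intro open_vimage continuous_poly_funpow) auto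
  obtain D where "D \<subseteq> UNIV" and D: "finite D" "C \<subseteq> (\<Union>n\<in>D. ?V n)"
    by (rule compactE_image[OF C(1) op cv]) (rule that | assumption)+
  have mono: "?V n \<subseteq> ?V (n + m)" for n m
  proof (induction m)
    case (Suc m)
    have "?V (n + m) \<subseteq> ?V (n + Suc m)" using e(1) by auto
    thus ?case using Suc by blast
  qed simp
  define M where "M = (\<Sum>n\<in>D. n)"
  have "n \<le> M" if "n \<in> D" for n
    unfolding M_def using member_le_sum[OF that, of "\<lambda>n. n"] D(1) by simp
  hence sub: "?V n \<subseteq> ?V M" if "n \<in> D" for n
    using mono[of n "M - n"] that by simp
  have "x \<in> ?V M" if x: "x \<in> C" for x
  proof -
    obtain n where "n \<in> D" "x \<in> ?V n" using subsetD[OF D(2) x] by (elim UN_E)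
    thus ?thesis using sub[of n] by (elim subsetD[rotated])
  qed
  hence "(poly P ^^ M) ` C \<subseteq> ball a \<epsilon>" by (simp add: image_subset_iff)
  thus ?thesis by (rule exI)
qed

abbreviation "A \<equiv> imm_basin P a"

lemma A_facts: "open A" "connected A" "a \<in> A" "A \<subseteq> basin P a"
proof -
  have "a \<in> basin P a"
  proof -
    have "(poly P ^^ n) a = a" for n using fixed by (induction n) auto
    thus ?thesis by (simp add: basin_def)
  qed
  thus "open A" "connected A" "a \<in> A" "A \<subseteq> basin P a"
    using open_basin by (auto simp: imm_basin_def open_connected_component connected_component_subset)
qed

lemma A_maximal: "connected S \<Longrightarrow> a \<in> S \<Longrightarrow> S \<subseteq> basin P a \<Longrightarrow> S \<subseteq> A"
  unfolding imm_basin_def by (rule connected_component_maximal)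

lemma A_invariant: "x \<in> A \<Longrightarrow> poly P x \<in> A"
proof -
  have "poly P ` A \<subseteq> A"
  proof (rule A_maximal)
    show "connected (poly P ` A)" using A_facts by (intro connected_continuous_image continuous_intros)
    show "a \<in> poly P ` A" using A_facts(3) fixed by (metis imageI)
    show "poly P ` A \<subseteq> basin P a" using A_facts(4) basin_iff by blast
  qed
  thus "x \<in> A \<Longrightarrow> poly P x \<in> A" by blast
qed

text \<open>The continuum \<open>L\<close> is a disc about \<open>a\<close> together with arcs
  inside \<open>A\<close> from \<open>a\<close> to every critical value; these arcs exist because
  the critical points, hence their images, lie in the open connected set \<open>A\<close>.\<close>

lemma connected_preimage_A: "connected (poly P -` A)"
proof -
  obtain e where e: "0 < e" "cball a e \<subseteq> A" using A_facts(1,3) open_contains_cball by blast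
  define Cr where "Cr = {c. poly (pderiv P) c = 0}"
  have fin: "finite Cr"
    unfolding Cr_def using deg by (intro poly_roots_finite) (simp add: pderiv_eq_0_iff)
  have "path_connected A" using A_facts(1,2) by (simp add: connected_open_path_connected)
  hence "\<forall>c\<in>Cr. \<exists>\<gamma>. path \<gamma> \<and> path_image \<gamma> \<subseteq> A \<and> pathstart \<gamma> = a \<and> pathfinish \<gamma> = poly P c"
    using A_facts(3) A_invariant crit_imm unfolding path_connected_def Cr_def by blast
  from bchoice[OF this] obtain \<gamma> where \<gamma>: "\<And>c. c \<in> Cr \<Longrightarrow> path (\<gamma> c)" "\<And>c. c \<in> Cr \<Longrightarrow> path_image (\<gamma> c) \<subseteq> A"
    "\<And>c. c \<in> Cr \<Longrightarrow> pathstart (\<gamma> c) = a" "\<And>c. c \<in> Cr \<Longrightarrow> pathfinish (\<gamma> c) = poly P c" by blast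
  define L where "L = \<Union>(insert (cball a e) ((\<lambda>c. path_image (\<gamma> c)) ` Cr))"
  show ?thesis
  proof (rule connected_preimage[OF deg A_facts(1,2), of L e a])
    show "compact L" unfolding L_def using fin \<gamma>(1)
      by (intro compact_Union) (auto simp: compact_path_image)
    have ain: "a \<in> path_image (\<gamma> c)" if "c \<in> Cr" for c
      using \<gamma>(3)[OF that] pathstart_in_path_image by metis
    show "connected L" unfolding L_def
    proof (rule connected_Union)
      show "\<And>s. s \<in> insert (cball a e) ((\<lambda>c. path_image (\<gamma> c)) ` Cr) \<Longrightarrow> connected s"
        using \<gamma>(1) by (auto simp: connected_path_image)
      have "a \<in> \<Inter> (insert (cball a e) ((\<lambda>c. path_image (\<gamma> c)) ` Cr))" using e ain by auto
      thus "\<Inter> (insert (cball a e) ((\<lambda>c. path_image (\<gamma> c)) ` Cr)) \<noteq> {}" by blast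
    qed
    show "L \<subseteq> A" unfolding L_def using e \<gamma>(2) by auto
    show "0 < e" by (rule e(1))
    show "ball a e \<subseteq> L" unfolding L_def by auto
    show "poly P c \<in> L" if "poly (pderiv P) c = 0" for c
      using pathfinish_in_path_image[of "\<gamma> c"] \<gamma>(4)[of c] that unfolding L_def Cr_def by auto
  qed
qed

text \<open>The preimage of \<open>A\<close> is connected, lies in the basin and contains the fixed
  point \<open>a\<close>, so maximality of the component puts it inside \<open>A\<close>.\<close>

lemma A_backward: "poly P x \<in> A \<Longrightarrow> x \<in> A"
proof -
  have "poly P -` A \<subseteq> A"
    by (rule A_maximal[OF connected_preimage_A]) (use A_facts fixed basin_iff in auto)
  thus "poly P x \<in> A \<Longrightarrow> x \<in> A" by blast
qed

lemma escape_radius: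
  obtains \<rho> where "1 \<le> \<rho>" "\<And>z n. \<rho> \<le> cmod z \<Longrightarrow> 2 ^ n \<le> cmod ((poly P ^^ n) z)"
    "\<And>z. z \<in> filled_julia P \<longleftrightarrow> (\<forall>n. cmod ((poly P ^^ n) z) \<le> \<rho>)"
proof -
  obtain \<rho> where \<rho>: "1 \<le> \<rho>" "\<And>z. \<rho> \<le> cmod z \<Longrightarrow> 2 * cmod z < cmod (poly P z)" using poly_proper[OF deg] by blast
  have esc: "\<rho> \<le> cmod ((poly P ^^ n) z) \<and> 2 ^ n * cmod z \<le> cmod ((poly P ^^ n) z)" if z: "\<rho> \<le> cmod z" for z n
  proof (induction n)
    case 0 thus ?case using z by simp
  next
    case (Suc n)
    hence "2 * cmod ((poly P ^^ n) z) < cmod (poly P ((poly P ^^ n) z))" using \<rho>(2) by blast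
    thus ?case using Suc \<rho>(1) by auto
  qed
  have iff: "z \<in> filled_julia P \<longleftrightarrow> (\<forall>n. cmod ((poly P ^^ n) z) \<le> \<rho>)" for z
  proof
    assume "z \<in> filled_julia P"
    then obtain B where B: "\<And>n. cmod ((poly P ^^ n) z) \<le> B"
      unfolding filled_julia_def bounded_iff by auto
    show "\<forall>n. cmod ((poly P ^^ n) z) \<le> \<rho>"
    proof (rule ccontr)
      assume "\<not> ?thesis"
      then obtain n where n: "\<rho> \<le> cmod ((poly P ^^ n) z)" by (auto simp: not_le intro: less_imp_le)
      obtain m where m: "B < 2 ^ m" using real_arch_pow[of 2 B] by auto
      have "2 ^ m * 1 \<le> 2 ^ m * cmod ((poly P ^^ n) z)" using n \<rho>(1) by (intro mult_left_mono) auto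
      also have "\<dots> \<le> cmod ((poly P ^^ m) ((poly P ^^ n) z))" using esc[OF n] by blast
      also have "\<dots> = cmod ((poly P ^^ (m + n)) z)" by (simp add: funpow_add)
      also have "\<dots> \<le> B" by (rule B)
      finally show False using m by simp
    qed
  next
    assume "\<forall>n. cmod ((poly P ^^ n) z) \<le> \<rho>"
    thus "z \<in> filled_julia P" unfolding filled_julia_def bounded_iff by auto
  qed
  show ?thesis
  proof (rule that[OF \<rho>(1) _ iff])
    fix z n assume z: "\<rho> \<le> cmod z"
    have "2 ^ n * 1 \<le> 2 ^ n * cmod z" using z \<rho>(1) by (intro mult_left_mono) auto
    thus "2 ^ n \<le> cmod ((poly P ^^ n) z)" using esc[OF z, of n] by linarith
  qed
qed

lemma compact_filled_julia: "compact (filled_julia P)"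
proof -
  obtain \<rho> where \<rho>: "\<And>z. z \<in> filled_julia P \<longleftrightarrow> (\<forall>n. cmod ((poly P ^^ n) z) \<le> \<rho>)"
    by (rule escape_radius) (rule that | assumption)+
  have "filled_julia P = (\<Inter>n. (poly P ^^ n) -` cball 0 \<rho>)" using \<rho> by auto
  hence "closed (filled_julia P)" by (auto intro!: closed_INT closed_vimage continuous_poly_funpow)
  moreover have "filled_julia P \<subseteq> cball 0 \<rho>"
  proof
    fix z assume "z \<in> filled_julia P"
    hence "cmod ((poly P ^^ 0) z) \<le> \<rho>" using \<rho> by blast
    thus "z \<in> cball 0 \<rho>" by simp
  qed
  ultimately show ?thesis by (meson bounded_cball bounded_subset compact_eq_bounded_closed)
qed

lemma filled_julia_iff: "poly P z \<in> filled_julia P \<longleftrightarrow> z \<in> filled_julia P"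
proof -
  obtain \<rho> where \<rho>: "1 \<le> \<rho>" "\<And>z n. \<rho> \<le> cmod z \<Longrightarrow> 2 ^ n \<le> cmod ((poly P ^^ n) z)"
    "\<And>z. z \<in> filled_julia P \<longleftrightarrow> (\<forall>n. cmod ((poly P ^^ n) z) \<le> \<rho>)"
    by (rule escape_radius) (rule that | assumption)+
  have *: "range (\<lambda>n. (poly P ^^ n) z) = insert z (range (\<lambda>n. (poly P ^^ n) (poly P z)))"
  proof -
    have "y \<in> insert z (range (\<lambda>n. (poly P ^^ Suc n) z))" if y: "y \<in> range (\<lambda>n. (poly P ^^ n) z)" for y
    proof -
      obtain n where "y = (poly P ^^ n) z" using y by blast
      thus ?thesis by (cases n) auto
    qed
    moreover have "z \<in> range (\<lambda>n. (poly P ^^ n) z)" by (rule range_eqI[of _ _ 0]) simp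
    ultimately have "range (\<lambda>n. (poly P ^^ n) z) = insert z (range (\<lambda>n. (poly P ^^ Suc n) z))"
      by blast
    thus ?thesis by (simp only: funpow_shift)
  qed
  show ?thesis unfolding filled_julia_def mem_Collect_eq * by simp
qed

lemma basin_subset: "basin P a \<subseteq> filled_julia P"
  unfolding basin_def filled_julia_def using convergent_imp_bounded by blast

lemma A_subset_interior: "A \<subseteq> interior (filled_julia P)"
  using A_facts(1,4) basin_subset by (intro interior_maximal) auto

text \<open>Near a frontier point away from \<open>A\<close> all iterates avoid \<open>A\<close> by
  total invariance, hence stay away from \<open>a\<close>, and the functions
  \<open>1 / (P^n - a)\<close> form a normal family without zeros. A limit is nonzero at
  \<open>z\<close>, whose orbit is bounded, but zero at a nearby escaping point, which contradicts
  Hurwitz.\<close>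

lemma frontier_subset_closure: "frontier (filled_julia P) \<subseteq> closure A"
proof
  fix z assume z: "z \<in> frontier (filled_julia P)"
  have zK: "z \<in> filled_julia P"
    using z compact_filled_julia by (metis compact_imp_closed frontier_subset_closed subsetD)
  show "z \<in> closure A"
  proof (rule ccontr)
    assume "z \<notin> closure A"
    hence "z \<in> - closure A" by simp
    with open_Compl[OF closed_closure] obtain r where r0: "0 < r" "ball z r \<subseteq> - closure A"
      by (rule openE)
    hence r: "0 < r" "ball z r \<inter> A = {}" using closure_subset[of A] by blast+
    obtain e where e: "0 < e" "ball a e \<subseteq> A" using A_facts(1,3) open_contains_ball by blast
    have notA: "(poly P ^^ n) w \<notin> A" if "w \<in> ball z r" for w n
    proof (induction n)
      case 0 thus ?case using that r(2) by auto
    next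
      case (Suc n) thus ?case using A_backward by auto
    qed
    have far: "e \<le> cmod ((poly P ^^ n) w - a)" if "w \<in> ball z r" for w n
    proof -
      have "(poly P ^^ n) w \<notin> ball a e" using notA[OF that, of n] e(2) by blast
      thus ?thesis by (simp add: dist_norm norm_minus_commute)
    qed
    define f where "f n w = 1 / ((poly P ^^ n) w - a)" for n w
    have hol: "f n holomorphic_on ball z r" for n
    proof -
      have "(poly P ^^ n) w - a \<noteq> 0" if "w \<in> ball z r" for w using far[OF that, of n] e(1) by auto
      thus ?thesis unfolding f_def[abs_def]
        by (intro holomorphic_on_divide holomorphic_on_const holomorphic_on_diff holomorphic_poly_funpow)
    qed
    have bd: "\<exists>B. \<forall>h\<in>range f. \<forall>w\<in>C. cmod (h w) \<le> B" if C: "compact C" "C \<subseteq> ball z r" for C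
    proof -
      have "cmod (f n w) \<le> 1 / e" if "w \<in> C" for n w
        using far[of w n] C(2) that e(1) by (auto simp: f_def norm_divide intro!: frac_le)
      thus ?thesis by blast
    qed
    have hol': "\<And>h. h \<in> range f \<Longrightarrow> h holomorphic_on ball z r" using hol by auto
    obtain g q where g: "g holomorphic_on ball z r" "strict_mono (q :: nat \<Rightarrow> nat)"
      "\<And>x. x \<in> ball z r \<Longrightarrow> (\<lambda>n. f (q n) x) \<longlonglongrightarrow> g x"
      "\<And>K. compact K \<Longrightarrow> K \<subseteq> ball z r \<Longrightarrow> uniform_limit K (f \<circ> q) g sequentially"
      by (rule Montel[OF open_ball hol' bd order.refl]) (rule that | assumption)+
    obtain \<rho> where \<rho>: "1 \<le> \<rho>" "\<And>z n. \<rho> \<le> cmod z \<Longrightarrow> 2 ^ n \<le> cmod ((poly P ^^ n) z)"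
      "\<And>z. z \<in> filled_julia P \<longleftrightarrow> (\<forall>n. cmod ((poly P ^^ n) z) \<le> \<rho>)"
      by (rule escape_radius) (rule that | assumption)+
    have zb: "z \<in> ball z r" using r(1) by simp
    have gz: "g z \<noteq> 0"
    proof
      assume "g z = 0"
      hence lim: "(\<lambda>n. cmod (f (q n) z)) \<longlonglongrightarrow> 0" using tendsto_norm[OF g(3)[OF zb]] by simp
      have "1 / (\<rho> + cmod a) \<le> cmod (f n z)" for n
      proof -
        have "cmod ((poly P ^^ n) z - a) \<le> \<rho> + cmod a"
        proof -
          have "cmod ((poly P ^^ n) z) \<le> \<rho>" using \<rho>(3) zK by blast
          thus ?thesis using norm_triangle_ineq4[of "(poly P ^^ n) z" a] by linarith
        qed
        moreover have "0 < cmod ((poly P ^^ n) z - a)" using far[OF zb, of n] e(1) by linarith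
        ultimately show ?thesis by (simp add: f_def norm_divide frac_le)
      qed
      hence "1 / (\<rho> + cmod a) \<le> 0" by (intro LIMSEQ_le_const[OF lim]) auto
      moreover have "0 < \<rho> + cmod a" using \<rho>(1) norm_ge_zero[of a] by linarith
      ultimately show False by (simp add: divide_le_0_iff)
    qed
    obtain w where w: "w \<in> ball z r" "w \<notin> filled_julia P"
    proof -
      have "\<not> ball z r \<subseteq> filled_julia P"
      proof
        assume "ball z r \<subseteq> filled_julia P"
        hence "ball z r \<subseteq> interior (filled_julia P)" by (intro interior_maximal) auto
        thus False using zb z unfolding frontier_def by blast
      qed
      thus ?thesis using that by blast
    qed
    have gw: "g w = 0"
    proof -
      obtain m where m: "\<rho> \<le> cmod ((poly P ^^ m) w)" using \<rho>(3)[of w] w(2) by (auto simp: not_le intro: less_imp_le)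
      have grow: "2 ^ n \<le> cmod ((poly P ^^ (n + m)) w)" for n
        using \<rho>(2)[OF m, of n] by (simp add: funpow_add)
      have "(\<lambda>n. f (n + m) w) \<longlonglongrightarrow> 0"
      proof (rule Lim_null_comparison)
        show "\<forall>\<^sub>F n in sequentially. cmod (f (n + m) w) \<le> 2 * (1 / 2) ^ n"
        proof -
          obtain k where k: "2 * cmod a + 1 < 2 ^ k" using real_arch_pow[of 2 "2 * cmod a + 1"] by auto
          have "cmod (f (n + m) w) \<le> 2 * (1 / 2) ^ n" if "k \<le> n" for n
          proof -
            have "(2 :: real) ^ k \<le> 2 ^ n" using that by (intro power_increasing) auto
            hence "2 ^ n / 2 \<le> cmod ((poly P ^^ (n + m)) w - a)"
              using k grow[of n] norm_triangle_ineq2[of "(poly P ^^ (n + m)) w" a] by linarith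
            hence "cmod (f (n + m) w) \<le> 1 / (2 ^ n / 2)" unfolding f_def norm_divide
              by (intro frac_le) auto
            thus ?thesis by (simp add: power_divide)
          qed
          thus ?thesis unfolding eventually_sequentially by blast
        qed
        have "(\<lambda>n. (1 / 2 :: real) ^ n) \<longlonglongrightarrow> 0" by (intro LIMSEQ_power_zero) simp
        thus "(\<lambda>n. 2 * (1 / 2 :: real) ^ n) \<longlonglongrightarrow> 0" by (rule tendsto_mult_right_zero)
      qed
      hence "(\<lambda>n. f n w) \<longlonglongrightarrow> 0" by (rule LIMSEQ_offset)
      hence "(\<lambda>n. f (q n) w) \<longlonglongrightarrow> 0" using LIMSEQ_subseq_LIMSEQ[OF _ g(2)] by (simp add: o_def)
      thus ?thesis by (rule LIMSEQ_unique[OF g(3)[OF w(1)]])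
    qed
    have "g w \<noteq> 0"
    proof (rule Hurwitz_no_zeros[OF open_ball connected_ball, of "f \<circ> q" z r g])
      show "(f \<circ> q) n holomorphic_on ball z r" for n using hol by simp
      show "\<not> g constant_on ball z r" using gz gw zb w(1) unfolding constant_on_def by metis
      show "(f \<circ> q) n x \<noteq> 0" if "x \<in> ball z r" for n x using far[OF that, of "q n"] e(1) by (auto simp: f_def)
    qed (use g w in auto)
    thus False using gw by simp
  qed
qed

lemma poly_basin_exists: "\<exists>p \<epsilon>. poly_basin P A a p (degree P) \<epsilon>"
proof -
  obtain \<epsilon> where e: "0 < \<epsilon>" "cball a \<epsilon> \<subseteq> basin P a" "poly P ` ball a \<epsilon> \<subseteq> ball a \<epsilon>"
    "\<And>z. z \<in> basin P a \<longleftrightarrow> (\<exists>n. (poly P ^^ n) z \<in> ball a \<epsilon>)"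
    by (rule basin_absorbing) (rule that | assumption)+
  have sub: "cball a \<epsilon> \<subseteq> A" by (rule A_maximal) (use e in auto)
  have "a + complex_of_real \<epsilon> \<in> cball a \<epsilon>" using e(1) by (simp add: dist_norm)
  hence p: "a + complex_of_real \<epsilon> \<in> A" using sub by blast
  have "poly_basin P A a (a + complex_of_real \<epsilon>) (degree P) \<epsilon>"
  proof
    show "open A" "connected A" "a \<in> A" by (rule A_facts)+
    show "a + complex_of_real \<epsilon> \<in> A" by (rule p)
    show "a + complex_of_real \<epsilon> \<noteq> a" using e(1) by simp
    show "degree P = degree P" ..
    show "2 \<le> degree P" by (rule deg)
    show "poly P a = a" by (rule fixed)
    show "poly P x \<in> A" if "x \<in> A" for x using that by (rule A_invariant)
    show "x \<in> A" if "poly P x \<in> A" for x using that by (rule A_backward)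
    show "c \<in> A" if "poly (pderiv P) c = 0" for c using that by (rule crit_imm)
    show "0 < \<epsilon>" "cball a \<epsilon> \<subseteq> A" by (rule e(1), rule sub)
    fix C assume C: "compact C" "C \<subseteq> A"
    obtain n where "(poly P ^^ n) ` C \<subseteq> ball a \<epsilon>"
      using absorb_compact[OF e(3,4) C(1) subset_trans[OF C(2) A_facts(4)]] by (elim exE)
    hence "(poly P ^^ n) ` C \<subseteq> cball a \<epsilon>" using ball_subset_cball by (rule subset_trans)
    thus "\<exists>n. (poly P ^^ n) ` C \<subseteq> cball a \<epsilon>" by (rule exI)
  qed
  thus ?thesis by blast
qed

end

section \<open>The Riemann sphere and its rational maps\<close>

text \<open>Homogeneous coordinates on the sphere, which avoid the case distinctions at infinity.
  The meaningless pair \<open>0, 0\<close> is sent to \<open>None\<close> by default, so statements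
  about \<open>proj\<close> exclude it.\<close>

definition proj :: "complex \<Rightarrow> complex \<Rightarrow> csph" where
  "proj x y = (if y = 0 then None else Some (x / y))"

lemma proj_scale: "t \<noteq> 0 \<Longrightarrow> proj (t * x) (t * y) = proj x y"
  by (simp add: proj_def)

lemma Some_eq_proj: "Some z = proj z 1" and None_eq_proj: "None = proj 1 0" and sinv_eq_proj: "sinv w = proj 1 w"
  by (auto simp: proj_def sinv_def)

lemma csph_cases:
  obtains x y where "s = proj x y" "x \<noteq> 0 \<or> y \<noteq> 0"
proof (cases s)
  case None thus ?thesis using that[of 1 0] by (simp add: proj_def)
next
  case (Some z) thus ?thesis using that[of z 1] by (simp add: proj_def)
qed

lemma proj_eq_iff:
  assumes "x \<noteq> 0 \<or> y \<noteq> 0" "u \<noteq> 0 \<or> v \<noteq> 0"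
  shows "proj x y = proj u v \<longleftrightarrow> x * v = u * y"
  using assms by (auto simp: proj_def divide_simps)

lemma open_sinv_vimage:
  assumes "sph_open U"
  shows "open {w. sinv w \<in> U}"
proof (subst open_subopen, intro ballI)
  fix w assume "w \<in> {w. sinv w \<in> U}"
  hence w: "sinv w \<in> U" by simp
  have oU: "open {z. Some z \<in> U}" using assms by (simp add: sph_open_def)
  show "\<exists>T. open T \<and> w \<in> T \<and> T \<subseteq> {w. sinv w \<in> U}"
  proof (cases "w = 0")
    case True
    then obtain R where R: "\<And>z. R < cmod z \<Longrightarrow> Some z \<in> U"
      using assms w unfolding sph_open_def by (auto simp: sinv_def)
    have "sinv v \<in> U" if "v \<in> ball 0 (1 / (\<bar>R\<bar> + 1))" for v
    proof (cases "v = 0")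
      case False
      hence "\<bar>R\<bar> + 1 < cmod (1 / v)" using that by (simp add: norm_divide field_simps)
      hence "R < cmod (1 / v)" by linarith
      thus ?thesis using R[of "1 / v"] False by (simp add: sinv_def)
    qed (use w True in simp)
    thus ?thesis using True by (intro exI[of _ "ball 0 (1 / (\<bar>R\<bar> + 1))"]) auto
  next
    case False
    have "open ((\<lambda>w. 1 / w) -` {z. Some z \<in> U} \<inter> - {0})"
      by (rule continuous_open_preimage[OF _ _ oU, of "- {0}" "\<lambda>w. 1 / w", unfolded Int_commute[of "- {0}"]])
        (auto intro!: continuous_intros)
    thus ?thesis using False w
      by (intro exI[of _ "(\<lambda>w. 1 / w) -` {z. Some z \<in> U} \<inter> - {0}"]) (auto simp: sinv_def)
  qed
qed

lemma sph_open_iff: "sph_open U \<longleftrightarrow> open {z. Some z \<in> U} \<and> open {w. sinv w \<in> U}"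
proof
  assume "sph_open U"
  thus "open {z. Some z \<in> U} \<and> open {w. sinv w \<in> U}"
    using open_sinv_vimage by (auto simp: sph_open_def)
next
  assume o: "open {z. Some z \<in> U} \<and> open {w. sinv w \<in> U}"
  have "\<exists>R. \<forall>z. R < cmod z \<longrightarrow> Some z \<in> U" if "None \<in> U"
  proof -
    have "0 \<in> {w. sinv w \<in> U}" using that by (simp add: sinv_def)
    then obtain e where e: "0 < e" "ball 0 e \<subseteq> {w. sinv w \<in> U}" using o openE by blast
    have "Some z \<in> U" if "1 / e < cmod z" for z
    proof -
      have z: "z \<noteq> 0" using that e(1) by auto
      have "1 / z \<in> ball 0 e" using that e(1) z by (simp add: norm_divide field_simps)
      thus ?thesis using e(2) z by (auto simp: sinv_def)
    qed
    thus ?thesis by blast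
  qed
  thus "sph_open U" using o by (simp add: sph_open_def)
qed

lemma open_proj_vimage:
  assumes U: "sph_open U" and S: "open S" and p: "continuous_on S p" "continuous_on S q"
    and nz: "\<And>z. z \<in> S \<Longrightarrow> p z \<noteq> 0 \<or> q z \<noteq> 0"
  shows "open {z \<in> S. proj (p z) (q z) \<in> U}"
proof -
  define S1 where "S1 = {z \<in> S. q z \<noteq> 0}"
  define S2 where "S2 = {z \<in> S. p z \<noteq> 0}"
  have "open (S \<inter> q -` (- {0}))" by (rule continuous_open_preimage[OF p(2) S]) (simp add: open_Compl)
  moreover have "open (S \<inter> p -` (- {0}))" by (rule continuous_open_preimage[OF p(1) S]) (simp add: open_Compl)
  ultimately have o: "open S1" "open S2" by (auto simp: S1_def S2_def Int_def vimage_def)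
  have c1: "continuous_on S1 (\<lambda>z. p z / q z)" and c2: "continuous_on S2 (\<lambda>z. q z / p z)"
    using p by (auto intro!: continuous_intros intro: continuous_on_subset simp: S1_def S2_def)
  have "open (S1 \<inter> (\<lambda>z. p z / q z) -` {z. Some z \<in> U})"
    using U by (intro continuous_open_preimage c1 o) (simp add: sph_open_def)
  moreover have "open (S2 \<inter> (\<lambda>z. q z / p z) -` {w. sinv w \<in> U})"
    using open_sinv_vimage[OF U] by (intro continuous_open_preimage c2 o)
  moreover have "{z \<in> S. proj (p z) (q z) \<in> U} =
      (S1 \<inter> (\<lambda>z. p z / q z) -` {z. Some z \<in> U}) \<union> (S2 \<inter> (\<lambda>z. q z / p z) -` {w. sinv w \<in> U})"
    using nz by (auto simp: S1_def S2_def proj_def sinv_def split: if_splits)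
  ultimately show ?thesis by auto
qed

lemma topspace_sph_top [simp]: "topspace sph_top = UNIV"
proof -
  have "openin sph_top UNIV" by (simp add: openin_sph_top sph_open_def)
  thus ?thesis using openin_subset by blast
qed

lemma continuous_Some: "continuous_map euclidean sph_top Some"
  unfolding continuous_map_def openin_sph_top by (auto simp: sph_open_def)

lemma continuous_sinv: "continuous_map euclidean sph_top sinv"
  unfolding continuous_map_def openin_sph_top using open_sinv_vimage by auto

lemma compact_space_sph: "compact_space sph_top"
proof -
  have "compactin sph_top (Some ` cball 0 1)"
    by (rule image_compactin[OF _ continuous_Some]) simp
  moreover have "compactin sph_top (sinv ` cball 0 1)"
    by (rule image_compactin[OF _ continuous_sinv]) simp
  moreover have "UNIV = Some ` cball 0 1 \<union> sinv ` cball 0 (1::real)"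
  proof -
    have "s \<in> Some ` cball 0 1 \<union> sinv ` cball 0 1" for s
    proof (cases s)
      case None
      thus ?thesis by (auto simp: sinv_def intro!: image_eqI[of _ _ 0])
    next
      case (Some z)
      show ?thesis
      proof (cases "cmod z \<le> 1")
        case False
        hence "z \<noteq> 0" "1 / z \<in> cball 0 1" by (auto simp: norm_divide divide_simps)
        thus ?thesis using Some by (auto simp: sinv_def intro!: image_eqI[of _ _ "1 / z"])
      qed (use Some in auto)
    qed
    thus ?thesis by blast
  qed
  ultimately show ?thesis
    unfolding compact_space_def topspace_sph_top by (metis compactin_Un)
qed

lemma sph_open_Some_image: "open S \<Longrightarrow> sph_open (Some ` S)"
  by (auto simp: sph_open_def image_iff)

lemma Hausdorff_sph: "Hausdorff_space sph_top"
proof -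
  have oc: "sph_open (- (Some ` cball a r))" for a r
  proof -
    have "{z. Some z \<in> - (Some ` cball a r)} = - cball a r" by auto
    moreover have "\<forall>z. cmod a + r < cmod z \<longrightarrow> Some z \<in> - (Some ` cball a r)"
    proof (intro allI impI)
      fix z assume "cmod a + r < cmod z"
      hence "r < cmod (z - a)" using norm_triangle_ineq2[of z a] by linarith
      thus "Some z \<in> - (Some ` cball a r)" by (auto simp: dist_norm norm_minus_commute)
    qed
    ultimately show ?thesis unfolding sph_open_def by auto
  qed
  have sep: "\<exists>U V. sph_open U \<and> sph_open V \<and> Some a \<in> U \<and> y \<in> V \<and> U \<inter> V = {}" if "y \<noteq> Some a" for a y
  proof (cases y)
    case None
    thus ?thesis
      by (intro exI[of _ "Some ` ball a 1"] exI[of _ "- (Some ` cball a 1)"]) (auto intro: sph_open_Some_image oc)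
  next
    case (Some b)
    hence ab: "a \<noteq> b" using that by auto
    define r where "r = dist a b / 2"
    have r: "0 < r" using ab by (simp add: r_def)
    have "ball a r \<inter> ball b r = {}" by (rule disjoint_ballI) (simp add: r_def)
    thus ?thesis using Some r
      by (intro exI[of _ "Some ` ball a r"] exI[of _ "Some ` ball b r"]) (auto intro: sph_open_Some_image)
  qed
  show ?thesis unfolding Hausdorff_space_def openin_sph_top
  proof (intro allI impI)
    fix x y :: csph assume xy: "x \<in> topspace sph_top \<and> y \<in> topspace sph_top \<and> x \<noteq> y"
    show "\<exists>U V. sph_open U \<and> sph_open V \<and> x \<in> U \<and> y \<in> V \<and> disjnt U V"
    proof (cases x)
      case (Some a)
      thus ?thesis using sep[of y a] xy by (auto simp: disjnt_def)
    next
      case None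
      then obtain b where "y = Some b" using xy by (cases y) auto
      thus ?thesis using sep[of x b] xy by (auto simp: disjnt_def Int_commute)
    qed
  qed
qed

text \<open>Homogenization in degree \<open>n\<close>, the degree of the map and not of
  \<open>p\<close>. Thus the coefficient of index \<open>n\<close>, even if it is 0, plays the role
  of the value at infinity, and being a pair of exact degree \<open>n\<close> means having no common
  zero in homogeneous coordinates.\<close>

definition hp :: "nat \<Rightarrow> complex poly \<Rightarrow> complex \<Rightarrow> complex \<Rightarrow> complex" where
  "hp n p x y = (\<Sum>i\<le>n. coeff p i * x ^ i * y ^ (n - i))"

lemma hp_1: "degree p \<le> n \<Longrightarrow> hp n p z 1 = poly p z"
  unfolding hp_def poly_altdef by (simp, rule sum.mono_neutral_right) (auto simp: coeff_eq_0)

lemma hp_scale: "hp n p (t * x) (t * y) = t ^ n * hp n p x y"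
  unfolding hp_def sum_distrib_left
  by (rule sum.cong) (auto simp: power_mult_distrib algebra_simps simp flip: power_add)

lemma hp_0: "hp n p x 0 = coeff p n * x ^ n"
proof -
  have "hp n p x 0 = (\<Sum>i\<in>{n}. coeff p i * x ^ i * 0 ^ (n - i))"
    unfolding hp_def by (rule sum.mono_neutral_right) auto
  thus ?thesis by simp
qed

lemma continuous_hp: "continuous_on S (\<lambda>w. hp n p (f w) (g w))" if "continuous_on S f" "continuous_on S g"
  unfolding hp_def by (intro continuous_intros that)

definition rmap :: "nat \<Rightarrow> complex poly \<Rightarrow> complex poly \<Rightarrow> csph \<Rightarrow> csph" where
  "rmap n N D x = (case x of None \<Rightarrow> proj (coeff N n) (coeff D n) | Some z \<Rightarrow> proj (poly N z) (poly D z))"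

definition rpair :: "nat \<Rightarrow> complex poly \<Rightarrow> complex poly \<Rightarrow> bool" where
  "rpair n N D \<longleftrightarrow> degree N \<le> n \<and> degree D \<le> n \<and> (coeff N n \<noteq> 0 \<or> coeff D n \<noteq> 0) \<and>
     (\<forall>z. \<not> (poly N z = 0 \<and> poly D z = 0))"

lemma rpair_hp: "rpair n N D \<Longrightarrow> x \<noteq> 0 \<or> y \<noteq> 0 \<Longrightarrow> hp n N x y \<noteq> 0 \<or> hp n D x y \<noteq> 0"
proof (cases "y = 0")
  case True
  assume "rpair n N D" "x \<noteq> 0 \<or> y \<noteq> 0"
  thus ?thesis using True by (auto simp: rpair_def hp_0)
next
  case False
  assume r: "rpair n N D"
  have "hp n p x y = y ^ n * poly p (x / y)" if "degree p \<le> n" for p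
    using hp_scale[of n p y "x / y" 1] False hp_1[OF that] by simp
  thus ?thesis using r False by (auto simp: rpair_def)
qed

lemma rmap_proj:
  assumes r: "rpair n N D" and xy: "x \<noteq> 0 \<or> y \<noteq> 0"
  shows "rmap n N D (proj x y) = proj (hp n N x y) (hp n D x y)"
proof (cases "y = 0")
  case True
  thus ?thesis using xy proj_scale[of "x ^ n" "coeff N n" "coeff D n"]
    by (simp add: rmap_def hp_0 mult.commute proj_def[of x])
next
  case False
  have "hp n p x y = y ^ n * poly p (x / y)" if "degree p \<le> n" for p
    using hp_scale[of n p y "x / y" 1] False hp_1[OF that] by simp
  thus ?thesis using r False by (simp add: rmap_def proj_def[of x] rpair_def proj_scale)
qed

lemma continuous_rmap:
  assumes r: "rpair n N D"
  shows "continuous_map sph_top sph_top (rmap n N D)"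
  unfolding continuous_map_def openin_sph_top
proof (intro conjI allI impI)
  fix U assume U: "sph_open U"
  have "open {z \<in> UNIV. proj (hp n N z 1) (hp n D z 1) \<in> U}"
    by (rule open_proj_vimage[OF U]) (use rpair_hp[OF r] in \<open>auto intro!: continuous_hp continuous_intros\<close>)
  moreover have "open {w \<in> UNIV. proj (hp n N 1 w) (hp n D 1 w) \<in> U}"
    by (rule open_proj_vimage[OF U]) (use rpair_hp[OF r] in \<open>auto intro!: continuous_hp continuous_intros\<close>)
  ultimately show "sph_open {x \<in> topspace sph_top. rmap n N D x \<in> U}"
    unfolding sph_open_iff by (simp add: Some_eq_proj sinv_eq_proj rmap_proj[OF r])
qed auto

lemma moeb_eq_rmap: "moeb a b c e = rmap 1 [:b, a:] [:e, c:]"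
  by (rule ext) (auto simp: moeb_def rmap_def proj_def algebra_simps split: option.splits)

lemma rpair_moeb: "a * e - b * c \<noteq> 0 \<Longrightarrow> rpair 1 [:b, a:] [:e, c:]"
proof -
  assume d: "a * e - b * c \<noteq> 0"
  have False if "b + z * a = 0" "e + z * c = 0" for z
  proof -
    have "b = - (z * a)" "e = - (z * c)" using that by (auto simp: add_eq_0_iff2)
    thus False using d by (simp add: algebra_simps)
  qed
  thus ?thesis using d by (auto simp: rpair_def)
qed

lemma moeb_proj:
  assumes "a * e - b * c \<noteq> 0" "x \<noteq> 0 \<or> y \<noteq> 0"
  shows "moeb a b c e (proj x y) = proj (a * x + b * y) (c * x + e * y)"
  unfolding moeb_eq_rmap rmap_proj[OF rpair_moeb[OF assms(1)] assms(2)]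
  by (simp add: hp_def algebra_simps)

lemma moeb_nonzero:
  assumes "a * e - b * c \<noteq> (0::complex)" "x \<noteq> 0 \<or> y \<noteq> 0"
  shows "a * x + b * y \<noteq> 0 \<or> c * x + e * y \<noteq> 0"
proof (rule ccontr)
  assume "\<not> ?thesis"
  hence z: "a * x + b * y = 0" "c * x + e * y = 0" by auto
  have "(a * e - b * c) * x = e * (a * x + b * y) - b * (c * x + e * y)" by (simp add: algebra_simps)
  moreover have "(a * e - b * c) * y = a * (c * x + e * y) - c * (a * x + b * y)" by (simp add: algebra_simps)
  ultimately show False using z assms by auto
qed

lemma continuous_moeb: "a * e - b * c \<noteq> 0 \<Longrightarrow> continuous_map sph_top sph_top (moeb a b c e)"
  unfolding moeb_eq_rmap by (intro continuous_rmap rpair_moeb)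

lemma moeb_compose:
  assumes "a * e - b * c \<noteq> 0" "a' * e' - b' * c' \<noteq> 0"
  shows "moeb a b c e (moeb a' b' c' e' s) = moeb (a * a' + b * c') (a * b' + b * e') (c * a' + e * c') (c * b' + e * e') s"
proof -
  have d: "(a * a' + b * c') * (c * b' + e * e') - (a * b' + b * e') * (c * a' + e * c') = (a * e - b * c) * (a' * e' - b' * c')"
    by (simp add: algebra_simps)
  obtain x y where s: "s = proj x y" "x \<noteq> 0 \<or> y \<noteq> 0" by (rule csph_cases)
  have d': "(a * a' + b * c') * (c * b' + e * e') - (a * b' + b * e') * (c * a' + e * c') \<noteq> 0"
    unfolding d using assms by simp
  show ?thesis
    unfolding s(1) moeb_proj[OF d' s(2)] moeb_proj[OF assms(2) s(2)] moeb_proj[OF assms(1) moeb_nonzero[OF assms(2) s(2)]]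
    by (simp add: algebra_simps)
qed

lemma moeb_scalar: "t \<noteq> 0 \<Longrightarrow> moeb t 0 0 t s = s"
  by (auto simp: moeb_def split: option.splits)

lemma moeb_inverse:
  assumes "a * e - b * c \<noteq> 0"
  shows "moeb e (- b) (- c) a (moeb a b c e s) = s" "moeb a b c e (moeb e (- b) (- c) a s) = s"
proof -
  have d: "e * a - (- b) * (- c) \<noteq> 0" using assms by (simp add: mult.commute)
  show "moeb e (- b) (- c) a (moeb a b c e s) = s" "moeb a b c e (moeb e (- b) (- c) a s) = s"
    unfolding moeb_compose[OF assms d] moeb_compose[OF d assms] using moeb_scalar[OF assms]
    by (simp_all add: mult.commute)
qed

lemma bij_moeb: "a * e - b * c \<noteq> 0 \<Longrightarrow> bij (moeb a b c e)"
  using moeb_inverse by (intro o_bij[of "moeb e (- b) (- c) a"]) (auto simp: fun_eq_iff)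

lemma eta_proj: "x \<noteq> 0 \<or> y \<noteq> 0 \<Longrightarrow> eta (proj x y) = proj y x"
  by (auto simp: eta_def proj_def)

lemma eta_eq_moeb: "eta = moeb 0 1 1 0"
  by (rule ext) (auto simp: eta_def moeb_def split: option.splits)

lemma eta_eta [simp]: "eta (eta x) = x"
  by (auto simp: eta_def split: option.splits)

lemma continuous_eta: "continuous_map sph_top sph_top eta"
  unfolding eta_eq_moeb by (rule continuous_moeb) simp

text \<open>The homogenized form of degree \<open>n\<close> composed with a linear map, read as a
  polynomial again; \<open>hp_psub\<close> is its defining property. Written as a sum it also makes
  sense for singular matrices, which occur as limits later.\<close>

definition psub :: "nat \<Rightarrow> complex \<Rightarrow> complex \<Rightarrow> complex \<Rightarrow> complex \<Rightarrow> complex poly \<Rightarrow> complex poly" where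
  "psub n a b c e p = (\<Sum>i\<le>n. smult (coeff p i) ([:b, a:] ^ i * [:e, c:] ^ (n - i)))"

lemma degree_linear_power: "degree ([:b, a:] ^ i) \<le> i" "coeff ([:b, a:] ^ i) i = (a :: complex) ^ i"
proof -
  show "degree ([:b, a:] ^ i) \<le> i" for i
    by (rule order_trans[OF degree_power_le]) auto
  thus "coeff ([:b, a:] ^ i) i = a ^ i"
  proof (induction i)
    case (Suc i)
    have "coeff ([:b, a:] * [:b, a:] ^ i) (1 + i) = coeff [:b, a:] 1 * coeff ([:b, a:] ^ i) i"
      by (rule coeff_mult_degree_bounds) (use Suc.prems in auto)
    thus ?case using Suc by simp
  qed simp
qed

lemma degree_psub: "degree (psub n a b c e p) \<le> n"
  unfolding psub_def
proof (rule degree_sum_le)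
  fix i assume i: "i \<in> {..n}"
  have "degree ([:b, a:] ^ i * [:e, c:] ^ (n - i)) \<le> i + (n - i)"
    by (rule order_trans[OF degree_mult_le]) (intro add_mono degree_linear_power)
  thus "degree (smult (coeff p i) ([:b, a:] ^ i * [:e, c:] ^ (n - i))) \<le> n"
    using i by (auto intro: order_trans[OF degree_smult_le])
qed simp

lemma hp_psub: "hp n (psub n a b c e p) x y = hp n p (a * x + b * y) (c * x + e * y)"
proof (cases "y = 0")
  case True
  have "coeff ([:b, a:] ^ i * [:e, c:] ^ (n - i)) n = a ^ i * c ^ (n - i)" if "i \<le> n" for i
    using coeff_mult_degree_bounds[OF degree_linear_power(1) degree_linear_power(1), of b a i e c "n - i"] that
    by (simp add: degree_linear_power(2))
  hence "coeff (psub n a b c e p) n = hp n p a c"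
    unfolding psub_def hp_def coeff_sum coeff_smult by (intro sum.cong) (auto simp: mult.assoc)
  thus ?thesis using True hp_scale[of n p x a c] by (simp add: hp_0 mult.commute)
next
  case False
  have "hp n (psub n a b c e p) x y = y ^ n * poly (psub n a b c e p) (x / y)"
    using hp_scale[of n _ y "x / y" 1] False hp_1[OF degree_psub] by simp
  also have "poly (psub n a b c e p) (x / y) = hp n p (a * (x / y) + b) (c * (x / y) + e)"
    unfolding psub_def hp_def poly_sum by (intro sum.cong) (auto simp: poly_power mult.assoc add.commute mult.commute)
  also have "y ^ n * \<dots> = hp n p (y * (a * (x / y) + b)) (y * (c * (x / y) + e))" by (rule hp_scale[symmetric])
  also have "y * (a * (x / y) + b) = a * x + b * y" using False by (simp add: field_simps)
  also have "y * (c * (x / y) + e) = c * x + e * y" using False by (simp add: field_simps)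
  finally show ?thesis .
qed

lemma rpair_iff_hp:
  assumes "degree N \<le> n" "degree D \<le> n"
  shows "rpair n N D \<longleftrightarrow> (\<forall>x y. x \<noteq> 0 \<or> y \<noteq> 0 \<longrightarrow> hp n N x y \<noteq> 0 \<or> hp n D x y \<noteq> 0)"
proof
  assume r: "\<forall>x y. x \<noteq> 0 \<or> y \<noteq> 0 \<longrightarrow> hp n N x y \<noteq> 0 \<or> hp n D x y \<noteq> 0"
  have "coeff N n \<noteq> 0 \<or> coeff D n \<noteq> 0" using r[rule_format, of 1 0] by (simp add: hp_0)
  moreover have "poly N z \<noteq> 0 \<or> poly D z \<noteq> 0" for z
    using r[rule_format, of z 1] hp_1[OF assms(1)] hp_1[OF assms(2)] by simp
  ultimately show "rpair n N D" using assms by (auto simp: rpair_def)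
qed (use rpair_hp in blast)

lemma rpair_psub:
  assumes "rpair n N D" "a * e - b * c \<noteq> 0"
  shows "rpair n (psub n a b c e N) (psub n a b c e D)"
  unfolding rpair_iff_hp[OF degree_psub degree_psub] hp_psub
  using rpair_hp[OF assms(1)] moeb_nonzero[OF assms(2)] by blast

lemma rmap_psub:
  assumes "rpair n N D" "a * e - b * c \<noteq> 0"
  shows "rmap n (psub n a b c e N) (psub n a b c e D) s = rmap n N D (moeb a b c e s)"
proof -
  obtain x y where s: "s = proj x y" "x \<noteq> 0 \<or> y \<noteq> 0" by (rule csph_cases)
  show ?thesis unfolding s(1) moeb_proj[OF assms(2) s(2)] rmap_proj[OF rpair_psub[OF assms] s(2)]
      rmap_proj[OF assms(1) moeb_nonzero[OF assms(2) s(2)]] hp_psub ..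
qed

lemma hp_combine: "hp n (smult a N + smult b D) x y = a * hp n N x y + b * hp n D x y"
  by (simp add: hp_def sum_distrib_left sum.distrib algebra_simps)

lemma rpair_post:
  assumes "rpair n N D" "a * e - b * c \<noteq> 0"
  shows "rpair n (smult a N + smult b D) (smult c N + smult e D)"
proof -
  have d: "degree (smult u N + smult v D) \<le> n" for u v
    using assms(1) by (intro degree_add_le order_trans[OF degree_smult_le]) (auto simp: rpair_def)
  show ?thesis unfolding rpair_iff_hp[OF d d] hp_combine
    using rpair_hp[OF assms(1)] moeb_nonzero[OF assms(2)] by blast
qed

lemma rmap_post:
  assumes "rpair n N D" "a * e - b * c \<noteq> 0"
  shows "rmap n (smult a N + smult b D) (smult c N + smult e D) s = moeb a b c e (rmap n N D s)"
proof -
  obtain x y where s: "s = proj x y" "x \<noteq> 0 \<or> y \<noteq> 0" by (rule csph_cases)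
  show ?thesis unfolding s(1) rmap_proj[OF rpair_post[OF assms] s(2)] rmap_proj[OF assms(1) s(2)]
      moeb_proj[OF assms(2) rpair_hp[OF assms(1) s(2)]] hp_combine ..
qed

lemma moeb_move:
  obtains a b c e where "a * e - b * c \<noteq> 0" "moeb a b c e x0 = None"
proof -
  obtain x y where s: "x0 = proj x y" "x \<noteq> 0 \<or> y \<noteq> 0" by (rule csph_cases)
  show ?thesis
  proof (cases "y = 0")
    case True
    hence "moeb 1 0 0 1 x0 = None" using s by (simp add: proj_def moeb_def)
    thus ?thesis using that[of 1 1 0 0] by simp
  next
    case False
    have d: "0 * (- x) - 1 * y \<noteq> 0" using False by simp
    have "moeb 0 1 y (- x) x0 = proj (0 * x + 1 * y) (y * x + - x * y)" unfolding s(1) by (rule moeb_proj[OF d s(2)])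
    also have "\<dots> = None" by (simp add: proj_def)
    finally show ?thesis using that[of 0 "- x" 1 y] d by simp
  qed
qed

section \<open>The Riemann-Hurwitz inequality\<close>

lemma simple_roots_if_card:
  fixes p :: "complex poly"
  assumes nz: "p \<noteq> 0" and card: "degree p \<le> card {z. poly p z = 0}" and z: "poly p z = 0"
  shows "poly (pderiv p) z \<noteq> 0"
proof
  assume d0: "poly (pderiv p) z = 0"
  have fin: "finite {z. poly p z = 0}" using nz by (rule poly_roots_finite)
  have o1: "1 \<le> order x p" if "poly p x = 0" for x
    using that nz order_root[of p x] by auto
  have "pderiv p \<noteq> 0"
  proof
    assume "pderiv p = 0"
    hence "degree p = 0" by (simp add: pderiv_eq_0_iff)
    then obtain c where "p = [:c:]" by (metis degree_eq_zeroE)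
    thus False using z nz by simp
  qed
  hence "order z p = Suc (order z (pderiv p))" using o1[OF z] z by (intro order_pderiv) auto
  moreover have "order z (pderiv p) \<noteq> 0" using d0 \<open>pderiv p \<noteq> 0\<close> order_root by blast
  ultimately have o2: "2 \<le> order z p" by simp
  have "card {z. poly p z = 0} = (\<Sum>x | poly p x = 0. 1)" by simp
  also have "\<dots> < (\<Sum>x | poly p x = 0. order x p)"
    using o1 o2 z by (intro sum_strict_mono_ex1 fin) force+
  also have "\<dots> = degree p" using degree_eq_sum_orders[OF nz] by simp
  finally show False using card by simp
qed

text \<open>Were the Wronskian divisible by the full power of \<open>x - z\<close> dividing
  \<open>q\<close>, so would be \<open>pderiv q * D\<close>, and hence \<open>pderiv q\<close>; but
  differentiation lowers the order of a root by exactly one.\<close>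

lemma order_wronskian_le:
  assumes q: "q \<noteq> 0" "poly q z = 0" and D: "poly D z \<noteq> 0" and W: "wronskian q D \<noteq> 0" and q': "pderiv q \<noteq> 0"
  shows "order z (wronskian q D) \<le> order z q - 1"
proof (rule ccontr)
  assume "\<not> ?thesis"
  hence ge: "order z q \<le> order z (wronskian q D)" by simp
  let ?l = "[:- z, 1:] ^ order z q"
  have "?l dvd wronskian q D" using ge W by (simp add: order_divides)
  moreover have "?l dvd q * pderiv D" by (simp add: order_1 dvd_mult2)
  ultimately have "?l dvd wronskian q D + q * pderiv D" by (rule dvd_add)
  hence "?l dvd pderiv q * D" by (simp add: wronskian_def)
  moreover have Dn: "D \<noteq> 0" using D by auto
  ultimately have "order z q \<le> order z (pderiv q * D)" using q' by (simp add: order_divides)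
  also have "\<dots> = order z (pderiv q) + order z D" using q' Dn by (simp add: order_mult)
  also have "order z D = 0" using D by (rule order_0I)
  finally have "order z q \<le> order z (pderiv q)" by simp
  moreover have "order z q = Suc (order z (pderiv q))"
    using q order_root[of q z] by (intro order_pderiv q') auto
  ultimately show False by simp
qed

lemma wronskian_sub: "wronskian (N - smult y D) D = wronskian N D"
  by (simp add: wronskian_def pderiv_diff pderiv_smult algebra_simps)

text \<open>The degree of the Wronskian is counted in two ways. Infinity is a simple pole, so the
  top coefficient carries the factor \<open>n - (n - 1) = 1\<close> and the degree is
  \<open>2 * n - 2\<close>. On the other hand the order at a zero is at most the multiplicity of the
  point in its fibre minus one, and summing over a fibre gives \<open>n\<close> minus the number of
  its points.\<close>

lemma riemann_hurwitz_normalized: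
  assumes n: "2 \<le> n" and r: "rpair n N D" and N: "coeff N n \<noteq> 0" and D0: "coeff D n = 0"
    and inf: "n - 1 \<le> card {z. poly D z = 0}"
    and Cv: "finite Cv" "\<And>y. y \<notin> Cv \<Longrightarrow> n \<le> card {z. poly (N - smult y D) z = 0}"
  shows "2 * n - 2 \<le> (\<Sum>y\<in>Cv. n - card {z. poly (N - smult y D) z = 0})"
proof -
  have dN: "degree N = n" using r N by (metis le_antisym le_degree rpair_def)
  have dD: "degree D \<le> n - 1"
  proof (rule degree_le, intro allI impI)
    fix i assume "n - 1 < i"
    thus "coeff D i = 0" using D0 r coeff_eq_0[of D i] by (cases "i = n") (auto simp: rpair_def)
  qed
  have Dn: "D \<noteq> 0"
  proof
    assume "D = 0"
    hence "card {z. poly D z = 0} = 0" using infinite_UNIV_char_0[where 'a = complex] by (simp add: card_eq_0_iff)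
    thus False using inf n by simp
  qed
  have dD': "degree D = n - 1" using inf card_poly_roots_bound[OF Dn] dD by linarith
  have Dsimple: "poly (pderiv D) z \<noteq> 0" if "poly D z = 0" for z
    by (rule simple_roots_if_card[OF Dn _ that]) (use inf dD' in simp)
  define W where "W = wronskian N D"
  have c1: "coeff (pderiv N * D) ((n - 1) + (n - 1)) = coeff (pderiv N) (n - 1) * coeff D (n - 1)"
    by (rule coeff_mult_degree_bounds) (use dN dD in \<open>auto simp: degree_pderiv\<close>)
  have c2: "coeff (N * pderiv D) (n + (n - 2)) = coeff N n * coeff (pderiv D) (n - 2)"
    by (rule coeff_mult_degree_bounds) (use dN dD in \<open>auto simp: degree_pderiv\<close>)
  have ar: "(n - 1) + (n - 1) = 2 * n - 2" "n + (n - 2) = 2 * n - 2" "Suc (n - 1) = n" "Suc (n - 2) = n - 1"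
    using n by auto
  have "coeff W (2 * n - 2) = coeff N n * coeff D (n - 1)"
    using c1 c2 n unfolding ar W_def wronskian_def
    by (simp add: coeff_pderiv ar algebra_simps of_nat_diff)
  moreover have "coeff D (n - 1) \<noteq> 0" using dD' Dn by (metis leading_coeff_0_iff)
  ultimately have cW: "coeff W (2 * n - 2) \<noteq> 0" using N by simp
  hence Wn: "W \<noteq> 0" by auto
  have dW: "2 * n - 2 \<le> degree W" using cW by (rule le_degree)
  define y where "y z = poly N z / poly D z" for z
  define q where "q u = N - smult u D" for u
  have dq: "degree (q u) = n" for u
  proof -
    have "degree (smult u D) < degree N" using dD dN n by (auto intro: le_less_trans[OF degree_smult_le])
    hence "degree (N + - smult u D) = degree N" by (intro degree_add_eq_left) simp
    thus ?thesis using dN by (simp add: q_def)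
  qed
  have qn: "q u \<noteq> 0" for u using dq[of u] n by auto
  have q'n: "pderiv (q u) \<noteq> 0" for u using dq[of u] n by (simp add: pderiv_eq_0_iff)
  have fin: "finite {z. poly (q u) z = 0}" for u using qn by (rule poly_roots_finite)
  have sumq: "(\<Sum>z | poly (q u) z = 0. order z (q u) - 1) = n - card {z. poly (q u) z = 0}" for u
  proof -
    have "1 \<le> order z (q u)" if "poly (q u) z = 0" for z
      using that qn order_root[of "q u" z] by auto
    hence "(\<Sum>z | poly (q u) z = 0. order z (q u) - 1) = (\<Sum>z | poly (q u) z = 0. order z (q u)) - (\<Sum>z | poly (q u) z = 0. 1)"
      by (intro sum_subtractf_nat) auto
    thus ?thesis using degree_eq_sum_orders[OF qn[of u]] dq[of u] by simp
  qed
  have root: "poly D z \<noteq> 0" "poly (q (y z)) z = 0" "y z \<in> Cv" if z: "poly W z = 0" for z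
  proof -
    show Dz: "poly D z \<noteq> 0"
    proof
      assume "poly D z = 0"
      moreover have "poly N z \<noteq> 0" using r calculation by (auto simp: rpair_def)
      ultimately show False using z Dsimple[of z] by (simp add: W_def wronskian_def)
    qed
    show qz: "poly (q (y z)) z = 0" using Dz by (simp add: q_def y_def)
    show "y z \<in> Cv"
    proof (rule ccontr)
      assume "y z \<notin> Cv"
      hence "degree (q (y z)) \<le> card {x. poly (q (y z)) x = 0}" using Cv(2) dq by (simp add: q_def)
      from simple_roots_if_card[OF qn this qz]
      have "poly (pderiv (q (y z))) z \<noteq> 0" .
      moreover have "poly (wronskian (q (y z)) D) z = 0" using z by (simp add: q_def wronskian_sub W_def)
      ultimately show False using qz Dz by (simp add: wronskian_def)
    qed
  qed
  have finW: "finite {z. poly W z = 0}" using Wn by (rule poly_roots_finite)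
  have "2 * n - 2 \<le> (\<Sum>z | poly W z = 0. order z W)"
    using dW degree_eq_sum_orders[OF Wn] by simp
  also have "\<dots> \<le> (\<Sum>z | poly W z = 0. order z (q (y z)) - 1)"
  proof (rule sum_mono)
    fix z assume "z \<in> {z. poly W z = 0}"
    hence z: "poly W z = 0" by simp
    have "order z (wronskian (q (y z)) D) \<le> order z (q (y z)) - 1"
      using Wn by (intro order_wronskian_le qn root[OF z] q'n) (simp add: q_def wronskian_sub W_def)
    thus "order z W \<le> order z (q (y z)) - 1" by (simp add: q_def wronskian_sub W_def)
  qed
  also have "\<dots> = (\<Sum>u\<in>Cv. \<Sum>z | z \<in> {z. poly W z = 0} \<and> y z = u. order z (q (y z)) - 1)"
    by (rule sum.group[symmetric, OF finW Cv(1)]) (use root in auto)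
  also have "\<dots> \<le> (\<Sum>u\<in>Cv. \<Sum>z | poly (q u) z = 0. order z (q u) - 1)"
  proof (rule sum_mono)
    fix u
    have "(\<Sum>z | z \<in> {z. poly W z = 0} \<and> y z = u. order z (q (y z)) - 1) =
        (\<Sum>z | z \<in> {z. poly W z = 0} \<and> y z = u. order z (q u) - 1)"
      by (rule sum.cong) auto
    also have "\<dots> \<le> (\<Sum>z | poly (q u) z = 0. order z (q u) - 1)"
      by (rule sum_mono2[OF fin]) (use root in auto)
    finally show "(\<Sum>z | z \<in> {z. poly W z = 0} \<and> y z = u. order z (q (y z)) - 1) \<le> (\<Sum>z | poly (q u) z = 0. order z (q u) - 1)" .
  qed
  also have "\<dots> = (\<Sum>u\<in>Cv. n - card {z. poly (q u) z = 0})" by (simp only: sumq)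
  finally show ?thesis by (simp add: q_def)
qed

lemma finite_fiber_normalized:
  assumes n: "2 \<le> n" and r: "rpair n N D" and N: "coeff N n \<noteq> 0" and D0: "coeff D n = 0"
  shows "{x. rmap n N D x = Some y} = Some ` {z. poly (N - smult y D) z = 0}"
    "{x. rmap n N D x = None} = insert None (Some ` {z. poly D z = 0})"
    "finite {z. poly (N - smult y D) z = 0}"
proof -
  show "{x. rmap n N D x = Some y} = Some ` {z. poly (N - smult y D) z = 0}"
  proof (rule set_eqI)
    fix x show "x \<in> {x. rmap n N D x = Some y} \<longleftrightarrow> x \<in> Some ` {z. poly (N - smult y D) z = 0}"
    proof (cases x)
      case (Some z)
      have "poly D z = 0 \<Longrightarrow> poly N z \<noteq> 0" using r by (auto simp: rpair_def)
      thus ?thesis using Some by (auto simp: rmap_def proj_def field_simps image_iff)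
    qed (use N D0 in \<open>auto simp: rmap_def proj_def\<close>)
  qed
  show "{x. rmap n N D x = None} = insert None (Some ` {z. poly D z = 0})"
  proof (rule set_eqI)
    fix x show "x \<in> {x. rmap n N D x = None} \<longleftrightarrow> x \<in> insert None (Some ` {z. poly D z = 0})"
      by (cases x) (use D0 in \<open>auto simp: rmap_def proj_def image_iff\<close>)
  qed
  have "coeff (N - smult y D) n \<noteq> 0" using N D0 by simp
  hence "N - smult y D \<noteq> 0" by (metis coeff_0)
  thus "finite {z. poly (N - smult y D) z = 0}" by (rule poly_roots_finite)
qed

lemma normalize_at:
  assumes r: "rpair n N D"
  obtains M1 M2 N' D' where "bij M1" "bij M2" "rpair n N' D'" "coeff N' n \<noteq> 0" "coeff D' n = 0"
    "\<And>s. rmap n N' D' s = M2 (rmap n N D (M1 s))" "M1 None = x0" "M2 (rmap n N D x0) = None"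
proof -
  obtain a b c e where m: "a * e - b * c \<noteq> 0" "moeb a b c e x0 = None" by (rule moeb_move)
  obtain a' b' c' e' where m': "a' * e' - b' * c' \<noteq> 0" "moeb a' b' c' e' (rmap n N D x0) = None" by (rule moeb_move)
  have d: "e * a - (- b) * (- c) \<noteq> 0" using m by (simp add: mult.commute)
  define M1 where "M1 = moeb e (- b) (- c) a"
  define M2 where "M2 = moeb a' b' c' e'"
  define N1 where "N1 = psub n e (- b) (- c) a N"
  define D1 where "D1 = psub n e (- b) (- c) a D"
  define N2 where "N2 = smult a' N1 + smult b' D1"
  define D2 where "D2 = smult c' N1 + smult e' D1"
  have r1: "rpair n N1 D1" unfolding N1_def D1_def by (rule rpair_psub[OF r d])
  have r2: "rpair n N2 D2" unfolding N2_def D2_def by (rule rpair_post[OF r1 m'(1)])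
  have eq: "rmap n N2 D2 s = M2 (rmap n N D (M1 s))" for s
  proof -
    have "rmap n N2 D2 s = M2 (rmap n N1 D1 s)"
      unfolding N2_def D2_def M2_def by (rule rmap_post[OF r1 m'(1)])
    also have "rmap n N1 D1 s = rmap n N D (M1 s)"
      unfolding N1_def D1_def M1_def by (rule rmap_psub[OF r d])
    finally show ?thesis .
  qed
  have M1N: "M1 None = x0" using moeb_inverse(1)[OF m(1), of x0] m(2) by (simp add: M1_def)
  have M2N: "M2 (rmap n N D x0) = None" using m' by (simp add: M2_def)
  have "rmap n N2 D2 None = None" unfolding eq M1N M2N ..
  hence "coeff D2 n = 0" by (auto simp: rmap_def proj_def split: if_splits)
  moreover have "coeff N2 n \<noteq> 0" using r2 calculation by (auto simp: rpair_def)
  ultimately show ?thesis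
    using that[OF _ _ r2 _ _ eq M1N M2N] bij_moeb[OF d] bij_moeb[OF m'(1)] by (simp add: M1_def M2_def)
qed

lemma finite_fiber:
  assumes n: "2 \<le> n" and r: "rpair n N D"
  shows "finite {x. rmap n N D x = y}"
proof (cases "{x. rmap n N D x = y} = {}")
  case False
  then obtain x0 where x0: "rmap n N D x0 = y" by blast
  obtain M1 M2 N' D' where m: "bij M1" "bij M2" "rpair n N' D'" "coeff N' n \<noteq> 0" "coeff D' n = 0"
    "\<And>s. rmap n N' D' s = M2 (rmap n N D (M1 s))" "M1 None = x0" "M2 (rmap n N D x0) = None"
    using normalize_at[OF r, where ?x0.0 = x0] by blast
  have "D' \<noteq> 0"
  proof
    assume "D' = 0"
    moreover have "degree N' \<noteq> 0" using le_degree[OF m(4)] n by simp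
    then obtain z where "poly N' z = 0" using fundamental_theorem_of_algebra[of N'] by (auto simp: constant_degree)
    ultimately show False using m(3) by (auto simp: rpair_def)
  qed
  hence f: "finite {x. rmap n N' D' x = None}"
    unfolding finite_fiber_normalized(2)[OF n m(3-5)] by (simp add: poly_roots_finite)
  have "{x. rmap n N D x = y} \<subseteq> M1 ` {x. rmap n N' D' x = None}"
  proof
    fix x assume "x \<in> {x. rmap n N D x = y}"
    moreover obtain s where "x = M1 s" using m(1) by (metis bij_pointE)
    ultimately show "x \<in> M1 ` {x. rmap n N' D' x = None}" using m(6)[of s] m(8) x0 by auto
  qed
  thus ?thesis using f finite_subset by blast
qed simp

text \<open>A value outside the exceptional set and one of its preimages are moved to infinity by
  Moebius maps. The fibre over infinity is then full, so all poles are simple and the normalized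
  count applies.\<close>

theorem riemann_hurwitz:
  assumes n: "2 \<le> n" and r: "rpair n N D" and Cv: "finite Cv" "\<And>y. y \<notin> Cv \<Longrightarrow> n \<le> card {x. rmap n N D x = y}"
  shows "2 * n - 2 \<le> (\<Sum>y\<in>Cv. n - card {x. rmap n N D x = y})"
proof -
  have "finite (\<Union>y\<in>Cv. {x. rmap n N D x = y})" using Cv(1) finite_fiber[OF n r] by blast
  moreover have "infinite (UNIV :: csph set)" using infinite_UNIV_char_0[where 'a = complex] by (simp add: finite_option_UNIV)
  ultimately obtain x0 where x0: "rmap n N D x0 \<notin> Cv"
    by (metis (mono_tags, lifting) UN_I UNIV_eq_I mem_Collect_eq)
  obtain M1 M2 N' D' where m: "bij M1" "bij M2" "rpair n N' D'" "coeff N' n \<noteq> 0" "coeff D' n = 0"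
    "\<And>s. rmap n N' D' s = M2 (rmap n N D (M1 s))" "M1 None = x0" "M2 (rmap n N D x0) = None"
    using normalize_at[OF r, where ?x0.0 = x0] by blast
  note inj2 = bij_is_inj[OF m(2), THEN injD]
  have fib: "card {x. rmap n N' D' x = M2 y} = card {x. rmap n N D x = y}" for y
  proof -
    have "{x. rmap n N D x = y} = M1 ` {x. rmap n N' D' x = M2 y}"
    proof (rule set_eqI, rule iffI)
      fix x assume x: "x \<in> {x. rmap n N D x = y}"
      obtain s where "x = M1 s" using m(1) by (metis bij_pointE)
      thus "x \<in> M1 ` {x. rmap n N' D' x = M2 y}" using m(6)[of s] x by auto
    next
      fix x assume "x \<in> M1 ` {x. rmap n N' D' x = M2 y}"
      thus "x \<in> {x. rmap n N D x = y}" using m(6) inj2 by auto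
    qed
    thus ?thesis using bij_is_inj[OF m(1)] by (simp add: card_image inj_on_subset)
  qed
  define Cv' where "Cv' = {u. Some u \<in> M2 ` Cv}"
  have MN: "None \<notin> M2 ` Cv" using x0 m(8) inj2 by (metis imageE)
  have img: "M2 ` Cv = Some ` Cv'"
  proof (rule set_eqI)
    fix x show "x \<in> M2 ` Cv \<longleftrightarrow> x \<in> Some ` Cv'" using MN by (cases x) (auto simp: Cv'_def image_iff)
  qed
  have fin': "finite Cv'" using Cv(1) img by (metis finite_imageD finite_imageI inj_Some)
  have sf: "card {x. rmap n N' D' x = Some u} = card {z. poly (N' - smult u D') z = 0}" for u
    unfolding finite_fiber_normalized(1)[OF n m(3-5)] by (simp add: card_image)
  have "2 * n - 2 \<le> (\<Sum>u\<in>Cv'. n - card {z. poly (N' - smult u D') z = 0})"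
  proof (rule riemann_hurwitz_normalized[OF n m(3-5) _ fin'])
    have "n \<le> card {x. rmap n N' D' x = M2 (rmap n N D x0)}" unfolding fib by (rule Cv(2)[OF x0])
    also have "\<dots> = card (insert None (Some ` {z. poly D' z = 0}))"
      unfolding m(8) finite_fiber_normalized(2)[OF n m(3-5)] ..
    also have "\<dots> \<le> Suc (card (Some ` {z. poly D' z = 0}))" by (rule card_insert_le_m1) auto
    also have "card (Some ` {z. poly D' z = 0}) = card {z. poly D' z = 0}" by (simp add: card_image)
    finally show "n - 1 \<le> card {z. poly D' z = 0}" by simp
    fix u assume u: "u \<notin> Cv'"
    obtain y where y: "Some u = M2 y" using m(2) by (metis bij_pointE)
    hence "y \<notin> Cv" using u by (auto simp: Cv'_def)
    hence "n \<le> card {x. rmap n N' D' x = Some u}" unfolding y fib by (rule Cv(2))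
    thus "n \<le> card {z. poly (N' - smult u D') z = 0}" by (simp only: sf)
  qed
  also have "\<dots> = (\<Sum>u\<in>Cv'. n - card {x. rmap n N' D' x = Some u})" by (simp only: sf)
  also have "\<dots> = (\<Sum>s\<in>Some ` Cv'. n - card {x. rmap n N' D' x = s})" by (simp add: sum.reindex)
  also have "\<dots> = (\<Sum>y\<in>Cv. n - card {x. rmap n N' D' x = M2 y})"
    unfolding img[symmetric] using bij_is_inj[OF m(2)] by (simp add: sum.reindex inj_on_subset)
  finally show ?thesis by (simp only: fib)
qed

section \<open>The Bowen-Series map\<close>

locale bs_geometry =
  fixes d :: nat
  assumes d2: "2 \<le> d"
begin

definition \<alpha> :: real where "\<alpha> = pi / (2 * real d)"
definition \<theta> :: "nat \<Rightarrow> real" where "\<theta> j = pi * (2 * real j + 1) / (2 * real d)"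
abbreviation "c \<equiv> bs_center d"
abbreviation "r \<equiv> bs_rad d"

lemma \<alpha>: "0 < \<alpha>" "\<alpha> < pi / 2" "0 < cos \<alpha>" "0 < sin \<alpha>"
proof -
  show a: "0 < \<alpha>" using d2 by (simp add: \<alpha>_def)
  have "pi / (2 * real d) \<le> pi / (2 * 2)" using d2 by (intro divide_left_mono) auto
  moreover have "pi / (2 * 2) < pi / 2" using pi_gt_zero by simp
  ultimately show b: "\<alpha> < pi / 2" unfolding \<alpha>_def by linarith
  show "0 < cos \<alpha>" using a b by (intro cos_gt_zero) auto
  show "0 < sin \<alpha>" using a b pi_gt_zero by (intro sin_gt_zero) linarith+
qed

lemma center_eq: "c j = cis (\<theta> j) / complex_of_real (cos \<alpha>)"
  by (simp add: bs_center_def \<theta>_def \<alpha>_def)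

lemma r_pos: "0 < r"
  using \<alpha> tan_gt_zero[of \<alpha>] by (simp add: bs_rad_def \<alpha>_def)

text \<open>Pythagoras for a circle orthogonal to the unit circle; the description of the side discs
  and the fact that the pairings preserve the unit disc both rest on it.\<close>

lemma center_norm: "(cmod (c j))\<^sup>2 = 1 + r\<^sup>2"
proof -
  have "(cmod (c j))\<^sup>2 = inverse ((cos \<alpha>)\<^sup>2)"
    using \<alpha>(3) by (simp add: center_eq norm_divide power_divide inverse_eq_divide)
  also have "\<dots> = 1 + (tan \<alpha>)\<^sup>2" using tan_sec[of \<alpha>] \<alpha>(3) by (simp add: power_inverse)
  finally show ?thesis by (simp add: bs_rad_def \<alpha>_def)
qed

lemma center_gt1: "1 < cmod (c j)"
proof (rule ccontr)
  assume "\<not> ?thesis"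
  hence "(cmod (c j))\<^sup>2 \<le> 1\<^sup>2" by (intro power_mono) auto
  thus False using center_norm[of j] r_pos by simp
qed

lemma cnj_center: "j < 2 * d \<Longrightarrow> cnj (c j) = c (2 * d - 1 - j)"
proof -
  assume j: "j < 2 * d"
  have "real (2 * d - 1 - j) = 2 * real d - 1 - real j" using j by (simp add: of_nat_diff)
  hence "\<theta> (2 * d - 1 - j) = pi * (4 * real d - (2 * real j + 1)) / (2 * real d)"
    unfolding \<theta>_def by (simp add: algebra_simps)
  also have "\<dots> = 2 * pi - \<theta> j" using d2 by (simp add: \<theta>_def field_simps)
  finally have "cis (\<theta> (2 * d - 1 - j)) = cis (- \<theta> j)"
    by (simp add: cis.code complex_eq_iff cos_diff sin_diff)
  thus ?thesis by (simp add: center_eq cis_cnj)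
qed

lemma dist_center_sq: "(cmod (z - c j))\<^sup>2 = (cmod z)\<^sup>2 - 2 * Re (z * cnj (c j)) + 1 + r\<^sup>2"
proof -
  have "(cmod (z - c j))\<^sup>2 = (cmod z)\<^sup>2 + (cmod (c j))\<^sup>2 - 2 * Re (z * cnj (c j))"
    unfolding cmod_power2 by (simp add: power2_eq_square algebra_simps)
  thus ?thesis using center_norm[of j] by simp
qed

lemma in_disc_iff: "cmod (z - c j) \<le> r \<longleftrightarrow> 1 + (cmod z)\<^sup>2 \<le> 2 * Re (z * cnj (c j))"
  "cmod (z - c j) < r \<longleftrightarrow> 1 + (cmod z)\<^sup>2 < 2 * Re (z * cnj (c j))"
proof -
  have "cmod (z - c j) \<le> r \<longleftrightarrow> (cmod (z - c j))\<^sup>2 \<le> r\<^sup>2"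
    using r_pos by (simp add: abs_le_square_iff[symmetric])
  thus "cmod (z - c j) \<le> r \<longleftrightarrow> 1 + (cmod z)\<^sup>2 \<le> 2 * Re (z * cnj (c j))"
    unfolding dist_center_sq by auto
  have "r \<le> cmod (z - c j) \<longleftrightarrow> r\<^sup>2 \<le> (cmod (z - c j))\<^sup>2"
    using r_pos by (simp add: abs_le_square_iff[symmetric])
  hence "cmod (z - c j) < r \<longleftrightarrow> (cmod (z - c j))\<^sup>2 < r\<^sup>2" by (meson not_le)
  thus "cmod (z - c j) < r \<longleftrightarrow> 1 + (cmod z)\<^sup>2 < 2 * Re (z * cnj (c j))"
    unfolding dist_center_sq by auto
qed

lemma Re_center: "Re (complex_of_real \<rho> * cis t * cnj (c j)) = \<rho> * cos (t - \<theta> j) / cos \<alpha>"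
  by (simp add: center_eq cos_diff algebra_simps add_divide_distrib)

text \<open>A side disc is seen from the origin under the angle \<open>\<alpha>\<close> on either
  side of its axis. Strictness comes from \<open>2 * \<rho> < 1 + \<rho>^2\<close>, which holds
  inside the unit disc and becomes an equality on the circle; this is why neighbouring discs touch
  only at ideal vertices.\<close>

lemma disc_angle:
  assumes "cmod z < 1" "cmod (z - c j) \<le> r"
  shows "z \<noteq> 0" "cos \<alpha> < cos (Arg z - \<theta> j)"
proof -
  have le: "1 + (cmod z)\<^sup>2 \<le> 2 * Re (z * cnj (c j))" using assms(2) in_disc_iff(1) by blast
  thus z0: "z \<noteq> 0" by auto
  define \<rho> where "\<rho> = cmod z"
  have \<rho>: "0 < \<rho>" "\<rho> < 1" using z0 assms(1) by (auto simp: \<rho>_def)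
  have z: "z = complex_of_real \<rho> * cis (Arg z)" using rcis_cmod_Arg[of z] by (simp add: rcis_def \<rho>_def)
  have "1 + \<rho>\<^sup>2 \<le> 2 * (\<rho> * cos (Arg z - \<theta> j) / cos \<alpha>)"
    using le Re_center[of \<rho> "Arg z" j] z by (metis \<rho>_def)
  hence "(1 + \<rho>\<^sup>2) * cos \<alpha> \<le> 2 * \<rho> * cos (Arg z - \<theta> j)" using \<alpha>(3) by (simp add: field_simps)
  moreover have "2 * \<rho> < 1 + \<rho>\<^sup>2"
  proof -
    have "0 < (1 - \<rho>)\<^sup>2" using \<rho> by simp
    thus ?thesis by (simp add: power2_eq_square algebra_simps)
  qed
  hence "2 * \<rho> * cos \<alpha> < (1 + \<rho>\<^sup>2) * cos \<alpha>" using \<alpha>(3) by simp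
  ultimately have "2 * \<rho> * cos \<alpha> < 2 * \<rho> * cos (Arg z - \<theta> j)" by linarith
  thus "cos \<alpha> < cos (Arg z - \<theta> j)" using \<rho>(1) by simp
qed

lemma cos_multiple_le:
  assumes "1 \<le> m" "m \<le> 2 * d - 1"
  shows "cos (real m * pi / real d) \<le> cos (pi / real d)"
proof -
  have key: "cos (real m * pi / real d) \<le> cos (pi / real d)" if "1 \<le> m" "m \<le> d" for m
  proof (rule cos_monotone_0_pi_le)
    show "0 \<le> pi / real d" by simp
    have "1 * pi \<le> real m * pi" using that by (intro mult_right_mono) auto
    thus "pi / real d \<le> real m * pi / real d" by (intro divide_right_mono) auto
    have "real m * pi \<le> real d * pi" using that by (intro mult_right_mono) auto
    thus "real m * pi / real d \<le> pi" using d2 by (simp add: field_simps)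
  qed
  show ?thesis
  proof (cases "m \<le> d")
    case True thus ?thesis using key assms by blast
  next
    case False
    have "real m * pi / real d = 2 * pi - real (2 * d - m) * pi / real d"
      using assms d2 by (simp add: of_nat_diff field_simps)
    hence "cos (real m * pi / real d) = cos (real (2 * d - m) * pi / real d)"
      by (simp add: cos_diff)
    also have "\<dots> \<le> cos (pi / real d)" using False assms by (intro key) auto
    finally show ?thesis .
  qed
qed

text \<open>A common point would make an angle with both axes whose cosine exceeds
  \<open>cos \<alpha>\<close>, so by the addition theorem the cosine of the difference of the axes
  would exceed \<open>cos (2 * \<alpha>)\<close>. But the axes differ by a multiple of
  \<open>2 * \<alpha>\<close> that is not a full turn.\<close>

lemma discs_disjoint:
  assumes z: "cmod z < 1" and i: "i < 2 * d" "cmod (z - c i) \<le> r" and j: "j < 2 * d" "cmod (z - c j) \<le> r"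
  shows "i = j"
proof -
  have False if ij: "i < j" "j < 2 * d" "cmod (z - c i) \<le> r" "cmod (z - c j) \<le> r" for i j
  proof -
    define u where "u = Arg z - \<theta> i"
    define v where "v = Arg z - \<theta> j"
    have uv: "cos \<alpha> < cos u" "cos \<alpha> < cos v" using disc_angle[OF z] ij by (auto simp: u_def v_def)
    have sq: "(sin x)\<^sup>2 \<le> (sin \<alpha>)\<^sup>2" if "cos \<alpha> < cos x" for x
    proof -
      have "(cos \<alpha>)\<^sup>2 \<le> (cos x)\<^sup>2" using that \<alpha>(3) by (intro power_mono) auto
      thus ?thesis using sin_cos_squared_add[of x] sin_cos_squared_add[of \<alpha>] by linarith
    qed
    have "\<bar>sin u\<bar> \<le> sin \<alpha>" "\<bar>sin v\<bar> \<le> sin \<alpha>"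
      using sq[OF uv(1)] sq[OF uv(2)] \<alpha>(4) by (simp_all add: abs_le_square_iff[symmetric])
    hence "\<bar>sin u * sin v\<bar> \<le> sin \<alpha> * sin \<alpha>" unfolding abs_mult by (intro mult_mono) auto
    moreover have "cos \<alpha> * cos \<alpha> < cos u * cos v" using uv \<alpha>(3) by (intro mult_strict_mono) auto
    ultimately have "cos \<alpha> * cos \<alpha> - sin \<alpha> * sin \<alpha> < cos (u - v)" by (simp add: cos_diff)
    moreover have "cos \<alpha> * cos \<alpha> - sin \<alpha> * sin \<alpha> = cos (pi / real d)"
      using cos_add[of \<alpha> \<alpha>] by (simp add: \<alpha>_def field_simps)
    moreover have "u - v = real (j - i) * pi / real d"
      using ij d2 by (simp add: u_def v_def \<theta>_def of_nat_diff field_simps)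
    moreover have "cos (real (j - i) * pi / real d) \<le> cos (pi / real d)" using ij by (intro cos_multiple_le) auto
    ultimately show False by simp
  qed
  thus ?thesis using i j by (metis linorder_neqE_nat)
qed

text \<open>The ideal vertices, described as the points of the circle inside no open side disc. Only
  an upper bound for their number is derived geometrically; the exact count comes out of
  Riemann--Hurwitz.\<close>

definition Vtx :: "complex set" where
  "Vtx = {z. cmod z = 1 \<and> (\<forall>j<2*d. r \<le> cmod (z - c j))}"

text \<open>The arguments are split into half-open arcs, so a point of arc \<open>m\<close> that is
  not inside disc \<open>m\<close> can only be the left endpoint of the arc. This is what identifies
  the vertices with roots of unity.\<close>

lemma circle_region:
  assumes "cmod z = 1"
  obtains m where "m < 2 * d" "cmod (z - c m) \<le> r" "r \<le> cmod (z - c m) \<Longrightarrow> z = cis (pi * real m / real d)"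
proof -
  define t where "t = Arg2pi z"
  have z: "z = cis t" and t: "0 \<le> t" "t < 2 * pi"
    using Arg2pi[of z] assms by (auto simp: t_def cis_conv_exp is_Arg_def)
  define m where "m = nat \<lfloor>t * real d / pi\<rfloor>"
  have q: "0 \<le> t * real d / pi" using t by simp
  have m: "real m \<le> t * real d / pi" "t * real d / pi < real m + 1"
    using q unfolding m_def by (simp_all add: of_nat_nat)
  have lo: "pi * real m / real d \<le> t" using m(1) d2 pi_gt_zero by (simp add: field_simps)
  have hi: "t < pi * (real m + 1) / real d" using m(2) d2 pi_gt_zero by (simp add: field_simps)
  have "t * real d / pi < 2 * real d" using t d2 pi_gt_zero by (simp add: field_simps)
  hence "real m < 2 * real d" using m(1) by linarith
  hence m2: "m < 2 * d" by linarith
  have mid: "\<theta> m - \<alpha> = pi * real m / real d" "\<theta> m + \<alpha> = pi * (real m + 1) / real d"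
    using d2 by (simp_all add: \<theta>_def \<alpha>_def field_simps)
  have ab: "\<bar>t - \<theta> m\<bar> \<le> \<alpha>" using lo hi mid by linarith
  have Re: "Re (z * cnj (c m)) = cos (t - \<theta> m) / cos \<alpha>"
    using Re_center[of 1 t m] by (simp add: z)
  have "cos \<alpha> \<le> cos \<bar>t - \<theta> m\<bar>"
    using ab \<alpha>(1,2) pi_gt_zero by (intro cos_monotone_0_pi_le) linarith+
  hence le: "cos \<alpha> \<le> cos (t - \<theta> m)" by simp
  show ?thesis
  proof (rule that[OF m2])
    show "cmod (z - c m) \<le> r" unfolding in_disc_iff(1) Re using le \<alpha>(3) assms by (simp add: field_simps)
    assume "r \<le> cmod (z - c m)"
    hence "\<not> cmod (z - c m) < r" by simp
    hence "\<not> 1 + (cmod z)\<^sup>2 < 2 * Re (z * cnj (c m))" by (simp only: in_disc_iff(2) not_False_eq_True)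
    hence "cos (t - \<theta> m) \<le> cos \<alpha>" unfolding Re using \<alpha>(3) assms by (simp add: field_simps)
    moreover have "cos \<alpha> < cos \<bar>t - \<theta> m\<bar>" if "\<bar>t - \<theta> m\<bar> < \<alpha>"
      using that \<alpha>(1,2) pi_gt_zero by (intro cos_monotone_0_pi) linarith+
    ultimately have "\<not> \<bar>t - \<theta> m\<bar> < \<alpha>" by auto
    hence "\<bar>t - \<theta> m\<bar> = \<alpha>" using ab by linarith
    hence "t = pi * real m / real d" using hi mid by linarith
    thus "z = cis (pi * real m / real d)" using z by simp
  qed
qed

lemma Vtx_finite: "finite Vtx" "card Vtx \<le> 2 * d"
proof -
  have sub: "Vtx \<subseteq> (\<lambda>m. cis (pi * real m / real d)) ` {..<2 * d}"
  proof
    fix z assume z: "z \<in> Vtx"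
    hence n: "cmod z = 1" by (simp add: Vtx_def)
    obtain m where "m < 2 * d" "cmod (z - c m) \<le> r" "r \<le> cmod (z - c m) \<Longrightarrow> z = cis (pi * real m / real d)"
      using circle_region[OF n] by blast
    thus "z \<in> (\<lambda>m. cis (pi * real m / real d)) ` {..<2 * d}" using z by (auto simp: Vtx_def)
  qed
  thus "finite Vtx" by (rule finite_subset) simp
  have "card Vtx \<le> card ((\<lambda>m. cis (pi * real m / real d)) ` {..<2 * d})" using sub by (intro card_mono) auto
  also have "\<dots> \<le> 2 * d" using card_image_le[of "{..<2 * d}"] by simp
  finally show "card Vtx \<le> 2 * d" .
qed

lemma dist_cnj: "j < 2 * d \<Longrightarrow> cmod (cnj z - c j) = cmod (z - c (2 * d - 1 - j))"
proof -
  assume "j < 2 * d"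
  have "cmod (cnj z - c j) = cmod (cnj (cnj z - c j))" by (rule complex_mod_cnj[symmetric])
  thus ?thesis using cnj_center[OF \<open>j < 2 * d\<close>] by simp
qed

lemma Vtx_cnj: "z \<in> Vtx \<Longrightarrow> cnj z \<in> Vtx"
  using dist_cnj by (auto simp: Vtx_def)

lemma bs_gen_on_circle:
  assumes "cmod (z - c j) = r"
  shows "bs_gen d j z = cnj z"
proof -
  have z: "z \<noteq> c j" using assms r_pos by auto
  have "(z - c j) * cnj (z - c j) = complex_of_real (r\<^sup>2)"
    using assms complex_norm_square[of "z - c j"] by simp
  hence "complex_of_real (r\<^sup>2) / (z - c j) = cnj (z - c j)" using z by (simp add: field_simps)
  thus ?thesis by (simp add: bs_gen_def)
qed

text \<open>On its own side circle every pairing is complex conjugation. So although two discs meet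
  at a vertex, the choice made by \<open>LEAST\<close> does not affect the value.\<close>

lemma bs_map_Vtx:
  assumes "z \<in> Vtx"
  shows "bs_map d z = cnj z"
proof -
  let ?Q = "\<lambda>j. j < 2 * d \<and> z \<in> bs_region d j"
  have n: "cmod z = 1" using assms by (simp add: Vtx_def)
  have reg: "z \<in> bs_region d j \<longleftrightarrow> cmod (z - c j) \<le> r" for j
    using n by (simp add: bs_region_def dist_norm norm_minus_commute)
  obtain m where "m < 2 * d" "cmod (z - c m) \<le> r" by (rule circle_region[OF n])
  hence "?Q m" using reg by blast
  hence L: "?Q (LEAST j. ?Q j)" by (rule LeastI)
  hence "cmod (z - c (LEAST j. ?Q j)) \<le> r" using reg by blast
  moreover have "r \<le> cmod (z - c (LEAST j. ?Q j))" using assms L by (simp add: Vtx_def)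
  ultimately have "cmod (z - c (LEAST j. ?Q j)) = r" by simp
  thus ?thesis unfolding bs_map_def by (rule bs_gen_on_circle)
qed

lemma bs_map_disc:
  assumes "cmod z < 1" "j < 2 * d" "cmod (z - c j) \<le> r"
  shows "bs_map d z = bs_gen d j z"
proof -
  let ?Q = "\<lambda>j. j < 2 * d \<and> z \<in> bs_region d j"
  have reg: "z \<in> bs_region d i \<longleftrightarrow> cmod (z - c i) \<le> r" for i
    using assms(1) by (simp add: bs_region_def dist_norm norm_minus_commute)
  have "?Q j" using assms reg by blast
  hence L: "?Q (LEAST j. ?Q j)" by (rule LeastI)
  hence "(LEAST j. ?Q j) = j" using discs_disjoint[OF assms(1) _ _ assms(2,3)] reg by blast
  thus ?thesis by (simp add: bs_map_def)
qed

text \<open>Orthogonality rewrites the map as \<open>(c u - 1) / (u - cnj c)\<close>. The squared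
  modulus of the denominator exceeds that of the numerator by the product of
  \<open>|c|^2 - 1\<close> and \<open>1 - |u|^2\<close>, which is positive inside the disc.\<close>

lemma moebius_disc:
  assumes "u \<noteq> cnj (c j)"
  shows "c j + complex_of_real (r\<^sup>2) / (u - cnj (c j)) = (c j * u - 1) / (u - cnj (c j))"
    "cmod u < 1 \<Longrightarrow> cmod (c j + complex_of_real (r\<^sup>2) / (u - cnj (c j))) < 1"
proof -
  have cc: "c j * cnj (c j) = 1 + complex_of_real (r\<^sup>2)"
    unfolding complex_norm_square[symmetric] center_norm by simp
  have "c j * (u - cnj (c j)) + complex_of_real (r\<^sup>2) = c j * u - 1" using cc by (simp add: algebra_simps)
  thus eq: "c j + complex_of_real (r\<^sup>2) / (u - cnj (c j)) = (c j * u - 1) / (u - cnj (c j))"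
    using assms by (simp add: field_simps)
  assume u: "cmod u < 1"
  have 1: "(cmod (u - cnj (c j)))\<^sup>2 = (cmod u)\<^sup>2 + (cmod (c j))\<^sup>2 - 2 * Re (c j * u)"
    unfolding cmod_power2 by (simp add: power2_eq_square algebra_simps)
  have 2: "(cmod (c j * u - 1))\<^sup>2 = (cmod (c j))\<^sup>2 * (cmod u)\<^sup>2 + 1 - 2 * Re (c j * u)"
    unfolding cmod_power2 by (simp add: power2_eq_square algebra_simps)
  have "0 < ((cmod (c j))\<^sup>2 - 1) * (1 - (cmod u)\<^sup>2)"
    using center_norm[of j] r_pos u by (intro mult_pos_pos) (auto simp: abs_square_less_1)
  hence "(cmod (c j * u - 1))\<^sup>2 < (cmod (u - cnj (c j)))\<^sup>2" unfolding 1 2 by (simp add: algebra_simps)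
  hence "cmod (c j * u - 1) < cmod (u - cnj (c j))" by (rule power_less_imp_less_base) simp
  thus "cmod (c j + complex_of_real (r\<^sup>2) / (u - cnj (c j))) < 1"
    unfolding eq norm_divide by (simp add: divide_less_eq)
qed

text \<open>The inverse of \<open>bs_gen d j\<close>. It lands in region \<open>j\<close>, where the
  Bowen--Series map uses this generator, as soon as \<open>u\<close> is not inside the conjugate
  disc.\<close>

definition pre :: "nat \<Rightarrow> complex \<Rightarrow> complex" where
  "pre j u = c j + complex_of_real (r\<^sup>2) / (u - cnj (c j))"

lemma ne_center: "cmod u < 1 \<Longrightarrow> u \<noteq> c j" "cmod u < 1 \<Longrightarrow> u \<noteq> cnj (c j)"
  using center_gt1[of j] by (auto dest: sym)

lemma pre_facts:
  assumes u: "cmod u < 1" and j: "j < 2 * d" and far: "r \<le> cmod (u - c (2 * d - 1 - j))"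
  shows "cmod (pre j u) < 1" "cmod (pre j u - c j) \<le> r" "bs_map d (pre j u) = u"
proof -
  have un: "u \<noteq> cnj (c j)" using ne_center(2)[OF u] .
  show p1: "cmod (pre j u) < 1" unfolding pre_def by (rule moebius_disc(2)[OF un u])
  have "r \<le> cmod (u - cnj (c j))" using far cnj_center[OF j] by simp
  hence "r\<^sup>2 / cmod (u - cnj (c j)) \<le> r\<^sup>2 / r" using r_pos \<open>r \<le> cmod (u - cnj (c j))\<close>
    by (intro divide_left_mono mult_pos_pos) auto
  hence "r\<^sup>2 / cmod (u - cnj (c j)) \<le> r" using r_pos by (simp add: power2_eq_square)
  moreover have "cmod (pre j u - c j) = r\<^sup>2 / cmod (u - cnj (c j))"
    by (simp add: pre_def norm_divide norm_power)
  ultimately show p2: "cmod (pre j u - c j) \<le> r" by simp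
  have "bs_gen d j (pre j u) = u" using un r_pos by (simp add: bs_gen_def pre_def)
  thus "bs_map d (pre j u) = u" using bs_map_disc[OF p1 j p2] by simp
qed

lemma bs_map_in_disc:
  assumes "cmod z < 1" "z \<in> bs_dom d"
  shows "cmod (bs_map d z) < 1"
proof -
  obtain j where j: "j < 2 * d" "cmod (z - c j) \<le> r"
    using assms by (auto simp: bs_dom_def poly_interior_def not_less)
  define j' where "j' = 2 * d - 1 - j"
  have j': "j' < 2 * d" "2 * d - 1 - j' = j" using j(1) by (auto simp: j'_def)
  have cj: "cnj (c j) = c j'" "cnj (c j') = c j" using cnj_center[OF j(1)] cnj_center[OF j'(1)] j' by (auto simp: j'_def)
  have "bs_map d z = c j' + complex_of_real (r\<^sup>2) / (z - cnj (c j'))"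
    unfolding bs_map_disc[OF assms(1) j] bs_gen_def cj ..
  thus ?thesis using moebius_disc(2)[of z j'] ne_center(2)[OF assms(1)] assms(1) by simp
qed

text \<open>Such a point lies on a side, where the map is conjugation, so a fixed point is real and
  lies in the side disc and in its conjugate. These have the different indices \<open>j\<close> and
  \<open>2 * d - 1 - j\<close>, whose sum is odd, and are disjoint in the open disc.\<close>

lemma no_fixed_point:
  assumes u: "cmod u < 1" "u \<in> bs_dom d" and far: "\<And>j. j < 2 * d \<Longrightarrow> r \<le> cmod (u - c j)"
  shows "bs_map d u \<noteq> u"
proof
  assume fx: "bs_map d u = u"
  obtain j where j: "j < 2 * d" "cmod (u - c j) \<le> r"
    using u by (auto simp: bs_dom_def poly_interior_def not_less)
  have "cmod (u - c j) = r" using far[OF j(1)] j(2) by simp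
  hence "cnj u = u" using fx bs_map_disc[OF u(1) j] bs_gen_on_circle by simp
  hence "cmod (u - c (2 * d - 1 - j)) \<le> r" using dist_cnj[OF j(1), of u] j(2) by simp
  hence "2 * d - 1 - j = j" using discs_disjoint[OF u(1) _ _ j] d2 by simp
  thus False using j(1) by presburger
qed

lemma bs_dom_cases:
  assumes "z \<in> bs_dom d"
  obtains j where "j < 2 * d" "cmod z \<le> 1" "cmod (z - c j) \<le> r"
proof (cases "cmod z = 1")
  case True
  thus ?thesis using that circle_region[OF True] by (metis order.refl)
next
  case False
  hence z: "cmod z < 1" using assms by (simp add: bs_dom_def)
  thus ?thesis using that assms by (auto simp: bs_dom_def poly_interior_def not_less)
qed

definition openreg :: "complex set" where
  "openreg = (\<Union>j<2*d. ball 0 1 \<inter> ball (c j) r)"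

text \<open>For two convex sets whose interiors meet, closure commutes with intersection. The common
  point is taken on the segment from the origin to the centre of the side, which is close enough
  because \<open>|c| < 1 + r\<close>.\<close>

lemma bs_dom_subset_closure: "bs_dom d \<subseteq> closure openreg"
proof
  fix z assume "z \<in> bs_dom d"
  then obtain j where j: "j < 2 * d" "cmod z \<le> 1" "cmod (z - c j) \<le> r" by (rule bs_dom_cases)
  have "z \<in> cball 0 1 \<inter> cball (c j) r" using j by (simp add: dist_norm norm_minus_commute)
  moreover have "cball 0 1 \<inter> cball (c j) r = closure (ball 0 1) \<inter> closure (ball (c j) r)"
    using r_pos by simp
  moreover have "closure (ball 0 1) \<inter> closure (ball (c j) r) = closure (ball 0 1 \<inter> ball (c j) r)"
  proof (rule closure_Int_convex[symmetric])
    have "ball 0 1 \<inter> ball (c j) r \<noteq> {}"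
    proof -
      have lt: "cmod (c j) - r < 1"
      proof (rule ccontr)
        assume "\<not> ?thesis"
        hence "1 + r \<le> cmod (c j)" by simp
        hence "(1 + r)\<^sup>2 \<le> (cmod (c j))\<^sup>2" using r_pos by (intro power_mono) auto
        thus False using center_norm[of j] r_pos by (simp add: power2_eq_square algebra_simps)
      qed
      define s where "s = (max 0 (cmod (c j) - r) + 1) / 2"
      have s: "0 < s" "s < 1" "cmod (c j) - r < s" using lt by (auto simp: s_def max_def)
      define w where "w = complex_of_real (s / cmod (c j)) * c j"
      have c0: "0 < cmod (c j)" using center_gt1[of j] by linarith
      have "cmod w = \<bar>s / cmod (c j)\<bar> * cmod (c j)" unfolding w_def by (simp only: norm_mult norm_of_real)
      hence "cmod w = s" using s c0 by (simp add: abs_mult abs_divide)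
      moreover have "cmod (w - c j) = cmod (c j) - s"
      proof -
        have "w - c j = complex_of_real (s / cmod (c j) - 1) * c j" by (simp add: w_def algebra_simps)
        hence "cmod (w - c j) = \<bar>s / cmod (c j) - 1\<bar> * cmod (c j)" by (simp only: norm_mult norm_of_real)
        also have "\<dots> = \<bar>s - cmod (c j)\<bar>" proof -
          have "\<bar>s / cmod (c j) - 1\<bar> * cmod (c j) = \<bar>(s / cmod (c j) - 1) * cmod (c j)\<bar>" by (simp only: abs_mult abs_norm_cancel)
          moreover have "(s / cmod (c j) - 1) * cmod (c j) = s - cmod (c j)" using c0 by (simp only: left_diff_distrib times_divide_eq_left nonzero_mult_div_cancel_right mult_1)
          ultimately show ?thesis by simp
        qed
        also have "\<dots> = cmod (c j) - s" using s center_gt1[of j] by simp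
        finally show ?thesis .
      qed
      ultimately have "w \<in> ball 0 1 \<inter> ball (c j) r" using s by (simp add: dist_norm norm_minus_commute)
      thus ?thesis by blast
    qed
    thus "rel_interior (ball 0 1) \<inter> rel_interior (ball (c j) r) \<noteq> {}"
      by (simp add: rel_interior_open)
  qed auto
  moreover have "closure (ball 0 1 \<inter> ball (c j) r) \<subseteq> closure openreg"
    using j(1) by (intro closure_mono) (auto simp: openreg_def)
  ultimately show "z \<in> closure openreg" by blast
qed

lemma closure_poly_interior: "closure (poly_interior d) \<subseteq> {z. cmod z \<le> 1 \<and> (\<forall>j<2*d. r \<le> cmod (z - c j))}"
proof (rule closure_minimal)
  show "poly_interior d \<subseteq> {z. cmod z \<le> 1 \<and> (\<forall>j<2*d. r \<le> cmod (z - c j))}"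
    by (auto simp: poly_interior_def intro: less_imp_le)
  have "{z. cmod z \<le> 1 \<and> (\<forall>j<2*d. r \<le> cmod (z - c j))} = cball 0 1 \<inter> (\<Inter>j\<in>{..<2*d}. - ball (c j) r)"
    by (auto simp: dist_norm norm_minus_commute not_less)
  thus "closed {z. cmod z \<le> 1 \<and> (\<forall>j<2*d. r \<le> cmod (z - c j))}"
    by (auto intro!: closed_Int closed_INT closed_Compl)
qed

lemma openreg_subset: "openreg \<subseteq> bs_dom d" "open openreg" "openreg \<subseteq> ball 0 1"
  by (auto simp: openreg_def bs_dom_def poly_interior_def dist_norm norm_minus_commute)

lemma closed_bs_dom: "compact (bs_dom d)"
proof -
  have "poly_interior d = ball 0 1 \<inter> (\<Inter>j\<in>{..<2*d}. - cball (c j) r)"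
    by (auto simp: poly_interior_def dist_norm norm_minus_commute not_le)
  hence "open (poly_interior d)" by (auto intro!: open_Int open_INT)
  thus ?thesis unfolding bs_dom_def by (intro compact_diff) auto
qed

end

section \<open>Maps into the sphere, disc homeomorphisms, defects of polynomial fibres\<close>

lemma cholo_open_image:
  assumes f: "cholo_on U f" "inj_on f U" and V: "open V" "V \<subseteq> U"
  shows "sph_open (f ` V)"
proof -
  have loc: "\<exists>T. sph_open T \<and> f z \<in> T \<and> T \<subseteq> f ` V" if z: "z \<in> V" for z
  proof -
    have "cholo_at U f z" using f(1) z V(2) by (auto simp: cholo_on_def)
    then obtain e where e: "0 < e" "ball z e \<subseteq> U"
      "((\<forall>w\<in>ball z e. f w \<noteq> None) \<and> (ch0 \<circ> f) holomorphic_on ball z e) \<or>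
       ((\<forall>w\<in>ball z e. f w \<noteq> Some 0) \<and> (chinf \<circ> f) holomorphic_on ball z e)"
      unfolding cholo_at_def by blast
    define B where "B = ball z e \<inter> V"
    have B: "open B" "z \<in> B" "B \<subseteq> V" "B \<subseteq> ball z e" "inj_on f B"
      using e V z f(2) by (auto simp: B_def intro: inj_on_subset)
    show ?thesis
      using e(3)
    proof
      assume h: "(\<forall>w\<in>ball z e. f w \<noteq> None) \<and> (ch0 \<circ> f) holomorphic_on ball z e"
      hence eq: "f w = Some (ch0 (f w))" if "w \<in> B" for w
        proof -
        have "f w \<noteq> None" using conjunct1[OF h] subsetD[OF B(4) that] by blast
        thus ?thesis by (auto simp: ch0_def)
      qed
      have "inj_on (ch0 \<circ> f) B"
        by (rule inj_onI) (metis B(5) comp_apply eq inj_onD)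
      moreover have "continuous_on B (ch0 \<circ> f)"
        using h B(4) by (meson holomorphic_on_imp_continuous_on continuous_on_subset)
      ultimately have "open ((ch0 \<circ> f) ` B)" using B(1) by (intro invariance_of_domain) auto
      hence "sph_open (Some ` (ch0 \<circ> f) ` B)" by (rule sph_open_Some_image)
      moreover have "Some ` (ch0 \<circ> f) ` B = f ` B" using eq by (force simp: image_image)
      ultimately show ?thesis using B(2,3) by (intro exI[of _ "f ` B"]) auto
    next
      assume h: "(\<forall>w\<in>ball z e. f w \<noteq> Some 0) \<and> (chinf \<circ> f) holomorphic_on ball z e"
      hence eq: "f w = sinv (chinf (f w))" if "w \<in> B" for w
        proof -
        have "f w \<noteq> Some 0" using conjunct1[OF h] subsetD[OF B(4) that] by blast
        thus ?thesis by (cases "f w") (auto simp: chinf_def sinv_def)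
      qed
      have "inj_on (chinf \<circ> f) B"
        by (rule inj_onI) (metis B(5) comp_apply eq inj_onD)
      moreover have "continuous_on B (chinf \<circ> f)"
        using h B(4) by (meson holomorphic_on_imp_continuous_on continuous_on_subset)
      ultimately have o: "open ((chinf \<circ> f) ` B)" using B(1) by (intro invariance_of_domain) auto
      have "sph_open (sinv ` (chinf \<circ> f) ` B)"
      proof -
        have "sinv ` S = eta ` Some ` S" for S by (auto simp: sinv_def eta_def image_image)
        moreover have "eta ` T = eta -` T" for T using eta_eta by force
        ultimately have "sinv ` (chinf \<circ> f) ` B = {x \<in> topspace sph_top. eta x \<in> Some ` (chinf \<circ> f) ` B}" by auto
        thus ?thesis
          using openin_continuous_map_preimage[OF continuous_eta, of "Some ` (chinf \<circ> f) ` B"] sph_open_Some_image[OF o]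
          by (simp add: openin_sph_top)
      qed
      moreover have "sinv ` (chinf \<circ> f) ` B = f ` B" using eq by (force simp: image_image)
      ultimately show ?thesis using B(2,3) by (intro exI[of _ "f ` B"]) auto
    qed
  qed
  have "openin sph_top (f ` V)"
    by (subst openin_subopen) (use loc in \<open>auto simp: openin_sph_top\<close>)
  thus ?thesis by (simp add: openin_sph_top)
qed

lemma cholo_proj:
  assumes pq: "p holomorphic_on UNIV" "q holomorphic_on UNIV" "\<And>z. p z \<noteq> 0 \<or> q z \<noteq> 0" and U: "open U"
  shows "cholo_on U (\<lambda>z. proj (p z) (q z))"
  unfolding cholo_on_def
proof
  fix z assume z: "z \<in> U"
  have c: "continuous_on UNIV p" "continuous_on UNIV q" using pq by (auto intro: holomorphic_on_imp_continuous_on)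
  show "cholo_at U (\<lambda>z. proj (p z) (q z)) z"
  proof (cases "q z = 0")
    case False
    have "open (q -` (- {0}))" by (rule open_vimage[OF _ c(2)]) (simp add: open_Compl)
    hence "open (U \<inter> q -` (- {0}))" using U by blast
    then obtain e where e: "0 < e" "ball z e \<subseteq> U \<inter> q -` (- {0})" using z False by (elim openE[of _ z]) auto
    have "(\<lambda>w. p w / q w) holomorphic_on ball z e"
      using e(2) pq(1,2) by (intro holomorphic_on_divide) (auto intro: holomorphic_on_subset)
    moreover have "(\<lambda>w. p w / q w) w = (ch0 \<circ> (\<lambda>z. proj (p z) (q z))) w" if "w \<in> ball z e" for w
      using e(2) that by (auto simp: proj_def ch0_def)
    ultimately have "(ch0 \<circ> (\<lambda>z. proj (p z) (q z))) holomorphic_on ball z e" by (rule holomorphic_transform)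
    thus ?thesis unfolding cholo_at_def using e
      by (intro exI[of _ e] conjI disjI1) (auto simp: proj_def)
  next
    case True
    hence "p z \<noteq> 0" using pq(3)[of z] by simp
    have "open (p -` (- {0}))" by (rule open_vimage[OF _ c(1)]) (simp add: open_Compl)
    hence "open (U \<inter> p -` (- {0}))" using U by blast
    then obtain e where e: "0 < e" "ball z e \<subseteq> U \<inter> p -` (- {0})" using z \<open>p z \<noteq> 0\<close> by (elim openE[of _ z]) auto
    have "(\<lambda>w. q w / p w) holomorphic_on ball z e"
      using e(2) pq(1,2) by (intro holomorphic_on_divide) (auto intro: holomorphic_on_subset)
    moreover have "(\<lambda>w. q w / p w) w = (chinf \<circ> (\<lambda>z. proj (p z) (q z))) w" if "w \<in> ball z e" for w
      using e(2) that by (auto simp: proj_def chinf_def)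
    ultimately have "(chinf \<circ> (\<lambda>z. proj (p z) (q z))) holomorphic_on ball z e" by (rule holomorphic_transform)
    thus ?thesis unfolding cholo_at_def using e
      by (intro exI[of _ e] conjI disjI2) (auto simp: proj_def)
  qed
qed

lemma holomorphic_hp:
  "(\<lambda>z. hp n p z 1) holomorphic_on S" "(\<lambda>z. hp n p 1 z) holomorphic_on S"
  unfolding hp_def by (auto intro!: holomorphic_intros)

lemma rmap_open_image:
  assumes r: "rpair n N D" and inj: "inj_on (rmap n N D) U" and U: "sph_open U"
  shows "sph_open (rmap n N D ` U)"
proof -
  let ?R = "rmap n N D"
  have o: "open {z. Some z \<in> U}" "open {w. sinv w \<in> U}" using U sph_open_iff by auto
  have "cholo_on {z. Some z \<in> U} (\<lambda>z. proj (hp n N z 1) (hp n D z 1))"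
    by (rule cholo_proj) (use rpair_hp[OF r] o in \<open>auto intro: holomorphic_hp\<close>)
  hence c1: "cholo_on {z. Some z \<in> U} (\<lambda>z. ?R (Some z))" by (simp add: Some_eq_proj rmap_proj[OF r])
  have "cholo_on {z. sinv z \<in> U} (\<lambda>z. proj (hp n N 1 z) (hp n D 1 z))"
    by (rule cholo_proj) (use rpair_hp[OF r] o in \<open>auto intro: holomorphic_hp\<close>)
  hence c2: "cholo_on {z. sinv z \<in> U} (\<lambda>z. ?R (sinv z))" by (simp add: sinv_eq_proj rmap_proj[OF r])
  have i1: "inj_on (\<lambda>z. ?R (Some z)) {z. Some z \<in> U}"
    using inj by (auto simp: inj_on_def)
  have i2: "inj_on (\<lambda>z. ?R (sinv z)) {z. sinv z \<in> U}"
  proof (rule inj_onI)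
    fix x y assume "x \<in> {z. sinv z \<in> U}" "y \<in> {z. sinv z \<in> U}" "?R (sinv x) = ?R (sinv y)"
    hence "sinv x = sinv y" using inj by (auto dest: inj_onD)
    thus "x = y" by (auto simp: sinv_def split: if_splits)
  qed
  have "sph_open ((\<lambda>z. ?R (Some z)) ` {z. Some z \<in> U})" by (rule cholo_open_image[OF c1 i1 o(1)]) simp
  moreover have "sph_open ((\<lambda>z. ?R (sinv z)) ` {z. sinv z \<in> U})" by (rule cholo_open_image[OF c2 i2 o(2)]) simp
  moreover have "?R ` U = (\<lambda>z. ?R (Some z)) ` {z. Some z \<in> U} \<union> (\<lambda>z. ?R (sinv z)) ` {z. sinv z \<in> U}"
  proof (rule set_eqI, rule iffI)
    fix s assume "s \<in> ?R ` U"
    then obtain x where x: "x \<in> U" "s = ?R x" by blast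
    show "s \<in> (\<lambda>z. ?R (Some z)) ` {z. Some z \<in> U} \<union> (\<lambda>z. ?R (sinv z)) ` {z. sinv z \<in> U}"
    proof (cases x)
      case None
      hence "x = sinv 0" by (simp add: sinv_def)
      thus ?thesis using x by blast
    qed (use x in blast)
  qed auto
  ultimately show ?thesis by (metis openin_Un openin_sph_top)
qed

lemma continuous_preimage_open:
  assumes "continuous_map (top_of_set T) sph_top f" "sph_open U"
  obtains V where "open V" "{x \<in> T. f x \<in> U} = T \<inter> V"
proof -
  have "openin (top_of_set T) {x \<in> T. f x \<in> U}"
    using openin_continuous_map_preimage[OF assms(1), of U] assms(2) by (simp add: openin_sph_top)
  thus ?thesis using that unfolding openin_open by blast
qed

lemma continuous_image_closure:
  assumes f: "continuous_map (top_of_set T) sph_top f" and C: "closedin sph_top C" and T: "closed T"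
    and S: "S \<subseteq> T" "f ` S \<subseteq> C"
  shows "f ` closure S \<subseteq> C"
proof -
  have "closedin (top_of_set T) {x \<in> T. f x \<in> C}"
    using closedin_continuous_map_preimage[OF f C] by simp
  hence "closed {x \<in> T. f x \<in> C}" using T closedin_closed_trans by blast
  hence "closure S \<subseteq> {x \<in> T. f x \<in> C}" using S by (intro closure_minimal) auto
  thus ?thesis by blast
qed

lemma disc_homeomorphism_parts:
  fixes \<phi> :: "complex \<Rightarrow> complex"
  assumes "homeomorphism (cball 0 1) (cball 0 1) \<phi> \<phi>i"
  shows "\<phi> ` ball 0 1 = ball 0 1" "\<phi> ` sphere 0 1 = sphere 0 1"
proof -
  have sub: "f ` ball 0 1 \<subseteq> ball 0 1" if f: "homeomorphism (cball 0 1) (cball 0 1) f g" for f g :: "complex \<Rightarrow> complex"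
  proof -
    have bc: "ball 0 1 \<subseteq> cball (0::complex) 1" by (rule ball_subset_cball)
    have c: "continuous_on (ball 0 1) f" using f bc unfolding homeomorphism_def by (meson continuous_on_subset)
    have "inj_on f (cball 0 1)" using f unfolding homeomorphism_def by (metis inj_on_inverseI)
    hence "inj_on f (ball 0 1)" using bc by (rule inj_on_subset)
    hence "open (f ` ball 0 1)" by (intro invariance_of_domain c) auto
    moreover have "f ` ball 0 1 \<subseteq> cball 0 1" using f bc unfolding homeomorphism_def by blast
    ultimately have "f ` ball 0 1 \<subseteq> interior (cball 0 1)" by (intro interior_maximal)
    thus ?thesis by simp
  qed
  have s1: "\<phi> ` ball 0 1 \<subseteq> ball 0 1" using sub[OF assms] .
  have s2: "\<phi>i ` ball 0 1 \<subseteq> ball 0 1" using sub homeomorphism_sym assms by blast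
  have inv: "\<phi> (\<phi>i y) = y" if "y \<in> cball 0 1" for y using assms that unfolding homeomorphism_def by blast
  have inv': "\<phi>i (\<phi> y) = y" if "y \<in> cball 0 1" for y using assms that unfolding homeomorphism_def by blast
  have im: "\<phi> ` cball 0 1 = cball 0 1" using assms unfolding homeomorphism_def by blast
  show b: "\<phi> ` ball 0 1 = ball 0 1"
  proof
    show "ball 0 1 \<subseteq> \<phi> ` ball 0 1"
    proof
      fix y :: complex assume y: "y \<in> ball 0 1"
      hence "\<phi> (\<phi>i y) = y" by (intro inv) simp
      moreover have "\<phi>i y \<in> ball 0 1" using y s2 by blast
      ultimately show "y \<in> \<phi> ` ball 0 1" by (metis imageI)
    qed
  qed (rule s1)
  have inj: "inj_on \<phi> (cball 0 1)" using inv' by (rule inj_on_inverseI)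
  have sph: "sphere 0 1 = cball (0::complex) 1 - ball 0 1" by auto
  have "\<phi> ` (cball 0 1 - ball 0 1) = \<phi> ` cball 0 1 - \<phi> ` ball 0 1"
    by (rule inj_on_image_set_diff[OF inj]) auto
  thus "\<phi> ` sphere 0 1 = sphere 0 1" unfolding sph im b .
qed

text \<open>The defect of a fibre is the sum of the orders of the zeros of \<open>pderiv P\<close>
  in it, so all defects together make up the degree of the derivative.\<close>

lemma poly_critical_value_sum:
  fixes P :: "complex poly"
  assumes deg: "2 \<le> degree P"
  defines "CV \<equiv> poly P ` {c. poly (pderiv P) c = 0}"
  shows "(\<Sum>w\<in>CV. degree P - card {x. poly P x = w}) \<le> degree P - 1"
proof -
  have P'n: "pderiv P \<noteq> 0" using deg by (simp add: pderiv_eq_0_iff)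
  have finC: "finite {c. poly (pderiv P) c = 0}" using P'n by (rule poly_roots_finite)
  define q where "q w = P - [:w:]" for w
  have dq: "degree (q w) = degree P" for w
  proof -
    have "degree (P + [:- w:]) = degree P" using deg by (intro degree_add_eq_left) simp
    moreover have "P + [:- w:] = P - [:w:]" by simp
    ultimately show ?thesis unfolding q_def by metis
  qed
  have qn: "q w \<noteq> 0" for w using dq[of w] deg by auto
  have q': "pderiv (q w) = pderiv P" for w by (simp add: q_def pderiv_diff pderiv_pCons)
  have fib: "{x. poly P x = w} = {x. poly (q w) x = 0}" for w by (auto simp: q_def)
  have fin: "finite {x. poly P x = w}" for w unfolding fib using qn by (rule poly_roots_finite)
  have ord: "order x (q w) = Suc (order x (pderiv P))" if "poly P x = w" for x w
    using order_pderiv[of "q w" x] P'n q' that order_root[of "q w" x] qn by (auto simp: q_def)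
  have one: "degree P - card {x. poly P x = w} = (\<Sum>x | poly P x = w. order x (pderiv P))" for w
  proof -
    have "degree P = (\<Sum>x | poly P x = w. order x (q w))"
      using degree_eq_sum_orders[OF qn[of w]] dq[of w] fib[of w] by simp
    also have "\<dots> = (\<Sum>x | poly P x = w. 1 + order x (pderiv P))" using ord by (intro sum.cong) auto
    also have "\<dots> = card {x. poly P x = w} + (\<Sum>x | poly P x = w. order x (pderiv P))" by (simp only: sum.distrib card_eq_sum)
    finally show ?thesis by simp
  qed
  have "(\<Sum>w\<in>CV. degree P - card {x. poly P x = w}) = (\<Sum>w\<in>CV. \<Sum>x | poly P x = w. order x (pderiv P))"
    by (simp only: one)
  also have "\<dots> = (\<Sum>w\<in>CV. \<Sum>x | x \<in> {c. poly (pderiv P) c = 0} \<and> poly P x = w. order x (pderiv P))"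
    by (rule sum.cong[OF refl], rule sum.mono_neutral_right[OF fin]) (use P'n in \<open>auto simp: order_root\<close>)
  also have "\<dots> = (\<Sum>x | poly (pderiv P) x = 0. order x (pderiv P))"
    by (rule sum.group[OF finC]) (use finC in \<open>auto simp: CV_def\<close>)
  also have "\<dots> = degree (pderiv P)" by (rule degree_eq_sum_orders[OF P'n, symmetric])
  finally show ?thesis by (simp add: degree_pderiv)
qed

section \<open>Critical points of the uniformizing rational map\<close>

locale mated = bs_geometry d + attracting_poly P a for d P a +
  fixes N0 D0 :: "complex poly" and \<phi> \<phi>i :: "complex \<Rightarrow> complex" and F :: "csph \<Rightarrow> csph"
    and XP XG :: "complex \<Rightarrow> csph" and Dom :: "csph set" and \<psi> h hi :: "complex \<Rightarrow> complex"
  assumes degP: "degree P = 2 * d - 1" and rp: "rpair (2 * d) N0 D0"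
    and hom: "homeomorphism (cball 0 1) (cball 0 1) \<phi> \<phi>i"
    and contF: "continuous_map (subtopology sph_top (sph_top closure_of mating_set d P \<phi> XP XG)) sph_top F"
    and contXP: "continuous_map (top_of_set (filled_julia P)) sph_top XP"
    and holXP: "cholo_on (interior (filled_julia P)) XP" and injXP: "inj_on XP (interior (filled_julia P))"
    and contXG: "continuous_map (top_of_set (cball 0 1)) sph_top XG"
    and holXG: "cholo_on (ball 0 1) XG" and injXG: "inj_on XG (ball 0 1)"
    and cover: "XP ` filled_julia P \<union> XG ` cball 0 1 = UNIV"
    and semP: "\<And>z. z \<in> filled_julia P \<Longrightarrow> XP (poly P z) = F (XP z)"
    and semG: "\<And>w. w \<in> \<phi> ` bs_dom d \<Longrightarrow> XG (\<phi> (bs_map d (\<phi>i w))) = F (XG w)"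
    and bott: "boettcher P \<psi>" and hhom: "homeomorphism (sphere 0 1) (sphere 0 1) h hi"
    and glue: "\<And>z w. z \<in> filled_julia P \<Longrightarrow> w \<in> cball 0 1 \<Longrightarrow>
      XP z = XG w \<longleftrightarrow> equivclp (mate_rel \<psi> h) (Inl z) (Inr w)"
    and etaDom: "eta ` Dom = - (sph_top closure_of Dom)"
    and injR: "inj_on (rmap (2 * d) N0 D0) Dom"
    and RDom: "rmap (2 * d) N0 D0 ` Dom = sph_top interior_of mating_set d P \<phi> XP XG"
    and FR: "\<And>x. x \<in> Dom \<Longrightarrow> F (rmap (2 * d) N0 D0 x) = rmap (2 * d) N0 D0 (eta x)"
begin

abbreviation "R \<equiv> rmap (2 * d) N0 D0"
abbreviation "K \<equiv> filled_julia P"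
abbreviation "\<M> \<equiv> mating_set d P \<phi> XP XG"
abbreviation "\<Omega> \<equiv> sph_top interior_of \<M>"
text \<open>The Julia point glued to the circle point \<open>w\<close>, obtained by solving
  \<open>w = h (cnj \<zeta>)\<close> for \<open>\<zeta>\<close>.\<close>

definition "q w = \<psi> (cnj (hi w))"

lemma hi_facts: "cmod w = 1 \<Longrightarrow> cmod (hi w) = 1" "cmod w = 1 \<Longrightarrow> h (hi w) = w"
  "cmod w = 1 \<Longrightarrow> cmod (h w) = 1" "cmod w = 1 \<Longrightarrow> hi (h w) = w"
proof -
  have s: "hi ` sphere 0 1 = sphere 0 1" "h ` sphere 0 1 = sphere 0 1"
    "\<forall>x\<in>sphere 0 1. hi (h x) = x" "\<forall>x\<in>sphere 0 1. h (hi x) = x"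
    using hhom unfolding homeomorphism_def by blast+
  show "cmod (hi w) = 1" "cmod (h w) = 1" if "cmod w = 1"
    using imageI[of w "sphere 0 1" hi] imageI[of w "sphere 0 1" h] that by (simp_all add: s)
  show "cmod w = 1 \<Longrightarrow> h (hi w) = w" "cmod w = 1 \<Longrightarrow> hi (h w) = w" using s by auto
qed

text \<open>The map \<open>\<kappa>\<close> replaces each circle point by the point of the filled
  Julia set glued to it. It takes equal values on generating pairs, hence on whole equivalence
  classes, and thus shows that the generated relation glues nothing more.\<close>

lemma glue_iff:
  assumes z: "z \<in> K" and w: "cmod w \<le> 1"
  shows "XP z = XG w \<longleftrightarrow> cmod w = 1 \<and> z = q w"
proof -
  define \<kappa> where "\<kappa> x = (case x of Inl z \<Rightarrow> Inl z | Inr w \<Rightarrow> if cmod w = 1 then Inl (q w) else Inr w)"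
    for x :: "complex + complex"
  have base: "\<kappa> x = \<kappa> y" if "mate_rel \<psi> h x y" for x y
  proof -
    obtain ze where ze: "cmod ze = 1" "x = Inl (\<psi> ze)" "y = Inr (h (cnj ze))"
      using \<open>mate_rel \<psi> h x y\<close> unfolding mate_rel_def by blast
    have "cmod (h (cnj ze)) = 1" "hi (h (cnj ze)) = cnj ze" using hi_facts ze(1) by simp_all
    thus ?thesis using ze by (simp add: \<kappa>_def q_def)
  qed
  have inv: "\<kappa> x = \<kappa> y" if "equivclp (mate_rel \<psi> h) x y" for x y
    using that by (induction rule: equivclp_induct) (auto dest: base)
  have "equivclp (mate_rel \<psi> h) (Inl z) (Inr w) \<longleftrightarrow> cmod w = 1 \<and> z = q w"
  proof
    assume "equivclp (mate_rel \<psi> h) (Inl z) (Inr w)"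
    from inv[OF this] show "cmod w = 1 \<and> z = q w" by (simp add: \<kappa>_def split: if_splits)
  next
    assume e: "cmod w = 1 \<and> z = q w"
    have "mate_rel \<psi> h (Inl z) (Inr w)" unfolding mate_rel_def
      by (intro exI[of _ "cnj (hi w)"]) (use e hi_facts in \<open>simp add: q_def\<close>)
    thus "equivclp (mate_rel \<psi> h) (Inl z) (Inr w)" by (rule r_into_equivclp)
  qed
  thus ?thesis using glue[OF z] w by simp
qed

lemma psi_conj:
  assumes "1 \<le> cmod z"
  shows "\<psi> (z ^ degree P) = poly P (\<psi> z)"
proof -
  have c: "continuous_on {z. 1 \<le> cmod z} \<psi>" and e: "\<And>z. 1 < cmod z \<Longrightarrow> \<psi> (z ^ degree P) = poly P (\<psi> z)"
    using bott unfolding boettcher_def by blast+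
  have ge: "{z. 1 \<le> cmod z} \<subseteq> closure {z. 1 < cmod z}"
  proof
    fix z :: complex assume z: "z \<in> {z. 1 \<le> cmod z}"
    show "z \<in> closure {z. 1 < cmod z}" unfolding closure_approachable
    proof (intro allI impI)
      fix e :: real assume e: "0 < e"
      have z0: "0 < cmod z" using z by (auto intro: less_le_trans[OF zero_less_one])
      define t where "t = 1 + e / (2 * cmod z)"
      have t: "1 < t" using e z0 by (simp add: t_def)
      have "cmod (of_real t * z) = t * cmod z" using t by (simp add: norm_mult)
      moreover have "1 < t * cmod z" using t z by (simp add: less_1_mult' le_less_trans less_le_trans[of 1 t] mult_le_cancel_left1)
      moreover have "dist (of_real t * z) z = e / 2"
      proof -
        have "of_real t * z - z = of_real (e / (2 * cmod z)) * z" by (simp add: t_def algebra_simps)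
        thus ?thesis using z0 e by (simp add: dist_norm norm_mult norm_divide)
      qed
      ultimately show "\<exists>y\<in>{z. 1 < cmod z}. dist y z < e"
        using e by (intro bexI[of _ "of_real t * z"]) auto
    qed
  qed
  have p: "1 \<le> cmod z ^ n" if "1 \<le> cmod z" for z :: complex and n
    using that by (rule one_le_power)
  have cc: "continuous_on {z. 1 \<le> cmod z} (\<lambda>z. \<psi> (z ^ degree P) - poly P (\<psi> z))"
    by (intro continuous_intros continuous_on_compose2[OF c] c) (auto simp: norm_power p)
  have cl: "closed {z :: complex. 1 \<le> cmod z}" by (intro closed_Collect_le continuous_intros)
  have "closure {z :: complex. 1 < cmod z} = {z. 1 \<le> cmod z}"
    proof (rule antisym[OF closure_minimal[OF _ cl] ge])
    show "{z :: complex. 1 < cmod z} \<subseteq> {z. 1 \<le> cmod z}" by (auto intro: less_imp_le)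
  qed
  note cle = this
  have "\<psi> (z ^ degree P) - poly P (\<psi> z) = 0"
  proof (rule continuous_constant_on_closure[where f = "\<lambda>z. \<psi> (z ^ degree P) - poly P (\<psi> z)"])
    show "continuous_on (closure {z. 1 < cmod z}) (\<lambda>z. \<psi> (z ^ degree P) - poly P (\<psi> z))"
      unfolding cle by (rule cc)
    show "z \<in> closure {z. 1 < cmod z}" unfolding cle using assms by simp
    show "\<psi> (x ^ degree P) - poly P (\<psi> x) = 0" if "x \<in> {z. 1 < cmod z}" for x
      using e[of x] that by simp
  qed
  thus ?thesis by simp
qed

lemma psi_circle: "cmod ze = 1 \<Longrightarrow> \<psi> ze \<in> K"
proof -
  assume z: "cmod ze = 1"
  have c: "continuous_on {z. 1 \<le> cmod z} \<psi>" using bott unfolding boettcher_def by blast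
  have "compact (\<psi> ` sphere 0 1)"
    by (intro compact_continuous_image continuous_on_subset[OF c]) auto
  hence b: "bounded (\<psi> ` sphere 0 1)" by (rule compact_imp_bounded)
  have "(poly P ^^ n) (\<psi> ze) \<in> \<psi> ` sphere 0 1" for n
  proof (induction n)
    case (Suc n)
    then obtain w where w: "cmod w = 1" "(poly P ^^ n) (\<psi> ze) = \<psi> w" by auto
    have "(poly P ^^ Suc n) (\<psi> ze) = \<psi> (w ^ degree P)" using w psi_conj[of w] by simp
    moreover have "w ^ degree P \<in> sphere 0 1" using w(1) by (simp add: norm_power)
    ultimately show ?case by (metis imageI)
  qed (use z in auto)
  hence "bounded (range (\<lambda>n. (poly P ^^ n) (\<psi> ze)))" by (intro bounded_subset[OF b]) blast
  thus ?thesis by (simp add: filled_julia_def)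
qed

lemma q_in_K: "cmod w = 1 \<Longrightarrow> q w \<in> K"
  unfolding q_def by (rule psi_circle) (simp add: hi_facts)

lemma XP_q: "cmod w = 1 \<Longrightarrow> XP (q w) = XG w"
  using glue_iff[OF q_in_K] by simp

text \<open>Near infinity \<open>\<psi>\<close> is comparable to the identity, so exterior points
  close to \<open>z\<close> come from a compact annulus, and \<open>z\<close> is a value of
  \<open>\<psi>\<close> on the closed exterior of the disc. As \<open>z\<close> belongs to the
  filled Julia set, the parameter has modulus 1.\<close>

lemma frontier_subset_q:
  assumes z: "z \<in> frontier K"
  obtains w where "cmod w = 1" "z = q w"
proof -
  have c: "continuous_on {z. 1 \<le> cmod z} \<psi>" and im: "\<psi> ` {z. 1 < cmod z} = - K"
    and lim: "((\<lambda>z. \<psi> z / z) \<longlongrightarrow> 1) at_infinity"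
    using bott unfolding boettcher_def by blast+
  have "\<forall>\<^sub>F x in at_infinity. 1 / 2 < cmod (\<psi> x / x)"
    using tendsto_norm[OF lim] by (rule order_tendstoD) simp
  then obtain \<rho> where \<rho>: "\<And>x. \<rho> \<le> cmod x \<Longrightarrow> 1 / 2 < cmod (\<psi> x / x)"
    unfolding eventually_at_infinity by blast
  define \<rho>' where "\<rho>' = max (max \<rho> 1) (2 * (cmod z + 1))"
  have far: "cmod z + 1 \<le> cmod (\<psi> x)" if "\<rho>' \<le> cmod x" for x
  proof -
    have x: "\<rho> \<le> cmod x" "1 \<le> cmod x" "2 * (cmod z + 1) \<le> cmod x" using that by (auto simp: \<rho>'_def)
    have "1 / 2 < cmod (\<psi> x) / cmod x" using \<rho>[OF x(1)] by (simp add: norm_divide)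
    moreover have "0 < cmod x" using x(2) by linarith
    ultimately have "cmod x < 2 * cmod (\<psi> x)" by (simp add: field_simps)
    with x(3) have "2 * (cmod z + 1) < 2 * cmod (\<psi> x)" by (rule le_less_trans)
    thus ?thesis by simp
  qed
  let ?C = "{x. 1 \<le> cmod x} \<inter> cball 0 \<rho>'"
  have "compact ?C" by (intro closed_Int_compact closed_Collect_le continuous_intros) auto
  hence "compact (\<psi> ` ?C)" by (intro compact_continuous_image continuous_on_subset[OF c]) auto
  hence cl: "closed (\<psi> ` ?C \<union> - ball 0 (cmod z + 1))" by (auto intro: compact_imp_closed simp: closed_Compl)
  have "- K \<subseteq> \<psi> ` ?C \<union> - ball 0 (cmod z + 1)"
    unfolding im[symmetric]
  proof (rule image_subsetI)
    fix x :: complex assume x: "x \<in> {z. 1 < cmod z}"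
    show "\<psi> x \<in> \<psi> ` ?C \<union> - ball 0 (cmod z + 1)"
    proof (cases "cmod x \<le> \<rho>'")
      case True thus ?thesis using x by auto
    next
      case False thus ?thesis using far[of x] by auto
    qed
  qed
  hence "closure (- K) \<subseteq> \<psi> ` ?C \<union> - ball 0 (cmod z + 1)" using cl by (rule closure_minimal)
  moreover have "z \<in> closure (- K)" using z by (simp add: frontier_closures)
  ultimately obtain x where x: "1 \<le> cmod x" "z = \<psi> x" by auto
  have "z \<in> K" using z compact_filled_julia by (metis compact_imp_closed frontier_subset_closed subsetD)
  hence "\<not> 1 < cmod x" using im x(2) by blast
  hence x1: "cmod x = 1" using x(1) by simp
  show ?thesis
  proof (rule that)
    show "cmod (h (cnj x)) = 1" using hi_facts x1 by simp
    show "z = q (h (cnj x))" using hi_facts(4)[of "cnj x"] x1 x(2) by (simp add: q_def)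
  qed
qed

lemma K_cases:
  assumes "z \<in> K"
  obtains "z \<in> interior K" | w where "cmod w = 1" "z = q w" "z \<in> frontier K"
proof (cases "z \<in> interior K")
  case False
  hence "z \<in> frontier K" using assms closure_subset by (auto simp: frontier_def)
  thus ?thesis using that(2) frontier_subset_q by metis
qed (use that in blast)

text \<open>In the interior this is part of the mating. A frontier point is \<open>q w\<close> for
  some circle point \<open>w\<close>, and the gluing allows only one partner for
  \<open>w\<close>.\<close>

lemma inj_XP: "inj_on XP K"
proof (rule inj_onI)
  fix x y assume x: "x \<in> K" and y: "y \<in> K" and e: "XP x = XP y"
  have *: "u = v" if "u \<in> K" "v \<in> K" "XP u = XP v" "cmod w = 1" "u = q w" for u v w
    using glue_iff[OF that(2), of w] XP_q[OF that(4)] that by simp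
  show "x = y"
  proof (rule K_cases[OF x])
    assume xi: "x \<in> interior K"
    show "x = y"
    proof (rule K_cases[OF y])
      assume "y \<in> interior K" thus ?thesis using injXP xi e by (auto dest: inj_onD)
    next
      fix w assume "cmod w = 1" "y = q w" thus ?thesis using *[of y x w] x y e by simp
    qed
  next
    fix w assume "cmod w = 1" "x = q w" thus ?thesis using *[of x y w] x y e by simp
  qed
qed

lemma \<phi>_facts: "u \<in> cball 0 1 \<Longrightarrow> \<phi>i (\<phi> u) = u" "cmod u < 1 \<Longrightarrow> cmod (\<phi> u) < 1" "cmod u = 1 \<Longrightarrow> cmod (\<phi> u) = 1"
  "cmod u \<le> 1 \<Longrightarrow> cmod (\<phi> u) \<le> 1" "cmod w \<le> 1 \<Longrightarrow> \<exists>u. cmod u \<le> 1 \<and> w = \<phi> u"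
proof -
  show "u \<in> cball 0 1 \<Longrightarrow> \<phi>i (\<phi> u) = u" using hom unfolding homeomorphism_def by blast
  show "cmod u < 1 \<Longrightarrow> cmod (\<phi> u) < 1" using disc_homeomorphism_parts(1)[OF hom] imageI[of u "ball 0 1" \<phi>] by simp
  show "cmod u = 1 \<Longrightarrow> cmod (\<phi> u) = 1" using disc_homeomorphism_parts(2)[OF hom] imageI[of u "sphere 0 1" \<phi>] by simp
  have im: "\<phi> ` cball 0 1 = cball 0 1" using hom unfolding homeomorphism_def by blast
  show "cmod u \<le> 1 \<Longrightarrow> cmod (\<phi> u) \<le> 1" using im imageI[of u "cball 0 1" \<phi>] by simp
  assume "cmod w \<le> 1"
  hence "w \<in> \<phi> ` cball 0 1" using im by simp
  thus "\<exists>u. cmod u \<le> 1 \<and> w = \<phi> u" by auto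
qed

lemma \<phi>_inj: "cmod u \<le> 1 \<Longrightarrow> cmod v \<le> 1 \<Longrightarrow> \<phi> u = \<phi> v \<Longrightarrow> u = v"
  using \<phi>_facts(1) by (metis mem_cball_0)

lemma \<phi>_norm_lt: "cmod u \<le> 1 \<Longrightarrow> cmod (\<phi> u) < 1 \<Longrightarrow> cmod u < 1"
  using \<phi>_facts(3)[of u] by (cases "cmod u = 1") auto

lemma XG_notin: "cmod w < 1 \<Longrightarrow> XG w \<notin> XP ` K"
proof
  assume w: "cmod w < 1" and "XG w \<in> XP ` K"
  then obtain z where "z \<in> K" "XP z = XG w" by (metis imageE)
  thus False using glue_iff[of z w] w by simp
qed

lemma XG_inj: "cmod w < 1 \<Longrightarrow> cmod w' \<le> 1 \<Longrightarrow> XG w = XG w' \<Longrightarrow> w = w'"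
proof (cases "cmod w' = 1")
  case True
  assume "cmod w < 1" "XG w = XG w'"
  thus ?thesis using XG_notin[of w] XP_q[OF True] q_in_K[OF True] by (metis imageI)
next
  case False
  assume "cmod w < 1" "cmod w' \<le> 1" "XG w = XG w'"
  thus ?thesis using False injXG by (auto dest: inj_onD)
qed

lemma sphere_cases:
  obtains z where "z \<in> K" "y = XP z" | u where "cmod u < 1" "y = XG (\<phi> u)"
proof (cases "y \<in> XP ` K")
  case False
  then obtain w where w: "cmod w \<le> 1" "y = XG w" using cover by auto
  have "cmod w < 1"
  proof (rule ccontr)
    assume "\<not> cmod w < 1"
    hence "cmod w = 1" using w(1) by simp
    thus False using False w(2) XP_q[of w] q_in_K[of w] by (metis imageI)
  qed
  moreover obtain u where u: "cmod u \<le> 1" "w = \<phi> u" using \<phi>_facts(5)[OF w(1)] by blast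
  ultimately have "cmod u < 1" using \<phi>_norm_lt by simp
  thus ?thesis using u(2) w(2) by (intro that(2)[of u]) auto
qed (use that(1) in blast)

lemma XG_in_mating_iff: "cmod u < 1 \<Longrightarrow> XG (\<phi> u) \<in> \<M> \<longleftrightarrow> u \<in> bs_dom d"
proof
  assume u: "cmod u < 1" and m: "XG (\<phi> u) \<in> \<M>"
  have "XG (\<phi> u) \<notin> XP ` K" using XG_notin \<phi>_facts(2)[OF u] by blast
  then obtain v where v: "v \<in> bs_dom d" "XG (\<phi> u) = XG (\<phi> v)" using m by (auto simp: mating_set_def)
  have v1: "cmod v \<le> 1" using v(1) by (auto simp: bs_dom_def)
  have "\<phi> u = \<phi> v" using XG_inj[OF \<phi>_facts(2)[OF u] \<phi>_facts(4)[OF v1] v(2)] .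
  thus "u \<in> bs_dom d" using \<phi>_inj[of u v] u v1 v(1) by simp
qed (auto simp: mating_set_def)

lemma compl_mating: "- \<M> = XG ` \<phi> ` poly_interior d"
proof (rule set_eqI)
  fix y
  show "y \<in> - \<M> \<longleftrightarrow> y \<in> XG ` \<phi> ` poly_interior d"
  proof
    assume y: "y \<in> - \<M>"
    hence "y \<notin> XP ` K" by (auto simp: mating_set_def)
    then obtain u where u: "cmod u < 1" "y = XG (\<phi> u)" by (rule_tac sphere_cases[of y]) auto
    hence "u \<in> poly_interior d" using y XG_in_mating_iff by (auto simp: bs_dom_def)
    thus "y \<in> XG ` \<phi> ` poly_interior d" using u(2) by blast
  next
    assume "y \<in> XG ` \<phi> ` poly_interior d"
    then obtain u where u: "u \<in> poly_interior d" "y = XG (\<phi> u)" by blast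
    thus "y \<in> - \<M>" using XG_in_mating_iff[of u] by (auto simp: bs_dom_def poly_interior_def)
  qed
qed

lemma cont_XG\<phi>: "continuous_map (top_of_set (cball 0 1)) sph_top (XG \<circ> \<phi>)"
proof (rule continuous_map_compose[OF _ contXG])
  show "continuous_map (top_of_set (cball 0 1)) (top_of_set (cball 0 1)) \<phi>"
    using hom unfolding homeomorphism_def
    by (metis continuous_map_in_subtopology continuous_map_iff_continuous image_subset_iff_funcset order_refl topspace_euclidean_subtopology)
qed

lemma compact_image_closed:
  assumes "continuous_map (top_of_set T) sph_top f" "compact S" "S \<subseteq> T"
  shows "closedin sph_top (f ` S)"
proof -
  have "compactin (top_of_set T) S" using assms by (simp add: compactin_subtopology)
  hence "compactin sph_top (f ` S)" by (rule image_compactin[OF _ assms(1)])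
  thus ?thesis by (rule compactin_imp_closedin[OF Hausdorff_sph])
qed

lemma closed_XP: "closedin sph_top (XP ` K)"
  using compact_image_closed[OF contXP compact_filled_julia] by simp

lemma closed_mating: "closedin sph_top \<M>"
proof -
  have "closedin sph_top ((XG \<circ> \<phi>) ` bs_dom d)"
    by (rule compact_image_closed[OF cont_XG\<phi> closed_bs_dom]) (auto simp: bs_dom_def)
  thus ?thesis unfolding mating_set_def using closed_XP by (simp add: image_comp closedin_Un)
qed

lemma interior_in_\<Omega>: "XP ` interior K \<subseteq> \<Omega>" "XG ` \<phi> ` openreg \<subseteq> \<Omega>"
proof -
  have "openin sph_top (XP ` interior K)"
    using cholo_open_image[OF holXP injXP, of "interior K"] by (simp add: openin_sph_top)
  thus "XP ` interior K \<subseteq> \<Omega>"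
    by (rule interior_of_maximal[rotated]) (use interior_subset in \<open>auto simp: mating_set_def\<close>)
  have sub: "openreg \<subseteq> cball 0 1" using openreg_subset(3) by (auto simp: subset_iff)
  have "continuous_on openreg \<phi>"
    using hom sub unfolding homeomorphism_def by (blast intro: continuous_on_subset)
  moreover have "inj_on \<phi> openreg"
    by (rule inj_onI, rule \<phi>_inj) (use sub in \<open>auto simp: subset_iff\<close>)
  ultimately have "open (\<phi> ` openreg)" by (intro invariance_of_domain openreg_subset)
  moreover have "\<phi> ` openreg \<subseteq> ball 0 1" using openreg_subset(3) \<phi>_facts(2) by (auto simp: subset_iff)
  ultimately have "openin sph_top (XG ` \<phi> ` openreg)"
    using cholo_open_image[OF holXG injXG] by (simp add: openin_sph_top)
  thus "XG ` \<phi> ` openreg \<subseteq> \<Omega>"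
    by (rule interior_of_maximal[rotated]) (use openreg_subset(1) in \<open>auto simp: mating_set_def\<close>)
qed

text \<open>Both halves of the mating set are limits of interior points: the filled Julia set
  because its frontier lies in the closure of \<open>A\<close>, the Bowen--Series domain because it
  is the closure of \<open>openreg\<close>.\<close>

lemma closure_\<Omega>: "sph_top closure_of \<Omega> = \<M>"
proof
  show "sph_top closure_of \<Omega> \<subseteq> \<M>" by (rule closure_of_minimal[OF interior_of_subset closed_mating])
  have cl: "closedin sph_top (sph_top closure_of \<Omega>)" by simp
  have sub: "\<Omega> \<subseteq> sph_top closure_of \<Omega>" by (rule closure_of_subset) simp
  have "XP ` closure (interior K) \<subseteq> sph_top closure_of \<Omega>"
    by (rule continuous_image_closure[OF contXP cl compact_imp_closed[OF compact_filled_julia] interior_subset])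
      (use interior_in_\<Omega>(1) sub in blast)
  moreover have "K \<subseteq> closure (interior K)"
  proof
    fix z assume z: "z \<in> K"
    show "z \<in> closure (interior K)"
    proof (cases "z \<in> interior K")
      case True thus ?thesis using closure_subset by blast
    next
      case False
      hence "z \<in> frontier K" using z closure_subset by (auto simp: frontier_def)
      thus ?thesis using frontier_subset_closure closure_mono[OF A_subset_interior] by blast
    qed
  qed
  ultimately have "XP ` K \<subseteq> sph_top closure_of \<Omega>" by blast
  moreover have "(XG \<circ> \<phi>) ` closure openreg \<subseteq> sph_top closure_of \<Omega>"
    by (rule continuous_image_closure[OF cont_XG\<phi> cl])
      (use interior_in_\<Omega>(2) sub openreg_subset(3) in \<open>auto simp: image_comp subset_iff\<close>)
  hence "XG ` \<phi> ` bs_dom d \<subseteq> sph_top closure_of \<Omega>" using bs_dom_subset_closure by (auto simp: subset_iff)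
  ultimately show "\<M> \<subseteq> sph_top closure_of \<Omega>" by (auto simp: mating_set_def)
qed

text \<open>Off the interior means in the closure of the complement, which is the image of the open
  polygon; by compactness the image of the closed polygon already contains that closure.\<close>

lemma off_\<Omega>:
  assumes "y \<notin> \<Omega>"
  obtains u where "cmod u \<le> 1" "\<And>j. j < 2 * d \<Longrightarrow> r \<le> cmod (u - c j)" "y = XG (\<phi> u)"
proof -
  have sub: "closure (poly_interior d) \<subseteq> cball 0 1" using closure_poly_interior by (auto simp: subset_iff)
  hence "bounded (closure (poly_interior d))" by (rule bounded_subset[OF bounded_cball])
  hence "compact (closure (poly_interior d))" by (simp add: compact_eq_bounded_closed)
  hence cl: "closedin sph_top ((XG \<circ> \<phi>) ` closure (poly_interior d))"
    by (rule compact_image_closed[OF cont_XG\<phi> _ sub])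
  have "- \<M> \<subseteq> (XG \<circ> \<phi>) ` closure (poly_interior d)"
    unfolding compl_mating using closure_subset[of "poly_interior d"] by (auto simp: image_comp)
  hence "sph_top closure_of (- \<M>) \<subseteq> (XG \<circ> \<phi>) ` closure (poly_interior d)"
    by (rule closure_of_minimal[OF _ cl])
  moreover have "\<Omega> = - (sph_top closure_of (- \<M>))"
    using interior_of_closure_of[of sph_top \<M>] by (simp add: Compl_eq_Diff_UNIV)
  ultimately have "y \<in> (XG \<circ> \<phi>) ` closure (poly_interior d)" using assms by blast
  then obtain u where "u \<in> closure (poly_interior d)" "y = XG (\<phi> u)" by auto
  thus ?thesis using closure_poly_interior by (intro that[of u]) auto
qed

definition "Ver = XP ` K - \<Omega>"

lemma Ver_subset: "Ver \<subseteq> (XG \<circ> \<phi>) ` Vtx"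
proof
  fix y assume y: "y \<in> Ver"
  hence "y \<notin> \<Omega>" by (simp add: Ver_def)
  then obtain u where u: "cmod u \<le> 1" "\<And>j. j < 2 * d \<Longrightarrow> r \<le> cmod (u - c j)" "y = XG (\<phi> u)"
    by (rule off_\<Omega>) (rule that | assumption)+
  have "cmod u = 1"
  proof (rule ccontr)
    assume "cmod u \<noteq> 1"
    hence "XG (\<phi> u) \<notin> XP ` K" using u(1) \<phi>_facts(2)[of u] by (intro XG_notin) auto
    thus False using y u(3) by (simp add: Ver_def)
  qed
  thus "y \<in> (XG \<circ> \<phi>) ` Vtx" using u by (auto simp: Vtx_def)
qed

lemma Ver_finite: "finite Ver" "card Ver \<le> 2 * d"
proof -
  have f: "finite ((XG \<circ> \<phi>) ` Vtx)" using Vtx_finite(1) by simp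
  thus "finite Ver" using Ver_subset finite_subset by blast
  have "card Ver \<le> card ((XG \<circ> \<phi>) ` Vtx)" using Ver_subset f by (intro card_mono)
  also have "\<dots> \<le> card Vtx" by (rule card_image_le[OF Vtx_finite(1)])
  also have "\<dots> \<le> 2 * d" by (rule Vtx_finite(2))
  finally show "card Ver \<le> 2 * d" .
qed

lemma Vtx_bs_dom: "u \<in> Vtx \<Longrightarrow> u \<in> bs_dom d"
  by (simp add: Vtx_def bs_dom_def poly_interior_def)

lemma F_XG: "u \<in> bs_dom d \<Longrightarrow> F (XG (\<phi> u)) = XG (\<phi> (bs_map d u))"
proof -
  assume u: "u \<in> bs_dom d"
  hence "u \<in> cball 0 1" by (simp add: bs_dom_def)
  thus ?thesis using semG[of "\<phi> u"] u \<phi>_facts(1) by simp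
qed

lemma F_Vtx: "u \<in> Vtx \<Longrightarrow> F (XG (\<phi> u)) = XG (\<phi> (cnj u))"
  using F_XG[OF Vtx_bs_dom] bs_map_Vtx by simp

lemma F_F_Ver: "y \<in> Ver \<Longrightarrow> F (F y) = y"
proof -
  assume "y \<in> Ver"
  then obtain u where "u \<in> Vtx" "y = XG (\<phi> u)" using Ver_subset by auto
  thus ?thesis using F_Vtx[of u] F_Vtx[OF Vtx_cnj, of u] by simp
qed

end

section \<open>Fibres of the uniformizing rational map\<close>

context mated
begin

abbreviation "clDom \<equiv> sph_top closure_of Dom"

lemma contR: "continuous_map sph_top sph_top R"
  using rp by (rule continuous_rmap)

lemma closed_image_R: "closedin sph_top C \<Longrightarrow> closedin sph_top (R ` C)"
proof -
  assume "closedin sph_top C"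
  hence "compactin sph_top C" by (rule closedin_compact_space[OF compact_space_sph])
  hence "compactin sph_top (R ` C)" by (rule image_compactin[OF _ contR])
  thus ?thesis by (rule compactin_imp_closedin[OF Hausdorff_sph])
qed

lemma Dom_subset: "Dom \<subseteq> clDom"
  by (rule closure_of_subset) simp

lemma R_clDom: "R ` clDom = \<M>"
proof
  show "R ` clDom \<subseteq> \<M>"
    using continuous_map_image_closure_subset[OF contR, of Dom] RDom closure_\<Omega> by simp
  have "sph_top closure_of \<Omega> \<subseteq> R ` clDom"
    by (rule closure_of_minimal[OF _ closed_image_R]) (use RDom Dom_subset in auto)
  thus "\<M> \<subseteq> R ` clDom" by (simp add: closure_\<Omega>)
qed

lemma FR_clDom: "x \<in> clDom \<Longrightarrow> F (R x) = R (eta x)"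
proof (rule forall_in_closure_of_eq[where X = "subtopology sph_top clDom" and Y = sph_top and S = Dom
      and f = "F \<circ> R" and g = "R \<circ> eta", unfolded comp_def])
  assume "x \<in> clDom"
  thus "x \<in> subtopology sph_top clDom closure_of Dom"
    using Dom_subset by (simp add: closure_of_subtopology Int_absorb1)
  show "Hausdorff_space sph_top" by (rule Hausdorff_sph)
  have "continuous_map (subtopology sph_top clDom) (subtopology sph_top \<M>) R"
    by (rule continuous_map_into_subtopology[OF continuous_map_from_subtopology[OF contR]]) (use R_clDom in auto)
  thus "continuous_map (subtopology sph_top clDom) sph_top (\<lambda>x. F (R x))"
    using continuous_map_compose[of _ _ R sph_top F] contF closure_of_eq[of sph_top \<M>] closed_mating by (simp add: comp_def)
  show "continuous_map (subtopology sph_top clDom) sph_top (\<lambda>x. R (eta x))"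
    using continuous_map_from_subtopology[OF continuous_map_compose[OF continuous_eta contR]] by (simp add: comp_def)
  show "F (R x) = R (eta x)" if "x \<in> Dom" for x using FR that .
qed

lemma eta_Dom_iff: "eta x \<in> Dom \<longleftrightarrow> x \<notin> clDom"
proof -
  have "eta x \<in> Dom \<longleftrightarrow> x \<in> eta ` Dom"
    using eta_eta by (metis imageE imageI)
  thus ?thesis using etaDom by simp
qed

lemma open_Dom: "openin sph_top Dom"
proof -
  have "Dom = {x \<in> topspace sph_top. eta x \<in> - clDom}" using eta_Dom_iff[of "eta _"] by auto
  moreover have "openin sph_top (- clDom)" by (simp add: Compl_eq_Diff_UNIV openin_diff flip: topspace_sph_top)
  ultimately show ?thesis using openin_continuous_map_preimage[OF continuous_eta] by metis
qed

text \<open>The value \<open>R x\<close> is also taken at some \<open>x'\<close> in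
  \<open>Dom\<close>. If \<open>x\<close> were a boundary point, points of \<open>Dom\<close> near
  \<open>x\<close> would share their values with points near \<open>x'\<close>, since
  \<open>R\<close> is open there; this contradicts injectivity.\<close>

lemma Dom_if_\<Omega>:
  assumes x: "x \<in> clDom" and y: "R x \<in> \<Omega>"
  shows "x \<in> Dom"
proof (rule ccontr)
  assume n: "x \<notin> Dom"
  obtain x' where x': "x' \<in> Dom" "R x = R x'" using y RDom by (metis imageE)
  hence "x \<noteq> x'" using n by blast
  then obtain U V where UV: "openin sph_top U" "openin sph_top V" "x \<in> U" "x' \<in> V" "disjnt U V"
    using Hausdorff_sph unfolding Hausdorff_space_def topspace_sph_top by (meson UNIV_I)
  have o: "openin sph_top (V \<inter> Dom)" using UV(2) open_Dom by (rule openin_Int)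
  have "sph_open (R ` (V \<inter> Dom))"
    by (rule rmap_open_image[OF rp inj_on_subset[OF injR]]) (use o in \<open>auto simp: openin_sph_top\<close>)
  hence o2: "openin sph_top {x \<in> topspace sph_top. R x \<in> R ` (V \<inter> Dom)}"
    by (intro openin_continuous_map_preimage[OF contR]) (simp add: openin_sph_top)
  have "openin sph_top (U \<inter> {x \<in> topspace sph_top. R x \<in> R ` (V \<inter> Dom)})" using UV(1) o2 by (rule openin_Int)
  moreover have "x \<in> U \<inter> {x \<in> topspace sph_top. R x \<in> R ` (V \<inter> Dom)}" using UV x' by auto
  ultimately have "\<exists>x''. x'' \<in> Dom \<and> x'' \<in> U \<inter> {x \<in> topspace sph_top. R x \<in> R ` (V \<inter> Dom)}"
    by (intro x[unfolded in_closure_of, THEN conjunct2, rule_format] conjI)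
  then obtain x'' where x'': "x'' \<in> Dom" "x'' \<in> U" "R x'' \<in> R ` (V \<inter> Dom)" by auto
  then obtain v where "v \<in> V" "v \<in> Dom" "R x'' = R v" by blast
  hence "x'' = v" using x''(1) injR by (auto dest: inj_onD)
  thus False using UV(5) x''(2) \<open>v \<in> V\<close> by (auto simp: disjnt_def)
qed

lemma fin_fib: "finite {x. R x = y}"
  by (rule finite_fiber[OF _ rp]) (use d2 in simp)

lemma lift: "s \<in> \<M> \<Longrightarrow> \<exists>x. x \<in> clDom \<and> R x = s"
  unfolding R_clDom[symmetric] by blast

text \<open>Every \<open>F\<close>-preimage of \<open>y\<close> lifts to a point of the closure of
  \<open>Dom\<close>, and \<open>eta\<close> moves this lift to a preimage of \<open>y\<close> under
  \<open>R\<close> lying outside \<open>Dom\<close>. If \<open>y\<close> is in the interior of the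
  mating set, one more preimage lies inside \<open>Dom\<close>.\<close>

lemma fiber_lower:
  assumes S: "finite S" "S \<subseteq> \<M>" "\<And>s. s \<in> S \<Longrightarrow> F s = y"
  shows "card S + (if y \<in> \<Omega> then 1 else 0) \<le> card {x. R x = y}"
proof -
  have "\<forall>s\<in>S. \<exists>x. x \<in> clDom \<and> R x = s" using lift S(2) by blast
  from bchoice[OF this] obtain \<xi> where \<xi>: "\<And>s. s \<in> S \<Longrightarrow> \<xi> s \<in> clDom" "\<And>s. s \<in> S \<Longrightarrow> R (\<xi> s) = s"
    by blast
  have inj: "inj_on (\<lambda>s. eta (\<xi> s)) S"
  proof (rule inj_onI)
    fix s t assume "s \<in> S" "t \<in> S" "eta (\<xi> s) = eta (\<xi> t)"
    moreover from this have "\<xi> s = \<xi> t" using eta_eta by metis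
    ultimately show "s = t" using \<xi>(2) by metis
  qed
  have sub: "(\<lambda>s. eta (\<xi> s)) ` S \<subseteq> {x. R x = y}"
  proof (rule image_subsetI)
    fix s assume s: "s \<in> S"
    show "eta (\<xi> s) \<in> {x. R x = y}" using FR_clDom[OF \<xi>(1)[OF s]] \<xi>(2)[OF s] S(3)[OF s] by simp
  qed
  have nD: "(\<lambda>s. eta (\<xi> s)) ` S \<inter> Dom = {}" using \<xi>(1) by (auto simp: eta_Dom_iff)
  show ?thesis
  proof (cases "y \<in> \<Omega>")
    case True
    then obtain x where x: "x \<in> Dom" "R x = y" using RDom by (metis imageE)
    have "card (insert x ((\<lambda>s. eta (\<xi> s)) ` S)) \<le> card {x. R x = y}"
      by (rule card_mono[OF fin_fib]) (use sub x in auto)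
    moreover have "x \<notin> (\<lambda>s. eta (\<xi> s)) ` S" using nD x(1) by blast
    hence "card (insert x ((\<lambda>s. eta (\<xi> s)) ` S)) = Suc (card S)"
      using card_insert_disjoint[of "(\<lambda>s. eta (\<xi> s)) ` S" x] S(1) card_image[OF inj] by simp
    ultimately show ?thesis using True by simp
  next
    case False
    thus ?thesis using card_mono[OF fin_fib sub] card_image[OF inj] by simp
  qed
qed

text \<open>Inverting the side pairings gives a preimage for each index unless \<open>u\<close> lies
  inside the conjugate disc. At most one index is lost in this way, and then \<open>u\<close> lies
  in \<open>openreg\<close>, so the preimage inside \<open>Dom\<close> makes up for it.\<close>

lemma fiber_group:
  assumes u: "cmod u < 1"
  shows "2 * d \<le> card {x. R x = XG (\<phi> u)}"
proof -
  define J where "J = {j. j < 2 * d \<and> r \<le> cmod (u - c (2 * d - 1 - j))}"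
  have fJ: "finite J" by (simp add: J_def)
  have pf: "cmod (pre j u) < 1" "cmod (pre j u - c j) \<le> r" "bs_map d (pre j u) = u" if "j \<in> J" for j
    using pre_facts[OF u, of j] that by (auto simp: J_def)
  have dom: "pre j u \<in> bs_dom d" if "j \<in> J" for j
    using pf[OF that] that by (auto simp: bs_dom_def poly_interior_def J_def not_less)
  let ?S = "(\<lambda>j. XG (\<phi> (pre j u))) ` J"
  have inj: "inj_on (\<lambda>j. XG (\<phi> (pre j u))) J"
  proof (rule inj_onI)
    fix i j assume i: "i \<in> J" and j: "j \<in> J" and e: "XG (\<phi> (pre i u)) = XG (\<phi> (pre j u))"
    have "\<phi> (pre i u) = \<phi> (pre j u)"
      by (rule XG_inj[OF _ _ e]) (use \<phi>_facts(2) pf(1) i j in \<open>auto intro: less_imp_le\<close>)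
    hence "pre i u = pre j u" by (rule \<phi>_inj[rotated 2]) (use pf(1) i j in \<open>auto intro: less_imp_le\<close>)
    thus "i = j" using discs_disjoint[of "pre i u" i j] pf[OF i] pf[OF j] i j by (simp add: J_def)
  qed
  have "card ?S + (if XG (\<phi> u) \<in> \<Omega> then 1 else 0) \<le> card {x. R x = XG (\<phi> u)}"
  proof (rule fiber_lower)
    show "finite ?S" using fJ by simp
    show "?S \<subseteq> \<M>" using dom by (auto simp: mating_set_def)
    show "F s = XG (\<phi> u)" if "s \<in> ?S" for s using that F_XG dom pf(3) by auto
  qed
  hence le: "card J + (if XG (\<phi> u) \<in> \<Omega> then 1 else 0) \<le> card {x. R x = XG (\<phi> u)}"
    by (simp add: card_image[OF inj])
  show ?thesis
  proof (cases "\<forall>i<2*d. r \<le> cmod (u - c i)")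
    case True
    hence "J = {..<2*d}" using d2 by (auto simp: J_def)
    thus ?thesis using le by simp
  next
    case False
    then obtain i where i: "i < 2 * d" "cmod (u - c i) < r" by (meson not_le)
    hence "u \<in> openreg" using u by (auto simp: openreg_def dist_norm norm_minus_commute)
    hence "XG (\<phi> u) \<in> \<Omega>" using interior_in_\<Omega>(2) by blast
    moreover have "{..<2*d} - {2 * d - 1 - i} \<subseteq> J"
    proof
      fix j assume j: "j \<in> {..<2*d} - {2 * d - 1 - i}"
      have "r \<le> cmod (u - c (2 * d - 1 - j))"
      proof (rule ccontr)
        assume "\<not> ?thesis"
        hence "2 * d - 1 - j = i" using j discs_disjoint[OF u, of "2 * d - 1 - j" i] i by auto
        thus False using j by auto
      qed
      thus "j \<in> J" using j by (auto simp: J_def)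
    qed
    hence "card ({..<2*d} - {2 * d - 1 - i}) \<le> card J" by (rule card_mono[OF fJ])
    hence "2 * d - 1 \<le> card J" using i by (simp add: card_Diff_singleton_if)
    ultimately show ?thesis using le by simp
  qed
qed

lemma fiber_poly:
  assumes z: "z \<in> K"
  shows "card {x. poly P x = z} + (if XP z \<in> \<Omega> then 1 else 0) \<le> card {x. R x = XP z}"
proof -
  have sub: "{x. poly P x = z} \<subseteq> K" using filled_julia_iff z by auto
  have "P - [:z:] \<noteq> 0"
  proof
    assume "P - [:z:] = 0"
    hence "degree P = degree [:z:]" by simp
    thus False using deg by simp
  qed
  hence fin: "finite {x. poly P x = z}" using poly_roots_finite[of "P - [:z:]"] by simp
  have "card (XP ` {x. poly P x = z}) + (if XP z \<in> \<Omega> then 1 else 0) \<le> card {x. R x = XP z}"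
  proof (rule fiber_lower)
    show "finite (XP ` {x. poly P x = z})" using fin by simp
    show "XP ` {x. poly P x = z} \<subseteq> \<M>" using sub by (auto simp: mating_set_def)
    show "F s = XP z" if "s \<in> XP ` {x. poly P x = z}" for s
      using that sub semP by force
  qed
  thus ?thesis using card_image[OF inj_on_subset[OF inj_XP sub]] by simp
qed

lemma A_in_\<Omega>: "z \<in> A \<Longrightarrow> XP z \<in> \<Omega>" "z \<in> A \<Longrightarrow> z \<in> K"
  using interior_in_\<Omega>(1) A_subset_interior interior_subset by blast+

lemma Ver_noncritical:
  assumes "XP z \<in> Ver" "z \<in> K"
  shows "card {x. poly P x = z} = 2 * d - 1" "finite {x. poly P x = z}"
proof -
  have "poly P cc \<noteq> z" if "poly (pderiv P) cc = 0" for cc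
    using A_in_\<Omega>(1) A_invariant[OF crit_imm[OF that]] assms(1) by (auto simp: Ver_def)
  thus "card {x. poly P x = z} = 2 * d - 1" "finite {x. poly P x = z}"
    using poly_fiber_card[of P z] deg degP by auto
qed

text \<open>Riemann--Hurwitz: critical points of \<open>P\<close> give only \<open>2d - 2\<close> of the \<open>4d - 2\<close> critical
  points of \<open>R\<close>; the other \<open>2d\<close> must lie over the ideal vertices.\<close>
lemma Ver_count: "card Ver = 2 * d" "y \<in> Ver \<Longrightarrow> card {x. R x = y} = 2 * d - 1"
proof -
  define CV where "CV = poly P ` {c. poly (pderiv P) c = 0}"
  have P'n: "pderiv P \<noteq> 0" using deg by (simp add: pderiv_eq_0_iff)
  have fCV: "finite CV" unfolding CV_def using poly_roots_finite[OF P'n] by simp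
  have CVA: "CV \<subseteq> A" using A_invariant crit_imm by (auto simp: CV_def)
  have ver: "2 * d - 1 \<le> card {x. R x = y}" if v: "y \<in> Ver" for y
  proof -
    obtain z where z: "z \<in> K" "y = XP z" using v by (auto simp: Ver_def)
    thus ?thesis using fiber_poly[OF z(1)] Ver_noncritical[of z] v by simp
  qed
  have off: "2 * d \<le> card {x. R x = y}" if "y \<notin> XP ` CV \<union> Ver" for y
  proof (rule sphere_cases[of y])
    fix u assume "cmod u < 1" "y = XG (\<phi> u)" thus ?thesis using fiber_group by simp
  next
    fix z assume z: "z \<in> K" "y = XP z"
    hence "y \<in> \<Omega>" using that by (auto simp: Ver_def)
    moreover have "poly P cc \<noteq> z" if "poly (pderiv P) cc = 0" for cc
      using that \<open>y \<notin> XP ` CV \<union> Ver\<close> z(2) by (auto simp: CV_def)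
    hence "card {x. poly P x = z} = 2 * d - 1" using poly_fiber_card[of P z] deg degP by auto
    ultimately show ?thesis using fiber_poly[OF z(1)] z(2) d2 by simp
  qed
  have dis: "XP ` CV \<inter> Ver = {}" using CVA A_in_\<Omega> by (auto simp: Ver_def)
  have injCV: "inj_on XP CV" using inj_on_subset[OF inj_XP] CVA A_in_\<Omega>(2) by blast
  have "2 * (2 * d) - 2 \<le> (\<Sum>y\<in>XP ` CV \<union> Ver. 2 * d - card {x. R x = y})"
    by (rule riemann_hurwitz[OF _ rp _ off]) (use d2 fCV Ver_finite in auto)
  also have "\<dots> = (\<Sum>y\<in>XP ` CV. 2 * d - card {x. R x = y}) + (\<Sum>y\<in>Ver. 2 * d - card {x. R x = y})"
    using fCV Ver_finite(1) dis by (intro sum.union_disjoint) auto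
  also have "(\<Sum>y\<in>XP ` CV. 2 * d - card {x. R x = y}) = (\<Sum>z\<in>CV. 2 * d - card {x. R x = XP z})"
    by (rule sum.reindex_cong[OF injCV]) auto
  \<comment> \<open>Critical values of \<open>P\<close> lie in \<open>A\<close>, hence in the
    interior of the mating set; the extra preimage in \<open>Dom\<close> matches the extra degree of
    \<open>R\<close>, so the defect is no larger than for \<open>P\<close>.\<close>
  also have "\<dots> \<le> (\<Sum>z\<in>CV. degree P - card {x. poly P x = z})"
  proof (rule sum_mono)
    fix z assume "z \<in> CV"
    hence "z \<in> A" using CVA by blast
    hence "card {x. poly P x = z} + 1 \<le> card {x. R x = XP z}"
      using fiber_poly[OF A_in_\<Omega>(2)] A_in_\<Omega>(1) by auto
    thus "2 * d - card {x. R x = XP z} \<le> degree P - card {x. poly P x = z}"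
      using degP by linarith
  qed
  also have "\<dots> \<le> degree P - 1" unfolding CV_def by (rule poly_critical_value_sum[OF deg])
  finally have big: "2 * d \<le> (\<Sum>y\<in>Ver. 2 * d - card {x. R x = y})" using degP d2 by simp
  \<comment> \<open>With at most \<open>2 * d\<close> ideal vertices, each of defect at most one,
    the lower bound \<open>big\<close> can only hold with equality everywhere.\<close>
  have one: "2 * d - card {x. R x = y} \<le> 1" if "y \<in> Ver" for y using ver[OF that] by simp
  have "(\<Sum>y\<in>Ver. 2 * d - card {x. R x = y}) \<le> (\<Sum>y\<in>Ver. 1)" by (rule sum_mono) (rule one)
  thus cV: "card Ver = 2 * d" using big Ver_finite(2) by simp
  show "card {x. R x = y} = 2 * d - 1" if y: "y \<in> Ver"
  proof (rule ccontr)
    assume n: "card {x. R x = y} \<noteq> 2 * d - 1"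
    have "(\<Sum>y\<in>Ver. 2 * d - card {x. R x = y}) < (\<Sum>y\<in>Ver. 1)"
      by (rule sum_strict_mono_ex1[OF Ver_finite(1)]) (use one y n ver[OF y] in \<open>auto intro!: bexI[of _ y]\<close>)
    thus False using big cV by simp
  qed
qed

lemma Ver_eq: "Ver = (XG \<circ> \<phi>) ` Vtx"
proof (rule card_subset_eq[OF _ Ver_subset])
  show f: "finite ((XG \<circ> \<phi>) ` Vtx)" using Vtx_finite(1) by simp
  have "card ((XG \<circ> \<phi>) ` Vtx) \<le> 2 * d" using card_image_le[OF Vtx_finite(1)] Vtx_finite(2) le_trans by blast
  thus "card Ver = card ((XG \<circ> \<phi>) ` Vtx)" using card_mono[OF f Ver_subset] Ver_count(1) by simp
qed

lemma F_Ver: "y \<in> Ver \<Longrightarrow> F y \<in> Ver"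
proof -
  assume "y \<in> Ver"
  then obtain u where u: "u \<in> Vtx" "y = XG (\<phi> u)" using Ver_eq by auto
  hence "F y = (XG \<circ> \<phi>) (cnj u)" using F_Vtx[of u] by simp
  thus ?thesis using Vtx_cnj[OF u(1)] Ver_eq by blast
qed

lemma Ver_lift: "y \<in> Ver \<Longrightarrow> \<exists>x\<in>clDom. R x = y"
proof -
  assume "y \<in> Ver"
  hence "y \<in> \<M>" by (auto simp: Ver_def mating_set_def)
  thus ?thesis unfolding R_clDom[symmetric] by blast
qed

text \<open>The fibre over \<open>F y\<close> has exactly \<open>2 * d - 1\<close> points, and these
  are accounted for by one lift over each point of a fibre of \<open>P\<close>, with
  \<open>y\<close> among them. A second lift of \<open>y\<close> would add another preimage through
  \<open>eta\<close>.\<close>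

lemma Ver_lift_unique:
  assumes y: "y \<in> Ver" and x: "x1 \<in> clDom" "R x1 = y" "x2 \<in> clDom" "R x2 = y"
  shows "x1 = x2"
proof (rule ccontr)
  assume ne: "x1 \<noteq> x2"
  obtain z where z: "z \<in> K" "y = XP z" using y by (auto simp: Ver_def)
  define w where "w = poly P z"
  have w: "w \<in> K" "XP w = F y" using z filled_julia_iff semP by (auto simp: w_def)
  hence wV: "XP w \<in> Ver" using F_Ver[OF y] by simp
  let ?S = "XP ` {x. poly P x = w}"
  have sub: "{x. poly P x = w} \<subseteq> K" using filled_julia_iff w(1) by auto
  have cS: "card ?S = 2 * d - 1" "finite ?S"
    using Ver_noncritical[OF wV w(1)] card_image[OF inj_on_subset[OF inj_XP sub]] by auto
  have S: "s \<in> \<M>" "F s = XP w" if "s \<in> ?S" for s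
    using that sub semP by (auto simp: mating_set_def)
  have yS: "y \<in> ?S" using z by (auto simp: w_def)
  have "\<forall>s\<in>?S. \<exists>x. x \<in> clDom \<and> R x = s" using lift S(1) by blast
  from bchoice[OF this] obtain \<xi> where \<xi>: "\<And>s. s \<in> ?S \<Longrightarrow> \<xi> s \<in> clDom \<and> R (\<xi> s) = s" by blast
  define \<xi>' where "\<xi>' = \<xi>(y := x1)"
  have \<xi>': "\<xi>' s \<in> clDom \<and> R (\<xi>' s) = s" if "s \<in> ?S" for s using \<xi>[OF that] x by (simp add: \<xi>'_def)
  have inj: "inj_on (\<lambda>s. eta (\<xi>' s)) ?S"
  proof (rule inj_onI)
    fix s t assume "s \<in> ?S" "t \<in> ?S" "eta (\<xi>' s) = eta (\<xi>' t)"
    moreover from this have "\<xi>' s = \<xi>' t" using eta_eta by metis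
    ultimately show "s = t" using \<xi>' by metis
  qed
  have nin: "eta x2 \<notin> (\<lambda>s. eta (\<xi>' s)) ` ?S"
  proof
    assume "eta x2 \<in> (\<lambda>s. eta (\<xi>' s)) ` ?S"
    then obtain s where s: "s \<in> ?S" "eta x2 = eta (\<xi>' s)" by blast
    hence e: "x2 = \<xi>' s" by (metis eta_eta)
    hence "s = y" using \<xi>'[OF s(1)] x(4) by simp
    thus False using e ne by (simp add: \<xi>'_def)
  qed
  have "insert (eta x2) ((\<lambda>s. eta (\<xi>' s)) ` ?S) \<subseteq> {x. R x = XP w}"
  proof -
    have "R (eta x2) = XP w" using FR_clDom[OF x(3)] x(4) w(2) by simp
    moreover have "R (eta (\<xi>' s)) = XP w" if "s \<in> ?S" for s
      using FR_clDom[of "\<xi>' s"] \<xi>'[OF that] S(2)[OF that] by simp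
    ultimately show ?thesis by (auto simp del: image_eqI)
  qed
  hence "card (insert (eta x2) ((\<lambda>s. eta (\<xi>' s)) ` ?S)) \<le> card {x. R x = XP w}"
    by (rule card_mono[OF fin_fib])
  thus False using nin cS Ver_count(2)[OF wV] d2 card_image[OF inj] by simp
qed

end

section \<open>Critical points on the boundary of the Jordan domain\<close>

context mated
begin

definition "Cr = {x \<in> clDom. x \<notin> Dom \<and> R x \<in> Ver}"

lemma boundary_eta: "x \<in> clDom \<Longrightarrow> x \<notin> Dom \<Longrightarrow> eta x \<in> clDom \<and> eta x \<notin> Dom"
  using eta_Dom_iff[of x] eta_Dom_iff[of "eta x"] by simp

lemma Cr_eta: "x \<in> Cr \<Longrightarrow> eta x \<in> Cr" and R_eta_Cr: "x \<in> Cr \<Longrightarrow> R (eta x) = F (R x)"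
  using boundary_eta[of x] FR_clDom[of x] F_Ver[of "R x"] by (auto simp: Cr_def)

lemma \<Omega>_lift: "y \<in> \<Omega> \<Longrightarrow> \<exists>x\<in>Dom. R x = y"
  unfolding RDom[symmetric] by blast

lemma Ver_lift_Cr: "x \<in> clDom \<Longrightarrow> R x \<in> Ver \<Longrightarrow> x \<in> Cr"
proof -
  assume x: "x \<in> clDom" "R x \<in> Ver"
  have "x \<notin> Dom"
  proof
    assume "x \<in> Dom"
    hence "R x \<in> \<Omega>" using RDom by (metis imageI)
    thus False using x(2) by (simp add: Ver_def)
  qed
  thus ?thesis using x by (simp add: Cr_def)
qed

lemma Cr_card: "finite Cr" "card Cr = 2 * d"
proof -
  have "bij_betw R Cr Ver"
    unfolding bij_betw_def
  proof
    show "inj_on R Cr" by (rule inj_onI) (use Ver_lift_unique in \<open>auto simp: Cr_def\<close>)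
    show "R ` Cr = Ver"
    proof
      show "Ver \<subseteq> R ` Cr"
      proof
        fix y assume y: "y \<in> Ver"
        then obtain x where "x \<in> clDom" "R x = y" using Ver_lift by blast
        thus "y \<in> R ` Cr" using Ver_lift_Cr y by blast
      qed
    qed (auto simp: Cr_def)
  qed
  thus "finite Cr" "card Cr = 2 * d"
    using Ver_finite(1) Ver_count(1) by (simp_all add: bij_betw_finite bij_betw_same_card)
qed

lemma Ver_frontier: "y \<in> Ver \<Longrightarrow> \<exists>z. z \<in> K \<and> z \<in> closure A \<and> y = XP z"
proof -
  assume "y \<in> Ver"
  then obtain z where z: "z \<in> K" "y = XP z" "y \<notin> \<Omega>" by (auto simp: Ver_def)
  hence "z \<notin> interior K" using interior_in_\<Omega>(1) by blast
  hence "z \<in> frontier K" using z(1) closure_subset by (auto simp: frontier_def)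
  thus ?thesis using z frontier_subset_closure by blast
qed

text \<open>Uniqueness of the lift makes lifting continuous at \<open>x\<close>: by compactness,
  values close to \<open>R x\<close> have all their lifts in the closed domain close to
  \<open>x\<close>.\<close>

lemma lift_near:
  assumes x: "x \<in> Cr" and U: "sph_open U" "x \<in> U"
  shows "sph_open (- (R ` (clDom - U)))" "R x \<in> - (R ` (clDom - U))"
proof -
  have "closedin sph_top (clDom - U)"
    using U(1) by (intro closedin_diff) (auto simp: openin_sph_top)
  from closed_image_R[OF this] show "sph_open (- (R ` (clDom - U)))"
    by (simp add: closedin_def openin_sph_top Compl_eq_Diff_UNIV)
  show "R x \<in> - (R ` (clDom - U))"
  proof
    assume "R x \<in> R ` (clDom - U)"
    then obtain x' where x'0: "R x = R x'" "x' \<in> clDom - U" by (rule imageE) (rule that | assumption)+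
    hence x': "x' \<in> clDom" "x' \<notin> U" "R x = R x'" by simp_all
    have "x = x'" by (rule Ver_lift_unique[of "R x"]) (use x x' in \<open>auto simp: Cr_def\<close>)
    thus False using x'(2) U(2) by simp
  qed
qed

lemma sph_open_eta_image: "sph_open U \<Longrightarrow> sph_open (eta ` U)"
proof -
  assume "sph_open U"
  hence "openin sph_top {x \<in> topspace sph_top. eta x \<in> U}"
    by (intro openin_continuous_map_preimage[OF continuous_eta]) (simp add: openin_sph_top)
  moreover have "{x \<in> topspace sph_top. eta x \<in> U} = eta ` U" using eta_eta by force
  ultimately show ?thesis by (simp add: openin_sph_top)
qed

lemma XP_near:
  assumes U: "sph_open U" and z: "z \<in> K" "XP z \<in> U"
  obtains e where "0 < e" "\<And>w. w \<in> K \<Longrightarrow> dist w z < e \<Longrightarrow> XP w \<in> U"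
proof -
  obtain V where V: "open V" "{x \<in> K. XP x \<in> U} = K \<inter> V"
    by (rule continuous_preimage_open[OF contXP U]) (rule that | assumption)+
  hence "z \<in> V" using z by blast
  then obtain e where e: "0 < e" "ball z e \<subseteq> V" using V(1) by (elim openE) auto
  show ?thesis
  proof (rule that[OF e(1)])
    fix w assume w: "w \<in> K" "dist w z < e"
    hence "w \<in> K \<inter> V" using e(2) by (auto simp: dist_commute)
    thus "XP w \<in> U" using V(2) by blast
  qed
qed

text \<open>Two nearby points with the same image: a lift of \<open>XP (P t)\<close> in \<open>Dom\<close> and the image under
  \<open>eta\<close> of the lift of \<open>XP t\<close>.\<close>
lemma not_locally_injective:
  assumes x: "x \<in> Cr" and U: "sph_open U" "x \<in> U"
  shows "\<not> inj_on R U"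
proof
  assume inj: "inj_on R U"
  have yV: "R x \<in> Ver" and exC: "eta x \<in> Cr" using x Cr_eta by (auto simp: Cr_def)
  have FV: "F (R x) \<in> Ver" using F_Ver[OF yV] .
  obtain z where z: "z \<in> K" "R x = XP z" using yV by (auto simp: Ver_def)
  obtain t where t: "t \<in> K" "t \<in> closure A" "F (R x) = XP t" using Ver_frontier[OF FV] by blast
  have "XP (poly P t) = XP z" using semP[OF t(1)] t(3) F_F_Ver[OF yV] z(2) by simp
  hence Pt: "poly P t = z"
    using inj_XP z(1) t(1) filled_julia_iff by (auto dest: inj_onD)
  let ?N1 = "- (R ` (clDom - eta ` U))" and ?N2 = "- (R ` (clDom - U))"
  have N2: "sph_open ?N2" "XP z \<in> ?N2" using lift_near[OF x U] z(2) by auto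
  have N1: "sph_open ?N1" "XP t \<in> ?N1"
    using lift_near[OF exC sph_open_eta_image[OF U(1)]] U(2) R_eta_Cr[OF x] t(3) by auto
  obtain e1 where e1: "0 < e1" "\<And>w. w \<in> K \<Longrightarrow> dist w t < e1 \<Longrightarrow> XP w \<in> ?N1"
    by (rule XP_near[OF N1(1) t(1) N1(2)]) (rule that | assumption)+
  obtain e2 where e2: "0 < e2" "\<And>w. w \<in> K \<Longrightarrow> dist w z < e2 \<Longrightarrow> XP w \<in> ?N2"
    by (rule XP_near[OF N2(1) z(1) N2(2)]) (rule that | assumption)+
  have "isCont (poly P) t" by simp
  then obtain e3 where e3: "0 < e3" "\<And>w. dist w t < e3 \<Longrightarrow> dist (poly P w) z < e2"
    unfolding continuous_at_eps_delta Pt using e2(1) by blast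
  obtain w where w: "w \<in> A" "dist w t < min e1 e3"
    using t(2) e1(1) e3(1) unfolding closure_approachable by (metis min_less_iff_conj)
  have wK: "w \<in> K" and PwA: "poly P w \<in> A" using A_in_\<Omega>(2)[OF w(1)] A_invariant[OF w(1)] .
  have y1: "XP w \<in> ?N1" using e1(2)[OF wK] w(2) by simp
  have y2: "XP (poly P w) \<in> ?N2" using e2(2)[OF A_in_\<Omega>(2)[OF PwA]] e3(2) w(2) by simp
  obtain x1 where x1: "x1 \<in> Dom" "R x1 = XP w" using \<Omega>_lift[OF A_in_\<Omega>(1)[OF w(1)]] by blast
  obtain x2 where x2: "x2 \<in> Dom" "R x2 = XP (poly P w)" using \<Omega>_lift[OF A_in_\<Omega>(1)[OF PwA]] by blast
  have "x1 \<in> eta ` U"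
  proof (rule ccontr)
    assume "x1 \<notin> eta ` U"
    hence "R x1 \<in> R ` (clDom - eta ` U)" using x1(1) Dom_subset by (intro imageI) auto
    thus False using y1 x1(2) by simp
  qed
  hence u1: "eta x1 \<in> U" by auto
  have u2: "x2 \<in> U"
  proof (rule ccontr)
    assume "x2 \<notin> U"
    hence "R x2 \<in> R ` (clDom - U)" using x2(1) Dom_subset by (intro imageI) auto
    thus False using y2 x2(2) by simp
  qed
  have "R (eta x1) = XP (poly P w)" using FR_clDom[of x1] x1 Dom_subset semP[OF wK] by auto
  hence "eta x1 = x2" by (intro inj_onD[OF inj _ u1 u2]) (simp add: x2(2))
  thus False using x1(1) x2(1) eta_Dom_iff[of x1] Dom_subset by blast
qed

text \<open>At a fixed point of \<open>eta\<close> the map \<open>F\<close> fixes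
  \<open>R x\<close>, which is not interior to the mating set. Since the open sides of the polygon
  carry no fixed points of the Bowen--Series map, \<open>R x\<close> comes from an ideal
  vertex.\<close>

lemma fixed_points:
  assumes "eta x = x"
  shows "x \<in> Cr"
proof -
  have xb: "x \<in> clDom" "x \<notin> Dom" using eta_Dom_iff[of x] assms Dom_subset by auto
  have Fy: "F (R x) = R x" using FR_clDom[OF xb(1)] assms by simp
  have n\<Omega>: "R x \<notin> \<Omega>" using Dom_if_\<Omega>[OF xb(1)] xb(2) by blast
  obtain u where u: "cmod u \<le> 1" "\<And>j. j < 2 * d \<Longrightarrow> r \<le> cmod (u - c j)" "R x = XG (\<phi> u)"
    by (rule off_\<Omega>[OF n\<Omega>]) (rule that | assumption)+
  have "cmod u = 1"
  proof (rule ccontr)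
    assume "cmod u \<noteq> 1"
    hence u1: "cmod u < 1" using u(1) by simp
    have "R x \<in> \<M>" unfolding R_clDom[symmetric] using xb(1) by (rule imageI)
    hence ud: "u \<in> bs_dom d" using XG_in_mating_iff[OF u1] u(3) by simp
    have b: "cmod (bs_map d u) < 1" by (rule bs_map_in_disc[OF u1 ud])
    have "XG (\<phi> (bs_map d u)) = XG (\<phi> u)" using F_XG[OF ud] Fy u(3) by simp
    hence "\<phi> (bs_map d u) = \<phi> u"
      by (rule XG_inj[OF \<phi>_facts(2)[OF b] \<phi>_facts(4)[OF u(1)]])
    hence "bs_map d u = u" by (rule \<phi>_inj[OF less_imp_le[OF b] u(1)])
    thus False using no_fixed_point[OF u1 ud u(2)] by simp
  qed
  hence "u \<in> Vtx" using u(2) by (simp add: Vtx_def)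
  hence "R x \<in> Ver" unfolding Ver_eq using u(3) by auto
  thus ?thesis by (rule Ver_lift_Cr[OF xb(1)])
qed

lemma one_in_Cr: "Some 1 \<in> Cr" "Some (- 1) \<in> Cr"
  by (rule fixed_points, simp add: eta_def)+

lemma R_one_limit:
  obtains z where "z \<in> K" "z \<in> closure A" "R (Some 1) = XP z"
proof -
  have "R (Some 1) \<in> Ver" using one_in_Cr(1) by (simp add: Cr_def)
  from Ver_frontier[OF this] show ?thesis using that by blast
qed

lemma R_one_notin: "R (Some 1) \<notin> XP ` A"
proof
  assume "R (Some 1) \<in> XP ` A"
  hence "R (Some 1) \<in> \<Omega>" using A_in_\<Omega>(1) by (metis imageE)
  thus False using one_in_Cr(1) by (simp add: Cr_def Ver_def)
qed

lemma Dom_eta_disjoint: "x \<in> Dom \<Longrightarrow> eta x \<notin> Dom"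
  using eta_Dom_iff Dom_subset by blast

lemma R_eta_XP: "x \<in> Dom \<Longrightarrow> z \<in> A \<Longrightarrow> R x = XP z \<Longrightarrow> R (eta x) = XP (poly P z)"
  using FR[of x] semP[of z] A_in_\<Omega>(2)[of z] by simp

end

section \<open>Failure of local injectivity in terms of the Wronskian\<close>

lemma locally_injective_if_wronskian:
  assumes r: "rpair n N D" and W: "poly (wronskian N D) v \<noteq> 0" and Dv: "poly D v \<noteq> 0"
  shows "\<exists>U. sph_open U \<and> Some v \<in> U \<and> inj_on (rmap n N D) U"
proof -
  define S where "S = {z. poly D z \<noteq> 0}"
  have oS: "open S" unfolding S_def by (intro open_Collect_neq continuous_intros)
  define f where "f z = poly N z / poly D z" for z
  have hf: "f holomorphic_on S"
    unfolding f_def by (intro holomorphic_intros) (auto simp: S_def)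
  have "(f has_field_derivative (poly (pderiv N) v * poly D v - poly N v * poly (pderiv D) v) / (poly D v * poly D v)) (at v)"
    unfolding f_def by (rule DERIV_divide) (use Dv in \<open>auto intro: poly_DERIV\<close>)
  hence "deriv f v = poly (wronskian N D) v / (poly D v * poly D v)"
    by (simp add: DERIV_imp_deriv wronskian_def)
  hence "deriv f v \<noteq> 0" using W Dv by simp
  then obtain e where e: "0 < e" "ball v e \<subseteq> S" "inj_on f (ball v e)"
    using has_complex_derivative_locally_injective[OF hf _ oS, of v] Dv by (auto simp: S_def)
  have eq: "rmap n N D (Some z) = Some (f z)" if "z \<in> ball v e" for z
    using subsetD[OF e(2) that] by (simp add: S_def rmap_def proj_def f_def)
  show ?thesis
  proof (intro exI[of _ "Some ` ball v e"] conjI)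
    show "sph_open (Some ` ball v e)" by (rule sph_open_Some_image) simp
    show "Some v \<in> Some ` ball v e" using e(1) by simp
    show "inj_on (rmap n N D) (Some ` ball v e)"
    proof (rule inj_onI)
      fix x y assume "x \<in> Some ` ball v e" "y \<in> Some ` ball v e" and E: "rmap n N D x = rmap n N D y"
      then obtain x' y' where "x = Some x'" "y = Some y'" "x' \<in> ball v e" "y' \<in> ball v e" by blast
      thus "x = y" using E eq e(3) by (auto dest: inj_onD)
    qed
  qed
qed

text \<open>At a pole the same argument is made for the reciprocal map, whose Wronskian differs only
  by its sign.\<close>

lemma wronskian_zero_if_not_locally_injective:
  assumes r: "rpair n N D" and ninj: "\<And>U. sph_open U \<Longrightarrow> Some v \<in> U \<Longrightarrow> \<not> inj_on (rmap n N D) U"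
  shows "poly (wronskian N D) v = 0"
proof (rule ccontr)
  assume W: "poly (wronskian N D) v \<noteq> 0"
  have r': "rpair n D N" using r by (auto simp: rpair_def)
  have W': "poly (wronskian D N) v \<noteq> 0" using W by (simp add: wronskian_def algebra_simps)
  have "\<exists>U. sph_open U \<and> Some v \<in> U \<and> inj_on (rmap n N D) U"
  proof (cases "poly D v = 0")
    case False thus ?thesis using locally_injective_if_wronskian[OF r W] by blast
  next
    case True
    hence "poly N v \<noteq> 0" using r by (auto simp: rpair_def)
    then obtain U where U: "sph_open U" "Some v \<in> U" "inj_on (rmap n D N) U"
      using locally_injective_if_wronskian[OF r' W'] by blast
    have eq: "rmap n D N s = eta (rmap n N D s)" for s
    proof (cases s)
      case None
      thus ?thesis using r by (auto simp: rmap_def rpair_def eta_proj)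
    next
      case (Some z)
      hence "poly N z \<noteq> 0 \<or> poly D z \<noteq> 0" using r by (auto simp: rpair_def)
      thus ?thesis using Some by (simp add: rmap_def eta_proj)
    qed
    have "inj_on (rmap n N D) U"
    proof (rule inj_onI)
      fix x y assume "x \<in> U" "y \<in> U" "rmap n N D x = rmap n N D y"
      thus "x = y" by (rule_tac inj_onD[OF U(3)]) (simp_all add: eq)
    qed
    thus ?thesis using U by blast
  qed
  thus False using ninj by blast
qed

lemma coeff_psub_flip: "j \<le> n \<Longrightarrow> coeff (psub n 0 1 1 0 p) j = coeff p (n - j)"
proof -
  assume j: "j \<le> n"
  have e: "coeff (smult (coeff p i) ([:1, 0:] ^ i * [:0, 1:] ^ (n - i))) j = (if i = n - j then coeff p i else 0)"
    if "i \<in> {..n}" for i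
  proof -
    have "[:1, 0:] ^ i * [:0, 1:] ^ (n - i) = monom (1 :: complex) (n - i)"
      by (simp add: monom_altdef flip: one_pCons)
    thus ?thesis using that j by (auto simp: coeff_monom)
  qed
  have "coeff (psub n 0 1 1 0 p) j = (\<Sum>i\<in>{..n}. if i = n - j then coeff p i else 0)"
    unfolding psub_def coeff_sum by (rule sum.cong[OF refl e])
  thus ?thesis by simp
qed

lemma wronskian_at_0: "poly (wronskian f g) 0 = coeff f 1 * coeff g 0 - coeff f 0 * coeff g 1"
  unfolding wronskian_def poly_diff poly_mult unfolding poly_0_coeff_0 by (simp add: coeff_pderiv)

text \<open>Subtracting from \<open>N\<close> its value at infinity times \<open>D\<close> leaves
  the Wronskian unchanged. The hypothesis on the coefficients says that this removes the two top
  terms of \<open>N\<close>, that is, that infinity is a multiple point of its fibre.\<close>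

lemma wronskian_degree_drop:
  fixes N D :: "complex poly"
  assumes n: "2 \<le> n" and deg: "degree N \<le> n" "degree D \<le> n" and b: "coeff D n \<noteq> 0"
    and e: "coeff N n * coeff D (n - 1) = coeff N (n - 1) * coeff D n"
  shows "degree (wronskian N D) \<le> 2 * n - 3"
proof -
  define t where "t = coeff N n / coeff D n"
  define E where "E = N - smult t D"
  have dE: "degree E \<le> n - 2"
  proof (rule degree_le, intro allI impI)
    fix i assume "n - 2 < i"
    then consider "i = n - 1" | "i = n" | "n < i" by linarith
    thus "coeff E i = 0"
    proof cases
      case 1 thus ?thesis using b e by (simp add: E_def t_def field_simps)
    next
      case 2 thus ?thesis using b by (simp add: E_def t_def)
    next
      case 3 thus ?thesis using deg by (simp add: E_def coeff_eq_0)
    qed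
  qed
  have W: "wronskian N D = wronskian E D"
    by (simp add: E_def wronskian_def pderiv_diff pderiv_smult algebra_simps)
  show ?thesis
  proof (cases "degree E = 0")
    case True
    hence "pderiv E = 0" by (simp add: pderiv_eq_0_iff)
    hence "degree (wronskian E D) = degree (E * pderiv D)" by (simp add: wronskian_def)
    also have "\<dots> \<le> degree E + degree (pderiv D)" by (rule degree_mult_le)
    also have "\<dots> \<le> 2 * n - 3" using True deg n by (simp add: degree_pderiv)
    finally show ?thesis by (simp add: W)
  next
    case False
    have "degree (wronskian E D) \<le> 2 * n - 3" unfolding wronskian_def
    proof -
      have "degree (pderiv E * D) \<le> degree (pderiv E) + degree D" by (rule degree_mult_le)
      also have "\<dots> \<le> 2 * n - 3" using False deg dE n by (simp add: degree_pderiv)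
      finally have 1: "degree (pderiv E * D) \<le> 2 * n - 3" .
      have "degree (E * pderiv D) \<le> degree E + degree (pderiv D)" by (rule degree_mult_le)
      also have "\<dots> \<le> 2 * n - 3" using False deg dE n by (simp add: degree_pderiv)
      finally have "degree (E * pderiv D) \<le> 2 * n - 3" .
      with 1 show "degree (pderiv E * D - E * pderiv D) \<le> 2 * n - 3" by (rule degree_diff_le)
    qed
    thus ?thesis by (simp add: W)
  qed
qed

text \<open>The flip by \<open>eta\<close> brings infinity to 0, where vanishing of the Wronskian is
  a relation between the two top coefficients. When \<open>coeff D n\<close> is 0, the two
  polynomials exchange roles.\<close>

lemma wronskian_degree_if_not_locally_injective:
  assumes n: "2 \<le> n" and r: "rpair n N D"
    and ninj: "\<And>U. sph_open U \<Longrightarrow> None \<in> U \<Longrightarrow> \<not> inj_on (rmap n N D) U"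
  shows "degree (wronskian N D) \<le> 2 * n - 3"
proof -
  let ?N = "psub n 0 1 1 0 N" and ?D = "psub n 0 1 1 0 D"
  have r': "rpair n ?N ?D" by (rule rpair_psub[OF r]) simp
  have eq: "rmap n ?N ?D s = rmap n N D (eta s)" for s
    using rmap_psub[OF r, of 0 0 1 1 s] by (simp add: eta_eq_moeb)
  have "poly (wronskian ?N ?D) 0 = 0"
  proof (rule wronskian_zero_if_not_locally_injective[OF r'])
    fix U assume U: "sph_open U" "Some 0 \<in> U"
    have "openin sph_top {x \<in> topspace sph_top. eta x \<in> U}"
      using U(1) by (intro openin_continuous_map_preimage[OF continuous_eta]) (simp add: openin_sph_top)
    hence o: "sph_open {x. eta x \<in> U}" by (simp add: openin_sph_top)
    have "None \<in> {x. eta x \<in> U}" using U(2) by (simp add: eta_def)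
    from ninj[OF o this] obtain x y where xy: "eta x \<in> U" "eta y \<in> U" "x \<noteq> y" "rmap n N D x = rmap n N D y"
      unfolding inj_on_def by blast
    show "\<not> inj_on (rmap n ?N ?D) U"
    proof
      assume "inj_on (rmap n ?N ?D) U"
      hence "eta x = eta y" by (rule inj_onD) (use xy in \<open>simp_all add: eq\<close>)
      thus False using xy(3) by (metis eta_eta)
    qed
  qed
  hence e: "coeff N n * coeff D (n - 1) = coeff N (n - 1) * coeff D n"
    unfolding wronskian_at_0 using n by (simp add: coeff_psub_flip)
  show ?thesis
  proof (cases "coeff D n = 0")
    case False
    thus ?thesis using r by (intro wronskian_degree_drop[OF n _ _ _ e]) (auto simp: rpair_def)
  next
    case True
    hence "degree (wronskian D N) \<le> 2 * n - 3"
      by (intro wronskian_degree_drop[OF n]) (use r e in \<open>auto simp: rpair_def mult.commute\<close>)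
    moreover have "wronskian D N = - wronskian N D" by (simp add: wronskian_def algebra_simps)
    ultimately show ?thesis by simp
  qed
qed

lemma moeb_three_points:
  assumes "x0 \<noteq> x1" "x0 \<noteq> x2" "x1 \<noteq> x2"
  obtains a b c e where "a * e - b * c \<noteq> 0" "moeb a b c e x0 = None" "moeb a b c e x1 = Some 0" "moeb a b c e x2 = Some 1"
proof -
  obtain a b c e where m: "a * e - b * c \<noteq> 0" "moeb a b c e x0 = None"
    by (rule moeb_move[of x0]) (rule that | assumption)+
  have inj: "inj (moeb a b c e)" using bij_moeb[OF m(1)] by (rule bij_is_inj)
  obtain s where s: "moeb a b c e x1 = Some s" using inj m(2) assms(1) by (metis injD not_Some_eq)
  obtain t where t: "moeb a b c e x2 = Some t" using inj m(2) assms(2) by (metis injD not_Some_eq)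
  have st: "t - s \<noteq> 0" using inj s t assms(3) by (metis injD right_minus_eq)
  have d: "1 * (t - s) - (- s) * 0 \<noteq> 0" using st by simp
  note comp = moeb_compose[OF d m(1)]
  show ?thesis
  proof (rule that)
    show "(1 * a + - s * c) * (0 * b + (t - s) * e) - (1 * b + - s * e) * (0 * a + (t - s) * c) \<noteq> 0"
    proof -
      have "(1 * a + - s * c) * (0 * b + (t - s) * e) - (1 * b + - s * e) * (0 * a + (t - s) * c)
          = (t - s) * (a * e - b * c)" by (simp add: algebra_simps)
      thus ?thesis using st m(1) by simp
    qed
    show "moeb (1 * a + - s * c) (1 * b + - s * e) (0 * a + (t - s) * c) (0 * b + (t - s) * e) x0 = None"
      using comp[of x0] m(2) by (simp add: moeb_def)
    show "moeb (1 * a + - s * c) (1 * b + - s * e) (0 * a + (t - s) * c) (0 * b + (t - s) * e) x1 = Some 0"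
      using comp[of x1] s st by (simp add: moeb_def)
    show "moeb (1 * a + - s * c) (1 * b + - s * e) (0 * a + (t - s) * c) (0 * b + (t - s) * e) x2 = Some 1"
      using comp[of x2] t st by (simp add: moeb_def)
  qed
qed

lemma holomorphic_moeb_chart:
  assumes f: "cholo_on U f" and V: "open V" "V \<subseteq> U" and m: "a * e - b * c \<noteq> 0"
    and fin: "\<And>z. z \<in> V \<Longrightarrow> moeb a b c e (f z) \<noteq> None"
  shows "(\<lambda>z. ch0 (moeb a b c e (f z))) holomorphic_on V"
proof -
  have "\<exists>B. open B \<and> z \<in> B \<and> (\<lambda>z. ch0 (moeb a b c e (f z))) holomorphic_on B" if z: "z \<in> V" for z
  proof -
    have "cholo_at U f z" using f z V(2) by (auto simp: cholo_on_def)
    then obtain \<epsilon> where \<epsilon>: "0 < \<epsilon>" "ball z \<epsilon> \<subseteq> U"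
      "((\<forall>w\<in>ball z \<epsilon>. f w \<noteq> None) \<and> (ch0 \<circ> f) holomorphic_on ball z \<epsilon>) \<or>
       ((\<forall>w\<in>ball z \<epsilon>. f w \<noteq> Some 0) \<and> (chinf \<circ> f) holomorphic_on ball z \<epsilon>)"
      unfolding cholo_at_def by blast
    have "\<exists>p q. p holomorphic_on ball z \<epsilon> \<and> q holomorphic_on ball z \<epsilon> \<and>
        (\<forall>w\<in>ball z \<epsilon>. (p w \<noteq> 0 \<or> q w \<noteq> 0) \<and> f w = proj (p w) (q w))"
      using \<epsilon>(3)
    proof
      assume h: "(\<forall>w\<in>ball z \<epsilon>. f w \<noteq> None) \<and> (ch0 \<circ> f) holomorphic_on ball z \<epsilon>"
      thus ?thesis
        by (intro exI[of _ "ch0 \<circ> f"] exI[of _ "\<lambda>_. 1"]) (auto simp: proj_def ch0_def split: option.splits)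
    next
      assume h: "(\<forall>w\<in>ball z \<epsilon>. f w \<noteq> Some 0) \<and> (chinf \<circ> f) holomorphic_on ball z \<epsilon>"
      thus ?thesis
        by (intro exI[of _ "\<lambda>_. 1"] exI[of _ "chinf \<circ> f"]) (auto simp: proj_def chinf_def split: option.splits)
    qed
    then obtain p q where pq: "p holomorphic_on ball z \<epsilon>" "q holomorphic_on ball z \<epsilon>"
      and pq2: "\<And>w. w \<in> ball z \<epsilon> \<Longrightarrow> p w \<noteq> 0 \<or> q w \<noteq> 0" "\<And>w. w \<in> ball z \<epsilon> \<Longrightarrow> f w = proj (p w) (q w)" by blast
    have eq: "moeb a b c e (f w) = proj (a * p w + b * q w) (c * p w + e * q w)" if "w \<in> ball z \<epsilon>" for w
      unfolding pq2(2)[OF that] by (rule moeb_proj[OF m pq2(1)[OF that]])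
    have nz: "c * p w + e * q w \<noteq> 0" if "w \<in> ball z \<epsilon> \<inter> V" for w
      using fin[of w] eq[of w] that by (auto simp: proj_def)
    have "(\<lambda>w. (a * p w + b * q w) / (c * p w + e * q w)) holomorphic_on ball z \<epsilon> \<inter> V"
      by (intro holomorphic_intros holomorphic_on_subset[OF pq(1)] holomorphic_on_subset[OF pq(2)]) (use nz in auto)
    hence "(\<lambda>w. ch0 (moeb a b c e (f w))) holomorphic_on ball z \<epsilon> \<inter> V"
      by (rule holomorphic_transform) (use eq nz in \<open>auto simp: proj_def ch0_def\<close>)
    thus ?thesis using \<epsilon>(1) V(1) z by (intro exI[of _ "ball z \<epsilon> \<inter> V"]) auto
  qed
  note loc = this
  show ?thesis unfolding holomorphic_on_def
  proof
    fix z assume "z \<in> V"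
    from loc[OF this] obtain B where "open B" "z \<in> B" "(\<lambda>z. ch0 (moeb a b c e (f z))) holomorphic_on B" by blast
    hence "(\<lambda>z. ch0 (moeb a b c e (f z))) field_differentiable at z"
      by (intro holomorphic_on_imp_differentiable_at)
    thus "(\<lambda>z. ch0 (moeb a b c e (f z))) field_differentiable at z within V"
      by (rule field_differentiable_at_within)
  qed
qed

section \<open>Normal form of a mating\<close>

context mated
begin

text \<open>On the target, \<open>R 1\<close> goes to infinity and the images of \<open>a\<close>
  and \<open>p\<close> to 0 and 1. On the source, \<open>L u = (1 + \<mu> u) / (1 - \<mu> u)\<close>
  carries 0 and infinity to the fixed points 1 and -1 of \<open>eta\<close> and conjugates
  \<open>eta\<close> to negation; the remaining parameter puts the lift of \<open>a\<close> at
  1.\<close>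

theorem normalized_mating_data:
  assumes pb: "poly_basin P A a p (2 * d - 1) \<epsilon>"
  obtains N D g X a2 b2 c2 e2 \<mu> where "\<mu> \<noteq> 0" "a2 * e2 - b2 * c2 \<noteq> 0" "rpair (2 * d) N D"
    "\<And>s. rmap (2 * d) N D s = moeb a2 b2 c2 e2 (R (moeb \<mu> 1 (- \<mu>) 1 s))"
    "poly_basin.mating_data P A a p (2 * d - 1) N D g X"
proof -
  interpret pb: poly_basin P A a p "2 * d - 1" \<epsilon> by (rule pb)
  have aA: "a \<in> A" and pA: "p \<in> A" and pa: "p \<noteq> a" using pb.aA pb.pA pb.pa .
  have injA: "inj_on XP A" using inj_XP by (rule inj_on_subset) (use A_in_\<Omega>(2) in blast)
  have R1: "R (Some 1) \<noteq> XP z" if "z \<in> A" for z using R_one_notin that by blast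
  have ap: "XP a \<noteq> XP p" using injA aA pA pa by (auto dest: inj_onD)
  obtain a2 b2 c2 e2 where m2: "a2 * e2 - b2 * c2 \<noteq> 0" "moeb a2 b2 c2 e2 (R (Some 1)) = None"
      "moeb a2 b2 c2 e2 (XP a) = Some 0" "moeb a2 b2 c2 e2 (XP p) = Some 1"
    by (rule moeb_three_points[OF R1[OF aA] R1[OF pA] ap]) (rule that | assumption)+
  define M2 where "M2 = moeb a2 b2 c2 e2"
  have injM2: "inj M2" unfolding M2_def using bij_moeb[OF m2(1)] by (rule bij_is_inj)
  obtain xa where xa: "xa \<in> Dom" "R xa = XP a" using \<Omega>_lift[OF A_in_\<Omega>(1)[OF aA]] by blast
  have not1: "Some 1 \<notin> Dom" "Some (- 1) \<notin> Dom" using one_in_Cr by (auto simp: Cr_def)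
  \<comment> \<open>The point \<open>xa\<close> is neither 1 nor -1, as these lie on the boundary of
    \<open>Dom\<close>; therefore its coordinate is neither 0 nor infinity.\<close>
  obtain \<mu> where \<mu>: "\<mu> \<noteq> 0" "moeb \<mu> 1 (- \<mu>) 1 (Some 1) = xa"
  proof -
    have d1: "1 * 1 - (- 1) * 1 \<noteq> (0 :: complex)" by simp
    have inv: "moeb 1 1 (- 1) 1 (moeb 1 (- 1) 1 1 xa) = xa"
      using moeb_inverse(1)[OF d1, of xa] by simp
    have "moeb 1 (- 1) 1 1 xa \<noteq> None"
    proof
      assume "moeb 1 (- 1) 1 1 xa = None"
      hence "moeb 1 1 (- 1) 1 None = xa" using inv by simp
      hence "xa = Some (- 1)" by (simp add: moeb_def)
      thus False using not1(2) xa(1) by simp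
    qed
    then obtain \<mu> where \<mu>: "moeb 1 (- 1) 1 1 xa = Some \<mu>" by blast
    have "\<mu> \<noteq> 0" using inv not1(1) xa(1) unfolding \<mu> by (auto simp: moeb_def)
    moreover have "moeb \<mu> 1 (- \<mu>) 1 (Some 1) = moeb 1 1 (- 1) 1 (Some \<mu>)" by (simp add: moeb_def)
    hence "moeb \<mu> 1 (- \<mu>) 1 (Some 1) = xa" using inv unfolding \<mu> by simp
    ultimately show ?thesis by (rule that)
  qed
  define L where "L = moeb \<mu> 1 (- \<mu>) 1"
  have dL: "\<mu> * 1 - 1 * (- \<mu>) \<noteq> 0" using \<mu>(1) by simp
  have bijL: "bij L" unfolding L_def by (rule bij_moeb[OF dL])
  have contL: "continuous_map sph_top sph_top L" unfolding L_def by (rule continuous_moeb[OF dL])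
  define Li where "Li = moeb 1 (- 1) (- (- \<mu>)) \<mu>"
  have Li: "Li (L s) = s" "L (Li s) = s" for s
    unfolding Li_def L_def by (rule moeb_inverse[OF dL])+
  have contLi: "continuous_map sph_top sph_top Li"
    unfolding Li_def by (rule continuous_moeb) (use \<mu>(1) in simp)
  have L0: "L (Some 0) = Some 1" and Linf: "L None = Some (- 1)" and L1: "L (Some 1) = xa"
    using \<mu> by (simp_all add: L_def moeb_def)
  have Lm: "L (Some (- u)) = eta (L (Some u))" for u
  proof -
    have nz: "\<mu> * u + 1 \<noteq> 0 \<or> (- \<mu>) * u + 1 \<noteq> 0" using moeb_nonzero[OF dL, of u 1] by simp
    have "L (Some (- u)) = proj (\<mu> * (- u) + 1 * 1) ((- \<mu>) * (- u) + 1 * 1)"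
      unfolding L_def Some_eq_proj by (rule moeb_proj[OF dL]) simp
    moreover have "L (Some u) = proj (\<mu> * u + 1 * 1) ((- \<mu>) * u + 1 * 1)"
      unfolding L_def Some_eq_proj by (rule moeb_proj[OF dL]) simp
    ultimately show ?thesis using eta_proj[OF nz] by simp
  qed
  define N1 where "N1 = psub (2 * d) \<mu> 1 (- \<mu>) 1 N0"
  define D1 where "D1 = psub (2 * d) \<mu> 1 (- \<mu>) 1 D0"
  define N where "N = smult a2 N1 + smult b2 D1"
  define D where "D = smult c2 N1 + smult e2 D1"
  have rp1: "rpair (2 * d) N1 D1" unfolding N1_def D1_def by (rule rpair_psub[OF rp dL])
  have rpN: "rpair (2 * d) N D" unfolding N_def D_def by (rule rpair_post[OF rp1 m2(1)])
  have eq: "rmap (2 * d) N D s = M2 (R (L s))" for s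
    unfolding N_def D_def rmap_post[OF rp1 m2(1)] M2_def L_def
    unfolding N1_def D1_def rmap_psub[OF rp dL] ..
  have nloc: "\<not> inj_on (rmap (2 * d) N D) U" if s: "L s \<in> Cr" and U: "sph_open U" "s \<in> U" for s U
  proof
    assume inj: "inj_on (rmap (2 * d) N D) U"
    have "openin sph_top {x \<in> topspace sph_top. Li x \<in> U}"
      using U(1) by (intro openin_continuous_map_preimage[OF contLi]) (simp add: openin_sph_top)
    hence o: "sph_open {x. Li x \<in> U}" by (simp add: openin_sph_top)
    have "inj_on R {x. Li x \<in> U}"
    proof (rule inj_onI)
      fix x y assume xy: "x \<in> {x. Li x \<in> U}" "y \<in> {x. Li x \<in> U}" "R x = R y"
      have "Li x = Li y" by (rule inj_onD[OF inj]) (use xy in \<open>simp_all add: eq Li\<close>)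
      thus "x = y" using Li(2) by metis
    qed
    moreover have "L s \<in> {x. Li x \<in> U}" using U(2) by (simp add: Li)
    ultimately show False using not_locally_injective[OF s o] by blast
  qed
  have Wv: "poly (wronskian N D) v = 0" if "L (Some v) \<in> Cr" for v
    by (rule wronskian_zero_if_not_locally_injective[OF rpN]) (rule nloc[OF that])
  have Wdeg: "degree (wronskian N D) \<le> 2 * (2 * d - 1) - 1"
  proof -
    have "degree (wronskian N D) \<le> 2 * (2 * d) - 3"
      by (rule wronskian_degree_if_not_locally_injective[OF _ rpN])
        (use d2 nloc[of None] one_in_Cr(2) Linf in auto)
    thus ?thesis by simp
  qed
  \<comment> \<open>Here \<open>2 * d \<ge> 4\<close> critical points are more than the two at 1 and
    -1. The partner \<open>- v\<close> is obtained from the symmetry of \<open>Cr\<close> under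
    \<open>eta\<close>.\<close>
  obtain v where v: "v \<noteq> 0" "L (Some v) \<in> Cr"
  proof -
    have "\<not> Cr \<subseteq> {Some 1, Some (- 1)}"
    proof
      assume "Cr \<subseteq> {Some 1, Some (- 1)}"
      hence "card Cr \<le> card {Some (1 :: complex), Some (- 1)}" by (rule card_mono[rotated]) simp
      also have "\<dots> \<le> 2" by (simp add: card_insert_if)
      finally show False using Cr_card(2) d2 by simp
    qed
    then obtain x where x: "x \<in> Cr" "x \<noteq> Some 1" "x \<noteq> Some (- 1)" by blast
    have "Li x \<noteq> None" using Li(2)[of x] Linf x(3) by metis
    then obtain v where v: "Li x = Some v" by blast
    hence Lv: "L (Some v) = x" using Li(2)[of x] by simp
    have "v \<noteq> 0" using Lv L0 x(2) by metis
    thus ?thesis using that Lv x(1) by blast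
  qed
  define X where "X z = ch0 (M2 (XP z))" for z
  have M2X: "M2 (XP z) = Some (X z)" if "z \<in> A" for z
  proof -
    have "M2 (XP z) \<noteq> None"
    proof
      assume "M2 (XP z) = None"
      hence "M2 (XP z) = M2 (R (Some 1))" using m2(2) by (simp add: M2_def)
      thus False using injM2 R1[OF that] by (metis injD)
    qed
    thus ?thesis by (auto simp: X_def ch0_def)
  qed
  have holX: "X holomorphic_on A"
    unfolding X_def M2_def
    by (rule holomorphic_moeb_chart[OF holXP A_facts(1) A_subset_interior m2(1)])
      (use M2X in \<open>auto simp: M2_def\<close>)
  have injX: "inj_on X A"
  proof (rule inj_onI)
    fix x y assume xy: "x \<in> A" "y \<in> A" "X x = X y"
    hence "XP x = XP y" using M2X injM2 by (metis injD)
    thus "x = y" using injA xy by (auto dest: inj_onD)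
  qed
  have Xa: "X a = 0" "X p = 1" using m2(3,4) by (simp_all add: X_def M2_def ch0_def)
  \<comment> \<open>The value \<open>R (Some 1)\<close>, sent to infinity, is a limit of
    \<open>XP\<close> along \<open>A\<close>; a bound on \<open>X\<close> would keep such limits in
    a finite disc.\<close>
  have unb: "\<not> bounded (X ` A)"
  proof
    assume "bounded (X ` A)"
    then obtain B where B: "\<And>z. z \<in> A \<Longrightarrow> cmod (X z) \<le> B" unfolding bounded_iff by blast
    obtain z where z: "z \<in> K" "z \<in> closure A" "R (Some 1) = XP z"
      by (rule R_one_limit) (rule that | assumption)+
    have c: "continuous_map (top_of_set K) sph_top (M2 \<circ> XP)"
      unfolding M2_def by (rule continuous_map_compose[OF contXP continuous_moeb[OF m2(1)]])
    have cl: "closedin sph_top (Some ` cball 0 B)"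
      by (rule compact_image_closed[of UNIV]) (use continuous_Some in auto)
    have "(M2 \<circ> XP) ` closure A \<subseteq> Some ` cball 0 B"
      by (rule continuous_image_closure[OF c cl compact_imp_closed[OF compact_filled_julia]])
        (use A_in_\<Omega>(2) M2X B in auto)
    hence "M2 (XP z) \<in> Some ` cball 0 B" using z(2) by auto
    thus False using m2(2) z(3) by (auto simp: M2_def)
  qed
  define U where "U = {u. L (Some u) \<in> Dom}"
  have oU: "open U"
  proof -
    have "openin sph_top {x \<in> topspace sph_top. L x \<in> Dom}"
      by (rule openin_continuous_map_preimage[OF contL open_Dom])
    hence "openin euclidean {u \<in> topspace euclidean. Some u \<in> {x \<in> topspace sph_top. L x \<in> Dom}}"
      by (rule openin_continuous_map_preimage[OF continuous_Some])
    thus ?thesis by (simp add: U_def)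
  qed
  have U0: "0 \<notin> U" using not1(1) by (simp add: U_def L0)
  have Um: "- u \<notin> U" if "u \<in> U" for u using Dom_eta_disjoint that by (simp add: U_def Lm)
  define V where "V = U \<inter> {u. poly D u \<noteq> 0}"
  have oV: "open V" unfolding V_def by (intro open_Int oU open_Collect_neq continuous_intros)
  define f where "f u = poly N u / poly D u" for u
  have f_eq: "M2 (R (L (Some u))) = Some (f u)" if "u \<in> V" for u
  proof -
    have "rmap (2 * d) N D (Some u) = Some (f u)" using that by (simp add: rmap_def proj_def f_def V_def)
    thus ?thesis by (simp only: eq)
  qed
  have holf: "f holomorphic_on V" unfolding f_def by (intro holomorphic_intros) (auto simp: V_def)
  have injf: "inj_on f V"
  proof (rule inj_onI)
    fix u w assume uw: "u \<in> V" "w \<in> V" "f u = f w"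
    hence "R (L (Some u)) = R (L (Some w))" using f_eq injM2 by (metis injD)
    hence "L (Some u) = L (Some w)" using injR uw by (auto simp: V_def U_def dest: inj_onD)
    thus "u = w" using Li(1) by (metis option.inject)
  qed
  obtain g0 where g0: "g0 holomorphic_on f ` V" "\<And>u. u \<in> V \<Longrightarrow> g0 (f u) = u"
    using holomorphic_has_inverse[OF holf oV injf] by metis
  have XV: "\<exists>u\<in>V. f u = X x \<and> R (L (Some u)) = XP x" if x: "x \<in> A" for x
  proof -
    obtain y where y: "y \<in> Dom" "R y = XP x" using \<Omega>_lift[OF A_in_\<Omega>(1)[OF x]] by blast
    have "Li y \<noteq> None" using Li(2)[of y] Linf y(1) not1(2) by metis
    then obtain u where "Li y = Some u" by blast
    hence u: "L (Some u) = y" using Li(2)[of y] by simp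
    hence e: "rmap (2 * d) N D (Some u) = Some (X x)" using eq M2X[OF x] y(2) by simp
    hence "poly D u \<noteq> 0" by (auto simp: rmap_def proj_def)
    hence "u \<in> V" using u y(1) by (simp add: V_def U_def)
    moreover have "f u = X x" using f_eq[OF \<open>u \<in> V\<close>] e eq by simp
    ultimately show ?thesis using u y(2) by blast
  qed
  \<comment> \<open>The branch of the inverse of \<open>R\<close> with values in \<open>Dom\<close>,
    composed with \<open>X\<close>: the lift of the polynomial side in the new source
    coordinate.\<close>
  define g where "g x = g0 (X x)" for x
  have gV: "g x \<in> V" "f (g x) = X x" "R (L (Some (g x))) = XP x" if x: "x \<in> A" for x
  proof -
    obtain u where u: "u \<in> V" "f u = X x" "R (L (Some u)) = XP x" using XV[OF x] by blast
    hence "g x = u" using g0(2)[of u] by (simp add: g_def)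
    thus "g x \<in> V" "f (g x) = X x" "R (L (Some (g x))) = XP x" using u by simp_all
  qed
  have holg: "g holomorphic_on A"
  proof -
    have "X ` A \<subseteq> f ` V" using gV by (metis image_eqI image_subsetI)
    from holomorphic_on_compose_gen[OF holX g0(1) this] show ?thesis by (simp add: g_def[abs_def] o_def)
  qed
  have injg: "inj_on g A"
    by (rule inj_onI) (metis gV(2) injX inj_onD)
  have ga: "g a = 1"
  proof -
    have e: "rmap (2 * d) N D (Some 1) = Some (X a)" using eq L1 xa(2) M2X[OF aA] by simp
    hence "poly D 1 \<noteq> 0" by (auto simp: rmap_def proj_def)
    hence V1: "1 \<in> V" using xa(1) by (simp add: V_def U_def L1)
    have "f 1 = X a" using f_eq[OF V1] e eq by simp
    thus ?thesis using g0(2)[OF V1] by (simp add: g_def)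
  qed
  have Ng: "poly N (g x) = X x * poly D (g x)" if "x \<in> A" for x
    using gV(1,2)[OF that] by (auto simp: f_def V_def field_simps)
  have Nmg: "poly N (- g x) = X (poly P x) * poly D (- g x)" if x: "x \<in> A" for x
  proof -
    have "L (Some (g x)) \<in> Dom" using gV(1)[OF x] by (simp add: V_def U_def)
    from R_eta_XP[OF this x gV(3)[OF x]]
    have "rmap (2 * d) N D (Some (- g x)) = Some (X (poly P x))"
      using M2X[OF A_invariant[OF x]] by (simp add: eq Lm)
    thus ?thesis by (auto simp: rmap_def proj_def field_simps split: if_splits)
  qed
  have D0: "poly D 0 = 0"
  proof -
    have "rmap (2 * d) N D (Some 0) = None" using m2(2) by (simp add: eq L0 M2_def)
    thus ?thesis by (auto simp: rmap_def proj_def split: if_splits)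
  qed
  have "pb.mating_data N D g X"
    unfolding pb.mating_data_def
  proof (intro conjI)
    show "degree N \<le> 2 * d - 1 + 1" "degree D \<le> 2 * d - 1 + 1" "\<forall>z. \<not> (poly N z = 0 \<and> poly D z = 0)"
      using rpN d2 by (auto simp: rpair_def)
    show "\<forall>x\<in>A. g x \<noteq> 0" using gV(1) U0 by (metis IntD1 V_def)
    show "\<forall>x\<in>A. \<forall>y\<in>A. g x \<noteq> - g y" using gV(1) Um by (metis IntD1 V_def)
    show "poly (wronskian N D) 0 = 0" by (rule Wv) (simp add: L0 one_in_Cr)
    show "\<exists>v. v \<noteq> 0 \<and> poly (wronskian N D) v = 0 \<and> poly (wronskian N D) (- v) = 0"
      using v Wv[of v] Wv[of "- v"] Cr_eta by (auto simp: Lm)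
  qed (use holg holX injg injX Ng Nmg Wdeg D0 unb Xa ga in blast)+
  thus ?thesis
    using that[OF \<mu>(1) m2(1) rpN] eq by (simp add: M2_def L_def)
qed

end

section \<open>The quotient space of rational maps\<close>

definition nump :: "nat \<Rightarrow> (nat \<Rightarrow> complex) \<Rightarrow> complex poly" where
  "nump d c = (\<Sum>i\<le>2*d. monom (c i) i)"

definition denp :: "nat \<Rightarrow> (nat \<Rightarrow> complex) \<Rightarrow> complex poly" where
  "denp d c = (\<Sum>i\<le>2*d. monom (c (2*d + 1 + i)) i)"

lemma coeff_nump: "coeff (nump d c) i = (if i \<le> 2 * d then c i else 0)"
  and coeff_denp: "coeff (denp d c) i = (if i \<le> 2 * d then c (2 * d + 1 + i) else 0)"
  by (simp_all add: nump_def denp_def coeff_sum coeff_monom)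

lemma degree_nump: "degree (nump d c) \<le> 2 * d" and degree_denp: "degree (denp d c) \<le> 2 * d"
  by (auto intro!: degree_le simp: coeff_nump coeff_denp)

lemma coeff_denp_top: "coeff (denp d c) (2 * d) = c (4 * d + 1)"
proof -
  have "2 * d + 1 + 2 * d = 4 * d + 1" by simp
  thus ?thesis by (simp only: coeff_denp order_refl if_True)
qed

lemma ratmap_eq: "ratmap d c = rmap (2 * d) (nump d c) (denp d c)"
proof
  fix x
  have "poly (nump d c) z = numer d c z" "poly (denp d c) z = denom d c z" for z
    by (simp_all add: nump_def denp_def numer_def denom_def poly_sum poly_monom)
  thus "ratmap d c x = rmap (2 * d) (nump d c) (denp d c) x"
    unfolding ratmap_def rmap_def proj_def coeff_denp_top by (simp add: coeff_nump split: option.splits)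
qed

lemma rat_space_iff: "c \<in> rat_space d \<longleftrightarrow> (\<forall>i>4*d+1. c i = 0) \<and> rpair (2 * d) (nump d c) (denp d c)"
proof -
  have "poly (nump d c) z = numer d c z" "poly (denp d c) z = denom d c z" for z
    by (simp_all add: nump_def denp_def numer_def denom_def poly_sum poly_monom)
  thus ?thesis
    unfolding rat_space_def rpair_def coeff_denp_top using degree_nump degree_denp by (auto simp: coeff_nump)
qed

definition cvec :: "nat \<Rightarrow> complex poly \<Rightarrow> complex poly \<Rightarrow> nat \<Rightarrow> complex" where
  "cvec d N D i = (if i \<le> 2 * d then coeff N i else if i \<le> 4 * d + 1 then coeff D (i - (2 * d + 1)) else 0)"

lemma nump_cvec: "degree N \<le> 2 * d \<Longrightarrow> nump d (cvec d N D) = N"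
  by (rule poly_eqI) (auto simp: coeff_nump cvec_def coeff_eq_0)

lemma denp_cvec: "degree D \<le> 2 * d \<Longrightarrow> denp d (cvec d N D) = D"
  by (rule poly_eqI) (auto simp: coeff_denp cvec_def coeff_eq_0)

lemma poly_eq_hp:
  assumes "degree p \<le> n" "degree q \<le> n" "\<And>x y. hp n p x y = hp n q x y"
  shows "p = q"
proof -
  have "poly p z = poly q z" for z using hp_1[OF assms(1), of z] hp_1[OF assms(2), of z] assms(3) by simp
  thus ?thesis by (simp add: poly_eq_poly_eq_iff[symmetric] fun_eq_iff)
qed

lemma psub_linear:
  "psub n a b c e (smult u p + smult v q) = smult u (psub n a b c e p) + smult v (psub n a b c e q)"
proof (rule poly_eqI)
  fix j
  show "coeff (psub n a b c e (smult u p + smult v q)) j = coeff (smult u (psub n a b c e p) + smult v (psub n a b c e q)) j"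
    by (simp add: psub_def coeff_sum sum_distrib_left sum.distrib algebra_simps)
qed

text \<open>The coordinate \<open>(z - 1) / (z + 1)\<close> of the source turns \<open>\<eta>\<close> into \<open>z \<mapsto> - z\<close>, and the Moebius
  maps commuting with \<open>\<eta>\<close> into \<open>\<lambda> z\<close> and \<open>\<lambda> / z\<close>.\<close>
definition TN :: "nat \<Rightarrow> (nat \<Rightarrow> complex) \<Rightarrow> complex poly" where
  "TN d c = psub (2 * d) 1 1 (- 1) 1 (nump d c)"

definition TD :: "nat \<Rightarrow> (nat \<Rightarrow> complex) \<Rightarrow> complex poly" where
  "TD d c = psub (2 * d) 1 1 (- 1) 1 (denp d c)"

text \<open>The inverse of passing to \<open>TN\<close> and \<open>TD\<close>. The product of the
  two substitution matrices is twice the identity, which acts on forms of degree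
  \<open>2 * d\<close> by the factor \<open>2 ^ (2 * d)\<close>.\<close>

definition tinv :: "nat \<Rightarrow> complex poly \<Rightarrow> complex poly \<Rightarrow> nat \<Rightarrow> complex" where
  "tinv d N D = cvec d (smult (1 / 2 ^ (2 * d)) (psub (2 * d) 1 (- 1) 1 1 N)) (smult (1 / 2 ^ (2 * d)) (psub (2 * d) 1 (- 1) 1 1 D))"

lemma hp_smult: "hp n (smult t p) x y = t * hp n p x y"
  using hp_combine[of n t p 0 0 x y] by simp

lemma T_tinv:
  assumes "degree N \<le> 2 * d" "degree D \<le> 2 * d"
  shows "TN d (tinv d N D) = N" "TD d (tinv d N D) = D"
proof -
  have dg: "degree (smult (1 / 2 ^ (2 * d)) (psub (2 * d) 1 (- 1) 1 1 p)) \<le> 2 * d" for p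
    by (rule order_trans[OF degree_smult_le degree_psub])
  have inv: "psub (2 * d) 1 1 (- 1) 1 (smult (1 / 2 ^ (2 * d)) (psub (2 * d) 1 (- 1) 1 1 p)) = p"
    if "degree p \<le> 2 * d" for p
  proof (rule poly_eq_hp[OF degree_psub that])
    fix x y :: complex
    have e: "hp (2 * d) p (1 * (1 * x + 1 * y) + - 1 * (- 1 * x + 1 * y)) (1 * (1 * x + 1 * y) + 1 * (- 1 * x + 1 * y))
        = hp (2 * d) p (2 * x) (2 * y)" by (rule arg_cong2[where f = "hp (2 * d) p"]) simp_all
    show "hp (2 * d) (psub (2 * d) 1 1 (- 1) 1 (smult (1 / 2 ^ (2 * d)) (psub (2 * d) 1 (- 1) 1 1 p))) x y = hp (2 * d) p x y"
      unfolding hp_psub hp_smult e hp_scale by simp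
  qed
  show "TN d (tinv d N D) = N" "TD d (tinv d N D) = D"
    unfolding TN_def TD_def tinv_def nump_cvec[OF dg] denp_cvec[OF dg] using inv assms by simp_all
qed

lemma degree_T: "degree (TN d c) \<le> 2 * d" "degree (TD d c) \<le> 2 * d"
  unfolding TN_def TD_def by (rule degree_psub)+

lemma hp_T: "hp (2 * d) (nump d c) x y = hp (2 * d) (TN d c) ((x - y) / 2) ((x + y) / 2)"
  "hp (2 * d) (denp d c) x y = hp (2 * d) (TD d c) ((x - y) / 2) ((x + y) / 2)"
proof -
  have "1 * ((x - y) / 2) + 1 * ((x + y) / 2) = x" "- 1 * ((x - y) / 2) + 1 * ((x + y) / 2) = y"
    by (simp_all add: field_simps)
  thus "hp (2 * d) (nump d c) x y = hp (2 * d) (TN d c) ((x - y) / 2) ((x + y) / 2)"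
    "hp (2 * d) (denp d c) x y = hp (2 * d) (TD d c) ((x - y) / 2) ((x + y) / 2)"
    unfolding TN_def TD_def hp_psub by simp_all
qed

lemma rat_space_iff_T: "c \<in> rat_space d \<longleftrightarrow> (\<forall>i>4*d+1. c i = 0) \<and> rpair (2 * d) (TN d c) (TD d c)"
proof -
  have "rpair (2 * d) (nump d c) (denp d c)" if r: "rpair (2 * d) (TN d c) (TD d c)"
    unfolding rpair_iff_hp[OF degree_nump degree_denp]
  proof (intro allI impI)
    fix x y :: complex assume "x \<noteq> 0 \<or> y \<noteq> 0"
    moreover have "x = (x - y) / 2 + (x + y) / 2" "y = (x + y) / 2 - (x - y) / 2" by (simp_all add: field_simps)
    ultimately have "(x - y) / 2 \<noteq> 0 \<or> (x + y) / 2 \<noteq> 0" by (metis add_0 diff_0_right)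
    from rpair_hp[OF r this] show "hp (2 * d) (nump d c) x y \<noteq> 0 \<or> hp (2 * d) (denp d c) x y \<noteq> 0"
      unfolding hp_T .
  qed
  moreover have "rpair (2 * d) (TN d c) (TD d c)" if "rpair (2 * d) (nump d c) (denp d c)"
    unfolding TN_def TD_def by (rule rpair_psub[OF that]) simp
  ultimately show ?thesis using rat_space_iff by blast
qed

lemma tinv_rat_space: "rpair (2 * d) N D \<Longrightarrow> tinv d N D \<in> rat_space d"
proof -
  assume r: "rpair (2 * d) N D"
  have "\<forall>i>4 * d + 1. tinv d N D i = 0" by (simp add: tinv_def cvec_def)
  thus ?thesis unfolding rat_space_iff_T using r T_tinv[of N d D] by (simp add: rpair_def)
qed

lemma ratmap_T: "c \<in> rat_space d \<Longrightarrow> rmap (2 * d) (TN d c) (TD d c) s = ratmap d c (moeb 1 1 (- 1) 1 s)"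
  unfolding ratmap_eq TN_def TD_def by (rule rmap_psub) (simp_all add: rat_space_iff)

text \<open>Coprimality turns each root of \<open>D\<close> into a root of \<open>D'\<close>.
  Dividing out roots one by one leaves a constant on the left and, on the right, a polynomial
  without zeros.\<close>

lemma denominators_proportional:
  fixes N D N' D' :: "complex poly"
  assumes "N * D' = N' * D" "D \<noteq> 0" "\<And>z. \<not> (poly N z = 0 \<and> poly D z = 0)" "\<And>z. \<not> (poly N' z = 0 \<and> poly D' z = 0)"
  shows "\<exists>t. D' = smult t D"
  using assms
proof (induction "degree D" arbitrary: D D')
  case 0
  then obtain b where b: "D = [:b:]" by (metis degree_eq_zeroE)
  have b0: "b \<noteq> 0" using b 0(3) by auto
  have "poly D' z \<noteq> 0" for z
  proof
    assume z: "poly D' z = 0"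
    have "poly (N * D') z = poly (N' * D) z" using 0(2) by simp
    hence "poly N' z = 0" using z b b0 by simp
    thus False using z 0(5) by blast
  qed
  hence "constant (poly D')" using fundamental_theorem_of_algebra by blast
  hence "degree D' = 0" by (simp add: constant_degree)
  then obtain b' where "D' = [:b':]" by (metis degree_eq_zeroE)
  thus ?case using b b0 by (intro exI[of _ "b' / b"]) simp
next
  case (Suc n)
  have "\<not> constant (poly D)" using Suc(2) by (simp add: constant_degree)
  then obtain z where z: "poly D z = 0" using fundamental_theorem_of_algebra by blast
  then obtain E where E: "D = [:- z, 1:] * E" unfolding poly_eq_0_iff_dvd by (rule dvdE)
  have "poly (N * D') z = poly (N' * D) z" using Suc(3) by simp
  hence "poly D' z = 0" using z Suc(5)[of z] by simp
  then obtain E' where E': "D' = [:- z, 1:] * E'" unfolding poly_eq_0_iff_dvd by (rule dvdE)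
  have "E \<noteq> 0" using E Suc(4) by auto
  have "degree D = Suc (degree E)" unfolding E using \<open>E \<noteq> 0\<close> by (subst degree_mult_eq) auto
  hence n: "n = degree E" using Suc(2) by simp
  have "[:- z, 1:] * (N * E') = [:- z, 1:] * (N' * E)" using Suc(3) unfolding E E' by (simp only: mult_ac)
  hence "N * E' = N' * E" by (subst (asm) mult_cancel_left) simp
  from Suc(1)[OF n this \<open>E \<noteq> 0\<close>] obtain t where "E' = smult t E"
    using Suc(5,6) unfolding E E' by fastforce
  thus ?case unfolding E E' by (intro exI[of _ t]) (simp only: mult_smult_right)
qed

text \<open>The second polynomial has a zero in homogeneous coordinates, at infinity if its degree
  is too small. A relation with nonzero coefficient at the first one would force a common zero
  there.\<close>

lemma rpair_independent:
  assumes r: "rpair n N D" and n: "1 \<le> n" and e: "smult u N + smult v D = 0"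
  shows "u = 0 \<and> v = 0"
proof -
  have *: "u = 0" if r: "rpair n N D" and e: "smult u N + smult v D = 0" for u v N D
  proof (rule ccontr)
    assume u: "u \<noteq> 0"
    have h: "u * hp n N x y + v * hp n D x y = 0" for x y
      using hp_combine[of n u N v D x y] unfolding e by (simp add: hp_def)
    obtain x y where xy: "x \<noteq> 0 \<or> y \<noteq> 0" "hp n D x y = 0"
    proof (cases "coeff D n = 0")
      case True thus ?thesis using that[of 1 0] by (simp add: hp_0)
    next
      case False
      hence "degree D = n" using r by (metis le_antisym le_degree rpair_def)
      hence "\<not> constant (poly D)" using n by (simp add: constant_degree)
      then obtain z where "poly D z = 0" using fundamental_theorem_of_algebra by blast
      thus ?thesis using that[of z 1] hp_1[of D n z] r by (simp add: rpair_def)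
    qed
    thus False using h[of x y] u rpair_hp[OF r xy(1)] by simp
  qed
  have r': "rpair n D N" using r by (auto simp: rpair_def)
  have e': "smult v D + smult u N = 0" using e by (simp add: add.commute)
  show ?thesis using *[OF r e] *[OF r' e'] by blast
qed

lemma rmap_eq_imp_proportional:
  assumes r: "rpair n N D" and r': "rpair n N' D'" and n: "1 \<le> n"
    and eq: "\<And>s. rmap n N D s = rmap n N' D' s"
  obtains t where "t \<noteq> 0" "N' = smult t N" "D' = smult t D"
proof -
  have c: "poly N z * poly D' z = poly N' z * poly D z" for z
  proof -
    have "poly N z \<noteq> 0 \<or> poly D z \<noteq> 0" "poly N' z \<noteq> 0 \<or> poly D' z \<noteq> 0" using r r' by (auto simp: rpair_def)
    from proj_eq_iff[OF this] show ?thesis using eq[of "Some z"] by (simp add: rmap_def)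
  qed
  have e: "N * D' = N' * D"
    by (simp add: poly_eq_poly_eq_iff[symmetric] fun_eq_iff c)
  have D0: "D \<noteq> 0"
  proof
    assume "D = 0"
    thus False using rpair_independent[OF r n, of 0 1] by simp
  qed
  obtain t where t: "D' = smult t D"
    using denominators_proportional[OF e D0] r r' unfolding rpair_def by blast
  have "D * smult t N = D * N'" using e unfolding t by (simp add: mult.commute)
  hence N': "N' = smult t N" using D0 by (subst (asm) mult_cancel_left) simp
  have "t \<noteq> 0" using r' t N' by (auto simp: rpair_def)
  thus ?thesis using that t N' by blast
qed

definition monomial_matrix :: "complex \<Rightarrow> complex \<Rightarrow> complex \<Rightarrow> complex \<Rightarrow> bool" where
  "monomial_matrix m1 m2 m3 m4 \<longleftrightarrow> m1 * m4 - m2 * m3 \<noteq> 0 \<and> (m2 = 0 \<and> m3 = 0 \<or> m1 = 0 \<and> m4 = 0)"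

lemma eta_fixed: "eta x = x \<Longrightarrow> x = Some 1 \<or> x = Some (- 1)"
  by (auto simp: eta_def field_simps power2_eq_1_iff simp flip: power2_eq_square split: option.splits if_splits)

text \<open>A map commuting with \<open>eta\<close> permutes the fixed points 1 and -1, which become
  0 and infinity in the new coordinate, so the conjugated matrix is diagonal or antidiagonal. The
  entries used are those of the conjugate, multiplied by 2 to avoid fractions.\<close>

lemma commuting_moeb_T:
  assumes d: "m1 * m4 - m2 * m3 \<noteq> 0" and c: "moeb m1 m2 m3 m4 \<circ> eta = eta \<circ> moeb m1 m2 m3 m4"
  obtains a b g e where "monomial_matrix a b g e" "\<And>s. moeb m1 m2 m3 m4 (moeb 1 1 (- 1) 1 s) = moeb 1 1 (- 1) 1 (moeb a b g e s)"
proof -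
  have fx: "moeb m1 m2 m3 m4 x = Some 1 \<or> moeb m1 m2 m3 m4 x = Some (- 1)" if "eta x = x" for x
    using fun_cong[OF c, of x] that by (intro eta_fixed) simp
  have c1: "m1 + m2 = m3 + m4 \<or> m1 + m2 = - (m3 + m4)"
    using fx[of "Some 1"] by (auto simp: eta_def moeb_def divide_eq_eq divide_minus_right split: if_splits)
  have c2: "m1 - m2 = m3 - m4 \<or> m1 - m2 = - (m3 - m4)"
    using fx[of "Some (- 1)"] by (auto simp: eta_def moeb_def divide_eq_eq algebra_simps split: if_splits)
  let ?a = "(m1 - m2) - (m3 - m4)" and ?b = "(m1 + m2) - (m3 + m4)"
    and ?g = "(m1 - m2) + (m3 - m4)" and ?e = "(m1 + m2) + (m3 + m4)"
  have det: "?a * ?e - ?b * ?g = 4 * (m1 * m4 - m2 * m3)" by (simp add: algebra_simps)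
  hence det0: "?a * ?e - ?b * ?g \<noteq> 0" using d by simp
  have mm: "monomial_matrix ?a ?b ?g ?e"
    unfolding monomial_matrix_def
  proof
    show "?a * ?e - ?b * ?g \<noteq> 0" by (rule det0)
    have "?b = 0 \<or> ?e = 0" "?a = 0 \<or> ?g = 0" using c1 c2 by auto
    thus "?b = 0 \<and> ?g = 0 \<or> ?a = 0 \<and> ?e = 0" using det0 by (elim disjE) (simp_all del: mult_eq_0_iff)
  qed
  show ?thesis
  proof (rule that[OF mm])
    fix s
    obtain x y where s: "s = proj x y" "x \<noteq> 0 \<or> y \<noteq> 0" by (rule csph_cases)
    have L: "1 * 1 - 1 * (- 1) \<noteq> (0 :: complex)" by simp
    have "moeb m1 m2 m3 m4 (moeb 1 1 (- 1) 1 s)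
        = proj (m1 * (1 * x + 1 * y) + m2 * (- 1 * x + 1 * y)) (m3 * (1 * x + 1 * y) + m4 * (- 1 * x + 1 * y))"
      unfolding s(1) moeb_proj[OF L s(2)] by (rule moeb_proj[OF d moeb_nonzero[OF L s(2)]])
    also have "\<dots> = proj (2 * (m1 * (1 * x + 1 * y) + m2 * (- 1 * x + 1 * y))) (2 * (m3 * (1 * x + 1 * y) + m4 * (- 1 * x + 1 * y)))"
      by (rule proj_scale[symmetric]) simp
    also have "\<dots> = proj (1 * (?a * x + ?b * y) + 1 * (?g * x + ?e * y)) (- 1 * (?a * x + ?b * y) + 1 * (?g * x + ?e * y))"
      by (rule arg_cong2[where f = proj]) (simp_all add: algebra_simps)
    also have "\<dots> = moeb 1 1 (- 1) 1 (moeb ?a ?b ?g ?e s)"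
      unfolding s(1) moeb_proj[OF det0 s(2)] by (rule moeb_proj[OF L moeb_nonzero[OF det0 s(2)], symmetric])
    finally show "moeb m1 m2 m3 m4 (moeb 1 1 (- 1) 1 s) = moeb 1 1 (- 1) 1 (moeb ?a ?b ?g ?e s)" .
  qed
qed

lemma monomial_moeb_commutes:
  assumes "monomial_matrix m1 m2 m3 m4"
  obtains a b g e where "a * e - b * g \<noteq> 0" "moeb a b g e \<circ> eta = eta \<circ> moeb a b g e"
    "\<And>s. moeb a b g e s = moeb 1 1 (- 1) 1 (moeb m1 m2 m3 m4 (moeb 1 (- 1) 1 1 s))"
proof -
  let ?a = "(m1 + m2) + (m3 + m4)" and ?b = "(m2 - m1) + (m4 - m3)"
    and ?g = "(m3 + m4) - (m1 + m2)" and ?e = "(m1 - m2) + (m4 - m3)"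
  have d: "m1 * m4 - m2 * m3 \<noteq> 0" using assms by (simp add: monomial_matrix_def)
  have "?a * ?e - ?b * ?g = 4 * (m1 * m4 - m2 * m3)" by (simp add: algebra_simps)
  hence det0: "?a * ?e - ?b * ?g \<noteq> 0" using d by simp
  have L: "1 * 1 - 1 * (- 1) \<noteq> (0 :: complex)" and L': "1 * 1 - (- 1) * 1 \<noteq> (0 :: complex)" by simp_all
  show ?thesis
  proof (rule that[OF det0])
    show "moeb ?a ?b ?g ?e \<circ> eta = eta \<circ> moeb ?a ?b ?g ?e"
    proof
      fix s
      obtain x y where s: "s = proj x y" "x \<noteq> 0 \<or> y \<noteq> 0" by (rule csph_cases)
      have s': "y \<noteq> 0 \<or> x \<noteq> 0" using s(2) by blast
      have l: "moeb ?a ?b ?g ?e (eta s) = proj (?a * y + ?b * x) (?g * y + ?e * x)"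
        unfolding s(1) eta_proj[OF s(2)] by (rule moeb_proj[OF det0 s'])
      have r: "eta (moeb ?a ?b ?g ?e s) = proj (?g * x + ?e * y) (?a * x + ?b * y)"
        unfolding s(1) moeb_proj[OF det0 s(2)] by (rule eta_proj[OF moeb_nonzero[OF det0 s(2)]])
      have "proj (?a * y + ?b * x) (?g * y + ?e * x) = proj (?g * x + ?e * y) (?a * x + ?b * y)"
      proof (cases "m2 = 0 \<and> m3 = 0")
        case True
        thus ?thesis by (intro arg_cong2[where f = proj]) (simp_all add: algebra_simps)
      next
        case False
        hence "m1 = 0 \<and> m4 = 0" using assms unfolding monomial_matrix_def by blast
        hence "proj (?a * y + ?b * x) (?g * y + ?e * x) = proj (- 1 * (?g * x + ?e * y)) (- 1 * (?a * x + ?b * y))"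
          by (intro arg_cong2[where f = proj]) (simp_all add: algebra_simps)
        also have "\<dots> = proj (?g * x + ?e * y) (?a * x + ?b * y)" by (rule proj_scale) simp
        finally show ?thesis .
      qed
      thus "(moeb ?a ?b ?g ?e \<circ> eta) s = (eta \<circ> moeb ?a ?b ?g ?e) s" using l r by simp
    qed
    fix s
    obtain x y where s: "s = proj x y" "x \<noteq> 0 \<or> y \<noteq> 0" by (rule csph_cases)
    have nz: "1 * x + - 1 * y \<noteq> 0 \<or> 1 * x + 1 * y \<noteq> 0" by (rule moeb_nonzero[OF L' s(2)])
    let ?u = "m1 * (1 * x + - 1 * y) + m2 * (1 * x + 1 * y)" and ?v = "m3 * (1 * x + - 1 * y) + m4 * (1 * x + 1 * y)"
    have "moeb 1 1 (- 1) 1 (moeb m1 m2 m3 m4 (moeb 1 (- 1) 1 1 s)) = proj (1 * ?u + 1 * ?v) (- 1 * ?u + 1 * ?v)"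
      unfolding s(1) moeb_proj[OF L' s(2)] moeb_proj[OF d nz] by (rule moeb_proj[OF L moeb_nonzero[OF d nz]])
    also have "\<dots> = proj (?a * x + ?b * y) (?g * x + ?e * y)"
      by (rule arg_cong2[where f = proj]) (simp_all add: algebra_simps)
    also have "\<dots> = moeb ?a ?b ?g ?e s" unfolding s(1) by (rule moeb_proj[OF det0 s(2), symmetric])
    finally show "moeb ?a ?b ?g ?e s = moeb 1 1 (- 1) 1 (moeb m1 m2 m3 m4 (moeb 1 (- 1) 1 1 s))" by (rule sym)
  qed
qed

lemma rat_equivI_T:
  assumes c: "c \<in> rat_space d" "c' \<in> rat_space d" and m: "monomial_matrix m1 m2 m3 m4" and det: "a * e - b * g \<noteq> 0"
    and eq: "\<And>s. rmap (2 * d) (TN d c') (TD d c') s = moeb a b g e (rmap (2 * d) (TN d c) (TD d c) (moeb m1 m2 m3 m4 s))"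
  shows "rat_equiv d c c'"
proof -
  obtain a1 b1 g1 e1 where M1: "a1 * e1 - b1 * g1 \<noteq> 0" "moeb a1 b1 g1 e1 \<circ> eta = eta \<circ> moeb a1 b1 g1 e1"
    "\<And>s. moeb a1 b1 g1 e1 s = moeb 1 1 (- 1) 1 (moeb m1 m2 m3 m4 (moeb 1 (- 1) 1 1 s))"
    by (rule monomial_moeb_commutes[OF m]) (rule that | assumption)+
  have "ratmap d c' = moeb a b g e \<circ> ratmap d c \<circ> moeb a1 b1 g1 e1"
  proof
    fix s
    have L: "1 * 1 - (- 1) * 1 \<noteq> (0 :: complex)" by simp
    have "moeb 1 1 (- 1) 1 (moeb 1 (- 1) 1 1 s) = s" using moeb_inverse(1)[OF L, of s] by simp
    hence "ratmap d c' s = rmap (2 * d) (TN d c') (TD d c') (moeb 1 (- 1) 1 1 s)"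
      using ratmap_T[OF c(2), of "moeb 1 (- 1) 1 1 s"] by simp
    also have "\<dots> = moeb a b g e (ratmap d c (moeb a1 b1 g1 e1 s))"
      unfolding eq ratmap_T[OF c(1)] M1(3) ..
    finally show "ratmap d c' s = (moeb a b g e \<circ> ratmap d c \<circ> moeb a1 b1 g1 e1) s" by simp
  qed
  thus ?thesis unfolding rat_equiv_def is_moeb_def using M1(1,2) det by blast
qed

text \<open>Equivalence expressed for pairs of polynomials rather than for maps, so that it can be
  passed to the limit coefficientwise; the projective factor is absorbed into \<open>a\<close>,
  \<open>b\<close>, \<open>g\<close>, \<open>e\<close>.\<close>

abbreviation (input) "T_related d c c' a b g e m1 m2 m3 m4 \<equiv> a * e - b * g \<noteq> 0 \<and> monomial_matrix m1 m2 m3 m4 \<and>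
    TN d c' = smult a (psub (2 * d) m1 m2 m3 m4 (TN d c)) + smult b (psub (2 * d) m1 m2 m3 m4 (TD d c)) \<and>
    TD d c' = smult g (psub (2 * d) m1 m2 m3 m4 (TN d c)) + smult e (psub (2 * d) m1 m2 m3 m4 (TD d c))"

lemma rat_equiv_iff_T:
  assumes d: "1 \<le> d" and c: "c \<in> rat_space d" "c' \<in> rat_space d"
  shows "rat_equiv d c c' \<longleftrightarrow> (\<exists>a b g e m1 m2 m3 m4. T_related d c c' a b g e m1 m2 m3 m4)"
proof
  have r: "rpair (2 * d) (TN d c) (TD d c)" and r': "rpair (2 * d) (TN d c') (TD d c')"
    using c by (simp_all add: rat_space_iff_T)
  assume "rat_equiv d c c'"
  then obtain m1 m2 m3 m4 a b g e where m: "m1 * m4 - m2 * m3 \<noteq> 0" "a * e - b * g \<noteq> 0"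
    "moeb m1 m2 m3 m4 \<circ> eta = eta \<circ> moeb m1 m2 m3 m4" "ratmap d c' = moeb a b g e \<circ> ratmap d c \<circ> moeb m1 m2 m3 m4"
    unfolding rat_equiv_def is_moeb_def by blast
  obtain m1' m2' m3' m4' where mm: "monomial_matrix m1' m2' m3' m4'"
    "\<And>s. moeb m1 m2 m3 m4 (moeb 1 1 (- 1) 1 s) = moeb 1 1 (- 1) 1 (moeb m1' m2' m3' m4' s)"
    by (rule commuting_moeb_T[OF m(1,3)]) (rule that | assumption)+
  have dt: "m1' * m4' - m2' * m3' \<noteq> 0" using mm(1) by (simp add: monomial_matrix_def)
  let ?p = "psub (2 * d) m1' m2' m3' m4'"
  let ?N = "smult a (?p (TN d c)) + smult b (?p (TD d c))" and ?D = "smult g (?p (TN d c)) + smult e (?p (TD d c))"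
  have rp: "rpair (2 * d) (?p (TN d c)) (?p (TD d c))" by (rule rpair_psub[OF r dt])
  have "rmap (2 * d) ?N ?D s = rmap (2 * d) (TN d c') (TD d c') s" for s
    unfolding rmap_post[OF rp m(2)] rmap_psub[OF r dt] ratmap_T[OF c(1)] ratmap_T[OF c(2)] m(4) by (simp add: mm(2))
  then obtain t where t: "t \<noteq> 0" "TN d c' = smult t ?N" "TD d c' = smult t ?D"
    by (rule rmap_eq_imp_proportional[OF rpair_post[OF rp m(2)] r', rotated]) (use d in \<open>auto intro: that\<close>)
  have "t * a * (t * e) - t * b * (t * g) = t * t * (a * e - b * g)" by (simp add: algebra_simps)
  hence "t * a * (t * e) - t * b * (t * g) \<noteq> 0" using t(1) m(2) by simp
  moreover have "TN d c' = smult (t * a) (?p (TN d c)) + smult (t * b) (?p (TD d c))"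
    "TD d c' = smult (t * g) (?p (TN d c)) + smult (t * e) (?p (TD d c))"
    using t(2,3) by (simp_all add: smult_add_right)
  ultimately show "\<exists>a b g e m1 m2 m3 m4. T_related d c c' a b g e m1 m2 m3 m4"
    using mm(1) by blast
next
  have r: "rpair (2 * d) (TN d c) (TD d c)" using c by (simp add: rat_space_iff_T)
  assume "\<exists>a b g e m1 m2 m3 m4. T_related d c c' a b g e m1 m2 m3 m4"
  then obtain a b g e m1 m2 m3 m4 where h: "a * e - b * g \<noteq> 0" "monomial_matrix m1 m2 m3 m4"
     "TN d c' = smult a (psub (2 * d) m1 m2 m3 m4 (TN d c)) + smult b (psub (2 * d) m1 m2 m3 m4 (TD d c))"
     "TD d c' = smult g (psub (2 * d) m1 m2 m3 m4 (TN d c)) + smult e (psub (2 * d) m1 m2 m3 m4 (TD d c))" by blast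
  have dt: "m1 * m4 - m2 * m3 \<noteq> 0" using h(2) by (simp add: monomial_matrix_def)
  show "rat_equiv d c c'"
    by (rule rat_equivI_T[OF c h(2,1)])
      (simp only: h(3,4) rmap_post[OF rpair_psub[OF r dt] h(1)] rmap_psub[OF r dt])
qed

lemma is_moeb_compose: "is_moeb M \<Longrightarrow> is_moeb M' \<Longrightarrow> is_moeb (M \<circ> M')"
proof -
  assume "is_moeb M" "is_moeb M'"
  then obtain a b c e a' b' c' e' where m: "a * e - b * c \<noteq> 0" "M = moeb a b c e" "a' * e' - b' * c' \<noteq> 0" "M' = moeb a' b' c' e'"
    unfolding is_moeb_def by blast
  have "(a * a' + b * c') * (c * b' + e * e') - (a * b' + b * e') * (c * a' + e * c') = (a * e - b * c) * (a' * e' - b' * c')"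
    by (simp add: algebra_simps)
  hence "(a * a' + b * c') * (c * b' + e * e') - (a * b' + b * e') * (c * a' + e * c') \<noteq> 0" using m by simp
  moreover have "M \<circ> M' = moeb (a * a' + b * c') (a * b' + b * e') (c * a' + e * c') (c * b' + e * e')"
    unfolding m(2,4) by (rule ext) (simp add: moeb_compose[OF m(1,3)])
  ultimately show ?thesis unfolding is_moeb_def by blast
qed

lemma is_moeb_inverse: "is_moeb M \<Longrightarrow> \<exists>M'. is_moeb M' \<and> M' \<circ> M = id \<and> M \<circ> M' = id"
proof -
  assume "is_moeb M"
  then obtain a b c e where m: "a * e - b * c \<noteq> 0" "M = moeb a b c e" unfolding is_moeb_def by blast
  have "e * a - (- b) * (- c) \<noteq> 0" using m(1) by (simp add: mult.commute)
  hence "is_moeb (moeb e (- b) (- c) a)" unfolding is_moeb_def by blast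
  thus ?thesis using moeb_inverse[OF m(1)] m(2)
    by (intro exI[of _ "moeb e (- b) (- c) a"]) (auto simp: fun_eq_iff)
qed

lemma rat_equiv_refl: "rat_equiv d c c"
proof -
  have "moeb 1 0 0 1 = id" by (rule ext) (simp add: moeb_scalar)
  hence "is_moeb id" unfolding is_moeb_def by (metis mult_1 mult_zero_left diff_zero one_neq_zero)
  thus ?thesis unfolding rat_equiv_def by (intro exI[of _ id]) simp
qed

lemma rat_equiv_trans: "rat_equiv d c c' \<Longrightarrow> rat_equiv d c' c'' \<Longrightarrow> rat_equiv d c c''"
proof -
  assume "rat_equiv d c c'" "rat_equiv d c' c''"
  then obtain M1 M2 M3 M4 where m: "is_moeb M1" "is_moeb M2" "M1 \<circ> eta = eta \<circ> M1" "ratmap d c' = M2 \<circ> ratmap d c \<circ> M1"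
    "is_moeb M3" "is_moeb M4" "M3 \<circ> eta = eta \<circ> M3" "ratmap d c'' = M4 \<circ> ratmap d c' \<circ> M3"
    unfolding rat_equiv_def by blast
  have "(M1 \<circ> M3) \<circ> eta = eta \<circ> (M1 \<circ> M3)" by (metis comp_assoc m(3,7))
  moreover have "ratmap d c'' = (M4 \<circ> M2) \<circ> ratmap d c \<circ> (M1 \<circ> M3)" unfolding m(8,4) by (simp only: comp_assoc)
  ultimately show ?thesis unfolding rat_equiv_def using is_moeb_compose m by blast
qed

lemma rat_equiv_sym: "rat_equiv d c c' \<Longrightarrow> rat_equiv d c' c"
proof -
  assume "rat_equiv d c c'"
  then obtain M1 M2 where m: "is_moeb M1" "is_moeb M2" "M1 \<circ> eta = eta \<circ> M1" "ratmap d c' = M2 \<circ> ratmap d c \<circ> M1"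
    unfolding rat_equiv_def by blast
  obtain I1 I2 where i: "is_moeb I1" "I1 \<circ> M1 = id" "M1 \<circ> I1 = id" "is_moeb I2" "I2 \<circ> M2 = id" "M2 \<circ> I2 = id"
    using is_moeb_inverse m(1,2) by metis
  have "I1 \<circ> eta = eta \<circ> I1"
  proof
    fix x
    have "M1 (eta (I1 x)) = eta (M1 (I1 x))" using fun_cong[OF m(3), of "I1 x"] by simp
    also have "\<dots> = eta x" using fun_cong[OF i(3), of x] by simp
    finally have "I1 (M1 (eta (I1 x))) = I1 (eta x)" by simp
    thus "(I1 \<circ> eta) x = (eta \<circ> I1) x" using fun_cong[OF i(2), of "eta (I1 x)"] by simp
  qed
  moreover have "ratmap d c = I2 \<circ> ratmap d c' \<circ> I1"
  proof
    fix x
    show "ratmap d c x = (I2 \<circ> ratmap d c' \<circ> I1) x"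
      using fun_cong[OF i(3), of x] fun_cong[OF i(5), of "ratmap d c x"] by (simp add: m(4))
  qed
  ultimately show ?thesis unfolding rat_equiv_def using i by blast
qed

lemma rat_cls_eq_iff:
  assumes "c' \<in> rat_space d"
  shows "rat_cls d c = rat_cls d c' \<longleftrightarrow> rat_equiv d c c'"
proof
  assume "rat_cls d c = rat_cls d c'"
  moreover have "c' \<in> rat_cls d c'" using assms rat_equiv_refl by (simp add: rat_cls_def)
  ultimately show "rat_equiv d c c'" by (auto simp: rat_cls_def)
next
  assume "rat_equiv d c c'"
  thus "rat_cls d c = rat_cls d c'"
    unfolding rat_cls_def using rat_equiv_trans rat_equiv_sym by blast
qed

section \<open>Limits of equivalent maps\<close>

lemma pconv_power: "pconv q p \<Longrightarrow> pconv (\<lambda>i. q i ^ m) (p ^ m)"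
  by (induction m) (auto intro: pconv_mult)

lemma pconv_sum: "(\<And>x. x \<in> S \<Longrightarrow> pconv (q x) (p x)) \<Longrightarrow> pconv (\<lambda>i. \<Sum>x\<in>S. q x i) (\<Sum>x\<in>S. p x)"
  unfolding pconv_def coeff_sum by (auto intro!: tendsto_intros)

lemma pconv_psub:
  assumes p: "pconv q p" and m: "a \<longlonglongrightarrow> a'" "b \<longlonglongrightarrow> b'" "c \<longlonglongrightarrow> c'" "e \<longlonglongrightarrow> e'"
  shows "pconv (\<lambda>k. psub n (a k) (b k) (c k) (e k) (q k)) (psub n a' b' c' e' p)"
  unfolding psub_def
  by (intro pconv_sum pconv_smult pconv_mult pconv_power pconv_linear m) (use p in \<open>simp add: pconv_def\<close>)

lemma tendsto_coordinate: "(x \<longlongrightarrow> l) F \<Longrightarrow> ((\<lambda>k. x k i) \<longlongrightarrow> l i) F" for x :: "_ \<Rightarrow> nat \<Rightarrow> complex"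
  by (rule continuous_on_tendsto_compose[OF continuous_on_product_coordinates]) auto

lemma pconv_T:
  assumes "x \<longlonglongrightarrow> l"
  shows "pconv (\<lambda>k. TN d (x k)) (TN d l)" "pconv (\<lambda>k. TD d (x k)) (TD d l)"
proof -
  have "pconv (\<lambda>k. nump d (x k)) (nump d l)" "pconv (\<lambda>k. denp d (x k)) (denp d l)"
    using tendsto_coordinate[OF assms] by (auto simp: pconv_def coeff_nump coeff_denp)
  note nd = this
  show "pconv (\<lambda>k. TN d (x k)) (TN d l)" "pconv (\<lambda>k. TD d (x k)) (TD d l)"
    unfolding TN_def TD_def
    by (rule pconv_psub[OF nd(1) tendsto_const tendsto_const tendsto_const tendsto_const],
        rule pconv_psub[OF nd(2) tendsto_const tendsto_const tendsto_const tendsto_const])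
qed

text \<open>Cramer's rule: the coefficients \<open>u k\<close> and \<open>v k\<close> need not
  converge, but the two-by-two minors do, and a nonzero minor of the limits exists by
  independence.\<close>

lemma span_limit:
  fixes N D E :: "nat \<Rightarrow> complex poly"
  assumes N: "pconv N N'" and D: "pconv D D'" and E: "pconv E E'"
    and ind: "\<And>u v. smult u N' + smult v D' = 0 \<Longrightarrow> u = 0 \<and> v = 0"
    and comb: "\<And>k. E k = smult (u k) (N k) + smult (v k) (D k)"
  shows "\<exists>u v. E' = smult u N' + smult v D'"
proof -
  obtain i j where ij: "coeff N' i * coeff D' j - coeff N' j * coeff D' i \<noteq> 0"
  proof (cases "N' = 0")
    case True
    thus ?thesis using ind[of 1 0] by simp
  next
    case False
    then obtain i where i: "coeff N' i \<noteq> 0" by (metis leading_coeff_0_iff)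
    have "\<exists>j. coeff N' i * coeff D' j - coeff N' j * coeff D' i \<noteq> 0"
    proof (rule ccontr)
      assume "\<not> ?thesis"
      hence "smult (- coeff D' i) N' + smult (coeff N' i) D' = 0"
        by (intro poly_eqI) (simp add: mult.commute)
      thus False using ind i by blast
    qed
    thus ?thesis using that by blast
  qed
  let ?m = "coeff N' i * coeff D' j - coeff N' j * coeff D' i"
  let ?u = "coeff E' i * coeff D' j - coeff E' j * coeff D' i"
  let ?v = "coeff N' i * coeff E' j - coeff N' j * coeff E' i"
  have cv: "(\<lambda>k. coeff (N k) t) \<longlonglongrightarrow> coeff N' t" "(\<lambda>k. coeff (D k) t) \<longlonglongrightarrow> coeff D' t"
    "(\<lambda>k. coeff (E k) t) \<longlonglongrightarrow> coeff E' t" for t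
    using N D E by (auto simp: pconv_def)
  have id: "?m * coeff E' t = ?u * coeff N' t + ?v * coeff D' t" for t
  proof (rule LIMSEQ_unique)
    show "(\<lambda>k. (coeff (N k) i * coeff (D k) j - coeff (N k) j * coeff (D k) i) * coeff (E k) t) \<longlonglongrightarrow> ?m * coeff E' t"
      by (intro tendsto_intros cv)
    have "(\<lambda>k. (coeff (E k) i * coeff (D k) j - coeff (E k) j * coeff (D k) i) * coeff (N k) t
        + (coeff (N k) i * coeff (E k) j - coeff (N k) j * coeff (E k) i) * coeff (D k) t)
        \<longlonglongrightarrow> ?u * coeff N' t + ?v * coeff D' t"
      by (intro tendsto_intros cv)
    thus "(\<lambda>k. (coeff (N k) i * coeff (D k) j - coeff (N k) j * coeff (D k) i) * coeff (E k) t)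
        \<longlonglongrightarrow> ?u * coeff N' t + ?v * coeff D' t"
      by (simp add: comb algebra_simps)
  qed
  show ?thesis
  proof (intro exI)
    show "E' = smult (?u / ?m) N' + smult (?v / ?m) D'"
    proof (rule poly_eqI)
      fix t
      have "?m * coeff (smult (?u / ?m) N' + smult (?v / ?m) D') t = ?m * coeff E' t"
        unfolding id coeff_add coeff_smult distrib_left using ij by simp
      thus "coeff E' t = coeff (smult (?u / ?m) N' + smult (?v / ?m) D') t"
        using ij by (metis mult_cancel_left)
    qed
  qed
qed

lemma psub_scale: "psub n (t * a) (t * b) (t * c) (t * e) p = smult (t ^ n) (psub n a b c e p)"
proof (rule poly_eq_hp[OF degree_psub order_trans[OF degree_smult_le degree_psub]])
  fix x y
  have "hp n p (t * a * x + t * b * y) (t * c * x + t * e * y) = hp n p (t * (a * x + b * y)) (t * (c * x + e * y))"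
    by (rule arg_cong2[where f = "hp n p"]) (simp_all add: algebra_simps)
  thus "hp n (psub n (t * a) (t * b) (t * c) (t * e) p) x y = hp n (smult (t ^ n) (psub n a b c e p)) x y"
    unfolding hp_psub hp_smult hp_scale .
qed

lemma hp_monom: "m \<le> n \<Longrightarrow> hp n (monom t m) x y = t * x ^ m * y ^ (n - m)"
proof -
  assume m: "m \<le> n"
  have "hp n (monom t m) x y = (\<Sum>i\<in>{..n}. if i = m then t * x ^ i * y ^ (n - i) else 0)"
    unfolding hp_def by (rule sum.cong) auto
  thus ?thesis using m by simp
qed

lemma hp_0_left: "hp n p 0 y = coeff p 0 * y ^ n"
proof -
  have "(\<Sum>i\<le>n. coeff p i * 0 ^ i * y ^ (n - i)) = (\<Sum>i\<in>{0}. coeff p i * 0 ^ i * y ^ (n - i))"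
    by (rule sum.mono_neutral_right) auto
  thus ?thesis by (simp add: hp_def)
qed

text \<open>When the normalized source change degenerates to rank one, the limit is a monomial.\<close>
lemma psub_rank_one:
  assumes z: "m1 * m2 = 0" "m1 * m3 = 0" "m4 * m2 = 0" "m4 * m3 = 0" and det: "m1 * m4 - m2 * m3 = 0"
    and nz: "m1 \<noteq> 0 \<or> m2 \<noteq> 0 \<or> m3 \<noteq> 0 \<or> m4 \<noteq> 0" and n: "1 \<le> n"
  obtains j m t where "j = 0 \<or> j = n" "m = 0 \<or> m = n" "t \<noteq> 0"
    "\<And>p. psub n m1 m2 m3 m4 p = smult (t * coeff p j) (monom 1 m)"
proof -
  have gen: "psub n m1 m2 m3 m4 p = smult (t * coeff p j) (monom 1 m)"
    if "m = 0 \<or> m = n" "\<And>x y. hp n p (m1 * x + m2 * y) (m3 * x + m4 * y) = t * coeff p j * x ^ m * y ^ (n - m)" for p t j m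
  proof (rule poly_eq_hp[OF degree_psub])
    have mn: "m \<le> n" using that(1) by auto
    show "degree (smult (t * coeff p j) (monom 1 m)) \<le> n"
      by (rule order_trans[OF degree_smult_le order_trans[OF degree_monom_le mn]])
    show "hp n (psub n m1 m2 m3 m4 p) x y = hp n (smult (t * coeff p j) (monom 1 m)) x y" for x y
      unfolding hp_psub hp_smult hp_monom[OF mn] that(2) by simp
  qed
  consider "m1 \<noteq> 0" "m2 = 0" "m3 = 0" "m4 = 0" | "m2 \<noteq> 0" "m1 = 0" "m3 = 0" "m4 = 0"
    | "m3 \<noteq> 0" "m1 = 0" "m2 = 0" "m4 = 0" | "m4 \<noteq> 0" "m1 = 0" "m2 = 0" "m3 = 0"
    using z det nz by auto
  thus ?thesis
  proof cases
    case 1 thus ?thesis by (intro that[of n n "m1 ^ n"] gen) (auto simp: hp_0 power_mult_distrib)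
  next
    case 2 thus ?thesis by (intro that[of n 0 "m2 ^ n"] gen) (auto simp: hp_0 power_mult_distrib)
  next
    case 3 thus ?thesis by (intro that[of 0 n "m3 ^ n"] gen) (auto simp: hp_0_left power_mult_distrib)
  next
    case 4 thus ?thesis by (intro that[of 0 0 "m4 ^ n"] gen) (auto simp: hp_0_left power_mult_distrib)
  qed
qed

text \<open>The pencil spanned by the pair contains 1 or the top power of the coordinate, so up to a
  Moebius map of the target the map is a polynomial in \<open>z\<close> or in
  \<open>1 / z\<close>.\<close>

definition has_monomial :: "nat \<Rightarrow> (nat \<Rightarrow> complex) \<Rightarrow> bool" where
  "has_monomial d l \<longleftrightarrow> (\<exists>m u v. (m = 0 \<or> m = 2 * d) \<and> monom 1 m = smult u (TN d l) + smult v (TD d l))"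

text \<open>Rescaling the source matrix changes both substituted polynomials by the same factor,
  which the target matrix absorbs. This keeps the source matrices in a compact set, so that only a
  drop of rank remains possible in the limit.\<close>

lemma normalized_equivalence:
  assumes d: "1 \<le> d" and c: "c \<in> rat_space d" "c' \<in> rat_space d" and e: "rat_equiv d c c'"
  shows "\<exists>a b g e m1 m2 m3 m4. T_related d c c' a b g e m1 m2 m3 m4 \<and>
     cmod m1 + cmod m2 + cmod m3 + cmod m4 = 1"
proof -
  obtain a b g e m1 m2 m3 m4 where h: "a * e - b * g \<noteq> 0" "monomial_matrix m1 m2 m3 m4"
     "TN d c' = smult a (psub (2 * d) m1 m2 m3 m4 (TN d c)) + smult b (psub (2 * d) m1 m2 m3 m4 (TD d c))"
     "TD d c' = smult g (psub (2 * d) m1 m2 m3 m4 (TN d c)) + smult e (psub (2 * d) m1 m2 m3 m4 (TD d c))"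
    using e unfolding rat_equiv_iff_T[OF d c] by blast
  define s where "s = cmod m1 + cmod m2 + cmod m3 + cmod m4"
  have s0: "s \<noteq> 0"
  proof
    assume "s = 0"
    hence "cmod m1 = 0" "cmod m2 = 0"
      unfolding s_def using norm_ge_zero[of m1] norm_ge_zero[of m2] norm_ge_zero[of m3] norm_ge_zero[of m4] by linarith+
    thus False using h(2) by (simp add: monomial_matrix_def)
  qed
  hence sp: "0 < s" unfolding s_def by (metis add_nonneg_nonneg norm_ge_zero order_le_less)
  define t where "t = complex_of_real (1 / s)"
  have t0: "t \<noteq> 0" using s0 by (simp add: t_def)
  define w where "w = t ^ (2 * d)"
  have w0: "w \<noteq> 0" using t0 by (simp add: w_def)
  let ?p = "psub (2 * d) (t * m1) (t * m2) (t * m3) (t * m4)"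
  have p: "smult q (psub (2 * d) m1 m2 m3 m4 f) = smult (q / w) (?p f)" for q f
    unfolding psub_scale w_def[symmetric] using w0 by simp
  have "a / w * (e / w) - b / w * (g / w) = (a * e - b * g) / (w * w)" by (simp add: diff_divide_distrib)
  hence 1: "a / w * (e / w) - b / w * (g / w) \<noteq> 0" using h(1) w0 by simp
  have "t * m1 * (t * m4) - t * m2 * (t * m3) = t * t * (m1 * m4 - m2 * m3)" by (simp add: algebra_simps)
  hence 2: "monomial_matrix (t * m1) (t * m2) (t * m3) (t * m4)" using h(2) t0 by (auto simp: monomial_matrix_def)
  have "cmod t = 1 / s" using sp by (simp add: t_def norm_divide)
  hence "cmod (t * m1) + cmod (t * m2) + cmod (t * m3) + cmod (t * m4) = 1 / s * s"
    unfolding norm_mult by (simp only: s_def distrib_left)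
  hence 3: "cmod (t * m1) + cmod (t * m2) + cmod (t * m3) + cmod (t * m4) = 1" using s0 by simp
  have 4: "TN d c' = smult (a / w) (?p (TN d c)) + smult (b / w) (?p (TD d c))" using h(3) by (simp only: p)
  have 5: "TD d c' = smult (g / w) (?p (TN d c)) + smult (e / w) (?p (TD d c))" using h(4) by (simp only: p)
  show ?thesis
    by (rule exI[of _ "a / w"], rule exI[of _ "b / w"], rule exI[of _ "g / w"], rule exI[of _ "e / w"],
        rule exI[of _ "t * m1"], rule exI[of _ "t * m2"], rule exI[of _ "t * m3"], rule exI[of _ "t * m4"])
      (intro conjI 1 2 3 4 5)
qed

text \<open>Along a subsequence the points of \<open>C\<close> and the source matrices converge; the
  target matrices are not controlled, and only the spans are compared. If the limiting source matrix
  is invertible, the limit is equivalent to a point of \<open>C\<close>. If it has rank one, every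
  substituted polynomial tends to a multiple of one monomial, which must then lie in the pencil of
  \<open>l\<close>.\<close>

lemma equivalence_limit:
  assumes d: "1 \<le> d" and C: "compact C" "C \<subseteq> rat_space d"
    and x: "\<And>k. x k \<in> rat_space d" "\<And>k. \<exists>y\<in>C. rat_equiv d y (x k)" and l: "x \<longlonglongrightarrow> l" "l \<in> rat_space d"
  shows "(\<exists>y\<in>C. rat_equiv d y l) \<or> has_monomial d l"
proof -
  define Q where "Q k y a b g e m1 m2 m3 m4 \<longleftrightarrow> y \<in> C \<and> T_related d y (x k) a b g e m1 m2 m3 m4 \<and>
     cmod m1 + cmod m2 + cmod m3 + cmod m4 = 1" for k y a b g e m1 m2 m3 m4
  have "\<exists>y a b g e m1 m2 m3 m4. Q k y a b g e m1 m2 m3 m4" for k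
  proof -
    obtain y where y: "y \<in> C" "rat_equiv d y (x k)" using x(2) by blast
    hence "y \<in> rat_space d" using C(2) by blast
    from normalized_equivalence[OF d this x(1) y(2)] show ?thesis unfolding Q_def using y(1) by blast
  qed
  then obtain y a b g e m1 m2 m3 m4 where Q: "\<And>k. Q k (y k) (a k) (b k) (g k) (e k) (m1 k) (m2 k) (m3 k) (m4 k)"
    by metis
  have mm: "monomial_matrix (m1 k) (m2 k) (m3 k) (m4 k)" and abge: "a k * e k - b k * g k \<noteq> 0" and yC: "y k \<in> C"
    and s1: "cmod (m1 k) + cmod (m2 k) + cmod (m3 k) + cmod (m4 k) = 1"
    and xN: "TN d (x k) = smult (a k) (psub (2 * d) (m1 k) (m2 k) (m3 k) (m4 k) (TN d (y k))) + smult (b k) (psub (2 * d) (m1 k) (m2 k) (m3 k) (m4 k) (TD d (y k)))"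
    and xD: "TD d (x k) = smult (g k) (psub (2 * d) (m1 k) (m2 k) (m3 k) (m4 k) (TN d (y k))) + smult (e k) (psub (2 * d) (m1 k) (m2 k) (m3 k) (m4 k) (TD d (y k)))"
    for k using Q[of k] by (auto simp: Q_def)
  let ?B = "cball (0 :: complex) 1"
  have cp: "compact (C \<times> ?B \<times> ?B \<times> ?B \<times> ?B)" by (intro compact_Times C(1) compact_cball)
  have inB: "\<forall>k. (y k, m1 k, m2 k, m3 k, m4 k) \<in> C \<times> ?B \<times> ?B \<times> ?B \<times> ?B"
  proof
    fix k
    have "cmod (m1 k) \<le> 1" "cmod (m2 k) \<le> 1" "cmod (m3 k) \<le> 1" "cmod (m4 k) \<le> 1"
      using s1[of k] norm_ge_zero[of "m1 k"] norm_ge_zero[of "m2 k"] norm_ge_zero[of "m3 k"] norm_ge_zero[of "m4 k"] by linarith+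
    thus "(y k, m1 k, m2 k, m3 k, m4 k) \<in> C \<times> ?B \<times> ?B \<times> ?B \<times> ?B" using yC by simp
  qed
  obtain L r where Lr: "L \<in> C \<times> ?B \<times> ?B \<times> ?B \<times> ?B" "strict_mono (r :: nat \<Rightarrow> nat)"
    "((\<lambda>k. (y k, m1 k, m2 k, m3 k, m4 k)) \<circ> r) \<longlonglongrightarrow> L"
    by (rule seq_compactE[OF compact_eq_seq_compact_metric[THEN iffD1, OF cp] inB]) (rule that | assumption)+
  obtain y' m1' m2' m3' m4' where L: "L = (y', m1', m2', m3', m4')" by (cases L)
  have lim: "(\<lambda>k. (y (r k), m1 (r k), m2 (r k), m3 (r k), m4 (r k))) \<longlonglongrightarrow> (y', m1', m2', m3', m4')"
    using Lr(3) by (simp add: L o_def)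
  have y': "(\<lambda>k. y (r k)) \<longlonglongrightarrow> y'" using tendsto_fst[OF lim] by simp
  have m1': "(\<lambda>k. m1 (r k)) \<longlonglongrightarrow> m1'" using tendsto_fst[OF tendsto_snd[OF lim]] by simp
  have m2': "(\<lambda>k. m2 (r k)) \<longlonglongrightarrow> m2'" using tendsto_fst[OF tendsto_snd[OF tendsto_snd[OF lim]]] by simp
  have m3': "(\<lambda>k. m3 (r k)) \<longlonglongrightarrow> m3'" using tendsto_fst[OF tendsto_snd[OF tendsto_snd[OF tendsto_snd[OF lim]]]] by simp
  have m4': "(\<lambda>k. m4 (r k)) \<longlonglongrightarrow> m4'" using tendsto_snd[OF tendsto_snd[OF tendsto_snd[OF tendsto_snd[OF lim]]]] by simp
  have y'C: "y' \<in> C" using Lr(1) L by simp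
  have x': "(\<lambda>k. x (r k)) \<longlonglongrightarrow> l" using LIMSEQ_subseq_LIMSEQ[OF l(1) Lr(2)] by (simp add: o_def)
  have prod0: "f * f' = 0" if "(\<lambda>k. h (r k)) \<longlonglongrightarrow> f" "(\<lambda>k. h' (r k)) \<longlonglongrightarrow> f'" "\<And>k. h k * h' k = 0"
    for f f' :: complex and h h'
    using LIMSEQ_unique[OF tendsto_mult[OF that(1,2)], of 0] that(3) by simp
  have mz: "m1 k * m2 k = 0" "m1 k * m3 k = 0" "m4 k * m2 k = 0" "m4 k * m3 k = 0" for k
    using mm[of k] by (auto simp: monomial_matrix_def)
  have z: "m1' * m2' = 0" "m1' * m3' = 0" "m4' * m2' = 0" "m4' * m3' = 0"
    by (rule prod0[OF m1' m2' mz(1)] prod0[OF m1' m3' mz(2)] prod0[OF m4' m2' mz(3)] prod0[OF m4' m3' mz(4)])+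
  have "(\<lambda>k. cmod (m1 (r k)) + cmod (m2 (r k)) + cmod (m3 (r k)) + cmod (m4 (r k))) \<longlonglongrightarrow> cmod m1' + cmod m2' + cmod m3' + cmod m4'"
    by (intro tendsto_intros m1' m2' m3' m4')
  from LIMSEQ_unique[OF this, of 1] have "cmod m1' + cmod m2' + cmod m3' + cmod m4' = 1" by (simp add: s1)
  hence nz: "m1' \<noteq> 0 \<or> m2' \<noteq> 0 \<or> m3' \<noteq> 0 \<or> m4' \<noteq> 0" by auto
  define pN where "pN k = psub (2 * d) (m1 (r k)) (m2 (r k)) (m3 (r k)) (m4 (r k)) (TN d (y (r k)))" for k
  define pD where "pD k = psub (2 * d) (m1 (r k)) (m2 (r k)) (m3 (r k)) (m4 (r k)) (TD d (y (r k)))" for k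
  define pN' where "pN' = psub (2 * d) m1' m2' m3' m4' (TN d y')"
  define pD' where "pD' = psub (2 * d) m1' m2' m3' m4' (TD d y')"
  have cN: "pconv pN pN'" and cD: "pconv pD pD'"
    unfolding pN_def pD_def pN'_def pD'_def by (intro pconv_psub pconv_T y' m1' m2' m3' m4')+
  have cX: "pconv (\<lambda>k. TN d (x (r k))) (TN d l)" "pconv (\<lambda>k. TD d (x (r k))) (TD d l)" by (rule pconv_T[OF x'])+
  have rl: "rpair (2 * d) (TN d l) (TD d l)" and ry: "rpair (2 * d) (TN d y') (TD d y')"
    using l(2) y'C C(2) rat_space_iff_T by blast+
  have d1: "1 \<le> 2 * d" using d by simp
  show ?thesis
  proof (cases "m1' * m4' - m2' * m3' = 0")
    case False
    have rp: "rpair (2 * d) pN' pD'" unfolding pN'_def pD'_def by (rule rpair_psub[OF ry False])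
    note ind = rpair_independent[OF rp d1]
    have "\<exists>u v. TN d l = smult u pN' + smult v pD'"
      by (rule span_limit[OF cN cD cX(1) ind]) (simp_all add: xN pN_def pD_def)
    then obtain a' b' where N: "TN d l = smult a' pN' + smult b' pD'" by blast
    have "\<exists>u v. TD d l = smult u pN' + smult v pD'"
      by (rule span_limit[OF cN cD cX(2) ind]) (simp_all add: xD pN_def pD_def)
    then obtain g' e' where D: "TD d l = smult g' pN' + smult e' pD'" by blast
    have det: "a' * e' - b' * g' \<noteq> 0"
    proof
      assume z: "a' * e' - b' * g' = 0"
      hence ae: "a' * e' = b' * g'" by simp
      have "smult e' (TN d l) + smult (- b') (TD d l) = smult (a' * e' - b' * g') pN'"
        unfolding N D by (simp add: smult_add_right smult_diff_left mult.commute)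
      hence 1: "e' = 0 \<and> - b' = 0" by (intro rpair_independent[OF rl d1]) (simp add: z)
      have "smult g' (TN d l) + smult (- a') (TD d l) = smult (b' * g' - a' * e') pD'"
        unfolding N D by (simp add: smult_add_right smult_diff_left mult.commute)
      hence "g' = 0 \<and> - a' = 0" by (intro rpair_independent[OF rl d1]) (simp add: ae)
      hence "TN d l = 0" "TD d l = 0" using 1 N D by simp_all
      thus False using rl by (simp add: rpair_def)
    qed
    have "monomial_matrix m1' m2' m3' m4'" unfolding monomial_matrix_def using False z by auto
    hence "rat_equiv d y' l"
      unfolding rat_equiv_iff_T[OF d subsetD[OF C(2) y'C] l(2)]
      using det N D unfolding pN'_def pD'_def by blast
    thus ?thesis using y'C by blast
  next
    case True
    obtain j m t where jmt: "j = 0 \<or> j = 2 * d" "m = 0 \<or> m = 2 * d" "t \<noteq> 0"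
      "\<And>p. psub (2 * d) m1' m2' m3' m4' p = smult (t * coeff p j) (monom 1 m)"
      by (rule psub_rank_one[OF z True nz d1]) (rule that | assumption)+
    \<comment> \<open>The target matrix is inverted to express the substituted pair through the
      convergent pair. The entries may diverge, which \<open>span_limit\<close> tolerates.\<close>
    have inv: "pN k = smult (e (r k) / (a (r k) * e (r k) - b (r k) * g (r k))) (TN d (x (r k))) + smult (- b (r k) / (a (r k) * e (r k) - b (r k) * g (r k))) (TD d (x (r k)))"
      "pD k = smult (- g (r k) / (a (r k) * e (r k) - b (r k) * g (r k))) (TN d (x (r k))) + smult (a (r k) / (a (r k) * e (r k) - b (r k) * g (r k))) (TD d (x (r k)))" for k
    proof -
      define D where "D = a (r k) * e (r k) - b (r k) * g (r k)"
      have D0: "D \<noteq> 0" using abge by (simp add: D_def)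
      have "smult D (pN k) = smult (e (r k)) (TN d (x (r k))) + smult (- b (r k)) (TD d (x (r k)))"
        unfolding xN xD pN_def[symmetric] pD_def[symmetric] D_def
        by (intro poly_eqI) (simp add: algebra_simps)
      hence "smult (1 / D) (smult D (pN k)) = smult (1 / D) (smult (e (r k)) (TN d (x (r k))) + smult (- b (r k)) (TD d (x (r k))))" by simp
      thus "pN k = smult (e (r k) / (a (r k) * e (r k) - b (r k) * g (r k))) (TN d (x (r k))) + smult (- b (r k) / (a (r k) * e (r k) - b (r k) * g (r k))) (TD d (x (r k)))"
        using D0 by (simp add: smult_add_right smult_diff_right flip: D_def)
      have "smult D (pD k) = smult (- g (r k)) (TN d (x (r k))) + smult (a (r k)) (TD d (x (r k)))"
        unfolding xN xD pN_def[symmetric] pD_def[symmetric] D_def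
        by (intro poly_eqI) (simp add: algebra_simps)
      hence "smult (1 / D) (smult D (pD k)) = smult (1 / D) (smult (- g (r k)) (TN d (x (r k))) + smult (a (r k)) (TD d (x (r k))))" by simp
      thus "pD k = smult (- g (r k) / (a (r k) * e (r k) - b (r k) * g (r k))) (TN d (x (r k))) + smult (a (r k) / (a (r k) * e (r k) - b (r k) * g (r k))) (TD d (x (r k)))"
        using D0 by (simp add: smult_add_right smult_diff_right flip: D_def)
    qed
    note ind = rpair_independent[OF rl d1]
    have sN: "\<exists>u v. pN' = smult u (TN d l) + smult v (TD d l)" by (rule span_limit[OF cX cN ind inv(1)])
    have sD: "\<exists>u v. pD' = smult u (TN d l) + smult v (TD d l)" by (rule span_limit[OF cX cD ind inv(2)])
    have fin: "has_monomial d l" if q: "q = smult (t * w) (monom 1 m)" "w \<noteq> 0" "\<exists>u v. q = smult u (TN d l) + smult v (TD d l)" for q w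
    proof -
      obtain u v where uv: "q = smult u (TN d l) + smult v (TD d l)" using q(3) by blast
      have "monom 1 m = smult (1 / (t * w)) q" using q(1,2) jmt(3) by simp
      hence "monom 1 m = smult (u / (t * w)) (TN d l) + smult (v / (t * w)) (TD d l)"
        unfolding uv by (simp add: smult_add_right)
      thus ?thesis unfolding has_monomial_def using jmt(2) by blast
    qed
    \<comment> \<open>The index \<open>j\<close> is 0 or \<open>2 * d\<close>, so vanishing of both
      coefficients would be a common zero at 0 or at infinity. Hence at least one of the two limits
      is a nonzero multiple of the monomial.\<close>
    have "coeff (TN d y') j \<noteq> 0 \<or> coeff (TD d y') j \<noteq> 0"
      using jmt(1) ry unfolding rpair_def by (metis poly_0_coeff_0)
    thus ?thesis using fin[OF _ _ sN] fin[OF _ _ sD] jmt(4) unfolding pN'_def pD'_def by blast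
  qed
qed

section \<open>Polynomial representatives of the degenerate limits\<close>

lemma compact_box:
  assumes "\<And>i. compact (S i)"
  shows "compact {a :: nat \<Rightarrow> complex. \<forall>i. a i \<in> S i}"
proof -
  have "compactin (product_topology (\<lambda>i. euclidean) UNIV) (PiE UNIV S)"
    unfolding compactin_PiE using assms by simp
  moreover have "PiE UNIV S = {a. \<forall>i. a i \<in> S i}" by (auto simp: PiE_def Pi_def)
  ultimately show ?thesis by (simp add: euclidean_product_topology)
qed

definition monic_numerator :: "nat \<Rightarrow> (nat \<Rightarrow> complex) \<Rightarrow> complex poly" where
  "monic_numerator d a = monom 1 (2 * d) + (\<Sum>i\<in>{1..<2*d}. monom (a i) i)"

lemma coeff_monic_numerator:
  "coeff (monic_numerator d a) i = (if i = 2 * d then 1 else if 1 \<le> i \<and> i < 2 * d then a i else 0)"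
  by (auto simp: monic_numerator_def coeff_sum coeff_monom)

lemma rpair_monic_numerator: "rpair (2 * d) (monic_numerator d a) 1"
proof -
  have "degree (monic_numerator d a) \<le> 2 * d" by (rule degree_le) (simp add: coeff_monic_numerator)
  thus ?thesis by (simp add: rpair_def coeff_monic_numerator)
qed

text \<open>Polynomials in the symmetric source coordinate. A translation of the target removes the
  constant term, and a scaling of the source brings the other coefficients into the unit disc, whose
  radius is a mere choice.\<close>

definition "polynomial_maps d = (\<lambda>a. tinv d (monic_numerator d a) 1) ` {a. \<forall>i. a i \<in> cball 0 1}"

lemma polynomial_maps_compact: "compact (polynomial_maps d)"
  unfolding polynomial_maps_def
proof (rule compact_continuous_image)
  show "compact {a :: nat \<Rightarrow> complex. \<forall>i. a i \<in> cball 0 1}" by (rule compact_box) simp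
  have cf: "continuous_on UNIV (\<lambda>a. coeff (monic_numerator d a) j)" for j
    unfolding coeff_monic_numerator
    by (cases "j = 2 * d"; cases "1 \<le> j \<and> j < 2 * d") (auto intro: continuous_on_product_coordinates)
  have ps: "continuous_on UNIV (\<lambda>a. coeff (smult t (psub n a1 b1 c1 e1 (monic_numerator d a))) i)" for t n a1 b1 c1 e1 i
    unfolding psub_def coeff_smult coeff_sum by (intro continuous_intros cf)
  have "continuous_on UNIV (\<lambda>a. tinv d (monic_numerator d a) 1 i)" for i
    unfolding tinv_def cvec_def by (cases "i \<le> 2 * d") (simp_all only: if_True if_False ps continuous_on_const)
  hence "continuous_on UNIV (\<lambda>a. tinv d (monic_numerator d a) 1)"
    by (rule continuous_on_coordinatewise_then_product)
  thus "continuous_on {a. \<forall>i. a i \<in> cball 0 1} (\<lambda>a. tinv d (monic_numerator d a) 1)"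
    by (rule continuous_on_subset) simp
qed

lemma polynomial_maps_subset: "polynomial_maps d \<subseteq> rat_space d"
  using tinv_rat_space[OF rpair_monic_numerator] by (auto simp: polynomial_maps_def)

lemma psub_diag: "psub n \<mu> 0 0 1 p = (\<Sum>i\<le>n. monom (\<mu> ^ i * coeff p i) i)"
  "psub n 0 1 \<mu> 0 p = (\<Sum>i\<le>n. monom (\<mu> ^ i * coeff p (n - i)) i)"
proof -
  have dg: "degree (\<Sum>i\<le>n. monom (f i) i) \<le> n" for f :: "nat \<Rightarrow> complex"
    by (rule degree_le) (auto simp: coeff_sum coeff_monom)
  have h: "hp n (\<Sum>i\<le>n. monom (f i) i) x y = (\<Sum>i\<le>n. f i * x ^ i * y ^ (n - i))" for f x y
    unfolding hp_def by (rule sum.cong) (auto simp: coeff_sum coeff_monom)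
  show "psub n \<mu> 0 0 1 p = (\<Sum>i\<le>n. monom (\<mu> ^ i * coeff p i) i)"
    by (rule poly_eq_hp[OF degree_psub dg], unfold hp_psub h, unfold hp_def, rule sum.cong)
      (auto simp: power_mult_distrib)
  show "psub n 0 1 \<mu> 0 p = (\<Sum>i\<le>n. monom (\<mu> ^ i * coeff p (n - i)) i)"
  proof (rule poly_eq_hp[OF degree_psub dg])
    fix x y
    have "hp n (psub n 0 1 \<mu> 0 p) x y = (\<Sum>i\<le>n. coeff p i * y ^ i * (\<mu> * x) ^ (n - i))"
      unfolding hp_psub unfolding hp_def by simp
    also have "\<dots> = (\<Sum>i\<le>n. coeff p (n - i) * y ^ (n - i) * (\<mu> * x) ^ (n - (n - i)))"
      by (rule sum.nat_diff_reindex[symmetric, of _ "Suc n", simplified lessThan_Suc_atMost diff_Suc_Suc])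
    also have "\<dots> = (\<Sum>i\<le>n. \<mu> ^ i * coeff p (n - i) * x ^ i * y ^ (n - i))"
      by (rule sum.cong) (auto simp: power_mult_distrib)
    finally show "hp n (psub n 0 1 \<mu> 0 p) x y = hp n (\<Sum>i\<le>n. monom (\<mu> ^ i * coeff p (n - i)) i) x y"
      unfolding h .
  qed
qed

text \<open>The combination equal to a monomial becomes the denominator, after an inversion of the
  source if the monomial is the top power. Replacing \<open>z\<close> by \<open>\<mu> z\<close> and
  dividing by the leading coefficient multiplies the coefficient of index \<open>i\<close> by
  \<open>\<mu> ^ i / \<mu> ^ (2 * d)\<close>, so a large \<open>\<mu>\<close> makes all lower ones
  small.\<close>

lemma has_monomial_equiv:
  assumes d: "1 \<le> d" and l: "l \<in> rat_space d" and h: "has_monomial d l"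
  shows "\<exists>y\<in>polynomial_maps d. rat_equiv d y l"
proof -
  let ?N = "TN d l" and ?D = "TD d l"
  have r: "rpair (2 * d) ?N ?D" using l by (simp add: rat_space_iff_T)
  obtain m u v where m: "m = 0 \<or> m = 2 * d" and uv: "monom 1 m = smult u ?N + smult v ?D"
    using h unfolding has_monomial_def by blast
  \<comment> \<open>Reading the coefficients backwards is the effect of the inversion, and reduces
    the case of the top power to that of the constant 1.\<close>
  define co where "co p i = coeff p (if m = 0 then i else 2 * d - i)" for p :: "complex poly" and i
  obtain S where S: "\<And>\<mu>. \<mu> \<noteq> 0 \<Longrightarrow> \<exists>m1 m2 m3 m4. monomial_matrix m1 m2 m3 m4 \<and> S \<mu> = psub (2 * d) m1 m2 m3 m4"
    and Sc: "\<And>\<mu> p i. coeff (S \<mu> p) i = (if i \<le> 2 * d then \<mu> ^ i * co p i else 0)"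
  proof (cases "m = 0")
    case True
    show ?thesis
    proof (rule that[of "\<lambda>\<mu>. psub (2 * d) \<mu> 0 0 1"])
      show "\<exists>m1 m2 m3 m4. monomial_matrix m1 m2 m3 m4 \<and> psub (2 * d) \<mu> 0 0 1 = psub (2 * d) m1 m2 m3 m4" if "\<mu> \<noteq> 0" for \<mu>
        by (rule exI[of _ \<mu>], rule exI[of _ 0], rule exI[of _ 0], rule exI[of _ 1]) (use that in \<open>simp add: monomial_matrix_def\<close>)
    qed (simp add: psub_diag coeff_sum coeff_monom co_def True)
  next
    case False
    show ?thesis
    proof (rule that[of "\<lambda>\<mu>. psub (2 * d) 0 1 \<mu> 0"])
      show "\<exists>m1 m2 m3 m4. monomial_matrix m1 m2 m3 m4 \<and> psub (2 * d) 0 1 \<mu> 0 = psub (2 * d) m1 m2 m3 m4" if "\<mu> \<noteq> 0" for \<mu>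
        by (rule exI[of _ 0], rule exI[of _ 1], rule exI[of _ \<mu>], rule exI[of _ 0]) (use that in \<open>simp add: monomial_matrix_def\<close>)
    qed (simp add: psub_diag coeff_sum coeff_monom co_def False)
  qed
  have co_lin: "u * co ?N i + v * co ?D i = (if i = 0 then 1 else 0)" if "i \<le> 2 * d" for i
  proof -
    have "u * co ?N i + v * co ?D i = co (monom 1 m) i" unfolding uv by (simp add: co_def)
    thus ?thesis using m that d by (auto simp: co_def coeff_monom)
  qed
  have top: "co ?N (2 * d) \<noteq> 0 \<or> co ?D (2 * d) \<noteq> 0"
    using r unfolding co_def rpair_def by (cases "m = 0") (auto simp: poly_0_coeff_0[symmetric])
  have z: "u * co ?N (2 * d) + v * co ?D (2 * d) = 0" using co_lin[of "2 * d"] d by simp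
  \<comment> \<open>A second row for the target matrix, independent of the row \<open>u\<close>,
    \<open>v\<close>, and scaled to make the numerator monic.\<close>
  obtain s t where st: "s * co ?N (2 * d) + t * co ?D (2 * d) = 1" "s * v - t * u \<noteq> 0"
  proof (cases "co ?N (2 * d) = 0")
    case False
    have "v \<noteq> 0"
    proof
      assume "v = 0"
      hence "u = 0" using z False by simp
      thus False using co_lin[of 0] \<open>v = 0\<close> by simp
    qed
    thus ?thesis using that[of "1 / co ?N (2 * d)" 0] False by simp
  next
    case True
    hence D: "co ?D (2 * d) \<noteq> 0" using top by simp
    have "u \<noteq> 0"
    proof
      assume "u = 0"
      hence "v = 0" using z D by simp
      thus False using co_lin[of 0] \<open>u = 0\<close> by simp
    qed
    thus ?thesis using that[of 0 "1 / co ?D (2 * d)"] D by simp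
  qed
  define f where "f i = s * co ?N i + t * co ?D i" for i
  \<comment> \<open>This value is at least 1 and at least the modulus of every \<open>f i\<close>.
    As \<open>i < 2 * d\<close> leaves one spare power of \<open>\<mu>\<close>, both together bound
    the rescaled coefficients by 1.\<close>
  define \<mu> where "\<mu> = complex_of_real (1 + (\<Sum>i\<le>2*d. cmod (f i)))"
  have sum0: "0 \<le> (\<Sum>i\<le>2*d. cmod (f i))" by (simp add: sum_nonneg)
  have \<mu>n: "cmod \<mu> = 1 + (\<Sum>i\<le>2*d. cmod (f i))" unfolding \<mu>_def norm_of_real using sum0 by simp
  have \<mu>0: "\<mu> \<noteq> 0" and \<mu>1: "1 \<le> cmod \<mu>" using \<mu>n sum0 by auto
  define w where "w = 1 / \<mu> ^ (2 * d)"
  have w0: "w \<noteq> 0" using \<mu>0 by (simp add: w_def)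
  define a where "a i = (if i < 2 * d then w * \<mu> ^ i * f i else 0)" for i
  have a: "cmod (a i) \<le> 1" for i
  proof (cases "i < 2 * d")
    case True
    have "cmod (f i) \<le> (\<Sum>i\<le>2*d. cmod (f i))" by (rule member_le_sum) (use True in auto)
    hence fi: "cmod (f i) \<le> cmod \<mu>" using \<mu>n by simp
    have "cmod \<mu> ^ i * cmod (f i) \<le> cmod \<mu> ^ i * cmod \<mu>" using fi by (intro mult_left_mono) auto
    also have "\<dots> = cmod \<mu> ^ Suc i" by (simp add: mult.commute)
    also have "\<dots> \<le> cmod \<mu> ^ (2 * d)" using \<mu>1 True by (intro power_increasing) auto
    finally have "cmod \<mu> ^ i * cmod (f i) / cmod \<mu> ^ (2 * d) \<le> 1" using \<mu>0 by (simp add: divide_le_eq_1)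
    thus ?thesis using True by (simp add: a_def w_def norm_mult norm_divide norm_power)
  qed (simp add: a_def)
  let ?y = "tinv d (monic_numerator d a) 1"
  have yP: "?y \<in> polynomial_maps d" unfolding polynomial_maps_def using a by auto
  hence yR: "?y \<in> rat_space d" using polynomial_maps_subset by blast
  obtain m1 m2 m3 m4 where mm: "monomial_matrix m1 m2 m3 m4" "S \<mu> = psub (2 * d) m1 m2 m3 m4" using S[OF \<mu>0] by blast
  have dgm: "degree (monic_numerator d a) \<le> 2 * d" "degree (1 :: complex poly) \<le> 2 * d"
    using rpair_monic_numerator[of d a] by (simp_all add: rpair_def)
  \<comment> \<open>The constant term, which is removed by subtracting a multiple of the
    denominator.\<close>
  let ?k = "w * f 0"
  have yD: "TD d ?y = smult u (S \<mu> ?N) + smult v (S \<mu> ?D)"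
    unfolding T_tinv(2)[OF dgm]
  proof (rule poly_eqI)
    fix i
    have "coeff (smult u (S \<mu> ?N) + smult v (S \<mu> ?D)) i = (if i \<le> 2 * d then \<mu> ^ i * (u * co ?N i + v * co ?D i) else 0)"
      by (simp add: Sc algebra_simps)
    thus "coeff 1 i = coeff (smult u (S \<mu> ?N) + smult v (S \<mu> ?D)) i"
      using co_lin[of i] by (simp add: coeff_1 split: if_splits)
  qed
  have yN: "TN d ?y = smult (w * s - ?k * u) (S \<mu> ?N) + smult (w * t - ?k * v) (S \<mu> ?D)"
    unfolding T_tinv(1)[OF dgm]
  proof (rule poly_eqI)
    fix i
    have "coeff (smult (w * s - ?k * u) (S \<mu> ?N) + smult (w * t - ?k * v) (S \<mu> ?D)) i
        = (if i \<le> 2 * d then w * \<mu> ^ i * f i - ?k * \<mu> ^ i * (u * co ?N i + v * co ?D i) else 0)"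
      by (simp add: Sc f_def algebra_simps)
    also have "\<dots> = (if i \<le> 2 * d then w * \<mu> ^ i * f i - (if i = 0 then ?k else 0) else 0)"
      using co_lin[of i] by simp
    also have "\<dots> = coeff (monic_numerator d a) i"
    proof -
      have "w * \<mu> ^ (2 * d) * f (2 * d) = 1" using st(1) \<mu>0 by (simp add: w_def f_def)
      thus ?thesis using d by (auto simp: coeff_monic_numerator a_def)
    qed
    finally show "coeff (monic_numerator d a) i = coeff (smult (w * s - ?k * u) (S \<mu> ?N) + smult (w * t - ?k * v) (S \<mu> ?D)) i" by (rule sym)
  qed
  have "(w * s - ?k * u) * v - (w * t - ?k * v) * u = w * (s * v - t * u)" by (simp add: algebra_simps)
  hence det: "(w * s - ?k * u) * v - (w * t - ?k * v) * u \<noteq> 0" using w0 st(2) by simp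
  have "rat_equiv d l ?y"
    unfolding rat_equiv_iff_T[OF d l yR] using det mm(1) yN yD unfolding mm(2) by blast
  thus ?thesis using rat_equiv_sym yP by blast
qed

text \<open>A limit of points equivalent to elements of \<open>C\<close> is again such a point
  unless the source changes degenerate; then it has a monomial in its pencil and is equivalent to
  one of the polynomial maps, which \<open>C\<close> contains by assumption.\<close>

lemma saturation_closed:
  assumes d: "1 \<le> d" and C: "compact C" "C \<subseteq> rat_space d" "polynomial_maps d \<subseteq> C"
  shows "closedin (top_of_set (rat_space d)) {c \<in> rat_space d. \<exists>y\<in>C. rat_equiv d y c}"
proof -
  let ?W = "{c \<in> rat_space d. \<exists>y\<in>C. rat_equiv d y c}"
  have "?W = rat_space d \<inter> closure ?W"
  proof
    show "?W \<subseteq> rat_space d \<inter> closure ?W" using closure_subset[of ?W] by blast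
    show "rat_space d \<inter> closure ?W \<subseteq> ?W"
    proof
      fix l assume l: "l \<in> rat_space d \<inter> closure ?W"
      hence "\<exists>x. (\<forall>k. x k \<in> ?W) \<and> x \<longlonglongrightarrow> l" unfolding Int_iff closure_sequential by (rule conjunct2)
      then obtain x where x: "\<forall>k. x k \<in> ?W" "x \<longlonglongrightarrow> l" by (elim exE conjE) (rule that)
      have x1: "x k \<in> rat_space d" "\<exists>y\<in>C. rat_equiv d y (x k)" for k using spec[OF x(1), of k] by simp_all
      have "(\<exists>y\<in>C. rat_equiv d y l) \<or> has_monomial d l"
        by (rule equivalence_limit[OF d C(1,2) x1 x(2)]) (use l in simp)
      thus "l \<in> ?W" using l has_monomial_equiv[OF d, of l] C(3) by blast
    qed
  qed
  thus ?thesis unfolding closedin_closed by (intro exI[of _ "closure ?W"] conjI closed_closure)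
qed

text \<open>Compactness of the image of \<open>C'\<close> comes from continuity, but its closedness
  does not follow from a separation property and is drawn from the closed saturation. The closure
  then is a closed subset of a compact set.\<close>

lemma quotient_precompact:
  assumes d: "1 \<le> d" and C: "compact C" "C \<subseteq> rat_space d"
    and B: "\<And>b. b \<in> B \<Longrightarrow> b \<in> rat_space d \<and> (\<exists>y\<in>C. rat_equiv d y b)"
  shows "compactin (rat_mod_top d) (rat_mod_top d closure_of (rat_cls d ` B))"
proof -
  define C' where "C' = C \<union> polynomial_maps d"
  have C': "compact C'" "C' \<subseteq> rat_space d" "polynomial_maps d \<subseteq> C'"
    using C polynomial_maps_compact polynomial_maps_subset by (auto simp: C'_def)
  let ?S = "rat_space d" and ?q = "rat_cls d"
  let ?X = "top_of_set ?S"
  have op: "openin (rat_mod_top d) U \<longleftrightarrow> U \<subseteq> ?q ` ?S \<and> openin ?X {x \<in> ?S. ?q x \<in> U}" for U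
    unfolding rat_mod_top_def quot_top_def using istopology_quot[of ?q ?X] by (simp add: topology_inverse')
  have "{x \<in> ?S. ?q x \<in> ?q ` ?S} = ?S" by blast
  hence "openin (rat_mod_top d) (?q ` ?S)" unfolding op by simp
  hence ts: "topspace (rat_mod_top d) = ?q ` ?S"
    using openin_subset[of "rat_mod_top d"] op[of "topspace (rat_mod_top d)"] by auto
  have cq: "continuous_map ?X (rat_mod_top d) ?q"
    unfolding continuous_map_def using op ts by auto
  have "compactin ?X C'" using C' by (simp add: compactin_subtopology)
  hence cp: "compactin (rat_mod_top d) (?q ` C')" by (rule image_compactin[OF _ cq])
  have sat: "{x \<in> ?S. ?q x \<in> ?q ` ?S - ?q ` C'} = ?S - {c \<in> ?S. \<exists>y\<in>C'. rat_equiv d y c}"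
  proof -
    have "?q x \<in> ?q ` C' \<longleftrightarrow> (\<exists>y\<in>C'. rat_equiv d y x)" if "x \<in> ?S" for x
      unfolding image_iff rat_cls_eq_iff[OF that, symmetric] by (rule bex_cong[OF refl]) (rule eq_commute)
    thus ?thesis by auto
  qed
  have "closedin (rat_mod_top d) (?q ` C')"
    unfolding closedin_def ts op sat
    using saturation_closed[OF d C'] C'(2) by (auto intro: openin_diff)
  moreover have "?q ` B \<subseteq> ?q ` C'"
  proof
    fix s assume "s \<in> ?q ` B"
    then obtain b where b: "b \<in> B" "s = ?q b" by blast
    then obtain y where y: "y \<in> C" "rat_equiv d y b" using B by blast
    hence "?q y = ?q b" using rat_cls_eq_iff B[OF b(1)] by blast
    thus "s \<in> ?q ` C'" using b(2) y(1) by (auto simp: C'_def)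
  qed
  ultimately have "rat_mod_top d closure_of (?q ` B) \<subseteq> ?q ` C'" by (intro closure_of_minimal)
  thus ?thesis by (rule closed_compactin[OF cp]) simp
qed

lemma ratmap_scale: "t \<noteq> 0 \<Longrightarrow> ratmap d (\<lambda>i. t * c i) = ratmap d c"
proof
  fix x assume t: "t \<noteq> 0"
  have "nump d (\<lambda>i. t * c i) = smult t (nump d c)" "denp d (\<lambda>i. t * c i) = smult t (denp d c)"
    by (rule poly_eqI, simp add: coeff_nump coeff_denp)+
  thus "ratmap d (\<lambda>i. t * c i) x = ratmap d c x"
    unfolding ratmap_eq rmap_def using proj_scale[OF t] by (simp split: option.splits)
qed

lemma T_scale: "TN d (\<lambda>i. t * c i) = smult t (TN d c)" "TD d (\<lambda>i. t * c i) = smult t (TD d c)"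
proof -
  have "nump d (\<lambda>i. t * c i) = smult t (nump d c)" "denp d (\<lambda>i. t * c i) = smult t (denp d c)"
    by (rule poly_eqI, simp add: coeff_nump coeff_denp)+
  thus "TN d (\<lambda>i. t * c i) = smult t (TN d c)" "TD d (\<lambda>i. t * c i) = smult t (TD d c)"
    unfolding TN_def TD_def using psub_linear[of "2 * d" 1 1 "- 1" 1 t _ 0 0] by simp_all
qed

lemma T_zero:
  assumes "TN d c = 0" "TD d c = 0" "i \<le> 4 * d + 1"
  shows "c i = 0"
proof -
  have hz: "hp n 0 x y = 0" for n x y by (simp add: hp_def)
  have "nump d c = 0"
    by (rule poly_eq_hp[OF degree_nump]) (simp_all add: hp_T assms hz)
  moreover have "denp d c = 0"
    by (rule poly_eq_hp[OF degree_denp]) (simp_all add: hp_T assms hz)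
  ultimately have z: "nump d c = 0" "denp d c = 0" by simp_all
  show ?thesis
  proof (cases "i \<le> 2 * d")
    case True
    thus ?thesis using coeff_nump[of d c i] z by simp
  next
    case False
    then obtain j where j: "i = 2 * d + 1 + j" using le_Suc_ex[of "2 * d + 1" i] by auto
    hence "j \<le> 2 * d" using assms(3) by simp
    hence "c (2 * d + 1 + j) = 0" using coeff_denp[of d c j] z(2) by simp
    thus ?thesis using j by simp
  qed
qed

text \<open>The scales \<open>s\<close> and \<open>t\<close> need not be comparable, yet the
  products of a coefficient in one scaling with a coefficient in the other are symmetric, and this
  symmetry passes to the limit.\<close>

lemma pair_limit_proportional:
  assumes f: "pconv (\<lambda>k. smult (s k) (N k)) N'" "pconv (\<lambda>k. smult (s k) (D k)) D'"
    and g: "pconv (\<lambda>k. smult (t k) (N k)) N''" "pconv (\<lambda>k. smult (t k) (D k)) D''"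
    and nz: "N' \<noteq> 0 \<or> D' \<noteq> 0"
  shows "\<exists>\<kappa>. N'' = smult \<kappa> N' \<and> D'' = smult \<kappa> D'"
proof -
  define V where "V b = (if b then N else D)" for b
  define V' where "V' b = (if b then N' else D')" for b
  define V'' where "V'' b = (if b then N'' else D'')" for b
  have lim: "(\<lambda>k. s k * coeff (V b k) i) \<longlonglongrightarrow> coeff (V' b) i" "(\<lambda>k. t k * coeff (V b k) i) \<longlonglongrightarrow> coeff (V'' b) i" for b i
    using f g by (auto simp: V_def V'_def V''_def pconv_def)
  have cross: "coeff (V'' b) i * coeff (V' b') j = coeff (V' b) i * coeff (V'' b') j" for b b' i j
  proof (rule LIMSEQ_unique)
    show "(\<lambda>k. (t k * coeff (V b k) i) * (s k * coeff (V b' k) j)) \<longlonglongrightarrow> coeff (V'' b) i * coeff (V' b') j"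
      by (intro tendsto_mult lim)
    have "(\<lambda>k. (s k * coeff (V b k) i) * (t k * coeff (V b' k) j)) \<longlonglongrightarrow> coeff (V' b) i * coeff (V'' b') j"
      by (intro tendsto_mult lim)
    thus "(\<lambda>k. (t k * coeff (V b k) i) * (s k * coeff (V b' k) j)) \<longlonglongrightarrow> coeff (V' b) i * coeff (V'' b') j"
      by (simp add: mult_ac)
  qed
  obtain b' j where bj: "coeff (V' b') j \<noteq> 0"
  proof (cases "N' = 0")
    case False thus ?thesis using that[of True "degree N'"] by (simp add: V'_def)
  next
    case True thus ?thesis using that[of False "degree D'"] nz by (simp add: V'_def)
  qed
  define \<kappa> where "\<kappa> = coeff (V'' b') j / coeff (V' b') j"
  have "V'' b = smult \<kappa> (V' b)" for b
    by (rule poly_eqI) (use cross[of b _ b' j] bj in \<open>simp add: \<kappa>_def field_simps\<close>)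
  from this[of True] this[of False] show ?thesis by (auto simp: V'_def V''_def)
qed

text \<open>Scaling coefficient vectors to norm 1 makes the closure compact. A limit in this scaling
  is proportional to the nondegenerate limit supplied by the hypothesis, and its norm 1 excludes the
  factor 0, so it still has full degree.\<close>

lemma compact_representatives:
  assumes S0: "S0 \<subseteq> rat_space d"
    and seq: "\<And>y. (\<And>k. y k \<in> S0) \<Longrightarrow> \<exists>r s N' D'. strict_mono (r :: nat \<Rightarrow> nat) \<and>
      pconv (\<lambda>k. smult (s k) (TN d (y (r k)))) N' \<and> pconv (\<lambda>k. smult (s k) (TD d (y (r k)))) D' \<and> rpair (2 * d) N' D'"
  shows "\<exists>C. compact C \<and> C \<subseteq> rat_space d \<and> (\<forall>y\<in>S0. \<exists>c\<in>C. rat_equiv d c y)"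
proof -
  define nrm where "nrm c = (\<Sum>i\<le>4*d+1. cmod (c i))" for c :: "nat \<Rightarrow> complex"
  define S1 where "S1 = {c \<in> rat_space d. nrm c = 1 \<and> (\<exists>t y. t \<noteq> 0 \<and> y \<in> S0 \<and> c = (\<lambda>i. t * y i))}"
  let ?B = "{c :: nat \<Rightarrow> complex. \<forall>i. c i \<in> (if i \<le> 4 * d + 1 then cball 0 1 else {0})}"
  have cB: "compact ?B" by (rule compact_box) simp
  have "S1 \<subseteq> ?B"
  proof
    fix c assume c: "c \<in> S1"
    have "cmod (c i) \<le> 1" if "i \<le> 4 * d + 1" for i
      using c member_le_sum[of i "{..4*d+1}" "\<lambda>i. cmod (c i)"] that by (auto simp: S1_def nrm_def)
    thus "c \<in> ?B" using c by (auto simp: S1_def rat_space_def)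
  qed
  hence clB: "closure S1 \<subseteq> ?B" by (rule closure_minimal[OF _ compact_imp_closed[OF cB]])
  hence "closure S1 = ?B \<inter> closure S1" by blast
  hence "compact (closure S1)" using compact_Int_closed[OF cB closed_closure, of S1] by simp
  moreover have "closure S1 \<subseteq> rat_space d"
  proof
    fix c assume c: "c \<in> closure S1"
    then obtain x where x: "\<And>k. x k \<in> S1" "x \<longlonglongrightarrow> c" unfolding closure_sequential by blast
    have "\<exists>t y. t \<noteq> 0 \<and> y \<in> S0 \<and> x k = (\<lambda>i. t * y i)" for k using x(1)[of k] by (simp add: S1_def)
    then obtain t y where ty: "\<And>k. t k \<noteq> 0 \<and> y k \<in> S0 \<and> x k = (\<lambda>i. t k * y k i)" by metis
    obtain r s N' D' where r: "strict_mono (r :: nat \<Rightarrow> nat)" "pconv (\<lambda>k. smult (s k) (TN d (y (r k)))) N'"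
      "pconv (\<lambda>k. smult (s k) (TD d (y (r k)))) D'" "rpair (2 * d) N' D'" using seq[of y] ty by blast
    have x': "(\<lambda>k. x (r k)) \<longlonglongrightarrow> c" using LIMSEQ_subseq_LIMSEQ[OF x(2) r(1)] by (simp add: o_def)
    have Tx: "TN d (x (r k)) = smult (t (r k)) (TN d (y (r k)))" "TD d (x (r k)) = smult (t (r k)) (TD d (y (r k)))" for k
      using ty[of "r k"] by (simp_all add: T_scale)
    have g: "pconv (\<lambda>k. smult (t (r k)) (TN d (y (r k)))) (TN d c)" "pconv (\<lambda>k. smult (t (r k)) (TD d (y (r k)))) (TD d c)"
      using pconv_T[OF x', of d] unfolding Tx by blast+
    have "N' \<noteq> 0 \<or> D' \<noteq> 0" using r(4) by (auto simp: rpair_def)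
    from pair_limit_proportional[OF r(2,3) g this] obtain \<kappa> where \<kappa>: "TN d c = smult \<kappa> N'" "TD d c = smult \<kappa> D'" by blast
    have "(\<lambda>k. nrm (x k)) \<longlonglongrightarrow> nrm c"
      unfolding nrm_def by (intro tendsto_sum tendsto_norm tendsto_coordinate[OF x(2)])
    moreover have "(\<lambda>k. nrm (x k)) = (\<lambda>k. 1)" using x(1) by (auto simp: S1_def)
    ultimately have n1: "nrm c = 1" using LIMSEQ_unique[OF tendsto_const] by metis
    have "\<kappa> \<noteq> 0"
    proof
      assume "\<kappa> = 0"
      hence "c i = 0" if "i \<le> 4 * d + 1" for i using T_zero[of d c i] \<kappa> that by simp
      hence "nrm c = 0" unfolding nrm_def by (intro sum.neutral) simp
      thus False using n1 by simp
    qed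
    hence "rpair (2 * d) (TN d c) (TD d c)" using r(4) unfolding \<kappa> rpair_def by simp
    moreover have "\<forall>i>4 * d + 1. c i = 0"
    proof (intro allI impI)
      fix i assume i: "4 * d + 1 < i"
      have "c \<in> ?B" using clB c by (rule subsetD)
      hence "c i \<in> (if i \<le> 4 * d + 1 then cball 0 1 else {0})" by blast
      thus "c i = 0" using i by simp
    qed
    ultimately show "c \<in> rat_space d" by (simp add: rat_space_iff_T)
  qed
  moreover have "\<exists>c\<in>closure S1. rat_equiv d c y" if y: "y \<in> S0" for y
  proof -
    have yR: "y \<in> rat_space d" using S0 y by blast
    have "0 < nrm y"
    proof -
      have "y (2 * d) \<noteq> 0 \<or> y (4 * d + 1) \<noteq> 0" using yR unfolding rat_space_def by blast
      then obtain i where i: "i \<le> 4 * d + 1" "y i \<noteq> 0"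
      proof
        assume "y (2 * d) \<noteq> 0" thus ?thesis using that[of "2 * d"] by simp
      next
        assume "y (4 * d + 1) \<noteq> 0" thus ?thesis using that[of "4 * d + 1"] by simp
      qed
      show ?thesis unfolding nrm_def by (rule sum_pos2[of _ i]) (use i in auto)
    qed
    define t where "t = complex_of_real (1 / nrm y)"
    have t0: "t \<noteq> 0" using \<open>0 < nrm y\<close> by (simp add: t_def)
    define c where "c = (\<lambda>i. t * y i)"
    have "nrm c = cmod t * nrm y" unfolding nrm_def c_def norm_mult sum_distrib_left ..
    also have "\<dots> = 1" unfolding t_def norm_of_real using \<open>0 < nrm y\<close> by simp
    finally have "nrm c = 1" .
    moreover have "c \<in> rat_space d" using yR t0 unfolding rat_space_iff_T c_def T_scale rpair_def by simp
    ultimately have "c \<in> S1" unfolding S1_def using t0 y c_def by blast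
    moreover have "rat_equiv d c y" using rat_equiv_refl[of d y] unfolding rat_equiv_def c_def ratmap_scale[OF t0] .
    ultimately show ?thesis using closure_subset by blast
  qed
  ultimately show ?thesis by blast
qed

theorem theorem7p1:
  fixes d :: nat and P :: "complex poly"
  assumes "2 \<le> d" and "P \<in> principal_hyp (2 * d - 1)"
  shows "compactin (rat_mod_top d) (rat_mod_top d closure_of bers_slice d P)"
proof -
  \<comment> \<open>A component lies in its set and \<open>coeffvec\<close> is injective, so
    \<open>P\<close> itself has an attracting fixed point whose immediate basin contains all
    critical points.\<close>
  have "coeffvec P \<in> coeffvec ` hyp_locus (2 * d - 1)"
    using assms(2) connected_component_subset unfolding principal_hyp_def by blast
  moreover have "inj coeffvec" by (rule injI) (simp add: coeffvec_def poly_eq_iff fun_eq_iff)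
  ultimately have "P \<in> hyp_locus (2 * d - 1)" by (simp add: inj_image_mem_iff)
  then obtain a where a: "degree P = 2 * d - 1" "poly P a = a" "cmod (poly (pderiv P) a) < 1"
    "\<And>c. poly (pderiv P) c = 0 \<Longrightarrow> c \<in> imm_basin P a"
    unfolding hyp_locus_def monic_centered_def by blast
  interpret attracting_poly P a by unfold_locales (use a assms(1) in auto)
  obtain p \<epsilon> where pb: "poly_basin P A a p (2 * d - 1) \<epsilon>" using poly_basin_exists unfolding a(1) by blast
  interpret pb: poly_basin P A a p "2 * d - 1" \<epsilon> by (rule pb)
  \<comment> \<open>Coefficient vectors of normalized matings. Every representative of the slice is
    equivalent to one of them, and their limits keep full degree.\<close>
  define S0 where "S0 = {c \<in> rat_space d. \<exists>g X. pb.mating_data (TN d c) (TD d c) g X}"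
  have "\<exists>C. compact C \<and> C \<subseteq> rat_space d \<and> (\<forall>y\<in>S0. \<exists>c\<in>C. rat_equiv d c y)"
  proof (rule compact_representatives)
    show "S0 \<subseteq> rat_space d" by (auto simp: S0_def)
    fix y :: "nat \<Rightarrow> nat \<Rightarrow> complex" assume y: "\<And>k. y k \<in> S0"
    have "\<forall>k. \<exists>g X. pb.mating_data (TN d (y k)) (TD d (y k)) g X" using y by (simp add: S0_def)
    then obtain g X where md: "\<And>k. pb.mating_data (TN d (y k)) (TD d (y k)) (g k) (X k)" by metis
    obtain r s N' D' where h: "strict_mono (r :: nat \<Rightarrow> nat)" "\<And>i. s i \<noteq> (0::complex)"
      "pconv (\<lambda>i. smult (s i) (TN d (y (r i)))) N'" "pconv (\<lambda>i. smult (s i) (TD d (y (r i)))) D'"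
      "degree N' \<le> 2 * d - 1 + 1" "degree D' \<le> 2 * d - 1 + 1" "degree N' = 2 * d - 1 + 1 \<or> degree D' = 2 * d - 1 + 1"
      "\<And>z. \<not> (poly N' z = 0 \<and> poly D' z = 0)"
      by (rule pb.mating_data_precompact[OF md]) (rule that | assumption)+
    have k: "2 * d - 1 + 1 = 2 * d" using assms(1) by simp
    have "coeff N' (2 * d) \<noteq> 0 \<or> coeff D' (2 * d) \<noteq> 0"
      using h(7) assms(1) unfolding k by (metis degree_0 leading_coeff_0_iff mult_eq_0_iff not_numeral_le_zero zero_neq_numeral)
    hence "rpair (2 * d) N' D'" using h(5,6,8) unfolding k rpair_def by blast
    thus "\<exists>r s N' D'. strict_mono (r :: nat \<Rightarrow> nat) \<and>
      pconv (\<lambda>k. smult (s k) (TN d (y (r k)))) N' \<and> pconv (\<lambda>k. smult (s k) (TD d (y (r k)))) D' \<and> rpair (2 * d) N' D'"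
      using h(1,3,4) by blast
  qed
  then obtain C where C: "compact C" "C \<subseteq> rat_space d" "\<And>y. y \<in> S0 \<Longrightarrow> \<exists>c\<in>C. rat_equiv d c y" by blast
  have "b \<in> rat_space d \<and> (\<exists>y\<in>C. rat_equiv d y b)" if b: "b \<in> {c. bers_rep d P c}" for b
  proof -
    have bR: "b \<in> rat_space d" using b by (simp add: bers_rep_def)
    note b' = b[unfolded mem_Collect_eq bers_rep_def]
    from conjunct2[OF b'] obtain \<phi> \<phi>i F XP XG Dom where br: "teich_marking d \<phi> \<phi>i \<and> conformal_mating d P \<phi> \<phi>i F XP XG \<and>
        jordan_domain Dom \<and> Some 1 \<in> sph_top frontier_of Dom \<and> eta ` Dom = - (sph_top closure_of Dom) \<and>
        sholo_on Dom (ratmap d b) \<and> inj_on (ratmap d b) Dom \<and>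
        ratmap d b ` Dom = sph_top interior_of mating_set d P \<phi> XP XG \<and>
        (\<forall>x\<in>Dom. F (ratmap d b x) = ratmap d b (eta x))"
      by (elim exE) (rule that)
    have tm: "teich_marking d \<phi> \<phi>i" and cm: "conformal_mating d P \<phi> \<phi>i F XP XG" using br by simp_all
    note cmu = cm[unfolded conformal_mating_def]
    have ex: "\<exists>\<psi> h. boettcher P \<psi> \<and> circle_conj d \<phi> \<phi>i h \<and>
        (\<forall>z\<in>filled_julia P. \<forall>w\<in>cball 0 1. XP z = XG w \<longleftrightarrow> equivclp (mate_rel \<psi> h) (Inl z) (Inr w))"
      using cmu by (elim conjE)
    then obtain \<psi> h where ps: "boettcher P \<psi>" "circle_conj d \<phi> \<phi>i h"
      "\<forall>z\<in>filled_julia P. \<forall>w\<in>cball 0 1. XP z = XG w \<longleftrightarrow> equivclp (mate_rel \<psi> h) (Inl z) (Inr w)"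
      by (elim exE conjE) (rule that)
    have "\<exists>hi. homeomorphism (sphere 0 1) (sphere 0 1) h hi" using ps(2) unfolding circle_conj_def by (elim conjE)
    then obtain hi where hi: "homeomorphism (sphere 0 1) (sphere 0 1) h hi" by (elim exE) (rule that)
    have sem1: "\<forall>z\<in>filled_julia P. XP (poly P z) = F (XP z)" using cmu by (elim conjE)
    have sem2: "\<forall>w\<in>\<phi> ` bs_dom d. XG (\<phi> (bs_map d (\<phi>i w))) = F (XG w)" using cmu by (elim conjE)
    have FR: "\<forall>x\<in>Dom. F (ratmap d b x) = ratmap d b (eta x)" using br by (elim conjE)
    interpret mated d P a "nump d b" "denp d b" \<phi> \<phi>i F XP XG Dom \<psi> h hi
    proof unfold_locales
      show "2 \<le> d" "degree P = 2 * d - 1" by (rule assms(1) a(1))+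
      show "rpair (2 * d) (nump d b) (denp d b)" using bR rat_space_iff by blast
      show "homeomorphism (cball 0 1) (cball 0 1) \<phi> \<phi>i" using tm unfolding teich_marking_def by (elim conjE)
      show "eta ` Dom = - (sph_top closure_of Dom)" using br by (elim conjE)
      show "inj_on (rmap (2 * d) (nump d b) (denp d b)) Dom"
        using br unfolding ratmap_eq by (elim conjE)
      show "rmap (2 * d) (nump d b) (denp d b) ` Dom = sph_top interior_of mating_set d P \<phi> XP XG"
        using br unfolding ratmap_eq by (elim conjE)
      show "F (rmap (2 * d) (nump d b) (denp d b) x) = rmap (2 * d) (nump d b) (denp d b) (eta x)" if "x \<in> Dom" for x
        using bspec[OF FR that] unfolding ratmap_eq .
      show "boettcher P \<psi>" "homeomorphism (sphere 0 1) (sphere 0 1) h hi" by (rule ps(1) hi)+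
      show "XP (poly P z) = F (XP z)" if "z \<in> filled_julia P" for z using bspec[OF sem1 that] .
      show "XG (\<phi> (bs_map d (\<phi>i w))) = F (XG w)" if "w \<in> \<phi> ` bs_dom d" for w using bspec[OF sem2 that] .
      show "XP z = XG w \<longleftrightarrow> equivclp (mate_rel \<psi> h) (Inl z) (Inr w)" if "z \<in> filled_julia P" "w \<in> cball 0 1" for z w
        using bspec[OF bspec[OF ps(3) that(1)] that(2)] .
    qed (insert cmu, (elim conjE, assumption)+)
    obtain N D g X a2 b2 c2 e2 \<mu> where m: "\<mu> \<noteq> 0" "a2 * e2 - b2 * c2 \<noteq> 0" "rpair (2 * d) N D"
      "\<And>s. rmap (2 * d) N D s = moeb a2 b2 c2 e2 (rmap (2 * d) (nump d b) (denp d b) (moeb \<mu> 1 (- \<mu>) 1 s))"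
      "pb.mating_data N D g X"
      by (rule normalized_mating_data[OF pb]) (rule that | assumption)+
    have T: "TN d (tinv d N D) = N" "TD d (tinv d N D) = D" using m(3) by (simp_all add: T_tinv rpair_def)
    have tR: "tinv d N D \<in> rat_space d" using m(3) by (rule tinv_rat_space)
    hence tS: "tinv d N D \<in> S0" unfolding S0_def using m(5) T by auto
    have "rat_equiv d b (tinv d N D)"
    proof (rule rat_equivI_T[OF bR tR _ m(2)])
      show "monomial_matrix \<mu> 0 0 1" using m(1) by (simp add: monomial_matrix_def)
      fix s
      \<comment> \<open>The source normalization factors into the fixed symmetric coordinate and the
        scaling by \<open>\<mu>\<close>; the latter is one of the changes of coordinates allowed by
        the equivalence.\<close>
      have "moeb 1 1 (- 1) 1 (moeb \<mu> 0 0 1 s) = moeb \<mu> 1 (- \<mu>) 1 s"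
        using m(1) by (subst moeb_compose) simp_all
      thus "rmap (2 * d) (TN d (tinv d N D)) (TD d (tinv d N D)) s = moeb a2 b2 c2 e2 (rmap (2 * d) (TN d b) (TD d b) (moeb \<mu> 0 0 1 s))"
        unfolding T m(4) ratmap_T[OF bR] ratmap_eq by simp
    qed
    thus ?thesis using C(3)[OF tS] bR rat_equiv_sym rat_equiv_trans by blast
  qed
  thus ?thesis
    unfolding bers_slice_def by (intro quotient_precompact[OF _ C(1,2)]) (use assms(1) in auto)
qed

end
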